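(* Let $k$ be a finitely generated field over $\mathbb{Q}$, and let $g\ge 1$ be an integer. Assume that the birational Grothendieck anabelian section conjecture (BGASC) holds true for all proper, smooth, and geometrically connected curves of genus $g$ over $k$. Then the BGASC holds true for every projective, smooth, and geometrically connected curve $X$ over $k$.
   Context: Let $k$ be a field of characteristic $0$ and $X$ a proper, smooth, geometrically connected algebraic curve over $k$ (of any genus) with function field $K_X$. Fix a separable closure $K_X^{\mathrm{sep}}$ of $K_X$, let $\bar k$ be the algebraic closure of $k$ in $K_X^{\mathrm{sep}}$, and put $G_k=\mathrm{Gal}(\bar k/k)$, $G_X=\mathrm{Gal}(K_X^{\mathrm{sep}}/K_X)$, $G_{\overline X}=\mathrm{Gal}(K_X^{\mathrm{sep}}/K_X\bar k)$. There is an exact sequence of profinite groups $1\to G_{\overline X}\to G_X\xrightarrow{\mathrm{pr}_X} G_k\to 1$. A section of $\mathrm{pr}_X$ is a continuous homomorphism $s:G_k\to G_X$ with $\mathrm{pr}_X\circ s=\mathrm{id}_{G_k}$. For $x\in X(k)$, a decomposition subgroup $D_x\subset G_X$ associated to $x$ is the decomposition group of an extension to $K_X^{\mathrm{sep}}$ of the discrete valuation of $K_X$ defined by $x$; it is well defined up to conjugation by elements of $G_{\overline X}$. "The BGASC holds true for the $k$-curve $X$" means: for every section $s:G_k\to G_X$ of $\mathrm{pr}_X$, there is a unique rational point $x\in X(k)$ such that $s(G_k)$ is contained in a decomposition subgroup $D_x\subset G_X$ associated to $x$. *)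

theory Defs
  imports
    "HOL-Analysis.Analysis"
    "HOL-Algebra.Generated_Fields"
    "HOL-Algebra.Algebraic_Closure_Type"
    "HOL-Library.Poly_Mapping"
    "HOL-Library.Function_Algebras"
begin

section \<open>The base field\<close>

text \<open>The base field \<open>k\<close> is a type \<open>'k\<close>; its prime field is \<open>\<rat>\<close> because of the sort
  \<open>field_char_0\<close>.\<close>

definition finitely_generated_over_Q :: "'k::field_char_0 itself \<Rightarrow> bool" where
  "finitely_generated_over_Q _ \<longleftrightarrow>
     (\<exists>S :: 'k set. finite S \<and> generate_field (ring_of_type_algebra :: 'k ring) S = UNIV)"


section \<open>Homogeneous polynomials and projective space\<close>

text \<open>Polynomials in countably many variables \<open>x\<^sub>0, x\<^sub>1, \<dots>\<close>; the homogeneous coordinate ring of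
  \<open>\<bbbP>\<^sup>n\<close> is \<open>poly_in n\<close>, the polynomials in \<open>x\<^sub>0, \<dots>, x\<^sub>n\<close>.\<close>

type_synonym 'k mpoly = "(nat \<Rightarrow>\<^sub>0 nat) \<Rightarrow>\<^sub>0 'k"

definition mdeg :: "(nat \<Rightarrow>\<^sub>0 nat) \<Rightarrow> nat" where
  "mdeg m = (\<Sum>i\<in>Poly_Mapping.keys m. Poly_Mapping.lookup m i)"

definition poly_in :: "nat \<Rightarrow> 'k::zero mpoly set" where
  "poly_in n = {p. \<forall>m\<in>Poly_Mapping.keys p. Poly_Mapping.keys m \<subseteq> {..n}}"

definition forms :: "nat \<Rightarrow> nat \<Rightarrow> 'k::zero mpoly set" where
  "forms n d = {p \<in> poly_in n. \<forall>m\<in>Poly_Mapping.keys p. mdeg m = d}"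

definition const_poly :: "'k::zero \<Rightarrow> 'k mpoly" where
  "const_poly c = Poly_Mapping.single 0 c"

definition var_poly :: "nat \<Rightarrow> 'k::zero_neq_one mpoly" where
  "var_poly i = Poly_Mapping.single (Poly_Mapping.single i 1) 1"

definition hom_component :: "nat \<Rightarrow> 'k::comm_monoid_add mpoly \<Rightarrow> 'k mpoly" where
  "hom_component d p = (\<Sum>m \<in> {m \<in> Poly_Mapping.keys p. mdeg m = d}.
     Poly_Mapping.single m (Poly_Mapping.lookup p m))"

definition partial_deriv :: "nat \<Rightarrow> 'k::comm_semiring_1 mpoly \<Rightarrow> 'k mpoly" where
  "partial_deriv i p = (\<Sum>m \<in> Poly_Mapping.keys p.
     Poly_Mapping.single (m - Poly_Mapping.single i 1) (of_nat (Poly_Mapping.lookup m i) * Poly_Mapping.lookup p m))"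

text \<open>Value at \<open>v\<close>, the coefficients being mapped by \<open>\<phi>\<close> (the identity, or \<open>k \<rightarrow> k\<^bsup>alg\<^esup>\<close>).\<close>

definition peval :: "('k::zero \<Rightarrow> 'b::comm_semiring_1) \<Rightarrow> 'k mpoly \<Rightarrow> (nat \<Rightarrow> 'b) \<Rightarrow> 'b" where
  "peval \<phi> p v = (\<Sum>m\<in>Poly_Mapping.keys p.
     \<phi> (Poly_Mapping.lookup p m) * (\<Prod>i\<in>Poly_Mapping.keys m. v i ^ Poly_Mapping.lookup m i))"

text \<open>A point is the set of all its vectors of homogeneous coordinates
  (extended by \<open>0\<close> beyond the index \<open>n\<close>).\<close>

definition proj_space :: "nat \<Rightarrow> (nat \<Rightarrow> 'b::field) set set" where
  "proj_space n = {{(\<lambda>i. c * v i) | c. c \<noteq> 0} | v. (\<exists>i. v i \<noteq> 0) \<and> (\<forall>i>n. v i = 0)}"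

definition zero_locus ::
  "('k::zero \<Rightarrow> 'b::field) \<Rightarrow> nat \<Rightarrow> 'k mpoly set \<Rightarrow> (nat \<Rightarrow> 'b) set set" where
  "zero_locus \<phi> n A = {P \<in> proj_space n. \<forall>f\<in>A. \<forall>v\<in>P. peval \<phi> f v = 0}"

definition zariski :: "nat \<Rightarrow> (nat \<Rightarrow> 'b::field) set topology" where
  "zariski n = topology_generated_by
     {proj_space n - zero_locus (\<lambda>c. c) n {f} | f. \<exists>d. f \<in> forms n d}"


section \<open>Projective curves\<close>

text \<open>A closed integral subscheme of \<open>\<bbbP>\<^sup>n\<close> over \<open>k\<close> is given by a homogeneous prime ideal
  of \<open>k[x\<^sub>0, \<dots>, x\<^sub>n]\<close> that does not contain all the variables.\<close>

record (overloaded) 'k proj_scheme =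
  amb :: nat
  van :: "'k mpoly set"

definition projective_variety :: "'k::field proj_scheme \<Rightarrow> bool" where
  "projective_variety C \<longleftrightarrow>
     van C \<subseteq> poly_in (amb C) \<and>
     0 \<in> van C \<and>
     (\<forall>f\<in>van C. \<forall>g\<in>van C. f + g \<in> van C) \<and>
     (\<forall>f\<in>van C. \<forall>g\<in>poly_in (amb C). g * f \<in> van C) \<and>
     1 \<notin> van C \<and>
     (\<forall>f\<in>poly_in (amb C). \<forall>g\<in>poly_in (amb C). f * g \<in> van C \<longrightarrow> f \<in> van C \<or> g \<in> van C) \<and>
     (\<forall>f\<in>van C. \<forall>d. hom_component d f \<in> van C) \<and>
     (\<exists>i\<le>amb C. var_poly i \<notin> van C)"

subsection \<open>The function field\<close>

text \<open>Fractions \<open>f/g\<close> of forms of the same degree with \<open>g \<notin> I\<close>, modulo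
  \<open>f/g = f'/g' \<longleftrightarrow> fg' - f'g \<in> I\<close>. The operations are taken over all representatives;
  the union is that of equal classes.\<close>

type_synonym 'k ratfun = "('k mpoly \<times> 'k mpoly) set"

definition fractions :: "'k::field proj_scheme \<Rightarrow> ('k mpoly \<times> 'k mpoly) set" where
  "fractions C = {(f, g). (\<exists>d. f \<in> forms (amb C) d \<and> g \<in> forms (amb C) d) \<and> g \<notin> van C}"

definition fraction :: "'k::field proj_scheme \<Rightarrow> 'k mpoly \<Rightarrow> 'k mpoly \<Rightarrow> 'k ratfun" where
  "fraction C f g = {(f', g') \<in> fractions C. f * g' - f' * g \<in> van C}"

definition function_field :: "'k::field proj_scheme \<Rightarrow> 'k ratfun ring" where
  "function_field C =
     \<lparr>carrier = {fraction C f g | f g. (f, g) \<in> fractions C},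
      monoid.mult = (\<lambda>a b. \<Union>(f, g)\<in>a. \<Union>(f', g')\<in>b. fraction C (f * f') (g * g')),
      one = fraction C 1 1,
      zero = fraction C 0 1,
      add = (\<lambda>a b. \<Union>(f, g)\<in>a. \<Union>(f', g')\<in>b. fraction C (f * g' + f' * g) (g * g'))\<rparr>"

definition const_fun :: "'k::field proj_scheme \<Rightarrow> 'k \<Rightarrow> 'k ratfun" where
  "const_fun C c = fraction C (const_poly c) 1"

subsection \<open>Dimension, smoothness, geometric connectedness, genus\<close>

text \<open>The function field has transcendence degree one over \<open>k\<close>.\<close>

definition one_dimensional :: "'k::field proj_scheme \<Rightarrow> bool" where
  "one_dimensional C \<longleftrightarrow>
     (let K = function_field C; k = range (const_fun C) in
      \<exists>t\<in>carrier K. ring.transcendental K k t \<and>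
        (\<forall>u\<in>carrier K. ring.algebraic K (generate_field K (insert t k)) u))"

text \<open>Jacobian criterion for a curve in \<open>\<bbbP>\<^sup>n\<close>: at every geometric point the gradients of the
  elements of the ideal span a space of dimension \<open>n - 1\<close>.\<close>

definition smooth_curve :: "'k::field proj_scheme \<Rightarrow> bool" where
  "smooth_curve C \<longleftrightarrow>
     (\<forall>P \<in> zero_locus (to_ac :: 'k \<Rightarrow> 'k alg_closure) (amb C) (van C). \<forall>v\<in>P.
        vector_space.dim (\<lambda>(c :: 'k alg_closure) w. (\<lambda>j :: nat. c * w j))
          {(\<lambda>j. if j \<le> amb C then peval to_ac (partial_deriv j f) v else 0) | f. f \<in> van C} + 1
        = amb C)"

definition geometrically_connected :: "'k::field proj_scheme \<Rightarrow> bool" where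
  "geometrically_connected C \<longleftrightarrow>
     connectedin (zariski (amb C))
       (zero_locus (to_ac :: 'k \<Rightarrow> 'k alg_closure) (amb C) (van C))"

text \<open>A smooth and geometrically connected scheme is integral and a proper curve over a field is
  projective: up to isomorphism these are all the proper, smooth, geometrically connected curves.\<close>

definition smooth_projective_curve :: "'k::field proj_scheme \<Rightarrow> bool" where
  "smooth_projective_curve C \<longleftrightarrow>
     projective_variety C \<and> one_dimensional C \<and> smooth_curve C \<and> geometrically_connected C"

text \<open>The Hilbert function \<open>m \<mapsto> dim\<^sub>k (k[x\<^sub>0, \<dots>, x\<^sub>n]/I)\<^sub>m\<close> is eventually a polynomial \<open>P\<close>, and the
  (arithmetic) genus of a curve is \<open>p\<^sub>a = 1 - P(0)\<close>. For a smooth projective geometrically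
  connected curve this is \<open>dim\<^sub>k H\<^sup>1(C, \<O>\<^sub>C)\<close>.\<close>

definition hilbert_function :: "'k::field proj_scheme \<Rightarrow> nat \<Rightarrow> nat" where
  "hilbert_function C m =
     vector_space.dim (\<lambda>(c :: 'k) p. const_poly c * p) (forms (amb C) m)
     - vector_space.dim (\<lambda>(c :: 'k) p. const_poly c * p) (forms (amb C) m \<inter> van C)"

definition hilbert_poly :: "'k::field proj_scheme \<Rightarrow> rat poly" where
  "hilbert_poly C =
     (THE P. \<forall>\<^sub>F m in sequentially. of_nat (hilbert_function C m) = poly P (of_nat m))"

definition genus :: "'k::field proj_scheme \<Rightarrow> rat" where
  "genus C = 1 - poly (hilbert_poly C) 0"

subsection \<open>Rational points and their local rings\<close>

definition rational_points :: "'k::field proj_scheme \<Rightarrow> (nat \<Rightarrow> 'k) set set" where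
  "rational_points C = zero_locus (\<lambda>c. c) (amb C) (van C)"

definition local_ring :: "'k::field proj_scheme \<Rightarrow> (nat \<Rightarrow> 'k) set \<Rightarrow> 'k ratfun set" where
  "local_ring C x =
     {fraction C f g | f g. (f, g) \<in> fractions C \<and> (\<forall>v\<in>x. peval (\<lambda>c. c) g v \<noteq> 0)}"


section \<open>Galois groups\<close>

text \<open>Automorphisms are taken extensional, so that they are equal as soon as they agree on \<open>E\<close>.\<close>

definition galois_group :: "('a, 'b) ring_scheme \<Rightarrow> 'a set \<Rightarrow> ('a \<Rightarrow> 'a) monoid" where
  "galois_group E F =
     \<lparr>carrier = {\<sigma> \<in> ring_iso E E \<inter> extensional (carrier E). \<forall>x\<in>F. \<sigma> x = x},
      monoid.mult = (\<lambda>\<sigma> \<tau>. compose (carrier E) \<sigma> \<tau>),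
      one = (\<lambda>x\<in>carrier E. x)\<rparr>"

text \<open>The basic open sets are the cosets \<open>\<sigma> Gal(E/M)\<close> with \<open>M\<close> finite over \<open>F\<close>.\<close>

definition krull_topology :: "('a, 'b) ring_scheme \<Rightarrow> 'a set \<Rightarrow> ('a \<Rightarrow> 'a) topology" where
  "krull_topology E F = topology_generated_by
     {{\<tau> \<in> carrier (galois_group E F). \<forall>x\<in>M. \<tau> x = \<sigma> x} | \<sigma> M.
        \<sigma> \<in> carrier (galois_group E F) \<and> subfield M E \<and> F \<subseteq> M \<and> ring.finite_dimension E F M}"


section \<open>The birational section conjecture for a curve\<close>

text \<open>In characteristic \<open>0\<close> a separable closure is an algebraic closure. It consists of a field \<open>L\<close>
  and an embedding \<open>\<iota>\<close> of \<open>K\<^sub>X\<close> in it. The type of the elements of \<open>L\<close> is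
  that of \<^const>\<open>field.alg_closure\<close>, so that there is one.\<close>

type_synonym 'k sepcl = "('k ratfun list \<times> nat) multiset \<Rightarrow> 'k ratfun"

definition separable_closure ::
  "'k::field_char_0 proj_scheme \<Rightarrow> 'k sepcl ring \<Rightarrow> ('k ratfun \<Rightarrow> 'k sepcl) \<Rightarrow> bool" where
  "separable_closure C L \<iota> \<longleftrightarrow>
     \<iota> \<in> ring_hom (function_field C) L \<and>
     algebraic_closure L (\<iota> ` carrier (function_field C))"

context
  fixes C :: "'k::field_char_0 proj_scheme"
    and L :: "'k sepcl ring"
    and \<iota> :: "'k ratfun \<Rightarrow> 'k sepcl"
begin

definition K_img :: "'k sepcl set" where
  "K_img = \<iota> ` carrier (function_field C)"

definition k_img :: "'k sepcl set" where
  "k_img = \<iota> ` range (const_fun C)"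

definition kbar :: "'k sepcl set" where
  "kbar = {a \<in> carrier L. ring.algebraic L k_img a}"

abbreviation kbar_field :: "'k sepcl ring" where
  "kbar_field \<equiv> L\<lparr>carrier := kbar\<rparr>"

abbreviation G_X :: "('k sepcl \<Rightarrow> 'k sepcl) monoid" where
  "G_X \<equiv> galois_group L K_img"

abbreviation G_k :: "('k sepcl \<Rightarrow> 'k sepcl) monoid" where
  "G_k \<equiv> galois_group kbar_field k_img"

definition pr_X :: "('k sepcl \<Rightarrow> 'k sepcl) \<Rightarrow> ('k sepcl \<Rightarrow> 'k sepcl)" where
  "pr_X \<sigma> = restrict \<sigma> kbar"

definition galois_section :: "(('k sepcl \<Rightarrow> 'k sepcl) \<Rightarrow> ('k sepcl \<Rightarrow> 'k sepcl)) \<Rightarrow> bool" where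
  "galois_section s \<longleftrightarrow>
     s \<in> hom G_k G_X \<and>
     continuous_map (krull_topology kbar_field k_img) (krull_topology L K_img) s \<and>
     (\<forall>\<tau>\<in>carrier G_k. pr_X (s \<tau>) = \<tau>)"

text \<open>Valuations are given by their valuation rings. The discrete valuation of \<open>K\<^sub>X\<close> defined by \<open>x\<close>
  has valuation ring \<open>\<O>\<^bsub>X,x\<^esub>\<close>, and the valuation of \<open>V\<close> extends it iff \<open>V \<inter> K\<^sub>X = \<O>\<^bsub>X,x\<^esub>\<close>.\<close>

definition valuation_ring :: "'k sepcl set \<Rightarrow> bool" where
  "valuation_ring V \<longleftrightarrow>
     subring V L \<and> (\<forall>a\<in>carrier L. a \<noteq> \<zero>\<^bsub>L\<^esub> \<longrightarrow> a \<in> V \<or> inv\<^bsub>L\<^esub> a \<in> V)"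

definition decomposition_subgroup ::
  "(nat \<Rightarrow> 'k) set \<Rightarrow> ('k sepcl \<Rightarrow> 'k sepcl) set \<Rightarrow> bool" where
  "decomposition_subgroup x D \<longleftrightarrow>
     (\<exists>V. valuation_ring V \<and> V \<inter> K_img = \<iota> ` local_ring C x \<and>
          D = {\<sigma> \<in> carrier G_X. \<sigma> ` V = V})"

end

definition BGASC :: "'k::field_char_0 proj_scheme \<Rightarrow> bool" where
  "BGASC C \<longleftrightarrow>
     (\<forall>L \<iota> s. separable_closure C L \<iota> \<longrightarrow> galois_section C L \<iota> s \<longrightarrow>
        (\<exists>!x. x \<in> rational_points C \<and>
           (\<exists>D. decomposition_subgroup C L \<iota> x D \<and> s ` carrier (G_k C L \<iota>) \<subseteq> D)))"

end

(* Let C be a curve over k with a section s, t a non-constant function on C and n = g + 1. A square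
   root of (t^n + 1)/(t^n - 1) is multiplied by -1 by a quadratic character of G_k, acting through s;
   since the character is trivialised by a finite extension of k, a constant multiple w of the root is
   fixed by s. So s is also a section for the curve Y with function field k(t, w), which has genus g,
   and by hypothesis its image fixes a valuation ring V of the separable closure that lies over a
   rational point of Y. Its residues on the function field of C are algebraic over k and fixed by
   G_k, hence in k, so V is centered at a rational point of C; as C is smooth, V induces the local ring
   of this point. If two points of C belonged to s in this way, choose t with a pole at only one of
   them: the two valuation rings would lie over different points of Y.

   Y is embedded in projective 3-space by (1 : w : t : tw), as a curve of bidegree (n, 2) on a quadric.
   The separable closure of the function field is replaced by an isomorphic field that is a type,
   so that only polynomials and subfields of this type have to be treated. *)
theory Submission
  imports Defs
begin

text \<open>The function fields of the given curve and of the auxiliary curve need not contain one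
  another. They share an algebraic closure, and a section for the one is a section for the other as
  soon as its values fix the other field. What is passed from curve to curve is therefore a
  valuation ring of the closure, stable under the action of G_k, containing k and not equal to the
  whole field; it has a center on every such curve.

  Why n = g + 1: a double cover of the line branched over the 2n simple zeros of t^(2n) - 1 has
  genus n - 1. Why a quotient under the root rather than a product: the equation becomes t^n (u^2 -
  c v^2) = s^n (u^2 + c v^2), which is smooth at all points of a product of two lines at once, with
  no singular point at infinity to resolve. Smoothness, connectedness and Hilbert function all rest
  on one normal form modulo this equation, and the norm from k(t, w) to k(t) detects when a normal
  form is zero.\<close>

hide_const (open) up_ring.monom up_ring.coeff

section \<open>Evaluation of polynomials\<close>

lemma mdeg_superset:
  assumes "finite S" "Poly_Mapping.keys m \<subseteq> S"
  shows "mdeg m = (\<Sum>i\<in>S. Poly_Mapping.lookup m i)"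
  unfolding mdeg_def using assms
  by (intro sum.mono_neutral_left) (auto simp: in_keys_iff)

lemma mdeg_zero [simp]: "mdeg 0 = 0"
  by (simp add: mdeg_def)

lemma mdeg_single [simp]: "mdeg (Poly_Mapping.single i k) = k"
  by (simp add: mdeg_def)

lemma keys_add_nat:
  "Poly_Mapping.keys (m + m' :: 'i \<Rightarrow>\<^sub>0 nat) = Poly_Mapping.keys m \<union> Poly_Mapping.keys m'"
  by (auto simp: in_keys_iff lookup_add)

lemma mdeg_add [simp]: "mdeg (m + m') = mdeg m + mdeg m'"
proof -
  define S where "S = Poly_Mapping.keys m \<union> Poly_Mapping.keys m'"
  have "finite S" "Poly_Mapping.keys m \<subseteq> S" "Poly_Mapping.keys m' \<subseteq> S" "Poly_Mapping.keys (m + m') \<subseteq> S"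
    by (auto simp: S_def keys_add_nat)
  then show ?thesis
    by (simp add: mdeg_superset[of S] lookup_add sum.distrib)
qed

lemma sum_singles: "(\<Sum>m\<in>Poly_Mapping.keys p. Poly_Mapping.single m (Poly_Mapping.lookup p m)) = p"
proof (rule poly_mapping_eqI)
  fix k
  show "Poly_Mapping.lookup (\<Sum>m\<in>Poly_Mapping.keys p. Poly_Mapping.single m (Poly_Mapping.lookup p m)) k
    = Poly_Mapping.lookup p k"
    by (cases "k \<in> Poly_Mapping.keys p")
      (auto simp: lookup_sum lookup_single when_def in_keys_iff)
qed

lemma poly_in_0 [simp]: "0 \<in> poly_in n"
  by (simp add: poly_in_def)

lemma poly_in_1 [simp]: "(1 :: 'k::zero_neq_one mpoly) \<in> poly_in n"
  by (simp add: poly_in_def)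

lemma poly_in_const [simp]: "const_poly c \<in> poly_in n"
  by (simp add: poly_in_def const_poly_def)

lemma poly_in_var [simp]: "i \<le> n \<Longrightarrow> var_poly i \<in> poly_in n"
  by (simp add: poly_in_def var_poly_def)

lemma poly_in_single: "Poly_Mapping.keys m \<subseteq> {..n} \<Longrightarrow> Poly_Mapping.single m c \<in> poly_in n"
  by (simp add: poly_in_def)

lemma poly_in_add:
  fixes p q :: "'k::comm_monoid_add mpoly"
  assumes "p \<in> poly_in n" "q \<in> poly_in n"
  shows "p + q \<in> poly_in n"
  using assms keys_add[of p q] unfolding poly_in_def by blast

lemma poly_in_uminus:
  fixes p :: "'k::ab_group_add mpoly"
  assumes "p \<in> poly_in n"
  shows "- p \<in> poly_in n"
  using assms unfolding poly_in_def by auto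

lemma poly_in_diff:
  fixes p q :: "'k::ab_group_add mpoly"
  assumes "p \<in> poly_in n" "q \<in> poly_in n"
  shows "p - q \<in> poly_in n"
  using poly_in_add[OF assms(1) poly_in_uminus[OF assms(2)]] by simp

lemma poly_in_mult:
  fixes p q :: "'k::comm_semiring_0 mpoly"
  assumes "p \<in> poly_in n" "q \<in> poly_in n"
  shows "p * q \<in> poly_in n"
proof -
  have "Poly_Mapping.keys m \<subseteq> {..n}" if m: "m \<in> Poly_Mapping.keys (p * q)" for m
  proof -
    obtain a b where "m = a + b" "a \<in> Poly_Mapping.keys p" "b \<in> Poly_Mapping.keys q"
      using m keys_mult[of p q] by blast
    then show ?thesis
      using assms by (auto simp: poly_in_def keys_add_nat)
  qed
  then show ?thesis
    by (simp add: poly_in_def)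
qed

lemma poly_in_power:
  fixes p :: "'k::comm_semiring_1 mpoly"
  assumes "p \<in> poly_in n"
  shows "p ^ k \<in> poly_in n"
  using assms by (induction k) (auto intro: poly_in_mult)

lemma forms_poly_in: "p \<in> forms n d \<Longrightarrow> p \<in> poly_in n"
  by (simp add: forms_def)

lemma forms_0 [simp]: "0 \<in> forms n d"
  by (simp add: forms_def)

lemma forms_1 [simp]: "(1 :: 'k::zero_neq_one mpoly) \<in> forms n 0"
  by (simp add: forms_def)

lemma forms_const [simp]: "const_poly c \<in> forms n 0"
  unfolding forms_def using poly_in_const[of c n] by (auto simp: const_poly_def split: if_splits)

lemma forms_var [simp]: "i \<le> n \<Longrightarrow> var_poly i \<in> forms n 1"
  unfolding forms_def using poly_in_var[of i n] by (auto simp: var_poly_def)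

lemma forms_single:
  "Poly_Mapping.keys m \<subseteq> {..n} \<Longrightarrow> mdeg m = d \<Longrightarrow> Poly_Mapping.single m c \<in> forms n d"
  by (simp add: forms_def poly_in_single)

lemma forms_add:
  fixes p q :: "'k::comm_monoid_add mpoly"
  assumes "p \<in> forms n d" "q \<in> forms n d"
  shows "p + q \<in> forms n d"
  using assms keys_add[of p q] poly_in_add[of p n q] unfolding forms_def by blast

lemma forms_uminus:
  fixes p :: "'k::ab_group_add mpoly"
  assumes "p \<in> forms n d"
  shows "- p \<in> forms n d"
  using assms unfolding forms_def by (auto intro: poly_in_uminus)

lemma forms_diff:
  fixes p q :: "'k::ab_group_add mpoly"
  assumes "p \<in> forms n d" "q \<in> forms n d"
  shows "p - q \<in> forms n d"
  using forms_add[OF assms(1) forms_uminus[OF assms(2)]] by simp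

lemma forms_mult:
  fixes p q :: "'k::comm_semiring_0 mpoly"
  assumes "p \<in> forms n d" "q \<in> forms n e"
  shows "p * q \<in> forms n (d + e)"
proof -
  have "p * q \<in> poly_in n"
    using assms by (auto intro: poly_in_mult simp: forms_def)
  moreover have "mdeg m = d + e" if m: "m \<in> Poly_Mapping.keys (p * q)" for m
  proof -
    obtain a b where "m = a + b" "a \<in> Poly_Mapping.keys p" "b \<in> Poly_Mapping.keys q"
      using m keys_mult[of p q] by blast
    then show ?thesis
      using assms by (simp add: forms_def)
  qed
  ultimately show ?thesis
    by (simp add: forms_def)
qed

lemma forms_sum:
  fixes f :: "'i \<Rightarrow> 'k::comm_monoid_add mpoly"
  assumes "\<And>i. i \<in> A \<Longrightarrow> f i \<in> forms n d"
  shows "sum f A \<in> forms n d"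
  using assms by (induction A rule: infinite_finite_induct) (auto intro: forms_add)

lemma forms_power:
  fixes p :: "'k::comm_semiring_1 mpoly"
  assumes "p \<in> forms n d"
  shows "p ^ k \<in> forms n (k * d)"
proof (induction k)
  case (Suc k)
  then show ?case
    using forms_mult[OF assms Suc] by (simp add: algebra_simps)
qed simp

lemma lookup_hom_component:
  "Poly_Mapping.lookup (hom_component d p) m = (if mdeg m = d then Poly_Mapping.lookup p m else 0)"
  by (auto simp: hom_component_def lookup_sum lookup_single when_def in_keys_iff)

lemma hom_component_forms:
  assumes "p \<in> poly_in n"
  shows "hom_component d p \<in> forms n d"
  using assms
  by (auto simp: forms_def poly_in_def in_keys_iff lookup_hom_component split: if_splits)

lemma hom_component_form:
  assumes "p \<in> forms n d"
  shows "hom_component e p = (if e = d then p else 0)"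
  using assms by (intro poly_mapping_eqI) (auto simp: lookup_hom_component forms_def in_keys_iff)

lemma hom_component_add: "hom_component d (p + q) = hom_component d p + hom_component d q"
  by (intro poly_mapping_eqI) (auto simp: lookup_hom_component lookup_add)

lemma hom_component_hom_component:
  "hom_component e (hom_component d p) = (if e = d then hom_component d p else 0)"
  by (intro poly_mapping_eqI) (auto simp: lookup_hom_component)

lemma sum_hom_components:
  assumes "\<And>m. m \<in> Poly_Mapping.keys p \<Longrightarrow> mdeg m \<le> N"
  shows "(\<Sum>d\<le>N. hom_component d p) = p"
  using assms by (intro poly_mapping_eqI) (auto simp: lookup_hom_component lookup_sum in_keys_iff)

lemma mdeg_bounded: obtains N where "\<And>m. m \<in> Poly_Mapping.keys p \<Longrightarrow> mdeg m \<le> N"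
  using that[of "Max (mdeg ` Poly_Mapping.keys p)"] by simp

lemma exponent_split:
  assumes "i \<in> Poly_Mapping.keys m"
  shows "Poly_Mapping.single i 1 + (m - Poly_Mapping.single i 1) = (m :: nat \<Rightarrow>\<^sub>0 nat)"
  using assms
  by (intro poly_mapping_eqI) (auto simp: lookup_add lookup_minus lookup_single when_def in_keys_iff)

lemma var_poly_mult_single:
  "var_poly i * Poly_Mapping.single m c = Poly_Mapping.single (Poly_Mapping.single i 1 + m) (c :: 'k::comm_semiring_1)"
  by (simp add: var_poly_def mult_single)

text \<open>A monomial is built up one variable at a time, so the only product in the induction is
  that of a variable and a monomial. Arguments such as Taylor expansion need the product rule in
  this case only.\<close>

lemma mpoly_induct [consumes 1, case_names const var add]:
  fixes p :: "'k::comm_semiring_1 mpoly"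
  assumes p: "p \<in> poly_in n"
    and const: "\<And>c. P (const_poly c)"
    and var: "\<And>i m c. i \<le> n \<Longrightarrow> Poly_Mapping.keys m \<subseteq> {..n} \<Longrightarrow> P (Poly_Mapping.single m c) \<Longrightarrow>
      P (var_poly i * Poly_Mapping.single m c)"
    and add: "\<And>p q. p \<in> poly_in n \<Longrightarrow> q \<in> poly_in n \<Longrightarrow> P p \<Longrightarrow> P q \<Longrightarrow> P (p + q)"
  shows "P p"
proof -
  have single: "P (Poly_Mapping.single m c)" if "Poly_Mapping.keys m \<subseteq> {..n}" for m c
    using that
  proof (induction "mdeg m" arbitrary: m)
    case 0
    have "m = 0"
    proof (rule ccontr)
      assume "m \<noteq> 0"
      then obtain i where "i \<in> Poly_Mapping.keys m"
        by (metis all_not_in_conv keys_eq_empty)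
      then have "mdeg (Poly_Mapping.single i 1 + (m - Poly_Mapping.single i 1)) = 0"
        using 0 exponent_split[of i m] by simp
      then show False
        by simp
    qed
    then show ?case
      using const[of c] by (simp add: const_poly_def)
  next
    case (Suc d)
    then have "Poly_Mapping.keys m \<noteq> {}"
      by (auto simp: mdeg_def)
    then obtain i where i: "i \<in> Poly_Mapping.keys m"
      by blast
    define m' where "m' = m - Poly_Mapping.single i 1"
    have m: "m = Poly_Mapping.single i 1 + m'"
      using exponent_split[OF i] by (simp add: m'_def)
    have k: "Poly_Mapping.keys m' \<subseteq> {..n}"
      using Suc.prems m keys_add_nat[of "Poly_Mapping.single i 1" m'] by auto
    have "mdeg m' = d"
      using Suc.hyps(2) m by simp
    then have "P (Poly_Mapping.single m' c)"
      using Suc.hyps(1) k by simp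
    then have "P (var_poly i * Poly_Mapping.single m' c)"
      using var i Suc.prems k by blast
    then show ?case
      using m by (simp add: var_poly_mult_single)
  qed
  have "P (\<Sum>m\<in>A. Poly_Mapping.single m (Poly_Mapping.lookup p m)) \<and>
      (\<Sum>m\<in>A. Poly_Mapping.single m (Poly_Mapping.lookup p m)) \<in> poly_in n"
    if "finite A" "A \<subseteq> Poly_Mapping.keys p" for A
    using that
  proof (induction A)
    case empty
    then show ?case
      using const[of 0] by (simp add: const_poly_def)
  next
    case (insert m A)
    then have "Poly_Mapping.keys m \<subseteq> {..n}"
      using p by (auto simp: poly_in_def)
    then show ?case
      using insert single[of m] poly_in_single[of m n]
      by (auto intro!: add poly_in_add)
  qed
  from this[of "Poly_Mapping.keys p"] show ?thesis
    by (simp add: sum_singles)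
qed

section \<open>Values of polynomials under a homomorphism of the coefficients\<close>

definition mon :: "(nat \<Rightarrow>\<^sub>0 nat) \<Rightarrow> (nat \<Rightarrow> 'b::comm_semiring_1) \<Rightarrow> 'b" where
  "mon m v = (\<Prod>i\<in>Poly_Mapping.keys m. v i ^ Poly_Mapping.lookup m i)"

lemma mon_superset:
  assumes "finite S" "Poly_Mapping.keys m \<subseteq> S"
  shows "mon m v = (\<Prod>i\<in>S. v i ^ Poly_Mapping.lookup m i)"
  unfolding mon_def using assms
  by (intro prod.mono_neutral_left) (auto simp: in_keys_iff)

lemma mon_0 [simp]: "mon 0 v = 1"
  by (simp add: mon_def)

lemma mon_single [simp]: "mon (Poly_Mapping.single i k) v = v i ^ k"
  by (simp add: mon_def)

lemma mon_add: "mon (m + m') v = mon m v * mon m' v"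
proof -
  define S where "S = Poly_Mapping.keys m \<union> Poly_Mapping.keys m'"
  have "finite S" "Poly_Mapping.keys m \<subseteq> S" "Poly_Mapping.keys m' \<subseteq> S" "Poly_Mapping.keys (m + m') \<subseteq> S"
    by (auto simp: S_def keys_add_nat)
  then show ?thesis
    by (simp add: mon_superset[of S] lookup_add power_add prod.distrib)
qed

lemma mon_scale: "mon m (\<lambda>i. c * v i) = c ^ mdeg m * mon m v"
  by (simp add: mon_def mdeg_def power_mult_distrib prod.distrib power_sum)

lemma peval_mon:
  "peval \<phi> p v = (\<Sum>m\<in>Poly_Mapping.keys p. \<phi> (Poly_Mapping.lookup p m) * mon m v)"
  by (simp add: peval_def mon_def)

text \<open>A predicate on functions, so that the same evaluation lemmas serve the identity of k,
  \<open>to_ac\<close>, embeddings of k in a larger field, automorphisms of that field, and maps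
  into constant polynomials, which carry gradings and tangent vectors.\<close>

locale coeff_hom =
  fixes \<phi> :: "'k::comm_ring_1 \<Rightarrow> 'b::comm_ring_1"
  assumes hom_add: "\<phi> (a + b) = \<phi> a + \<phi> b"
    and hom_mult: "\<phi> (a * b) = \<phi> a * \<phi> b"
    and hom_one: "\<phi> 1 = 1"
begin

lemma hom_zero: "\<phi> 0 = 0"
  using hom_add[of 0 0] by simp

lemma hom_uminus: "\<phi> (- a) = - \<phi> a"
  using hom_add[of a "- a"] hom_zero by (simp add: eq_neg_iff_add_eq_0 add.commute)

lemma hom_diff: "\<phi> (a - b) = \<phi> a - \<phi> b"
  using hom_add[of a "- b"] hom_uminus by simp

lemma hom_sum: "\<phi> (sum f A) = (\<Sum>i\<in>A. \<phi> (f i))"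
  by (induction A rule: infinite_finite_induct) (auto simp: hom_zero hom_add)

lemma hom_power: "\<phi> (a ^ n) = \<phi> a ^ n"
  by (induction n) (auto simp: hom_one hom_mult)

lemma hom_of_nat: "\<phi> (of_nat n) = of_nat n"
  by (induction n) (auto simp: hom_zero hom_one hom_add)

lemma peval_superset:
  assumes "finite S" "Poly_Mapping.keys p \<subseteq> S"
  shows "peval \<phi> p v = (\<Sum>m\<in>S. \<phi> (Poly_Mapping.lookup p m) * mon m v)"
  unfolding peval_mon using assms
  by (intro sum.mono_neutral_left) (auto simp: in_keys_iff hom_zero)

lemma peval_0: "peval \<phi> 0 v = 0"
  by (simp add: peval_def)

lemma peval_single: "peval \<phi> (Poly_Mapping.single m c) v = \<phi> c * mon m v"
  by (simp add: peval_mon hom_zero)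

lemma peval_const: "peval \<phi> (const_poly c) v = \<phi> c"
  by (simp add: const_poly_def peval_single)

lemma peval_1: "peval \<phi> 1 v = 1"
  using peval_const[of 1 v] by (simp add: const_poly_def hom_one)

lemma peval_var: "peval \<phi> (var_poly i) v = v i"
  by (simp add: var_poly_def peval_single hom_one)

lemma peval_add: "peval \<phi> (p + q) v = peval \<phi> p v + peval \<phi> q v"
proof -
  define S where "S = Poly_Mapping.keys p \<union> Poly_Mapping.keys q"
  have "finite S" "Poly_Mapping.keys p \<subseteq> S" "Poly_Mapping.keys q \<subseteq> S" "Poly_Mapping.keys (p + q) \<subseteq> S"
    using keys_add[of p q] by (auto simp: S_def)
  then show ?thesis
    by (simp add: peval_superset[of S] lookup_add hom_add algebra_simps sum.distrib)
qed

lemma peval_sum: "peval \<phi> (sum f A) v = (\<Sum>i\<in>A. peval \<phi> (f i) v)"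
  by (induction A rule: infinite_finite_induct) (auto simp: peval_0 peval_add)

lemma peval_uminus: "peval \<phi> (- p) v = - peval \<phi> p v"
  using peval_add[of p "- p" v] peval_0 by (simp add: eq_neg_iff_add_eq_0 add.commute)

lemma peval_diff: "peval \<phi> (p - q) v = peval \<phi> p v - peval \<phi> q v"
  using peval_add[of p "- q" v] peval_uminus by simp

lemma peval_mult: "peval \<phi> (p * q) v = peval \<phi> p v * peval \<phi> q v"
proof -
  have "peval \<phi> (p * q) v = peval \<phi> ((\<Sum>a\<in>Poly_Mapping.keys p. Poly_Mapping.single a (Poly_Mapping.lookup p a)) *
      (\<Sum>b\<in>Poly_Mapping.keys q. Poly_Mapping.single b (Poly_Mapping.lookup q b))) v"
    by (simp add: sum_singles)
  also have "\<dots> = (\<Sum>a\<in>Poly_Mapping.keys p. \<Sum>b\<in>Poly_Mapping.keys q.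
      (\<phi> (Poly_Mapping.lookup p a) * mon a v) * (\<phi> (Poly_Mapping.lookup q b) * mon b v))"
    by (simp add: sum_product mult_single peval_sum peval_single hom_mult mon_add algebra_simps)
  also have "\<dots> = peval \<phi> p v * peval \<phi> q v"
    by (simp add: peval_mon sum_product)
  finally show ?thesis .
qed

lemma peval_power: "peval \<phi> (p ^ n) v = peval \<phi> p v ^ n"
  by (induction n) (auto simp: peval_1 peval_mult)

lemma peval_scale:
  assumes "p \<in> forms n d"
  shows "peval \<phi> p (\<lambda>i. c * v i) = c ^ d * peval \<phi> p v"
  using assms by (auto simp: peval_mon mon_scale forms_def sum_distrib_left algebra_simps intro!: sum.cong)

lemmas peval_simps = peval_0 peval_1 peval_const peval_var peval_add peval_diff peval_uminus
  peval_mult peval_power peval_sum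

lemma coeff_hom_const: "coeff_hom (\<lambda>c. [:\<phi> c:])"
  by unfold_locales (auto simp: hom_add hom_mult hom_one)

lemma peval_monom:
  "peval (\<lambda>c. [:\<phi> c:]) p (\<lambda>i. monom (v i) 1)
    = (\<Sum>m\<in>Poly_Mapping.keys p. monom (\<phi> (Poly_Mapping.lookup p m) * mon m v) (mdeg m))"
proof -
  have "mon m (\<lambda>i. monom (v i) 1) = monom (mon m v) (mdeg m)" for m
  proof -
    have *: "(\<Prod>i\<in>A. monom (v i) 1 ^ f i) = monom (\<Prod>i\<in>A. v i ^ f i) (sum f A)" for A and f :: "nat \<Rightarrow> nat"
      by (induction A rule: infinite_finite_induct) (auto simp: monom_power mult_monom)
    show ?thesis
      unfolding mon_def mdeg_def by (rule *)
  qed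
  then show ?thesis
    by (simp add: peval_mon smult_monom)
qed

text \<open>Substituting v_i X for x_i multiplies the part of degree d by X^d, so the values at v of
  all homogeneous components are read off from one polynomial in X.\<close>

lemma coeff_peval_monom:
  "coeff (peval (\<lambda>c. [:\<phi> c:]) p (\<lambda>i. monom (v i) 1)) d = peval \<phi> (hom_component d p) v"
proof -
  have "peval \<phi> (hom_component d p) v
      = (\<Sum>m\<in>Poly_Mapping.keys p. \<phi> (Poly_Mapping.lookup (hom_component d p) m) * mon m v)"
    by (intro peval_superset) (auto simp: in_keys_iff lookup_hom_component split: if_splits)
  then show ?thesis
    unfolding peval_monom by (auto simp: coeff_sum lookup_hom_component hom_zero intro!: sum.cong)
qed

end

lemma coeff_hom_id: "coeff_hom (\<lambda>c. c)"
  by unfold_locales auto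

lemma coeff_hom_to_ac: "coeff_hom to_ac"
  by unfold_locales auto

lemma coeff_hom_comp:
  assumes "coeff_hom \<phi>" "coeff_hom h"
  shows "coeff_hom (\<lambda>c. h (\<phi> c))"
  using assms by (simp add: coeff_hom_def)

lemma hom_mon:
  assumes "coeff_hom h"
  shows "h (mon m v) = mon m (\<lambda>i. h (v i))"
proof -
  interpret coeff_hom h by fact
  have "h (\<Prod>i\<in>A. v i ^ f i) = (\<Prod>i\<in>A. h (v i) ^ f i)" for A and f :: "nat \<Rightarrow> nat"
    by (induction A rule: infinite_finite_induct) (auto simp: hom_one hom_mult hom_power)
  then show ?thesis
    by (simp add: mon_def)
qed

lemma hom_peval:
  assumes "coeff_hom h"
  shows "h (peval \<phi> p v) = peval (\<lambda>c. h (\<phi> c)) p (\<lambda>i. h (v i))"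
proof -
  interpret coeff_hom h by fact
  show ?thesis
    by (simp add: peval_mon hom_sum hom_mult hom_mon[OF assms])
qed

lemma field_hom_inj:
  fixes \<phi> :: "'k::field \<Rightarrow> 'b::comm_ring_1"
  assumes "coeff_hom \<phi>"
  shows "\<phi> a = \<phi> b \<longleftrightarrow> a = b"
proof
  interpret coeff_hom \<phi> by fact
  assume eq: "\<phi> a = \<phi> b"
  show "a = b"
  proof (rule ccontr)
    assume "a \<noteq> b"
    then have "(a - b) * inverse (a - b) = 1"
      by simp
    then have "\<phi> (a - b) * \<phi> (inverse (a - b)) = 1"
      by (metis hom_mult hom_one)
    then show False
      using eq by (simp add: hom_diff)
  qed
qed simp

lemma field_hom_inverse:
  fixes \<phi> :: "'k::field \<Rightarrow> 'b::field"
  assumes "coeff_hom \<phi>"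
  shows "\<phi> (inverse a) = inverse (\<phi> a)"
proof (cases "a = 0")
  case True
  then show ?thesis
    using coeff_hom.hom_zero[OF assms] by simp
next
  case False
  then have "\<phi> a * \<phi> (inverse a) = 1"
    by (metis assms coeff_hom.hom_mult coeff_hom.hom_one right_inverse)
  then show ?thesis
    by (simp add: inverse_unique)
qed

lemma field_hom_divide:
  fixes \<phi> :: "'k::field \<Rightarrow> 'b::field"
  assumes "coeff_hom \<phi>"
  shows "\<phi> (a / b) = \<phi> a / \<phi> b"
  by (simp add: field_class.field_divide_inverse coeff_hom.hom_mult[OF assms] field_hom_inverse[OF assms])

section \<open>Partial derivatives\<close>

lemma lookup_partial_deriv:
  "Poly_Mapping.lookup (partial_deriv i p) m
    = of_nat (Poly_Mapping.lookup m i + 1) * Poly_Mapping.lookup p (m + Poly_Mapping.single i 1)"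
proof -
  let ?e = "Poly_Mapping.single i (1::nat)"
  \<comment> \<open>Subtraction of exponents is truncated, so the equivalence may fail where x_i
    does not occur in m'; there the factor \<open>of_nat\<close> vanishes.\<close>
  have *: "m' - ?e = m \<longleftrightarrow> m' = m + ?e" if "Poly_Mapping.lookup m' i \<noteq> 0" for m'
    using exponent_split[of i m'] that by (auto simp: in_keys_iff add.commute)
  have "Poly_Mapping.lookup (partial_deriv i p) m
      = (\<Sum>m'\<in>Poly_Mapping.keys p. if m' - ?e = m then of_nat (Poly_Mapping.lookup m' i) * Poly_Mapping.lookup p m' else 0)"
    by (auto simp: partial_deriv_def lookup_sum lookup_single when_def)
  also have "\<dots> = (\<Sum>m'\<in>Poly_Mapping.keys p. if m' = m + ?e then of_nat (Poly_Mapping.lookup m' i) * Poly_Mapping.lookup p m' else 0)"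
  proof (intro sum.cong refl)
    fix m'
    show "(if m' - ?e = m then of_nat (Poly_Mapping.lookup m' i) * Poly_Mapping.lookup p m' else 0)
        = (if m' = m + ?e then of_nat (Poly_Mapping.lookup m' i) * Poly_Mapping.lookup p m' else 0)"
      using *[of m'] by (cases "Poly_Mapping.lookup m' i = 0") simp_all
  qed
  also have "\<dots> = of_nat (Poly_Mapping.lookup m i + 1) * Poly_Mapping.lookup p (m + ?e)"
    by (auto simp: lookup_add in_keys_iff)
  finally show ?thesis .
qed

lemma partial_deriv_add: "partial_deriv i (p + q) = partial_deriv i p + partial_deriv i q"
  by (intro poly_mapping_eqI) (simp add: lookup_partial_deriv lookup_add distrib_left del: of_nat_add)

lemma partial_deriv_const: "partial_deriv i (const_poly c) = 0"
  by (simp add: partial_deriv_def const_poly_def)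

lemma partial_deriv_single:
  "partial_deriv i (Poly_Mapping.single m c)
    = Poly_Mapping.single (m - Poly_Mapping.single i 1) (of_nat (Poly_Mapping.lookup m i) * c)"
  by (simp add: partial_deriv_def)

lemma partial_deriv_var_mult:
  "partial_deriv j (var_poly i * Poly_Mapping.single m c)
    = (if i = j then Poly_Mapping.single m c else 0)
      + var_poly i * partial_deriv j (Poly_Mapping.single m (c :: 'k::comm_ring_1))"
proof (cases "j \<in> Poly_Mapping.keys m")
  case False
  then have "Poly_Mapping.lookup m j = 0"
    by (simp add: in_keys_iff)
  then show ?thesis
    by (auto simp: var_poly_mult_single partial_deriv_single lookup_add lookup_single when_def)
next
  case True
  have "Poly_Mapping.single i 1 + m - Poly_Mapping.single j 1
      = Poly_Mapping.single i 1 + (m - Poly_Mapping.single j (1::nat))"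
    using True
    by (intro poly_mapping_eqI) (auto simp: lookup_add lookup_minus lookup_single when_def in_keys_iff)
  moreover have "Poly_Mapping.single j 1 + m - Poly_Mapping.single j (1::nat) = m"
    by simp
  moreover have "Poly_Mapping.single j 1 + (m - Poly_Mapping.single j (1::nat)) = m"
    using True by (rule exponent_split)
  ultimately show ?thesis
    by (auto simp: var_poly_mult_single partial_deriv_single lookup_add lookup_single when_def
        algebra_simps single_add)
qed

section \<open>The variety with a given generic point\<close>

text \<open>The condition is on each homogeneous component, since v is a vector of homogeneous
  coordinates, possibly over a larger field: this is the homogeneous ideal of the closure of the
  point v.\<close>

definition vanishing_ideal :: "('k::comm_monoid_add \<Rightarrow> 'b::comm_ring_1) \<Rightarrow> nat \<Rightarrow> (nat \<Rightarrow> 'b) \<Rightarrow> 'k mpoly set" where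
  "vanishing_ideal \<phi> n v = {p \<in> poly_in n. \<forall>d. peval \<phi> (hom_component d p) v = 0}"

lemma vanishing_ideal_form:
  assumes "coeff_hom \<phi>" "p \<in> forms n d"
  shows "p \<in> vanishing_ideal \<phi> n v \<longleftrightarrow> peval \<phi> p v = 0"
  using assms by (auto simp: vanishing_ideal_def forms_poly_in hom_component_form coeff_hom.peval_0)

text \<open>By the substitution of v_i X the ideal becomes the kernel of a single ring homomorphism
  into polynomials; over a domain this makes it prime.\<close>

lemma vanishing_ideal_iff:
  assumes "coeff_hom \<phi>"
  shows "p \<in> vanishing_ideal \<phi> n v \<longleftrightarrow>
    p \<in> poly_in n \<and> peval (\<lambda>c. [:\<phi> c:]) p (\<lambda>i. monom (v i) 1) = 0"
  by (simp add: vanishing_ideal_def poly_eq_iff coeff_hom.coeff_peval_monom[OF assms] del: One_nat_def)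

lemma projective_variety_vanishing_ideal:
  fixes \<phi> :: "'k::field \<Rightarrow> 'b::idom"
  assumes \<phi>: "coeff_hom \<phi>" and v: "i \<le> n" "v i \<noteq> 0"
  shows "projective_variety \<lparr>amb = n, van = vanishing_ideal \<phi> n v\<rparr>"
proof -
  interpret P: coeff_hom "\<lambda>c. [:\<phi> c:]" using \<phi> by (rule coeff_hom.coeff_hom_const)
  note iff = vanishing_ideal_iff[OF \<phi>]
  have "var_poly i \<notin> vanishing_ideal \<phi> n v"
    using vanishing_ideal_form[OF \<phi> forms_var[OF v(1)]] v(2) by (simp add: coeff_hom.peval_var[OF \<phi>])
  moreover have "hom_component d f \<in> vanishing_ideal \<phi> n v" if "f \<in> vanishing_ideal \<phi> n v" for f d
    using that hom_component_forms[of f n d] forms_poly_in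
    by (auto simp: vanishing_ideal_def hom_component_hom_component coeff_hom.peval_0[OF \<phi>])
  ultimately show ?thesis
    unfolding projective_variety_def using v(1)
    by (auto simp: iff P.peval_simps poly_in_add poly_in_mult)
qed

section \<open>Subfields and algebraic elements\<close>

lemma rota_simps [simp]:
  "carrier ring_of_type_algebra = UNIV"
  "monoid.mult ring_of_type_algebra x y = x * y"
  "one ring_of_type_algebra = 1"
  "zero ring_of_type_algebra = 0"
  "add ring_of_type_algebra x y = x + y"
  by (auto simp: ring_of_type_algebra_def)

lemma rota_a_inv [simp]: "a_inv (ring_of_type_algebra :: 'a::comm_ring_1 ring) x = - x"
proof -
  interpret ring "ring_of_type_algebra :: 'a ring" by (rule ring_from_type_algebra)
  have "add ring_of_type_algebra (- x) x = zero ring_of_type_algebra"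
    by simp
  then show ?thesis
    using minus_equality[of "- x" x] by simp
qed

lemma rota_m_inv: "x \<noteq> 0 \<Longrightarrow> m_inv (ring_of_type_algebra :: 'a::field ring) x = inverse x"
proof -
  assume "x \<noteq> 0"
  interpret field "ring_of_type_algebra :: 'a ring" by (rule field_from_type_algebra)
  have "monoid.mult ring_of_type_algebra x (inverse x) = one ring_of_type_algebra"
    using \<open>x \<noteq> 0\<close> by simp
  then show ?thesis
    using comm_inv_char[of x "inverse x"] by simp
qed

lemma rota_pow [simp]: "pow (ring_of_type_algebra :: 'a::comm_ring_1 ring) x (n::nat) = x ^ n"
proof -
  interpret ring "ring_of_type_algebra :: 'a ring" by (rule ring_from_type_algebra)
  show ?thesis
    by (induction n) (simp_all add: mult.commute)
qed

text \<open>Differences give zero and negatives, hence sums, and \<open>inverse 0 = 0\<close>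
  removes the exception in the last clause.\<close>

definition is_subfield :: "'a::field set \<Rightarrow> bool" where
  "is_subfield F \<longleftrightarrow> 1 \<in> F \<and> (\<forall>x\<in>F. \<forall>y\<in>F. x - y \<in> F \<and> x * y \<in> F) \<and> (\<forall>x\<in>F. inverse x \<in> F)"

context
  fixes F :: "'a::field set"
  assumes F: "is_subfield F"
begin

lemma sf_1: "1 \<in> F" and sf_diff: "x \<in> F \<Longrightarrow> y \<in> F \<Longrightarrow> x - y \<in> F"
  and sf_mult: "x \<in> F \<Longrightarrow> y \<in> F \<Longrightarrow> x * y \<in> F" and sf_inverse: "x \<in> F \<Longrightarrow> inverse x \<in> F"
  using F unfolding is_subfield_def by blast+

lemma sf_0: "0 \<in> F"
  using sf_diff[OF sf_1 sf_1] by simp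

lemma sf_uminus: "x \<in> F \<Longrightarrow> - x \<in> F"
  using sf_diff[OF sf_0] by simp

lemma sf_add: "x \<in> F \<Longrightarrow> y \<in> F \<Longrightarrow> x + y \<in> F"
  using sf_diff[of x "- y"] sf_uminus by simp

lemma sf_divide: "x \<in> F \<Longrightarrow> y \<in> F \<Longrightarrow> x / y \<in> F"
  by (simp add: field_class.field_divide_inverse sf_mult sf_inverse)

lemma sf_sum: "(\<And>i. i \<in> A \<Longrightarrow> f i \<in> F) \<Longrightarrow> sum f A \<in> F"
  by (induction A rule: infinite_finite_induct) (auto simp: sf_0 sf_add)

lemma sf_power: "x \<in> F \<Longrightarrow> x ^ n \<in> F"
  by (induction n) (auto simp: sf_1 sf_mult)

end

lemmas sf_intros = sf_0 sf_1 sf_diff sf_mult sf_inverse sf_uminus sf_add sf_divide sf_sum sf_power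

lemma is_subfield_iff: "is_subfield F \<longleftrightarrow> subfield F (ring_of_type_algebra :: 'a::field ring)"
proof
  interpret field "ring_of_type_algebra :: 'a ring" by (rule field_from_type_algebra)
  assume F: "is_subfield F"
  have "subring F ring_of_type_algebra"
    by (rule subringI) (use F in \<open>auto simp: sf_intros\<close>)
  then show "subfield F ring_of_type_algebra"
    by (rule subfieldI') (use F in \<open>auto simp: sf_intros rota_m_inv\<close>)
next
  interpret field "ring_of_type_algebra :: 'a ring" by (rule field_from_type_algebra)
  assume "subfield F ring_of_type_algebra"
  then have sF: "subfield F (ring_of_type_algebra :: 'a ring)" .
  note sr = subringE[OF subfieldE(1)[OF sF], simplified]
  have "x - y \<in> F" if "x \<in> F" "y \<in> F" for x y
    using sr that by (metis diff_conv_add_uminus)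
  moreover have "inverse x \<in> F" if "x \<in> F" for x
  proof (cases "x = 0")
    case False
    then have "x \<in> F - {zero ring_of_type_algebra}"
      using that by simp
    then show ?thesis
      using subfield_m_inv(1)[OF sF] False rota_m_inv[of x] by force
  qed (use that in simp)
  ultimately show "is_subfield F"
    unfolding is_subfield_def using sr by auto
qed

lemma is_subfield_range:
  fixes \<phi> :: "'k::field \<Rightarrow> 'a::field"
  assumes "coeff_hom \<phi>"
  shows "is_subfield (range \<phi>)"
proof -
  interpret coeff_hom \<phi> by fact
  have "1 \<in> range \<phi>" using hom_one by (metis rangeI)
  moreover have "x - y \<in> range \<phi> \<and> x * y \<in> range \<phi>" if "x \<in> range \<phi>" "y \<in> range \<phi>" for x y
    using that by (auto simp flip: hom_diff hom_mult)
  moreover have "inverse x \<in> range \<phi>" if "x \<in> range \<phi>" for x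
    using that by (auto simp flip: field_hom_inverse[OF assms])
  ultimately show ?thesis
    by (simp add: is_subfield_def)
qed

section \<open>Polynomials with coefficients in a subfield\<close>

definition poly_over :: "'a::zero set \<Rightarrow> 'a poly \<Rightarrow> bool" where
  "poly_over F p \<longleftrightarrow> (\<forall>i. coeff p i \<in> F)"

lemma poly_over_mono: "F \<subseteq> F' \<Longrightarrow> poly_over F p \<Longrightarrow> poly_over F' p"
  by (auto simp: poly_over_def)

context
  fixes F :: "'a::field set"
  assumes F: "is_subfield F"
begin

lemma poly_over_0: "poly_over F 0" and poly_over_1: "poly_over F 1"
  using F by (auto simp: poly_over_def sf_intros coeff_1)

lemma poly_over_pCons: "poly_over F (pCons a p) \<longleftrightarrow> a \<in> F \<and> poly_over F p"
  by (auto simp: poly_over_def coeff_pCons split: nat.splits)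

lemma poly_over_add: "poly_over F p \<Longrightarrow> poly_over F q \<Longrightarrow> poly_over F (p + q)"
  and poly_over_diff: "poly_over F p \<Longrightarrow> poly_over F q \<Longrightarrow> poly_over F (p - q)"
  and poly_over_uminus: "poly_over F p \<Longrightarrow> poly_over F (- p)"
  and poly_over_smult: "a \<in> F \<Longrightarrow> poly_over F p \<Longrightarrow> poly_over F (Polynomial.smult a p)"
  and poly_over_monom: "a \<in> F \<Longrightarrow> poly_over F (monom a n)"
  using F by (auto simp: poly_over_def sf_intros)

lemma poly_over_mult: "poly_over F p \<Longrightarrow> poly_over F q \<Longrightarrow> poly_over F (p * q)"
  using F by (auto simp: poly_over_def coeff_mult intro!: sf_intros)

lemma poly_over_poly: "poly_over F p \<Longrightarrow> x \<in> F \<Longrightarrow> poly p x \<in> F"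
  using F by (induction p) (auto simp: poly_over_pCons intro!: sf_intros)

text \<open>Long division divides only by the leading coefficient of q, so quotient and remainder
  keep their coefficients in F.\<close>

lemma poly_over_division:
  assumes "q \<noteq> 0" "poly_over F q" "poly_over F p"
  shows "\<exists>s r. poly_over F s \<and> poly_over F r \<and> p = s * q + r \<and> (r = 0 \<or> Polynomial.degree r < Polynomial.degree q)"
  using assms(3)
proof (induction "Polynomial.degree p" arbitrary: p rule: less_induct)
  case less
  show ?case
  proof (cases "p = 0 \<or> Polynomial.degree p < Polynomial.degree q")
    case True
    then show ?thesis
      using less.prems poly_over_0 by (intro exI[of _ 0] exI[of _ p]) auto
  next
    case False
    then have p: "p \<noteq> 0" "Polynomial.degree q \<le> Polynomial.degree p"
      by auto
    define m where "m = monom (Polynomial.lead_coeff p / Polynomial.lead_coeff q) (Polynomial.degree p - Polynomial.degree q)"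
    define p' where "p' = p - m * q"
    have "Polynomial.lead_coeff p \<in> F" "Polynomial.lead_coeff q \<in> F"
      using less.prems assms by (auto simp: poly_over_def)
    then have m: "poly_over F m"
      unfolding m_def using F by (intro poly_over_monom sf_intros)
    have p': "poly_over F p'"
      unfolding p'_def by (intro poly_over_diff poly_over_mult less.prems m assms)
    have m0: "m \<noteq> 0" and dm: "Polynomial.degree m = Polynomial.degree p - Polynomial.degree q"
      and lm: "Polynomial.lead_coeff m = Polynomial.lead_coeff p / Polynomial.lead_coeff q"
      using p assms(1) by (auto simp: m_def degree_monom_eq monom_eq_0_iff)
    have d: "Polynomial.degree (m * q) = Polynomial.degree p"
      using m0 assms(1) p dm by (simp add: degree_mult_eq)
    have l: "Polynomial.lead_coeff (m * q) = Polynomial.lead_coeff p"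
      using assms(1) by (simp only: lead_coeff_mult lm) simp
    have "\<exists>s r. poly_over F s \<and> poly_over F r \<and> p' = s * q + r \<and> (r = 0 \<or> Polynomial.degree r < Polynomial.degree q)"
    proof (cases "p' = 0")
      case True
      then show ?thesis
        using poly_over_0 by (intro exI[of _ 0]) auto
    next
      case p'0: False
      have "coeff p' (Polynomial.degree p) = 0"
        using l d by (simp add: p'_def)
      moreover have "Polynomial.degree p' \<le> Polynomial.degree p"
        unfolding p'_def by (rule degree_diff_le) (use d in auto)
      ultimately have "Polynomial.degree p' < Polynomial.degree p"
        using p'0 by (metis le_neq_implies_less leading_coeff_0_iff)
      then show ?thesis
        using less.hyps p' by blast
    qed
    then obtain s r where "poly_over F s" "poly_over F r" "p' = s * q + r"
      "r = 0 \<or> Polynomial.degree r < Polynomial.degree q"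
      by blast
    then show ?thesis
      using m by (intro exI[of _ "s + m"] exI[of _ r]) (auto simp: p'_def algebra_simps poly_over_add)
  qed
qed

end

section \<open>Algebraic elements\<close>

definition alg_over :: "'a::field set \<Rightarrow> 'a \<Rightarrow> bool" where
  "alg_over F a \<longleftrightarrow> (\<exists>p. p \<noteq> 0 \<and> poly_over F p \<and> poly p a = 0)"

lemma alg_over_mono: "F \<subseteq> F' \<Longrightarrow> alg_over F a \<Longrightarrow> alg_over F' a"
  unfolding alg_over_def using poly_over_mono by blast

text \<open>The lists of \<open>univ_poly\<close> start with the leading coefficient, those of
  \<open>Poly\<close> with the constant one.\<close>

lemma eval_rota:
  "ring.eval (ring_of_type_algebra :: 'a::field ring) xs a = poly (Poly (rev xs)) a"
proof -
  interpret field "ring_of_type_algebra :: 'a ring" by (rule field_from_type_algebra)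
  show ?thesis
    by (induction xs) (auto simp: Poly_append poly_monom algebra_simps)
qed

lemma algebraic_rota:
  fixes F :: "'a::field set"
  assumes F: "is_subfield F"
  shows "ring.algebraic ring_of_type_algebra F a \<longleftrightarrow> alg_over F a"
proof
  interpret R: field "ring_of_type_algebra :: 'a ring" by (rule field_from_type_algebra)
  have sf: "subfield F ring_of_type_algebra"
    using F by (simp add: is_subfield_iff)
  {
    assume "R.algebraic F a"
    then obtain p where p: "p \<in> carrier (univ_poly ring_of_type_algebra F)" "p \<noteq> []" "R.eval p a = 0"
      using R.algebraicE[OF subfieldE(1)[OF sf], of a] by (auto simp: over_def)
    define q where "q = Poly (rev p)"
    have "Polynomial.lead_coeff q \<noteq> 0 \<and> coeffs q = rev p"
    proof -
      have "hd p \<noteq> 0" "set p \<subseteq> F"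
        using p by (auto simp: univ_poly_def polynomial_def)
      then have "coeffs q = rev p"
        using p(2) by (cases p) (auto simp: q_def)
      then show ?thesis
        using p(2) by auto
    qed
    then have "q \<noteq> 0" and c: "coeffs q = rev p"
      by auto
    moreover have "poly_over F q"
    proof -
      have "set p \<subseteq> F"
        using p by (auto simp: univ_poly_def polynomial_def)
      then show ?thesis
        using sf_0[OF F] by (auto simp: poly_over_def q_def nth_default_def coeff_Poly_eq)
          (metis length_rev nth_mem set_rev subsetD)
    qed
    moreover have "poly q a = 0"
      using p(3) by (simp add: q_def eval_rota)
    ultimately show "alg_over F a"
      by (auto simp: alg_over_def)
  }
  {
    assume "alg_over F a"
    then obtain q where q: "q \<noteq> 0" "poly_over F q" "poly q a = 0"
      by (auto simp: alg_over_def)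
    have "rev (coeffs q) \<in> carrier (univ_poly ring_of_type_algebra F)"
    proof -
      have "set (coeffs q) \<subseteq> F"
        using q by (auto simp: poly_over_def coeffs_def)
      then show ?thesis
        using q by (auto simp: univ_poly_def polynomial_def hd_rev last_coeffs_eq_coeff_degree)
    qed
    moreover have "rev (coeffs q) \<noteq> []"
      using q by simp
    moreover have "R.eval (rev (coeffs q)) a = zero ring_of_type_algebra"
      using q by (simp add: eval_rota)
    ultimately show "R.algebraic F a"
      using R.algebraicI[of "rev (coeffs q)" F a] by (simp add: over_def)
  }
qed

lemma alg_over_self: "is_subfield F \<Longrightarrow> a \<in> F \<Longrightarrow> alg_over F a"
  unfolding alg_over_def
  by (intro exI[of _ "[:- a, 1:]"]) (auto simp: poly_over_pCons poly_over_0 sf_intros)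

lemma is_subfield_algebraic:
  fixes F :: "'a::field set"
  assumes "is_subfield F"
  shows "is_subfield {a. alg_over F a}"
proof -
  interpret R: field "ring_of_type_algebra :: 'a ring" by (rule field_from_type_algebra)
  show ?thesis
    using R.subfield_of_algebraics[of F] assms
    by (simp add: over_def algebraic_rota is_subfield_iff[symmetric])
qed

text \<open>The finitely many coefficients of p generate a finite extension N of K; a is finite over
  N, hence over K.\<close>

lemma (in field) algebraic_trans:
  assumes K: "subfield K R" and M: "\<And>x. x \<in> M \<Longrightarrow> x \<in> carrier R \<and> (algebraic over K) x"
    and p: "set p \<subseteq> M" "p \<noteq> []" "hd p \<noteq> \<zero>" "eval p a = \<zero>" and a: "a \<in> carrier R"
  shows "(algebraic over K) a"
proof -
  have pR: "set p \<subseteq> carrier R"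
    using M p by auto
  define N where "N = finite_extension K p"
  have N: "subfield N R" and Nfin: "finite_dimension K N"
    unfolding N_def using finite_extension_is_subfield[OF K pR] finite_extension_finite_dimension(1)[OF K pR] M p by auto
  have "set p \<subseteq> N"
    unfolding N_def using finite_extension_mem[OF subfieldE(1)[OF K] pR] .
  then have "p \<in> carrier (N[X])"
    using p by (simp add: univ_poly_def polynomial_def)
  then have aN: "(algebraic over N) a"
    using algebraicI p by blast
  have "finite_dimension N (simple_extension N a)"
    using finite_dimension_simple_extension[OF N a] aN by simp
  then have "finite_dimension K (simple_extension N a)"
    using telescopic_base_dim(1)[OF K N Nfin] by blast
  moreover have "subring (simple_extension N a) R"
    using simple_extension_is_subring[OF subfieldE(1)[OF N] a] .
  moreover have "a \<in> simple_extension N a"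
    using simple_extension_mem[OF subfieldE(1)[OF N] a] .
  ultimately show ?thesis
    using finite_dimension_imp_algebraic[OF K] by blast
qed

lemma alg_over_trans:
  fixes F F' :: "'a::field set"
  assumes F: "is_subfield F" and F': "\<And>x. x \<in> F' \<Longrightarrow> alg_over F x" and a: "alg_over F' a"
  shows "alg_over F a"
proof -
  interpret R: field "ring_of_type_algebra :: 'a ring" by (rule field_from_type_algebra)
  obtain q where q: "q \<noteq> 0" "poly_over F' q" "poly q a = 0"
    using a by (auto simp: alg_over_def)
  have "(R.algebraic over F) a"
  proof (rule R.algebraic_trans)
    show "subfield F ring_of_type_algebra"
      using F by (simp add: is_subfield_iff)
    show "set (rev (coeffs q)) \<subseteq> F'"
      using q by (auto simp: poly_over_def coeffs_def)
  qed (use q F' algebraic_rota[OF F] in \<open>auto simp: over_def hd_rev last_coeffs_eq_coeff_degree eval_rota\<close>)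
  then show ?thesis
    using algebraic_rota[OF F] by (simp add: over_def)
qed

lemma alg_over_inj_range:
  fixes \<phi> :: "'k::field \<Rightarrow> 'a::field"
  assumes "coeff_hom \<phi>"
  shows "alg_over (range \<phi>) a \<longleftrightarrow> (\<exists>p. p \<noteq> 0 \<and> poly (map_poly \<phi> p) a = 0)"
proof
  interpret coeff_hom \<phi> by fact
  assume "alg_over (range \<phi>) a"
  then obtain q where q: "q \<noteq> 0" "poly_over (range \<phi>) q" "poly q a = 0"
    by (auto simp: alg_over_def)
  define p where "p = map_poly (inv_into UNIV \<phi>) q"
  have inv: "inv_into UNIV \<phi> (\<phi> c) = c" for c
    using field_hom_inj[OF assms] by (simp add: inv_f_f inj_def)
  have "\<phi> (inv_into UNIV \<phi> (coeff q i)) = coeff q i" for i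
    using q(2) by (auto simp: poly_over_def intro: f_inv_into_f)
  moreover have "inv_into UNIV \<phi> 0 = 0"
    using inv[of 0] hom_zero by simp
  ultimately have "map_poly \<phi> p = q"
    by (intro poly_eqI) (simp add: p_def coeff_map_poly hom_zero)
  then show "\<exists>p. p \<noteq> 0 \<and> poly (map_poly \<phi> p) a = 0"
    using q by (intro exI[of _ p]) auto
next
  interpret coeff_hom \<phi> by fact
  assume "\<exists>p. p \<noteq> 0 \<and> poly (map_poly \<phi> p) a = 0"
  then obtain p where p: "p \<noteq> 0" "poly (map_poly \<phi> p) a = 0"
    by blast
  have "coeff (map_poly \<phi> p) (Polynomial.degree p) \<noteq> 0"
    using p(1) field_hom_inj[OF assms, of _ 0] by (simp add: coeff_map_poly hom_zero)
  then have "map_poly \<phi> p \<noteq> 0"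
    by auto
  then show "alg_over (range \<phi>) a"
    unfolding alg_over_def using p(2)
    by (intro exI[of _ "map_poly \<phi> p"]) (auto simp: poly_over_def coeff_map_poly hom_zero)
qed

lemma (in coeff_hom) map_poly_hom:
  shows "map_poly \<phi> (p + q) = map_poly \<phi> p + map_poly \<phi> q"
    and "map_poly \<phi> (p - q) = map_poly \<phi> p - map_poly \<phi> q"
    and "map_poly \<phi> (p * q) = map_poly \<phi> p * map_poly \<phi> q"
    and "map_poly \<phi> 1 = 1"
  by (auto intro!: poly_eqI simp: coeff_map_poly hom_zero hom_add hom_diff coeff_mult hom_sum hom_mult coeff_1 hom_one)

section \<open>Extension of embeddings\<close>

lemma minimal_polynomial:
  assumes "alg_over F a"
  obtains p where "poly_over F p" "p \<noteq> 0" "poly p a = 0"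
    "\<And>q. poly_over F q \<Longrightarrow> q \<noteq> 0 \<Longrightarrow> poly q a = 0 \<Longrightarrow> Polynomial.degree p \<le> Polynomial.degree q"
proof -
  obtain p0 where "p0 \<noteq> 0 \<and> poly_over F p0 \<and> poly p0 a = 0"
    using assms by (auto simp: alg_over_def)
  from ex_has_least_nat[where P = "\<lambda>p. p \<noteq> 0 \<and> poly_over F p \<and> poly p a = 0" and m = Polynomial.degree, OF this]
  show ?thesis
    using that by blast
qed

text \<open>The source is a subfield of a field type and the target a field with a carrier, because
  the given separable closure is a record. \<open>\<sigma>\<close> is constrained on F alone, so
  that it can be extended step by step.\<close>

locale field_emb = field R for R (structure) +
  fixes F :: "'e::field set" and \<sigma> :: "'e \<Rightarrow> 'a"
  assumes F: "is_subfield F"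
    and emb_closed: "x \<in> F \<Longrightarrow> \<sigma> x \<in> carrier R"
    and emb_diff: "x \<in> F \<Longrightarrow> y \<in> F \<Longrightarrow> \<sigma> (x - y) = \<sigma> x \<ominus> \<sigma> y"
    and emb_mult: "x \<in> F \<Longrightarrow> y \<in> F \<Longrightarrow> \<sigma> (x * y) = \<sigma> x \<otimes> \<sigma> y"
    and emb_1: "\<sigma> 1 = \<one>"
begin

lemma emb_0: "\<sigma> 0 = \<zero>"
  using emb_diff[OF sf_1[OF F] sf_1[OF F]] emb_1 by (simp add: a_minus_def r_neg)

lemma emb_uminus: "x \<in> F \<Longrightarrow> \<sigma> (- x) = \<ominus> \<sigma> x"
  using emb_diff[OF sf_0[OF F], of x] emb_0 emb_closed by (simp add: a_minus_def)

lemma emb_add: "x \<in> F \<Longrightarrow> y \<in> F \<Longrightarrow> \<sigma> (x + y) = \<sigma> x \<oplus> \<sigma> y"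
  using emb_diff[of x "- y"] emb_uminus[of y] F emb_closed
  by (simp add: sf_uminus a_minus_def minus_minus)

lemma emb_nonzero: "x \<in> F \<Longrightarrow> x \<noteq> 0 \<Longrightarrow> \<sigma> x \<noteq> \<zero>"
proof
  assume x: "x \<in> F" "x \<noteq> 0" "\<sigma> x = \<zero>"
  then have "\<sigma> (x * inverse x) = \<zero>"
    using emb_mult[of x "inverse x"] F emb_closed[of "inverse x"] by (simp add: sf_inverse)
  then show False
    using x emb_1 by simp
qed

text \<open>The value at b of the polynomial whose coefficients are carried over by \<sigma>, by
  Horner's rule.\<close>

definition T :: "'a \<Rightarrow> 'e poly \<Rightarrow> 'a" where
  "T b q = foldr (\<lambda>c acc. \<sigma> c \<oplus> b \<otimes> acc) (coeffs q) \<zero>"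

lemma T_0 [simp]: "T b 0 = \<zero>"
  by (simp add: T_def)

lemma T_pCons: "b \<in> carrier R \<Longrightarrow> T b (pCons c q) = \<sigma> c \<oplus> b \<otimes> T b q"
  by (cases "c = 0 \<and> q = 0") (auto simp: T_def emb_0 cCons_def coeffs_pCons_eq_cCons)

lemma T_closed: "b \<in> carrier R \<Longrightarrow> poly_over F p \<Longrightarrow> T b p \<in> carrier R"
  by (induction p) (auto simp: T_pCons poly_over_pCons[OF F] emb_closed)

lemma T_const: "b \<in> carrier R \<Longrightarrow> c \<in> F \<Longrightarrow> T b [:c:] = \<sigma> c"
  by (simp add: T_pCons emb_closed)

lemma T_X: "b \<in> carrier R \<Longrightarrow> T b [:0, 1:] = b"
  by (simp add: T_pCons emb_0 emb_1)

lemma T_diff: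
  assumes b: "b \<in> carrier R" and "poly_over F p" "poly_over F q"
  shows "T b (p - q) = T b p \<ominus> T b q"
  using assms(2,3)
proof (induction p q rule: poly_induct2)
  case 0
  then show ?case
    by (simp add: a_minus_def)
next
  case (pCons c p d q)
  then have "c \<in> F" "d \<in> F" "poly_over F p" "poly_over F q"
    by (auto simp: poly_over_pCons[OF F])
  moreover have "T b p \<in> carrier R" "T b q \<in> carrier R" "\<sigma> c \<in> carrier R" "\<sigma> d \<in> carrier R"
    using calculation b by (auto simp: T_closed emb_closed)
  moreover have "(\<sigma> c \<ominus> \<sigma> d) \<oplus> b \<otimes> (T b p \<ominus> T b q) = (\<sigma> c \<oplus> b \<otimes> T b p) \<ominus> (\<sigma> d \<oplus> b \<otimes> T b q)"
    using calculation b by algebra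
  ultimately show ?case
    using pCons.IH b by (simp add: T_pCons emb_diff)
qed

lemma T_add:
  assumes b: "b \<in> carrier R" and "poly_over F p" "poly_over F q"
  shows "T b (p + q) = T b p \<oplus> T b q"
proof -
  have "T b p = T b (p + q) \<ominus> T b q"
    using T_diff[OF b poly_over_add[OF F assms(2,3)] assms(3)] by simp
  moreover have "T b p \<in> carrier R" "T b q \<in> carrier R" "T b (p + q) \<in> carrier R"
    using assms by (auto intro!: T_closed poly_over_add[OF F])
  ultimately show ?thesis
    by (metis a_minus_def a_inv_closed add.inv_solve_right' minus_minus)
qed

lemma T_smult:
  assumes b: "b \<in> carrier R" and c: "c \<in> F" and "poly_over F p"
  shows "T b (Polynomial.smult c p) = \<sigma> c \<otimes> T b p"
  using assms(3)
proof (induction p)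
  case 0
  then show ?case
    using c by (simp add: emb_closed)
next
  case (pCons d p)
  then have "d \<in> F" "poly_over F p"
    by (auto simp: poly_over_pCons[OF F])
  moreover have "T b p \<in> carrier R" "\<sigma> c \<in> carrier R" "\<sigma> d \<in> carrier R"
    using calculation b c by (auto simp: T_closed emb_closed)
  moreover have "\<sigma> c \<otimes> \<sigma> d \<oplus> b \<otimes> (\<sigma> c \<otimes> T b p) = \<sigma> c \<otimes> (\<sigma> d \<oplus> b \<otimes> T b p)"
    using calculation b by algebra
  ultimately show ?case
    using pCons b c by (simp add: T_pCons emb_mult)
qed

lemma T_mult:
  assumes b: "b \<in> carrier R" and "poly_over F p" and q: "poly_over F q"
  shows "T b (p * q) = T b p \<otimes> T b q"
  using assms(2)
proof (induction p)
  case 0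
  then show ?case
    using b q by (simp add: T_closed)
next
  case (pCons d p)
  then have dp: "d \<in> F" "poly_over F p"
    by (auto simp: poly_over_pCons[OF F])
  have cl: "T b p \<in> carrier R" "T b q \<in> carrier R" "\<sigma> d \<in> carrier R"
    using dp b q by (auto simp: T_closed emb_closed)
  have "T b (pCons d p * q) = T b (Polynomial.smult d q) \<oplus> T b (pCons 0 (p * q))"
    using b dp q
    by (simp add: mult_pCons_left T_add poly_over_smult[OF F] poly_over_pCons[OF F] poly_over_mult[OF F] sf_0[OF F])
  also have "\<dots> = \<sigma> d \<otimes> T b q \<oplus> b \<otimes> (T b p \<otimes> T b q)"
    using pCons dp b q cl by (simp add: T_pCons T_smult emb_0)
  also have "\<dots> = (\<sigma> d \<oplus> b \<otimes> T b p) \<otimes> T b q"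
    using cl b by algebra
  finally show ?case
    using b by (simp add: T_pCons)
qed

lemma eval_emb:
  assumes "b \<in> carrier R" "set cs \<subseteq> F"
  shows "eval (map \<sigma> (rev cs)) b = foldr (\<lambda>c acc. \<sigma> c \<oplus> b \<otimes> acc) cs \<zero>"
  using assms(2)
proof (induction cs)
  case (Cons c cs)
  have s: "set (map \<sigma> (rev cs)) \<subseteq> carrier R" "\<sigma> c \<in> carrier R"
    using Cons.prems emb_closed by auto
  have "eval (map \<sigma> (rev cs) @ [\<sigma> c]) b = eval (map \<sigma> (rev cs)) b \<otimes> b \<oplus> \<sigma> c"
    by (rule eval_append_aux) (use s assms in auto)
  moreover have "eval (map \<sigma> (rev cs)) b \<in> carrier R"
    using eval_in_carrier[OF s(1) assms(1)] .
  ultimately show ?case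
    using Cons s assms by (simp add: a_comm m_comm)
qed simp

lemma eval_emb_coeffs:
  assumes "b \<in> carrier R" "poly_over F p"
  shows "eval (map \<sigma> (rev (coeffs p))) b = T b p"
proof -
  have "set (coeffs p) \<subseteq> F"
    using assms by (auto simp: poly_over_def coeffs_def split: if_splits)
  then show ?thesis
    using eval_emb[of b "coeffs p"] assms by (simp add: T_def)
qed

lemma exists_root:
  assumes rts: "\<And>P. P \<in> carrier (poly_ring R) \<Longrightarrow> length P > 1 \<Longrightarrow> \<exists>x\<in>carrier R. eval P x = \<zero>"
    and p: "poly_over F p" "Polynomial.degree p > 0"
  shows "\<exists>b\<in>carrier R. T b p = \<zero>"
proof -
  let ?P = "map \<sigma> (rev (coeffs p))"
  have "p \<noteq> 0"
    using p by auto
  have cF: "set (coeffs p) \<subseteq> F"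
    using p by (auto simp: poly_over_def coeffs_def split: if_splits)
  have lc: "\<sigma> (Polynomial.lead_coeff p) \<noteq> \<zero>"
    using p \<open>p \<noteq> 0\<close> by (intro emb_nonzero) (auto simp: poly_over_def)
  have "set ?P \<subseteq> carrier R"
    using cF emb_closed by auto
  moreover have "hd ?P \<noteq> \<zero>"
    using lc \<open>p \<noteq> 0\<close> by (simp add: hd_map hd_rev last_coeffs_eq_coeff_degree)
  ultimately have "?P \<in> carrier (poly_ring R)"
    by (simp add: univ_poly_def polynomial_def)
  moreover have "length ?P > 1"
    using p \<open>p \<noteq> 0\<close> by (simp add: length_coeffs)
  ultimately obtain x where "x \<in> carrier R" "eval ?P x = \<zero>"
    using rts by blast
  then show ?thesis
    using eval_emb_coeffs p by auto
qed

text \<open>A nonzero u of least degree with \<open>T b u = \<zero>\<close> divides p. If its degree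
  were below that of p, then u or the cofactor, both of smaller degree, would vanish at a, against
  the minimality of p. So the relations of a and those of b are the multiples of p.\<close>

lemma root_iff:
  assumes b: "b \<in> carrier R" and p: "poly_over F p" "p \<noteq> 0" "poly p a = 0" "T b p = \<zero>"
    and min: "\<And>q. poly_over F q \<Longrightarrow> q \<noteq> 0 \<Longrightarrow> poly q a = 0 \<Longrightarrow> Polynomial.degree p \<le> Polynomial.degree q"
    and q: "poly_over F q"
  shows "T b q = \<zero> \<longleftrightarrow> poly q a = 0"
proof -
  have pos: "Polynomial.degree p > 0"
  proof (rule ccontr)
    assume "\<not> Polynomial.degree p > 0"
    then obtain c where "p = [:c:]"
      by (meson degree_eq_zeroE neq0_conv)
    then show False
      using p by simp
  qed
  obtain s r where sr: "poly_over F s" "poly_over F r" "q = s * p + r" "r = 0 \<or> Polynomial.degree r < Polynomial.degree p"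
    using poly_over_division[OF F p(2) p(1) q] by blast
  have Tq: "T b q = T b r"
    using sr b p by (simp add: T_add T_mult T_closed poly_over_mult[OF F])
  have qa: "poly q a = poly r a"
    using sr p by simp
  have "r = 0" if "T b r = \<zero>"
  proof (rule ccontr)
    assume "r \<noteq> 0"
    define P where "P u \<longleftrightarrow> poly_over F u \<and> u \<noteq> 0 \<and> T b u = \<zero>" for u
    have "P r"
      using sr that \<open>r \<noteq> 0\<close> by (simp add: P_def)
    from ex_has_least_nat[of P r Polynomial.degree, OF this]
    obtain u where u: "P u" "\<And>v. P v \<Longrightarrow> Polynomial.degree u \<le> Polynomial.degree v"
      by blast
    have du: "Polynomial.degree u < Polynomial.degree p"
      using u(2)[OF \<open>P r\<close>] sr \<open>r \<noteq> 0\<close> by auto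
    have u': "poly_over F u" "u \<noteq> 0" "T b u = \<zero>"
      using u by (auto simp: P_def)
    obtain s' r' where s'r': "poly_over F s'" "poly_over F r'" "p = s' * u + r'"
      "r' = 0 \<or> Polynomial.degree r' < Polynomial.degree u"
      using poly_over_division[OF F u'(2,1) p(1)] by blast
    have "T b r' = \<zero>"
      using s'r' b p u' by (simp add: T_add T_mult T_closed poly_over_mult[OF F])
    then have "P r'" if "r' \<noteq> 0"
      using s'r' that by (simp add: P_def)
    then have "r' = 0"
      using s'r' u(2)[of r'] by linarith
    then have pu: "p = s' * u"
      using s'r' by simp
    then have s'0: "s' \<noteq> 0" and ds: "Polynomial.degree p = Polynomial.degree s' + Polynomial.degree u"
      using p u' by (auto simp: degree_mult_eq)
    have "Polynomial.degree u > 0"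
    proof (rule ccontr)
      assume "\<not> Polynomial.degree u > 0"
      then obtain c where c: "u = [:c:]"
        by (meson degree_eq_zeroE neq0_conv)
      then have "c \<in> F" "c \<noteq> 0"
        using u' by (auto simp: poly_over_pCons[OF F])
      then show False
        using u' c b emb_nonzero by (auto simp: T_const)
    qed
    then have "Polynomial.degree s' < Polynomial.degree p"
      using ds by simp
    moreover have "poly s' a = 0 \<or> poly u a = 0"
      using p pu by simp
    ultimately show False
      using min[OF s'r'(1) s'0] min[OF u'(1,2)] du by linarith
  qed
  moreover have "r = 0" if "poly r a = 0"
  proof (rule ccontr)
    assume "r \<noteq> 0"
    then show False
      using min[OF sr(2) _ that] sr(4) by simp
  qed
  ultimately show ?thesis
    using Tq qa by auto
qed

end

section \<open>Partial embeddings as graphs, and Zorn's lemma\<close>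

context field
begin

text \<open>A partial embedding is kept as its graph, with the domain as part of the data: extension
  is then inclusion, and the union of a chain is again such a graph.\<close>

definition hom_graph :: "('e::field \<times> 'a) set \<Rightarrow> bool" where
  "hom_graph G \<longleftrightarrow>
     (\<forall>x y. (x, y) \<in> G \<longrightarrow> y \<in> carrier R \<and> inverse x \<in> Domain G) \<and>
     (\<forall>x y y'. (x, y) \<in> G \<longrightarrow> (x, y') \<in> G \<longrightarrow> y = y') \<and> (1, \<one>) \<in> G \<and>
     (\<forall>x y x' y'. (x, y) \<in> G \<longrightarrow> (x', y') \<in> G \<longrightarrow> (x - x', y \<ominus> y') \<in> G \<and> (x * x', y \<otimes> y') \<in> G)"

definition fun_of :: "('e \<times> 'a) set \<Rightarrow> 'e \<Rightarrow> 'a" where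
  "fun_of G x = (THE y. (x, y) \<in> G)"

lemma fun_of_iff: "hom_graph G \<Longrightarrow> x \<in> Domain G \<Longrightarrow> (x, y) \<in> G \<longleftrightarrow> y = fun_of G x"
proof -
  assume G: "hom_graph G" and "x \<in> Domain G"
  then obtain y' where y': "(x, y') \<in> G"
    by auto
  have "fun_of G x = y'"
    unfolding fun_of_def using y' G unfolding hom_graph_def by (intro the_equality) blast+
  then show ?thesis
    using y' G unfolding hom_graph_def by blast
qed

lemma hom_graph_emb:
  assumes "hom_graph G"
  shows "field_emb R (Domain G) (fun_of G)"
proof -
  have mem: "(x, fun_of G x) \<in> G" if "x \<in> Domain G" for x
    using fun_of_iff[OF assms that] by simp
  have eq: "fun_of G x = y" if "(x, y) \<in> G" for x y
    using fun_of_iff[OF assms, of x y] that by auto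
  have c: "(x - x', y \<ominus> y') \<in> G" "(x * x', y \<otimes> y') \<in> G" if "(x, y) \<in> G" "(x', y') \<in> G" for x y x' y'
    using assms that unfolding hom_graph_def by blast+
  have one: "(1, \<one>) \<in> G"
    using assms unfolding hom_graph_def by blast
  show ?thesis
  proof
    have "inverse x \<in> Domain G" if "x \<in> Domain G" for x
      using assms that unfolding hom_graph_def by blast
    then show "is_subfield (Domain G)"
      unfolding is_subfield_def using c mem one by blast
    show "fun_of G x \<in> carrier R" if "x \<in> Domain G" for x
      using assms mem[OF that] unfolding hom_graph_def by blast
    show "fun_of G (x - y) = fun_of G x \<ominus> fun_of G y" if "x \<in> Domain G" "y \<in> Domain G" for x y
      using eq[OF c(1)[OF mem[OF that(1)] mem[OF that(2)]]] .
    show "fun_of G (x * y) = fun_of G x \<otimes> fun_of G y" if "x \<in> Domain G" "y \<in> Domain G" for x y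
      using eq[OF c(2)[OF mem[OF that(1)] mem[OF that(2)]]] .
    show "fun_of G 1 = \<one>"
      using eq[OF one] .
  qed
qed

lemma emb_hom_graph:
  assumes "field_emb R F f"
  shows "hom_graph {(x, f x) | x. x \<in> F}"
proof -
  interpret field_emb R F f by fact
  show ?thesis
    unfolding hom_graph_def
  proof (intro conjI allI impI)
    show "(1, \<one>) \<in> {(x, f x) | x. x \<in> F}"
      using sf_1[OF F] emb_1 by force
  next
    fix x y assume "(x, y) \<in> {(x, f x) | x. x \<in> F}"
    then have "x \<in> F" "y = f x"
      by auto
    then show "y \<in> carrier R" "inverse x \<in> Domain {(x, f x) | x. x \<in> F}"
      using sf_inverse[OF F] emb_closed by (blast, blast)
  next
    fix x y x' y' assume "(x, y) \<in> {(x, f x) | x. x \<in> F}" "(x', y') \<in> {(x, f x) | x. x \<in> F}"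
    then have x: "x \<in> F" "y = f x" "x' \<in> F" "y' = f x'"
      by auto
    then show "(x - x', y \<ominus> y') \<in> {(x, f x) | x. x \<in> F}" "(x * x', y \<otimes> y') \<in> {(x, f x) | x. x \<in> F}"
      using emb_diff[of x x'] emb_mult[of x x'] sf_diff[OF F, of x x'] sf_mult[OF F, of x x'] by auto
  qed auto
qed

text \<open>\<open>H\<close> says that a and b satisfy the same polynomials, so that q(a)/r(a) may
  be sent to q(b)/r(b). It covers an algebraic a with a conjugate b as well as transcendental a and
  b. The last conclusion keeps the new domain inside every subfield that contains the old one and
  a.\<close>

lemma hom_graph_simple_extension:
  assumes G: "hom_graph G" and b: "b \<in> carrier R"
    and H: "\<And>q. poly_over (Domain G) q \<Longrightarrow> field_emb.T R (fun_of G) b q = \<zero> \<longleftrightarrow> poly q a = 0"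
  obtains G' where "hom_graph G'" "G \<subseteq> G'" "(a, b) \<in> G'"
    "\<And>M. is_subfield M \<Longrightarrow> Domain G \<subseteq> M \<Longrightarrow> a \<in> M \<Longrightarrow> Domain G' \<subseteq> M"
proof -
  interpret E: field_emb R "Domain G" "fun_of G"
    by (rule hom_graph_emb[OF G])
  let ?F = "Domain G" and ?T = "E.T b"
  note F = E.F
  \<comment> \<open>The quotients are recorded without division, by the equations x r(a) = q(a) and
    z r(b) = q(b).\<close>
  define G' where "G' = {(x, z). z \<in> carrier R \<and> (\<exists>q r. poly_over ?F q \<and> poly_over ?F r \<and>
    poly r a \<noteq> 0 \<and> x * poly r a = poly q a \<and> z \<otimes> ?T r = ?T q)}"
  have G'E: thesis if "(x, z) \<in> G'"
    "\<And>q r. poly_over ?F q \<Longrightarrow> poly_over ?F r \<Longrightarrow> poly r a \<noteq> 0 \<Longrightarrow> x * poly r a = poly q a \<Longrightarrow> z \<otimes> ?T r = ?T q \<Longrightarrow>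
      z \<in> carrier R \<Longrightarrow> ?T q \<in> carrier R \<Longrightarrow> ?T r \<in> carrier R \<Longrightarrow> ?T r \<noteq> \<zero> \<Longrightarrow> thesis" for x z thesis
    using that E.T_closed[OF b] H unfolding G'_def by blast
  have G'I: "(x, z) \<in> G'" if "poly_over ?F q" "poly_over ?F r" "poly r a \<noteq> 0" "x * poly r a = poly q a"
    "z \<otimes> ?T r = ?T q" "z \<in> carrier R" for x z q r
    using that unfolding G'_def by blast
  have "hom_graph G'"
    unfolding hom_graph_def
  proof (intro conjI allI impI)
    fix x y assume xy: "(x, y) \<in> G'"
    show "y \<in> carrier R"
      using xy by (rule G'E)
    show "inverse x \<in> Domain G'"
      using xy
    proof (rule G'E)
      fix q r assume qr: "poly_over ?F q" "poly_over ?F r" "poly r a \<noteq> 0" "x * poly r a = poly q a" "y \<otimes> ?T r = ?T q"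
        "y \<in> carrier R" "?T q \<in> carrier R" "?T r \<in> carrier R" "?T r \<noteq> \<zero>"
      show ?thesis
      proof (cases "x = 0")
        case True
        then show ?thesis using xy by auto
      next
        case False
        then have q0: "poly q a \<noteq> 0"
          using qr by (metis mult_eq_0_iff)
        then have "?T q \<noteq> \<zero>"
          using H qr by blast
        then have u: "inv (?T q) \<in> carrier R" "inv (?T q) \<otimes> ?T q = \<one>"
          using qr by (auto simp: field_Units)
        have "(inverse x, ?T r \<otimes> inv (?T q)) \<in> G'"
        proof (rule G'I[OF qr(2,1) q0])
          show "inverse x * poly q a = poly r a"
            using False qr(4) by (simp add: field_simps)
          show "?T r \<otimes> inv ?T q \<otimes> ?T q = ?T r"
            using u qr by (simp add: m_assoc)
        qed (use u qr in simp)
        then show ?thesis by auto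
      qed
    qed
  next
    fix x y y' assume "(x, y) \<in> G'" "(x, y') \<in> G'"
    then show "y = y'"
    proof (elim G'E)
      fix q r q' r'
      assume a: "poly_over ?F q" "poly_over ?F r" "poly r a \<noteq> 0" "x * poly r a = poly q a" "y \<otimes> ?T r = ?T q"
        "y \<in> carrier R" "?T q \<in> carrier R" "?T r \<in> carrier R" "?T r \<noteq> \<zero>"
        "poly_over ?F q'" "poly_over ?F r'" "poly r' a \<noteq> 0" "x * poly r' a = poly q' a" "y' \<otimes> ?T r' = ?T q'"
        "y' \<in> carrier R" "?T q' \<in> carrier R" "?T r' \<in> carrier R" "?T r' \<noteq> \<zero>"
      have "poly (q * r' - q' * r) a = 0"
        using a(4,13) by (simp flip: a(4) a(13))
      then have "?T (q * r' - q' * r) = \<zero>"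
        using H a by (simp add: poly_over_diff[OF F] poly_over_mult[OF F])
      then have "(y \<otimes> ?T r) \<otimes> ?T r' \<ominus> (y' \<otimes> ?T r') \<otimes> ?T r = \<zero>"
        using a b by (simp add: E.T_diff E.T_mult poly_over_mult[OF F])
      moreover have "(y \<otimes> ?T r) \<otimes> ?T r' \<ominus> (y' \<otimes> ?T r') \<otimes> ?T r = (y \<ominus> y') \<otimes> (?T r \<otimes> ?T r')"
        using a(6,8,15,17) by algebra
      ultimately have "y \<ominus> y' = \<zero>"
        using a integral by (metis m_closed minus_closed)
      then show ?thesis
        using a by simp
    qed
  next
    show "(1, \<one>) \<in> G'"
      by (rule G'I[OF poly_over_1[OF F] poly_over_1[OF F]])
        (use b E.T_const[OF b sf_1[OF F]] E.emb_1 in \<open>auto simp: one_pCons\<close>)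
  next
    fix x y x' y' assume "(x, y) \<in> G'" "(x', y') \<in> G'"
    then have "(x - x', y \<ominus> y') \<in> G' \<and> (x * x', y \<otimes> y') \<in> G'"
    proof (elim G'E)
      fix q r q' r'
      assume a: "poly_over ?F q" "poly_over ?F r" "poly r a \<noteq> 0" "x * poly r a = poly q a" "y \<otimes> ?T r = ?T q"
        "y \<in> carrier R" "?T q \<in> carrier R" "?T r \<in> carrier R" "?T r \<noteq> \<zero>"
        "poly_over ?F q'" "poly_over ?F r'" "poly r' a \<noteq> 0" "x' * poly r' a = poly q' a" "y' \<otimes> ?T r' = ?T q'"
        "y' \<in> carrier R" "?T q' \<in> carrier R" "?T r' \<in> carrier R" "?T r' \<noteq> \<zero>"
      have e1: "(y \<ominus> y') \<otimes> (?T r \<otimes> ?T r') = (y \<otimes> ?T r) \<otimes> ?T r' \<ominus> (y' \<otimes> ?T r') \<otimes> ?T r"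
        using a(6,8,15,17) by algebra
      have e2: "(y \<otimes> y') \<otimes> (?T r \<otimes> ?T r') = (y \<otimes> ?T r) \<otimes> (y' \<otimes> ?T r')"
        using a(6,8,15,17) by algebra
      show ?thesis
      proof
        show "(x - x', y \<ominus> y') \<in> G'"
        proof (rule G'I[of "q * r' - q' * r" "r * r'"])
          show "(x - x') * poly (r * r') a = poly (q * r' - q' * r) a"
            using a(4,13) by (simp flip: a(4) a(13) add: algebra_simps)
          show "(y \<ominus> y') \<otimes> ?T (r * r') = ?T (q * r' - q' * r)"
            using a b e1 by (simp add: E.T_diff E.T_mult poly_over_mult[OF F])
        qed (use a in \<open>auto intro!: poly_over_diff[OF F] poly_over_mult[OF F]\<close>)
        show "(x * x', y \<otimes> y') \<in> G'"
        proof (rule G'I[of "q * q'" "r * r'"])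
          show "x * x' * poly (r * r') a = poly (q * q') a"
            using a(4,13) by (simp flip: a(4) a(13) add: algebra_simps)
          show "y \<otimes> y' \<otimes> ?T (r * r') = ?T (q * q')"
            using a b e2 by (simp add: E.T_mult)
        qed (use a in \<open>auto intro!: poly_over_mult[OF F]\<close>)
      qed
    qed
    then show "(x - x', y \<ominus> y') \<in> G'" "(x * x', y \<otimes> y') \<in> G'"
      by auto
  qed
  moreover have "G \<subseteq> G'"
  proof
    fix e assume "e \<in> G"
    then obtain x y where e: "e = (x, y)" "x \<in> ?F" "y = fun_of G x"
      using fun_of_iff[OF G] by (metis Domain.DomainI surj_pair)
    have "(x, fun_of G x) \<in> G'"
      by (rule G'I[of "[:x:]" 1])
        (use e b F E.T_const[OF b] E.emb_1 E.emb_closed in \<open>auto simp: one_pCons poly_over_pCons poly_over_0 sf_1\<close>)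
    then show "e \<in> G'"
      using e by simp
  qed
  moreover have "(a, b) \<in> G'"
    by (rule G'I[of "[:0, 1:]" 1])
      (use b F E.T_const[OF b sf_1[OF F]] E.emb_1 E.T_X in \<open>auto simp: one_pCons poly_over_pCons poly_over_0 sf_1 sf_0\<close>)
  moreover have "Domain G' \<subseteq> M" if M: "is_subfield M" "?F \<subseteq> M" "a \<in> M" for M
  proof
    fix x assume "x \<in> Domain G'"
    then obtain q r where "poly_over ?F q" "poly_over ?F r" "poly r a \<noteq> 0" "x * poly r a = poly q a"
      unfolding G'_def by blast
    then have "x = poly q a / poly r a" "poly q a \<in> M" "poly r a \<in> M"
      using poly_over_poly[OF M(1) poly_over_mono[OF M(2)] M(3)] by (auto simp: field_simps)
    then show "x \<in> M"
      using sf_divide[OF M(1)] by simp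
  qed
  ultimately show ?thesis
    using that by blast
qed

text \<open>A maximal graph with domain inside M has domain M: a missing element could be sent to a
  root of its minimal polynomial, transported along the graph.\<close>

theorem extend_embedding:
  assumes rts: "\<And>P. P \<in> carrier (poly_ring R) \<Longrightarrow> length P > 1 \<Longrightarrow> \<exists>x\<in>carrier R. eval P x = \<zero>"
    and G: "hom_graph (G :: ('e::field \<times> 'a) set)"
    and M: "is_subfield M" "Domain G \<subseteq> M" "\<And>a. a \<in> M \<Longrightarrow> alg_over (Domain G) a"
  obtains G' where "hom_graph G'" "G \<subseteq> G'" "Domain G' = M"
proof -
  define A where "A = {G'. hom_graph G' \<and> G \<subseteq> G' \<and> Domain G' \<subseteq> M}"
  have "\<exists>G'\<in>A. \<forall>Y\<in>A. G' \<subseteq> Y \<longrightarrow> Y = G'"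
  proof (rule subset_Zorn_nonempty)
    show "A \<noteq> {}"
      using G M by (auto simp: A_def)
    fix \<C> assume C: "\<C> \<noteq> {}" "subset.chain A \<C>"
    have inA: "hom_graph Y" "G \<subseteq> Y" "Domain Y \<subseteq> M" if "Y \<in> \<C>" for Y
      using C(2) that by (auto simp: subset.chain_def A_def)
    have two: "\<exists>Y\<in>\<C>. e \<in> Y \<and> e' \<in> Y" if "e \<in> \<Union>\<C>" "e' \<in> \<Union>\<C>" for e e'
      using that C(2) unfolding subset_chain_def by blast
    have "hom_graph (\<Union>\<C>)"
      unfolding hom_graph_def
    proof (intro conjI allI impI)
      fix x y assume "(x, y) \<in> \<Union>\<C>"
      then obtain Y where Y: "Y \<in> \<C>" "(x, y) \<in> Y"
        by blast
      then show "y \<in> carrier R"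
        using inA unfolding hom_graph_def by blast
      have "inverse x \<in> Domain Y"
        using Y inA(1)[OF Y(1)] unfolding hom_graph_def by blast
      then show "inverse x \<in> Domain (\<Union>\<C>)"
        using Y by blast
    next
      fix x y y' assume "(x, y) \<in> \<Union>\<C>" "(x, y') \<in> \<Union>\<C>"
      then obtain Y where "Y \<in> \<C>" "(x, y) \<in> Y" "(x, y') \<in> Y"
        using two by blast
      then show "y = y'"
        using inA(1)[of Y] unfolding hom_graph_def by blast
    next
      obtain Y where "Y \<in> \<C>"
        using C by blast
      then show "(1, \<one>) \<in> \<Union>\<C>"
        using inA(1)[of Y] unfolding hom_graph_def by blast
    next
      fix x y x' y' assume "(x, y) \<in> \<Union>\<C>" "(x', y') \<in> \<Union>\<C>"
      then obtain Y where Y: "Y \<in> \<C>" "(x, y) \<in> Y" "(x', y') \<in> Y"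
        using two by blast
      then have "(x - x', y \<ominus> y') \<in> Y" "(x * x', y \<otimes> y') \<in> Y"
        using inA(1)[of Y] unfolding hom_graph_def by blast+
      then show "(x - x', y \<ominus> y') \<in> \<Union>\<C>" "(x * x', y \<otimes> y') \<in> \<Union>\<C>"
        using Y by blast+
    qed
    moreover have "G \<subseteq> \<Union>\<C>"
      using C(1) inA(2) by blast
    moreover have "Domain (\<Union>\<C>) \<subseteq> M"
      using inA(3) by blast
    ultimately show "\<Union>\<C> \<in> A"
      by (simp add: A_def)
  qed
  then obtain G' where G'A: "G' \<in> A" and maxA: "\<forall>Y\<in>A. G' \<subseteq> Y \<longrightarrow> Y = G'"
    by (rule bexE)
  then have G': "hom_graph G'" "G \<subseteq> G'" "Domain G' \<subseteq> M"
    by (simp_all add: A_def)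
  have max: "Y = G'" if "hom_graph Y" "G' \<subseteq> Y" "Domain Y \<subseteq> M" for Y
  proof -
    have "Y \<in> A"
      using that G'(2) by (simp add: A_def)
    then show ?thesis
      using maxA that(2) by simp
  qed
  have "a \<in> Domain G'" if "a \<in> M" for a
  proof -
    interpret E: field_emb R "Domain G'" "fun_of G'"
      by (rule hom_graph_emb[OF G'(1)])
    have "alg_over (Domain G') a"
      using M(3)[OF that] alg_over_mono[OF Domain_mono[OF G'(2)]] by blast
    then obtain p where p: "poly_over (Domain G') p" "p \<noteq> 0" "poly p a = 0"
      and min: "\<And>q. poly_over (Domain G') q \<Longrightarrow> q \<noteq> 0 \<Longrightarrow> poly q a = 0 \<Longrightarrow> Polynomial.degree p \<le> Polynomial.degree q"
      using minimal_polynomial by blast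
    have "Polynomial.degree p > 0"
    proof (rule ccontr)
      assume "\<not> Polynomial.degree p > 0"
      then obtain c where "p = [:c:]"
        by (meson degree_eq_zeroE neq0_conv)
      then show False
        using p by simp
    qed
    then obtain b where b: "b \<in> carrier R" "E.T b p = \<zero>"
      using E.exists_root[OF rts p(1)] by blast
    show ?thesis
    proof (rule hom_graph_simple_extension[OF G'(1) b(1), of a])
      show "E.T b q = \<zero> \<longleftrightarrow> poly q a = 0" if "poly_over (Domain G') q" for q
        using E.root_iff[OF b(1) p b(2) min that] by blast
    next
      fix Y assume Y: "hom_graph Y" "G' \<subseteq> Y" "(a, b) \<in> Y"
        "\<And>M. is_subfield M \<Longrightarrow> Domain G' \<subseteq> M \<Longrightarrow> a \<in> M \<Longrightarrow> Domain Y \<subseteq> M"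
      then have "Y = G'"
        using max[OF Y(1,2)] Y(4)[OF M(1) G'(3) that] by simp
      then show ?thesis
        using Y(3) by (simp add: Domain.DomainI)
    qed
  qed
  then have "Domain G' = M"
    using G'(3) by (metis subset_antisym subsetI)
  then show ?thesis
    using that G' by simp
qed

end

lemma rota_has_roots:
  fixes P :: "'e::alg_closed_field list"
  assumes P: "P \<in> carrier (univ_poly ring_of_type_algebra UNIV)" "length P > 1"
  shows "\<exists>x\<in>carrier ring_of_type_algebra. ring.eval ring_of_type_algebra P x = \<zero>\<^bsub>ring_of_type_algebra\<^esub>"
proof -
  have "hd P \<noteq> 0" "P \<noteq> []"
    using P by (auto simp: univ_poly_def polynomial_def)
  then have "coeffs (Poly (rev P)) = rev P"
    by (cases P) auto
  then have "length (coeffs (Poly (rev P))) > 1"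
    using P by simp
  then have "Polynomial.degree (Poly (rev P)) > 0"
    by (simp add: degree_eq_length_coeffs)
  then obtain x where "poly (Poly (rev P)) x = 0"
    using alg_closed_imp_poly_has_root by blast
  then show ?thesis
    by (auto simp: eval_rota)
qed

text \<open>The source is algebraically closed, so a polynomial over the image that kills y splits
  into linear factors over the image, and one of them kills y.\<close>

lemma (in field) hom_graph_surj:
  fixes G :: "('e::alg_closed_field \<times> 'a) set"
  assumes G: "hom_graph G" "Domain G = UNIV" and alg: "\<And>y. y \<in> carrier R \<Longrightarrow> (algebraic over (range (fun_of G))) y"
    and sub: "subring (range (fun_of G)) R"
  shows "bij_betw (fun_of G) UNIV (carrier R)"
proof -
  interpret E: field_emb R UNIV "fun_of G"
    using hom_graph_emb[OF G(1)] G(2) by simp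
  have po: "poly_over UNIV q" for q :: "'e poly"
    by (simp add: poly_over_def)
  have root: "y \<in> range (fun_of G)" if "q \<noteq> 0" "E.T y q = \<zero>" and y: "y \<in> carrier R" for q y
    using that(1,2)
  proof (induction "Polynomial.degree q" arbitrary: q rule: less_induct)
    case less
    show ?case
    proof (cases "Polynomial.degree q = 0")
      case True
      then obtain c where "q = [:c:]"
        by (meson degree_eq_zeroE)
      then show ?thesis
        using less.prems E.T_const[OF y, of c] E.emb_nonzero[of c] by auto
    next
      case False
      then obtain e where "poly q e = 0"
        using alg_closed_imp_poly_has_root by blast
      then obtain q' where q': "q = [:- e, 1:] * q'"
        by (auto simp: poly_eq_0_iff_dvd)
      have "E.T y [:- e, 1:] = \<ominus> fun_of G e \<oplus> y"
        using y by (simp add: E.T_pCons E.emb_uminus E.emb_1 E.emb_closed E.T_closed[OF y po])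
      then have "(\<ominus> fun_of G e \<oplus> y) \<otimes> E.T y q' = \<zero>"
        using less.prems(2) E.T_mult[OF y po po, of "[:- e, 1:]" q'] q' by simp
      moreover have "fun_of G e \<in> carrier R" "E.T y q' \<in> carrier R"
        using E.emb_closed E.T_closed[OF y po] by auto
      ultimately consider "\<ominus> fun_of G e \<oplus> y = \<zero>" | "E.T y q' = \<zero>"
        using integral[of "\<ominus> fun_of G e \<oplus> y" "E.T y q'"] y by auto
      then show ?thesis
      proof cases
        case 1
        then have "y = fun_of G e"
          using y E.emb_closed[of e] by (metis UNIV_I a_comm a_inv_closed minus_equality minus_minus)
        then show ?thesis by simp
      next
        case 2
        have "q' \<noteq> 0"
          using less.prems q' by auto
        moreover have "Polynomial.degree q' < Polynomial.degree q"
          unfolding q' using \<open>q' \<noteq> 0\<close> by (subst degree_mult_eq) auto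
        ultimately show ?thesis
          using less.hyps 2 by blast
      qed
    qed
  qed
  have "y \<in> range (fun_of G)" if y: "y \<in> carrier R" for y
  proof -
    obtain p where p: "p \<in> carrier ((range (fun_of G))[X])" "p \<noteq> []" "eval p y = \<zero>"
      using algebraicE[OF sub y alg[OF y]] by blast
    then have "set p \<subseteq> range (fun_of G)" "hd p \<noteq> \<zero>"
      by (auto simp: univ_poly_def polynomial_def)
    then obtain cs where cs: "rev p = map (fun_of G) cs"
      by (metis ex_map_conv set_rev subsetD rangeE)
    have "cs \<noteq> []"
      using cs p by auto
    moreover have "last cs \<noteq> 0"
    proof
      assume "last cs = 0"
      then have "last (rev p) = \<zero>"
        using cs \<open>cs \<noteq> []\<close> E.emb_0 by (simp add: last_map)
      then show False
        using \<open>hd p \<noteq> \<zero>\<close> p by (simp add: last_rev)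
    qed
    ultimately have c: "coeffs (Poly cs) = cs" "Poly cs \<noteq> 0"
      by (auto simp: coeffs_Poly strip_while_idem_iff Poly_eq_0 no_trailing_unfold)
    have "p = map (fun_of G) (rev cs)"
      using cs by (metis rev_map rev_swap)
    then have "E.T y (Poly cs) = \<zero>"
      using E.eval_emb_coeffs[OF y po, of "Poly cs"] p c by simp
    then show ?thesis
      using root[OF c(2)] y by blast
  qed
  moreover have "inj (fun_of G)"
  proof (rule injI)
    fix x y assume "fun_of G x = fun_of G y"
    then have "fun_of G (x - y) = \<zero>"
      using E.emb_diff[of x y] E.emb_closed[of y] by (simp add: a_minus_def r_neg)
    then show "x = y"
      using E.emb_nonzero[of "x - y"] by auto
  qed
  ultimately show ?thesis
    using E.emb_closed by (auto simp: bij_betw_def)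
qed

lemma to_fract_hom: "coeff_hom (\<lambda>c :: 'k::field. to_fract [:c:])"
  by unfold_locales (auto simp flip: to_fract_add to_fract_mult simp: one_pCons[symmetric])

text \<open>L is an algebraic closure of k(t) with t transcendental, hence a copy of the algebraic
  closure of the rational function field. The map is fixed on k, then on k(X) by sending X to t, and
  then extended by Zorn's lemma; it is onto since its image is algebraically closed.\<close>

theorem alg_closure_iso:
  fixes L :: "('l, 'm) ring_scheme" and \<phi>' :: "'k::field \<Rightarrow> 'l"
  assumes "algebraically_closed L" and \<phi>': "\<phi>' \<in> ring_hom ring_of_type_algebra L"
    and t: "t \<in> carrier L" "ring.transcendental L (range \<phi>') t"
    and alg: "\<And>x. x \<in> carrier L \<Longrightarrow> ring.algebraic L (generate_field L (insert t (range \<phi>'))) x"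
  obtains h :: "'k poly fract alg_closure \<Rightarrow> 'l"
  where "bij_betw h UNIV (carrier L)" "h \<in> ring_hom ring_of_type_algebra L"
    "\<And>c. h (to_ac (to_fract [:c:])) = \<phi>' c" "h (to_ac (to_fract [:0, 1:])) = t"
proof -
  interpret L: algebraically_closed L by fact
  interpret K: ring "ring_of_type_algebra :: 'k ring" by (rule ring_from_type_algebra)
  define i :: "'k \<Rightarrow> 'k poly fract alg_closure" where "i c = to_ac (to_fract [:c:])" for c
  define Y where "Y = (to_ac (to_fract [:0, 1:]) :: 'k poly fract alg_closure)"
  have i: "coeff_hom i"
    unfolding i_def by (rule coeff_hom_comp[OF to_fract_hom coeff_hom_to_ac])
  interpret i: coeff_hom i by (rule i)
  have inj: "i c = i d \<longleftrightarrow> c = d" for c d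
    by (rule field_hom_inj[OF i])
  define j where "j = (\<lambda>x. \<phi>' (inv_into UNIV i x))"
  have ji [simp]: "j (i c) = \<phi>' c" for c
    using inj by (simp add: j_def inj_def)
  have p_cl: "\<phi>' c \<in> carrier L" for c
    using ring_hom_closed[OF \<phi>', of c] by simp
  have p_mult: "\<phi>' (c * d) = \<phi>' c \<otimes>\<^bsub>L\<^esub> \<phi>' d" and p_add: "\<phi>' (c + d) = \<phi>' c \<oplus>\<^bsub>L\<^esub> \<phi>' d" for c d
    using ring_hom_mult[OF \<phi>', of c d] ring_hom_add[OF \<phi>', of c d] by auto
  have p_1: "\<phi>' 1 = \<one>\<^bsub>L\<^esub>"
    using ring_hom_one[OF \<phi>'] by simp
  have p_diff: "\<phi>' (c - d) = \<phi>' c \<ominus>\<^bsub>L\<^esub> \<phi>' d" for c d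
  proof -
    have "\<phi>' c = \<phi>' (c - d) \<oplus>\<^bsub>L\<^esub> \<phi>' d"
      using p_add[of "c - d" d] by simp
    then show ?thesis
      using p_cl by (metis a_minus_def L.a_inv_closed L.add.inv_solve_right' L.minus_minus)
  qed
  have emb0: "field_emb L (range i) j"
  proof
    show "is_subfield (range i)"
      by (rule is_subfield_range[OF i])
  qed (auto simp: p_cl p_mult p_1 p_diff i.hom_one[symmetric] simp flip: i.hom_diff i.hom_mult)
  define G0 where "G0 = {(x, j x) | x. x \<in> range i}"
  have G0: "L.hom_graph G0"
    unfolding G0_def by (rule L.emb_hom_graph[OF emb0])
  have G0D: "Domain G0 = range i"
    unfolding G0_def by blast
  have G0j: "L.fun_of G0 x = j x" if "x \<in> range i" for x
    using L.fun_of_iff[OF G0, of x "j x"] that G0D by (simp add: G0_def)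
  interpret E0: field_emb L "Domain G0" "L.fun_of G0"
    by (rule L.hom_graph_emb[OF G0])
  \<comment> \<open>X and t are both transcendental over k, so both sides hold only for q =
    0.\<close>
  have "E0.T t q = \<zero>\<^bsub>L\<^esub> \<longleftrightarrow> poly q Y = 0" if q: "poly_over (Domain G0) q" for q
  proof (cases "q = 0")
    case False
    have "E0.T t q \<noteq> \<zero>\<^bsub>L\<^esub>"
    proof
      assume T: "E0.T t q = \<zero>\<^bsub>L\<^esub>"
      define P where "P = map (L.fun_of G0) (rev (coeffs q))"
      have eP: "L.eval P t = \<zero>\<^bsub>L\<^esub>"
        unfolding P_def using E0.eval_emb_coeffs[OF t(1) q] T by simp
      have "set (coeffs q) \<subseteq> range i"
        using q G0D by (auto simp: poly_over_def coeffs_def split: if_splits)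
      then have "set P \<subseteq> range \<phi>'"
      proof (intro subsetI)
        fix y assume "y \<in> set P"
        then obtain x where "x \<in> set (coeffs q)" "y = L.fun_of G0 x"
          by (auto simp: P_def)
        then obtain d where "y = j (i d)"
          using \<open>set (coeffs q) \<subseteq> range i\<close> G0j by blast
        then show "y \<in> range \<phi>'"
          by simp
      qed
      moreover have "hd P \<noteq> \<zero>\<^bsub>L\<^esub>"
      proof -
        have "hd P = L.fun_of G0 (Polynomial.lead_coeff q)"
          unfolding P_def using False by (simp add: hd_map hd_rev last_coeffs_eq_coeff_degree)
        then show ?thesis
          using E0.emb_nonzero[of "Polynomial.lead_coeff q"] q False by (auto simp: poly_over_def)
      qed
      ultimately have "P \<in> carrier (univ_poly L (range \<phi>'))"
        by (simp add: univ_poly_def polynomial_def)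
      then have "P = []"
        using L.eval_transcendental[of "range \<phi>'" t P] t eP by (simp add: over_def)
      then show False
        using False by (simp add: P_def)
    qed
    moreover have "poly q Y \<noteq> 0"
    proof
      assume qY: "poly q Y = 0"
      define q' where "q' = map_poly (inv_into UNIV i) q"
      have ii: "inv_into UNIV i (i c) = c" for c
        using inj by (simp add: inj_def)
      have "i (inv_into UNIV i (coeff q n)) = coeff q n" for n
        using q G0D by (auto simp: poly_over_def intro: f_inv_into_f)
      moreover have "inv_into UNIV i 0 = 0"
        using ii[of 0] i.hom_zero by simp
      ultimately have q: "q = map_poly i q'"
        by (intro poly_eqI) (simp add: q'_def coeff_map_poly i.hom_zero)
      have "poly (map_poly i p) Y = to_ac (to_fract p)" for p
      proof (induction p)
        case (pCons a p)
        have "to_fract (pCons a p) = to_fract [:a:] + to_fract [:0, 1:] * to_fract p"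
          by (simp flip: to_fract_add to_fract_mult)
        then show ?case
          using pCons by (simp add: map_poly_pCons i.hom_zero i_def Y_def)
      qed simp
      then have "to_ac (to_fract q') = 0"
        using qY q by simp
      then have "q' = 0"
        using field_hom_inj[OF coeff_hom_to_ac, of "to_fract q'" 0] by simp
      then show False
        using q False by simp
    qed
    ultimately show ?thesis
      by simp
  qed simp
  then obtain G1 where G1: "L.hom_graph G1" "G0 \<subseteq> G1" "(Y, t) \<in> G1"
    using L.hom_graph_simple_extension[OF G0 t(1), of Y] by metis
  have sf1: "is_subfield (Domain G1)"
    using L.hom_graph_emb[OF G1(1)] field_emb.F by blast
  have mem1: "to_ac (to_fract p) \<in> Domain G1" for p
  proof (induction p)
    case 0
    then show ?case
      using sf_0[OF sf1] by simp
  next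
    case (pCons a p)
    have "to_ac (to_fract (pCons a p)) = i a + Y * to_ac (to_fract p)"
      by (simp add: i_def Y_def flip: to_fract_add to_fract_mult to_ac_add to_ac_mult)
    moreover have "i a \<in> Domain G1" "Y \<in> Domain G1"
      using Domain_mono[OF G1(2)] Domain.DomainI[OF G1(3)] by (auto simp: G0D)
    ultimately show ?case
      using pCons by (simp add: sf_add[OF sf1] sf_mult[OF sf1])
  qed
  have "range to_ac \<subseteq> Domain G1"
  proof safe
    fix r :: "'k poly fract"
    obtain p q where "r = to_fract p / to_fract q"
      by (metis Fract_conv_to_fract Fract_cases)
    then show "to_ac r \<in> Domain G1"
      using mem1 by (simp add: sf_divide[OF sf1])
  qed
  moreover have "alg_over (range to_ac) a" for a :: "'k poly fract alg_closure"
  proof -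
    obtain p where "p \<noteq> 0" "poly (map_poly to_ac p) a = 0"
      using alg_closure_algebraic[of a] by blast
    then show ?thesis
      using alg_over_inj_range[OF coeff_hom_to_ac] by blast
  qed
  ultimately have "alg_over (Domain G1) a" for a
    using alg_over_mono by blast
  moreover have "\<exists>x\<in>carrier L. L.eval P x = \<zero>\<^bsub>L\<^esub>" if P: "P \<in> carrier (univ_poly L (carrier L))" "length P > 1" for P
  proof -
    have "L.roots P \<noteq> {#}"
      using L.roots_over_carrier[OF P(1)] P(2) by (auto simp: L.splitted_def)
    then obtain x where "x \<in># L.roots P"
      by blast
    then show ?thesis
      using L.roots_mem_iff_is_root[OF P(1)] by (auto simp: L.is_root_def)
  qed
  ultimately obtain G where G: "L.hom_graph G" "G1 \<subseteq> G" "Domain G = UNIV"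
    using L.extend_embedding[OF _ G1(1), of UNIV] by (auto simp: is_subfield_def)
  define h where "h = L.fun_of G"
  have hG: "h x = y" if "(x, y) \<in> G" for x y
    using L.fun_of_iff[OF G(1), of x y] that by (auto simp: h_def)
  interpret E: field_emb L UNIV h
    unfolding h_def using L.hom_graph_emb[OF G(1)] G(3) by simp
  have hh: "h \<in> ring_hom ring_of_type_algebra L"
    by (rule ring_hom_memI) (auto simp: E.emb_closed E.emb_mult E.emb_add E.emb_1)
  interpret RE: field "ring_of_type_algebra :: 'k poly fract alg_closure ring" by (rule field_from_type_algebra)
  interpret H: ring_hom_ring "ring_of_type_algebra :: 'k poly fract alg_closure ring" L h
    by (rule ring_hom_ringI2[OF RE.is_ring L.is_ring hh])
  have sfh: "subfield (range h) L"
    using H.img_is_subfield(2)[OF RE.carrier_is_subfield] L.one_not_zero by simp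
  have hi: "h (i c) = \<phi>' c" for c
  proof -
    have "(i c, j (i c)) \<in> G0"
      unfolding G0_def by blast
    then show ?thesis
      using hG[of "i c" "\<phi>' c"] G1(2) G(2) by auto
  qed
  have hY: "h Y = t"
    using hG G1 G by blast
  have "insert t (range \<phi>') \<subseteq> range h"
  proof (intro insert_subsetI subsetI)
    show "t \<in> range h"
      by (simp flip: hY)
    show "y \<in> range h" if "y \<in> range \<phi>'" for y
      using that hi by (metis imageE rangeI)
  qed
  then have "generate_field L (insert t (range \<phi>')) \<subseteq> range h"
    using L.generate_field_min_subfield1[OF _ sfh, of "insert t (range \<phi>')"] p_cl t(1) by auto
  then have "ring.algebraic L (range h) y" if "y \<in> carrier L" for y
    using alg[OF that] L.algebraic_mono[of _ "range h" y] by (simp add: over_def)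
  then have bij: "bij_betw h UNIV (carrier L)"
    using L.hom_graph_surj[OF G(1,3)] subfieldE(1)[OF sfh] by (simp add: h_def over_def)
  show ?thesis
    by (rule that[OF bij hh]) (simp_all add: hi[unfolded i_def] hY[unfolded Y_def])
qed

section \<open>Curves of bidegree \<open>(n, 2)\<close> on a quadric\<close>

text \<open>The normal form modulo \<open>t\<^sup>n u\<^sup>2 = s\<^sup>n u\<^sup>2 + c t\<^sup>n v\<^sup>2 + c s\<^sup>n v\<^sup>2\<close> of the bihomogeneous monomial with
  exponents \<open>a\<close> of \<open>t\<close> and \<open>b\<close> of \<open>u\<close>: its coefficient at the monomial with exponents \<open>i\<close> and \<open>j\<close>.\<close>

function nf :: "nat \<Rightarrow> 'a::comm_ring_1 \<Rightarrow> nat \<Rightarrow> nat \<Rightarrow> nat \<times> nat \<Rightarrow> 'a" where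
  "nf n c a b = (if n = 0 \<or> a < n \<or> b < 2 then (\<lambda>ij. if ij = (a, b) then 1 else 0)
     else (\<lambda>ij. nf n c (a - n) b ij + c * nf n c a (b - 2) ij + c * nf n c (a - n) (b - 2) ij))"
  by pat_completeness auto
termination
  by (relation "Wellfounded.measure (\<lambda>(n, c, a, b). a + b)") auto

declare nf.simps [simp del]

text \<open>The exponents of those monomials of bidegree (d, d) that t^n u^2 does not
  divide.\<close>

definition normal_exps :: "nat \<Rightarrow> nat \<Rightarrow> (nat \<times> nat) set" where
  "normal_exps n d = {(i, j). i \<le> d \<and> j \<le> d \<and> (i < n \<or> j < 2)}"

lemma finite_normal_exps [simp]: "finite (normal_exps n d)"
  by (rule finite_subset[of _ "{..d} \<times> {..d}"]) (auto simp: normal_exps_def)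

text \<open>Under the Segre embedding, forms of degree d in four variables become forms of bidegree
  (d, d) in (s : t) and (v : u); these are the monomials of the latter.\<close>

definition bimon :: "nat \<Rightarrow> 'b::comm_ring_1 \<Rightarrow> 'b \<Rightarrow> 'b \<Rightarrow> 'b \<Rightarrow> nat \<times> nat \<Rightarrow> 'b" where
  "bimon d s t u v ij = s ^ (d - fst ij) * t ^ fst ij * v ^ (d - snd ij) * u ^ snd ij"

text \<open>The equation of the curve, t^n (u^2 - c v^2) = s^n (u^2 + c v^2); for s = v = 1 it says
  that u^2 (t^n - 1) = c (t^n + 1).\<close>

definition biform :: "nat \<Rightarrow> 'b::comm_ring_1 \<Rightarrow> 'b \<Rightarrow> 'b \<Rightarrow> 'b \<Rightarrow> 'b \<Rightarrow> 'b" where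
  "biform n c s t u v = t ^ n * u\<^sup>2 - s ^ n * u\<^sup>2 - c * (t ^ n * v\<^sup>2) - c * (s ^ n * v\<^sup>2)"

lemma bimon_reduce:
  assumes "n \<le> a" "2 \<le> b" "a \<le> d" "b \<le> d"
  shows "bimon d s t u v (a, b) - (bimon d s t u v (a - n, b) + c * bimon d s t u v (a, b - 2)
    + c * bimon d s t u v (a - n, b - 2)) = biform n c s t u v * (s ^ (d - a) * t ^ (a - n) * v ^ (d - b) * u ^ (b - 2))"
proof -
  obtain a' b' where ab: "a = a' + n" "b = b' + 2"
    using assms by (metis add.commute le_Suc_ex)
  have "d - a' = (d - a) + n" "d - b' = (d - b) + 2"
    using assms ab by auto
  then show ?thesis
    using ab by (simp add: bimon_def biform_def power_add power2_eq_square algebra_simps)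
qed

text \<open>Each rewriting step changes a bihomogeneous monomial by a multiple of
  \<open>biform\<close>. The coordinates lie in an arbitrary ring, because the congruence is used at
  generic points, at geometric points and along tangent vectors.\<close>

lemma nf_congruence:
  assumes "coeff_hom \<psi>" "n > 0" "a \<le> d" "b \<le> d"
  shows "biform n (\<psi> c) s t u v dvd
    bimon d s t u v (a, b) - (\<Sum>ij\<in>normal_exps n d. \<psi> (nf n c a b ij) * bimon d s t u v ij)"
  using assms(2-4)
proof (induction n c a b rule: nf.induct)
  case (1 n c a b)
  interpret coeff_hom \<psi> by fact
  show ?case
  proof (cases "n = 0 \<or> a < n \<or> b < 2")
    case True
    have "(a, b) \<in> normal_exps n d"
      using True 1 by (auto simp: normal_exps_def)
    then have "(\<Sum>ij\<in>normal_exps n d. if ij = (a, b) then bimon d s t u v (a, b) else 0) = bimon d s t u v (a, b)"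
      by simp
    moreover have "nf n c a b = (\<lambda>ij. if ij = (a, b) then 1 else 0)"
      using True by (simp add: nf.simps[of n c a b])
    then have "(\<Sum>ij\<in>normal_exps n d. \<psi> (nf n c a b ij) * bimon d s t u v ij)
        = (\<Sum>ij\<in>normal_exps n d. if ij = (a, b) then bimon d s t u v (a, b) else 0)"
      by (intro sum.cong refl) (auto simp: hom_zero hom_one)
    ultimately show ?thesis
      by simp
  next
    case False
    define D where "D a b = bimon d s t u v (a, b) - (\<Sum>ij\<in>normal_exps n d. \<psi> (nf n c a b ij) * bimon d s t u v ij)" for a b
    have IH: "biform n (\<psi> c) s t u v dvd D (a - n) b" "biform n (\<psi> c) s t u v dvd D a (b - 2)"
      "biform n (\<psi> c) s t u v dvd D (a - n) (b - 2)"
      using 1 False by (auto simp: D_def)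
    have "D a b = biform n (\<psi> c) s t u v * (s ^ (d - a) * t ^ (a - n) * v ^ (d - b) * u ^ (b - 2))
        + D (a - n) b + \<psi> c * D a (b - 2) + \<psi> c * D (a - n) (b - 2)"
      using False bimon_reduce[of n a b d s t u v "\<psi> c"] 1(5,6)
      by (simp add: D_def nf.simps[of n c a b] hom_add hom_mult distrib_right sum.distrib
          sum_distrib_left algebra_simps)
    then show ?thesis
      unfolding D_def[symmetric] using IH by (simp add: dvd_add dvd_mult)
  qed
qed

section \<open>Independence of the normal monomials\<close>

text \<open>\<open>Ppoly\<close> and \<open>Spoly\<close> are the denominator and the numerator of
  w^2 on the curve, as polynomials in t.\<close>

definition Ppoly :: "nat \<Rightarrow> 'a::field poly" where
  "Ppoly n = monom 1 n - 1"

definition Spoly :: "nat \<Rightarrow> 'a \<Rightarrow> 'a::field poly" where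
  "Spoly n c = Polynomial.smult c (monom 1 n + 1)"

lemma poly_Ppoly: "poly (Ppoly n) x = x ^ n - 1" and poly_Spoly: "poly (Spoly n c) x = c * (x ^ n + 1)"
  by (simp_all add: Ppoly_def Spoly_def poly_monom)

context
  fixes n :: nat and c :: "'a::field"
  assumes n: "of_nat n \<noteq> (0 :: 'a)" and two: "(2 :: 'a) \<noteq> 0" and c: "c \<noteq> 0"
begin

lemma n_pos: "n > 0"
  using n by (cases n) auto

lemma degree_Ppoly: "Polynomial.degree (Ppoly n :: 'a poly) = n"
proof -
  have "Polynomial.degree (monom (1::'a) n + - 1) = n"
    using n_pos by (subst degree_add_eq_left) (auto simp: degree_monom_eq)
  then show ?thesis
    by (simp add: Ppoly_def)
qed

lemma Ppoly_nonzero: "(Ppoly n :: 'a poly) \<noteq> 0"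
  using degree_Ppoly n_pos by fastforce

lemma Spoly_nonzero: "Spoly n c \<noteq> 0"
proof -
  have "poly (Spoly n c) 1 \<noteq> 0"
    using two c by (simp add: poly_Spoly)
  then show ?thesis
    by auto
qed

text \<open>\<open>Spoly\<close> is congruent to the nonzero constant 2c modulo
  \<open>Ppoly\<close>.\<close>

lemma Ppoly_dvd_cancel:
  assumes "(Ppoly n :: 'a poly) dvd A * Spoly n c ^ k"
  shows "Ppoly n dvd A"
  using assms
proof (induction k)
  case (Suc k)
  define B where "B = A * Spoly n c ^ k"
  have "Spoly n c = Polynomial.smult c (Ppoly n) + [:2 * c:]"
    by (simp add: Spoly_def Ppoly_def smult_diff_right smult_add_right one_pCons)
  then have "A * Spoly n c ^ Suc k = Ppoly n * Polynomial.smult c B + Polynomial.smult (2 * c) B"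
    by (simp add: B_def algebra_simps)
  then have "Ppoly n dvd Polynomial.smult (2 * c) B"
    using Suc.prems by (metis dvd_add_right_iff dvd_triv_left)
  then show ?case
    using Suc.IH two c by (simp add: B_def dvd_smult_iff)
qed simp

text \<open>Modulo \<open>Ppoly\<close> only the term j = J survives, so \<open>Ppoly\<close>
  divides \<open>A J\<close>, which is zero for reasons of degree; then one factor
  \<open>Ppoly\<close> cancels. \<open>A 0\<close> remains last and is zero without any bound on its
  degree.\<close>

lemma SP_independent:
  fixes A :: "nat \<Rightarrow> 'a poly"
  assumes deg: "\<And>j. 0 < j \<Longrightarrow> j \<le> J \<Longrightarrow> A j = 0 \<or> Polynomial.degree (A j) < n"
    and sum: "(\<Sum>j\<le>J. A j * Spoly n c ^ j * Ppoly n ^ (J - j)) = 0"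
  shows "j \<le> J \<Longrightarrow> A j = 0"
  using deg sum
proof (induction J arbitrary: j)
  case (Suc J)
  have split: "(\<Sum>j\<le>Suc J. A j * Spoly n c ^ j * Ppoly n ^ (Suc J - j))
      = Ppoly n * (\<Sum>j\<le>J. A j * Spoly n c ^ j * Ppoly n ^ (J - j)) + A (Suc J) * Spoly n c ^ Suc J"
  proof -
    have "(\<Sum>j\<le>J. A j * Spoly n c ^ j * Ppoly n ^ (Suc J - j))
        = Ppoly n * (\<Sum>j\<le>J. A j * Spoly n c ^ j * Ppoly n ^ (J - j))"
      unfolding sum_distrib_left by (intro sum.cong refl) (simp add: Suc_diff_le mult_ac)
    then show ?thesis
      by simp
  qed
  then have "Ppoly n dvd Ppoly n * (\<Sum>j\<le>J. A j * Spoly n c ^ j * Ppoly n ^ (J - j)) + A (Suc J) * Spoly n c ^ Suc J"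
    unfolding split[symmetric] Suc.prems(3) by simp
  then have "Ppoly n dvd A (Suc J) * Spoly n c ^ Suc J"
    by (simp only: dvd_add_right_iff[OF dvd_triv_left])
  then have "Ppoly n dvd A (Suc J)"
    by (rule Ppoly_dvd_cancel)
  then have A0: "A (Suc J) = 0"
    using Suc.prems(2)[of "Suc J"] dvd_imp_degree_le[of "Ppoly n" "A (Suc J)"] degree_Ppoly
    by (metis le_refl not_le zero_less_Suc)
  then have "(\<Sum>j\<le>J. A j * Spoly n c ^ j * Ppoly n ^ (J - j)) = 0"
    using split unfolding Suc.prems(3) A0 using Ppoly_nonzero by simp
  then have "A j = 0" if "j \<le> J"
    using Suc.IH[of j] Suc.prems(2) that by simp
  then show ?case
    using A0 Suc.prems(1) by (cases "j = Suc J") auto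
qed simp

text \<open>\<open>Ppoly\<close> has a simple zero at 1 and \<open>Spoly\<close> none, so the two
  sides would have orders of different parity there. In other words, c (t^n + 1)/(t^n - 1) is not a
  square of a rational function.\<close>

lemma norm_zero:
  fixes a b :: "'a poly"
  assumes eq: "a\<^sup>2 * Ppoly n = b\<^sup>2 * Spoly n c"
  shows "a = 0 \<and> b = 0"
proof (rule ccontr)
  assume "\<not> (a = 0 \<and> b = 0)"
  then have ab: "a \<noteq> 0" "b \<noteq> 0"
    using eq Ppoly_nonzero Spoly_nonzero by auto
  define U where "U = (\<Sum>i<n. monom (1::'a) 1 ^ i)"
  have PU: "Ppoly n = [:- 1, 1:] * U"
  proof -
    have "monom (1::'a) n - 1 = (monom 1 1 - 1) * U"
      using power_diff_1_eq[of "monom (1::'a) 1" n] unfolding U_def monom_power[of 1 1 n] power_one mult_1 .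
    moreover have "monom (1::'a) 1 - 1 = [:- 1, 1:]"
      by (simp add: monom_Suc monom_0 one_pCons)
    ultimately show ?thesis
      by (simp add: Ppoly_def)
  qed
  have "poly U 1 = of_nat n"
    by (simp add: U_def poly_sum poly_power poly_monom)
  then have "U \<noteq> 0" "Polynomial.order 1 U = 0"
    using n by (auto intro: order_0I)
  moreover have "Polynomial.order 1 [:- 1, 1 :: 'a:] = 1"
    using order_power_n_n[of "1::'a" 1] by simp
  ultimately have oP: "Polynomial.order 1 (Ppoly n :: 'a poly) = 1"
    using Ppoly_nonzero unfolding PU by (subst order_mult) auto
  have "poly (Spoly n c) 1 \<noteq> 0"
    using two c by (simp add: poly_Spoly)
  then have oS: "Polynomial.order 1 (Spoly n c) = 0"
    by (rule order_0I)
  have "Polynomial.order 1 (a * (a * Ppoly n)) = 2 * Polynomial.order 1 a + 1"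
    using ab oP Ppoly_nonzero by (simp add: order_mult)
  moreover have "Polynomial.order 1 (b * (b * Spoly n c)) = 2 * Polynomial.order 1 b"
    using ab oS Spoly_nonzero by (simp add: order_mult)
  moreover have "a * (a * Ppoly n) = b * (b * Spoly n c)"
    using eq by (simp add: power2_eq_square mult.assoc)
  ultimately have "2 * Polynomial.order 1 a + 1 = 2 * Polynomial.order 1 b"
    by metis
  then show False
    by presburger
qed

text \<open>The terms with j of parity e, where w^2 is replaced by S/P and everything is multiplied
  by P^d: the sum of all terms, times P^d, is \<open>part 0\<close> + w
  \<open>part 1\<close>.\<close>

definition part :: "nat \<Rightarrow> nat \<Rightarrow> (nat \<times> nat \<Rightarrow> 'a) \<Rightarrow> 'a poly" where
  "part e d N = (\<Sum>(i, j) | (i, j) \<in> normal_exps n d \<and> j mod 2 = e.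
     monom (N (i, j)) i * Spoly n c ^ (j div 2) * Ppoly n ^ (d - j div 2))"

text \<open>P times the norm of \<open>part 0\<close> + w \<open>part 1\<close> from the field
  generated by t and w to the rational functions in t.\<close>

definition norm_poly :: "nat \<Rightarrow> (nat \<times> nat \<Rightarrow> 'a) \<Rightarrow> 'a poly" where
  "norm_poly d N = (part 0 d N)\<^sup>2 * Ppoly n - (part 1 d N)\<^sup>2 * Spoly n c"

text \<open>Collecting the terms by k = j div 2 gives a relation between products of powers of S and
  P. For k > 0 normality means i < n, which is the degree bound of \<open>SP_independent\<close>;
  for k = 0 neither has one.\<close>

lemma part_zero:
  assumes e: "e < 2" and z: "part e d N = 0" and ij: "(i, j) \<in> normal_exps n d" "j mod 2 = e"
  shows "N (i, j) = 0"
proof -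
  define A where "A k = (\<Sum>i | (i, 2 * k + e) \<in> normal_exps n d. monom (N (i, 2 * k + e)) i)" for k
  have fin: "finite {i. (i, j) \<in> normal_exps n d}" for j
    by (rule finite_subset[of _ "{..d}"]) (auto simp: normal_exps_def)
  have cA: "coeff (A k) i = (if (i, 2 * k + e) \<in> normal_exps n d then N (i, 2 * k + e) else 0)" for k i
    using fin by (simp add: A_def coeff_sum sum.delta')
  have "part e d N = (\<Sum>(k, i) \<in> (SIGMA k:{..d}. {i. (i, 2 * k + e) \<in> normal_exps n d}).
      monom (N (i, 2 * k + e)) i * Spoly n c ^ k * Ppoly n ^ (d - k))"
    unfolding part_def
    by (rule sum.reindex_bij_witness[where i = "\<lambda>(k, i). (i, 2 * k + e)" and j = "\<lambda>(i, j). (j div 2, i)"])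
      (use e in \<open>auto simp: normal_exps_def\<close>)
  also have "\<dots> = (\<Sum>k\<le>d. A k * Spoly n c ^ k * Ppoly n ^ (d - k))"
    using fin by (simp add: sum.Sigma[symmetric] A_def sum_distrib_right)
  finally have "(\<Sum>k\<le>d. A k * Spoly n c ^ k * Ppoly n ^ (d - k)) = 0"
    using z by simp
  moreover have "A k = 0 \<or> Polynomial.degree (A k) < n" if "0 < k" for k
  proof -
    have "coeff (A k) i = 0" if "i \<ge> n" for i
      using \<open>0 < k\<close> that by (auto simp: cA normal_exps_def)
    then show ?thesis
      by (metis leading_coeff_0_iff not_le)
  qed
  ultimately have "A (j div 2) = 0"
    using SP_independent[of d A "j div 2"] ij by (auto simp: normal_exps_def)
  then have "coeff (A (j div 2)) i = 0"
    by simp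
  moreover have "2 * (j div 2) + e = j"
    using ij by presburger
  ultimately show ?thesis
    using ij by (simp add: cA)
qed

lemma norm_poly_zero:
  assumes "norm_poly d N = 0" "ij \<in> normal_exps n d"
  shows "N ij = 0"
proof -
  obtain i j where ij: "ij = (i, j)"
    by (cases ij)
  have "part 0 d N = 0 \<and> part 1 d N = 0"
    using assms(1) norm_zero[of "part 0 d N" "part 1 d N"] by (simp add: norm_poly_def)
  moreover have "j mod 2 = 0 \<or> j mod 2 = 1"
    by auto
  ultimately show ?thesis
    using part_zero[of 0 d N i j] part_zero[of 1 d N i j] assms(2) ij by auto
qed

text \<open>At a zero, \<open>part 0\<close> = - w \<open>part 1\<close>, and squaring removes w. So
  a form can vanish on this chart of the curve only over roots of its norm polynomial, be t generic
  or the coordinate of a geometric point.\<close>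

lemma norm_poly_root:
  fixes \<psi> :: "'a \<Rightarrow> 'b::field"
  assumes "coeff_hom \<psi>" and w: "w\<^sup>2 * (t ^ n - 1) = \<psi> c * (t ^ n + 1)"
    and z: "(\<Sum>ij\<in>normal_exps n d. \<psi> (N ij) * bimon d 1 t w 1 ij) = 0"
  shows "poly (map_poly \<psi> (norm_poly d N)) t = 0"
proof -
  interpret coeff_hom \<psi> by fact
  define ev where "ev p = poly (map_poly \<psi> p) t" for p
  have ev: "ev (p + q) = ev p + ev q" "ev (p - q) = ev p - ev q" "ev (p * q) = ev p * ev q" "ev 0 = 0" "ev 1 = 1" for p q
    by (simp_all add: ev_def map_poly_hom)
  have evs: "ev (sum f A) = (\<Sum>i\<in>A. ev (f i))" for f and A :: "(nat \<times> nat) set"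
    by (induction A rule: infinite_finite_induct) (auto simp: ev)
  have evp: "ev (p ^ k) = ev p ^ k" for p k
    by (induction k) (auto simp: ev)
  have evm: "ev (monom a i) = \<psi> a * t ^ i" for a i
    by (simp add: ev_def map_poly_monom hom_zero poly_monom)
  have evP: "ev (Ppoly n) = t ^ n - 1"
    by (simp add: Ppoly_def ev evm hom_one)
  have "ev (Spoly n c) = ev (monom c n + monom c 0)"
    by (simp add: Spoly_def smult_add_right smult_monom monom_0 one_pCons)
  then have evS: "ev (Spoly n c) = \<psi> c * (t ^ n + 1)"
    by (simp add: ev evm algebra_simps)
  define P where "P = t ^ n - 1"
  have evS': "ev (Spoly n c) = w\<^sup>2 * P"
    using w evS by (simp add: P_def)
  have evpart: "w ^ e * ev (part e d N) = P ^ d * (\<Sum>ij | ij \<in> normal_exps n d \<and> snd ij mod 2 = e. \<psi> (N ij) * bimon d 1 t w 1 ij)" for e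
  proof -
    have "w ^ e * (\<psi> (N ij) * t ^ fst ij * (w\<^sup>2 * P) ^ (snd ij div 2) * P ^ (d - snd ij div 2))
        = P ^ d * (\<psi> (N ij) * bimon d 1 t w 1 ij)" if "ij \<in> normal_exps n d" "snd ij mod 2 = e" for ij
    proof -
      have "P ^ d = P ^ (snd ij div 2) * P ^ (d - snd ij div 2)"
      proof -
        have "snd ij div 2 \<le> d"
          using that(1) by (auto simp: normal_exps_def)
        then show ?thesis
          by (simp flip: power_add)
      qed
      moreover have "w ^ snd ij = w ^ e * (w\<^sup>2) ^ (snd ij div 2)"
      proof -
        have "e + 2 * (snd ij div 2) = snd ij"
          using that(2) by presburger
        then show ?thesis
          by (simp flip: power_mult power_add)
      qed
      ultimately show ?thesis
        by (simp add: bimon_def power_mult_distrib algebra_simps)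
    qed
    note * = this
    have evP': "ev (Ppoly n) = P"
      by (simp add: evP P_def)
    have part_eq: "part e d N = (\<Sum>ij | ij \<in> normal_exps n d \<and> snd ij mod 2 = e.
        monom (N ij) (fst ij) * Spoly n c ^ (snd ij div 2) * Ppoly n ^ (d - snd ij div 2))"
      unfolding part_def by (intro sum.cong) auto
    show ?thesis
      unfolding part_eq evs sum_distrib_left
    proof (intro sum.cong refl)
      fix ij assume "ij \<in> {ij. ij \<in> normal_exps n d \<and> snd ij mod 2 = e}"
      then have "ij \<in> normal_exps n d" "snd ij mod 2 = e"
        by auto
      from *[OF this] show "w ^ e * ev (monom (N ij) (fst ij) * Spoly n c ^ (snd ij div 2) * Ppoly n ^ (d - snd ij div 2))
          = P ^ d * (\<psi> (N ij) * bimon d 1 t w 1 ij)"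
        unfolding ev(3) evp evm evP' evS' .
    qed
  qed
  have "(\<Sum>ij\<in>normal_exps n d. \<psi> (N ij) * bimon d 1 t w 1 ij)
      = (\<Sum>ij\<in>{ij \<in> normal_exps n d. snd ij mod 2 = 0}. \<psi> (N ij) * bimon d 1 t w 1 ij)
      + (\<Sum>ij\<in>{ij \<in> normal_exps n d. snd ij mod 2 = 1}. \<psi> (N ij) * bimon d 1 t w 1 ij)"
    by (subst sum.union_disjoint[symmetric]) (auto intro!: sum.cong)
  then have "ev (part 0 d N) + w * ev (part 1 d N) = 0"
    using z evpart[of 0] evpart[of 1] unfolding power_0 power_one_right mult_1
    by (simp flip: distrib_left)
  then have "ev (part 0 d N) = - (w * ev (part 1 d N))"
    by (simp add: eq_neg_iff_add_eq_0)
  then have "ev (part 0 d N) ^ 2 * P = (ev (part 1 d N)) ^ 2 * ev (Spoly n c)"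
    by (simp add: evS' power_mult_distrib algebra_simps)
  then show ?thesis
    unfolding ev_def[symmetric] norm_poly_def by (simp add: ev evp evP flip: P_def)
qed

end

section \<open>The Segre embedding\<close>

definition segre :: "'b::comm_ring_1 \<Rightarrow> 'b \<Rightarrow> 'b \<Rightarrow> 'b \<Rightarrow> nat \<Rightarrow> 'b" where
  "segre s t u v = (\<lambda>i. if i = 0 then s * v else if i = 1 then s * u else if i = 2 then t * v
     else if i = 3 then t * u else 0)"

abbreviation texp :: "(nat \<Rightarrow>\<^sub>0 nat) \<Rightarrow> nat" where
  "texp m \<equiv> Poly_Mapping.lookup m 2 + Poly_Mapping.lookup m 3"

abbreviation uexp :: "(nat \<Rightarrow>\<^sub>0 nat) \<Rightarrow> nat" where
  "uexp m \<equiv> Poly_Mapping.lookup m 1 + Poly_Mapping.lookup m 3"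

lemma atMost_3: "{..3::nat} = {0, 1, 2, 3}"
  by auto

lemma mdeg_4:
  assumes "Poly_Mapping.keys m \<subseteq> {..3}"
  shows "mdeg m = Poly_Mapping.lookup m 0 + Poly_Mapping.lookup m 1 + Poly_Mapping.lookup m 2 + Poly_Mapping.lookup m 3"
  using mdeg_superset[of "{..3}" m] assms by (simp add: atMost_3)

lemma mon_segre:
  assumes "Poly_Mapping.keys m \<subseteq> {..3}"
  shows "mon m (segre s t u v) = bimon (mdeg m) s t u v (texp m, uexp m)"
proof -
  define a b e f where "a = Poly_Mapping.lookup m 0" "b = Poly_Mapping.lookup m 1"
    "e = Poly_Mapping.lookup m 2" "f = Poly_Mapping.lookup m 3"
  have e: "texp m = e + f" "uexp m = b + f"
    by (simp_all add: a_b_e_f_def)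
  have "mon m (segre s t u v) = (s * v) ^ a * (s * u) ^ b * (t * v) ^ e * (t * u) ^ f"
    using mon_superset[of "{..3}" m "segre s t u v"] assms
    by (simp add: atMost_3 segre_def a_b_e_f_def mult.assoc)
  moreover have "mdeg m - (e + f) = a + b" "mdeg m - (b + f) = a + e"
    using mdeg_4[OF assms] by (auto simp: a_b_e_f_def)
  ultimately show ?thesis
    unfolding bimon_def fst_conv snd_conv e by (simp add: power_add power_mult_distrib mult_ac)
qed

text \<open>The coefficients of the normal form of f pulled back by the Segre embedding, indexed by
  the exponents of t and u.\<close>

definition nform :: "nat \<Rightarrow> 'a::comm_ring_1 \<Rightarrow> 'a mpoly \<Rightarrow> nat \<times> nat \<Rightarrow> 'a" where
  "nform n c f ij = (\<Sum>m\<in>Poly_Mapping.keys f. Poly_Mapping.lookup f m * nf n c (texp m) (uexp m) ij)"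

lemma nform_superset:
  assumes "finite A" "Poly_Mapping.keys f \<subseteq> A"
  shows "nform n c f ij = (\<Sum>m\<in>A. Poly_Mapping.lookup f m * nf n c (texp m) (uexp m) ij)"
  unfolding nform_def using assms by (intro sum.mono_neutral_left) (auto simp: in_keys_iff)

lemma nform_add: "nform n c (f + g) ij = nform n c f ij + nform n c g ij"
proof -
  define A where "A = Poly_Mapping.keys f \<union> Poly_Mapping.keys g"
  have "finite A" "Poly_Mapping.keys f \<subseteq> A" "Poly_Mapping.keys g \<subseteq> A" "Poly_Mapping.keys (f + g) \<subseteq> A"
    using keys_add[of f g] by (auto simp: A_def)
  then show ?thesis
    by (simp add: nform_superset[of A] lookup_add distrib_right sum.distrib)
qed

lemma nform_single: "nform n c (Poly_Mapping.single m a) ij = a * nf n c (texp m) (uexp m) ij"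
  by (simp add: nform_def)

lemma nform_smult: "nform n c (const_poly a * f) ij = a * nform n c f ij"
proof -
  have l: "Poly_Mapping.lookup (const_poly a * f) m = a * Poly_Mapping.lookup f m" for m
    using Poly_Mapping.map.rep_eq[of "(*) a" f]
    by (simp add: const_poly_def mult_map_scale_conv_mult[symmetric] when_def)
  then have "Poly_Mapping.keys (const_poly a * f) \<subseteq> Poly_Mapping.keys f"
    by (auto simp: in_keys_iff)
  then show ?thesis
    by (simp add: nform_superset[of "Poly_Mapping.keys f"] l sum_distrib_left mult.assoc)
qed

lemma form_congruence:
  assumes "coeff_hom \<psi>" and f: "f \<in> forms 3 d" and n: "n > 0"
  shows "biform n (\<psi> c) s t u v dvd
    peval \<psi> f (segre s t u v) - (\<Sum>ij\<in>normal_exps n d. \<psi> (nform n c f ij) * bimon d s t u v ij)"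
proof -
  interpret coeff_hom \<psi> by fact
  let ?K = "Poly_Mapping.keys f" and ?l = "Poly_Mapping.lookup f"
  have m: "Poly_Mapping.keys m \<subseteq> {..3} \<and> mdeg m = d" if "m \<in> ?K" for m
    using f that by (auto simp: forms_def poly_in_def)
  have "peval \<psi> f (segre s t u v) - (\<Sum>ij\<in>normal_exps n d. \<psi> (nform n c f ij) * bimon d s t u v ij)
      = (\<Sum>m\<in>?K. \<psi> (?l m) * bimon d s t u v (texp m, uexp m))
        - (\<Sum>m\<in>?K. \<Sum>ij\<in>normal_exps n d. \<psi> (?l m) * (\<psi> (nf n c (texp m) (uexp m) ij) * bimon d s t u v ij))"
    using m by (subst sum.swap) (simp add: peval_mon mon_segre nform_def hom_sum hom_mult sum_distrib_right mult.assoc)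
  also have "\<dots> = (\<Sum>m\<in>?K. \<psi> (?l m) * (bimon d s t u v (texp m, uexp m)
        - (\<Sum>ij\<in>normal_exps n d. \<psi> (nf n c (texp m) (uexp m) ij) * bimon d s t u v ij)))"
    by (simp add: sum_subtractf right_diff_distrib sum_distrib_left)
  finally have eq: "peval \<psi> f (segre s t u v) - (\<Sum>ij\<in>normal_exps n d. \<psi> (nform n c f ij) * bimon d s t u v ij)
      = (\<Sum>m\<in>?K. \<psi> (?l m) * (bimon d s t u v (texp m, uexp m)
        - (\<Sum>ij\<in>normal_exps n d. \<psi> (nf n c (texp m) (uexp m) ij) * bimon d s t u v ij)))" .
  show ?thesis
    unfolding eq
  proof (intro dvd_sum dvd_mult nf_congruence[OF assms(1) n])
    fix m' assume "m' \<in> ?K"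
    then show "texp m' \<le> d" "uexp m' \<le> d"
      using m[of m'] mdeg_4[of m'] by auto
  qed
qed

text \<open>Several monomials pull back to the exponents (a, b), because x_0 x_3 and x_1 x_2 agree
  on the quadric. This is the one with the most factors x_3 = tu; x_0 = sv fills up the
  degree.\<close>

definition segre_exp :: "nat \<Rightarrow> nat \<Rightarrow> nat \<Rightarrow> (nat \<Rightarrow>\<^sub>0 nat)" where
  "segre_exp d a b = Poly_Mapping.single 0 (d - max a b) + Poly_Mapping.single 1 (b - min a b)
     + Poly_Mapping.single 2 (a - min a b) + Poly_Mapping.single 3 (min a b)"

lemma segre_exp:
  assumes "a \<le> d" "b \<le> d"
  shows "Poly_Mapping.keys (segre_exp d a b) \<subseteq> {..3}" "mdeg (segre_exp d a b) = d"
    "texp (segre_exp d a b) = a" "uexp (segre_exp d a b) = b"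
  using assms by (auto simp: segre_exp_def keys_add_nat lookup_add lookup_single when_def)

definition segre_mon :: "nat \<Rightarrow> nat \<Rightarrow> nat \<Rightarrow> 'a::zero_neq_one mpoly" where
  "segre_mon d a b = Poly_Mapping.single (segre_exp d a b) 1"

lemma segre_mon_forms: "a \<le> d \<Longrightarrow> b \<le> d \<Longrightarrow> segre_mon d a b \<in> forms 3 d"
  using segre_exp[of a d b] by (auto simp: segre_mon_def intro!: forms_single)

lemma (in coeff_hom) peval_segre_mon:
  "a \<le> d \<Longrightarrow> b \<le> d \<Longrightarrow> peval \<phi> (segre_mon d a b) (segre s t u v) = bimon d s t u v (a, b)"
  using segre_exp[of a d b] by (simp add: segre_mon_def peval_single mon_segre hom_one del: One_nat_def)

lemma nform_segre_mon:
  "(a, b) \<in> normal_exps n d \<Longrightarrow> nform n c (segre_mon d a b) ij = (if ij = (a, b) then 1 else 0)"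
  using segre_exp[of a d b]
  by (auto simp: segre_mon_def nform_single normal_exps_def nf.simps[of n c a b] simp del: One_nat_def)

section \<open>Tangent vectors as first-order terms of polynomials\<close>

lemma coeff_mult_1: "coeff (p * q) 1 = coeff p 0 * coeff q 1 + coeff p 1 * coeff q 0"
  by (simp add: coeff_mult)

lemma coeff_linear_power_1: "coeff ([:a, b:] ^ n) 1 = of_nat n * a ^ (n - 1) * (b :: 'b::comm_ring_1)"
proof (induction n)
  case (Suc n)
  then show ?case
    by (cases n) (simp_all add: coeff_0_power algebra_simps)
qed simp

text \<open>The chain rule along the curve X \<mapsto> w(X). Only the terms of order 0 and 1 of w
  matter, and the induction has to carry both.\<close>

lemma peval_curve:
  assumes \<phi>: "coeff_hom \<phi>" and p: "p \<in> poly_in n"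
  shows "coeff (peval (\<lambda>c. [:\<phi> c:]) p w) 1 = (\<Sum>j\<le>n. peval \<phi> (partial_deriv j p) (\<lambda>i. coeff (w i) 0) * coeff (w j) 1)"
proof -
  interpret coeff_hom \<phi> by fact
  interpret P: coeff_hom "\<lambda>c. [:\<phi> c:]" by (rule coeff_hom_const)
  define v where "v i = coeff (w i) 0" for i
  have "coeff (peval (\<lambda>c. [:\<phi> c:]) p w) 0 = peval \<phi> p v \<and>
    coeff (peval (\<lambda>c. [:\<phi> c:]) p w) 1 = (\<Sum>j\<le>n. peval \<phi> (partial_deriv j p) v * coeff (w j) 1)"
    using p
  proof (induction p rule: mpoly_induct)
    case (const c)
    then show ?case
      by (simp add: P.peval_const peval_const partial_deriv_const peval_0)
  next
    case (var i m c)
    have "(\<Sum>j\<le>n. peval \<phi> (partial_deriv j (var_poly i * Poly_Mapping.single m c)) v * coeff (w j) 1)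
        = (\<Sum>j\<le>n. (if i = j then peval \<phi> (Poly_Mapping.single m c) v * coeff (w j) 1 else 0)
            + v i * (peval \<phi> (partial_deriv j (Poly_Mapping.single m c)) v * coeff (w j) 1))"
      by (intro sum.cong refl)
        (simp add: partial_deriv_var_mult peval_add peval_mult peval_var peval_0 algebra_simps)
    also have "\<dots> = peval \<phi> (Poly_Mapping.single m c) v * coeff (w i) 1
        + v i * (\<Sum>j\<le>n. peval \<phi> (partial_deriv j (Poly_Mapping.single m c)) v * coeff (w j) 1)"
      using var.hyps by (simp add: sum.distrib sum_distrib_left)
    finally show ?case
      using var.IH unfolding P.peval_mult P.peval_var peval_mult peval_var coeff_mult_0 coeff_mult_1
      by (simp add: algebra_simps flip: v_def)
  next
    case (add p q)
    then show ?case
      by (simp add: P.peval_add peval_add partial_deriv_add algebra_simps sum.distrib)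
  qed
  then show ?thesis
    unfolding v_def by blast
qed

text \<open>The vectors with entries a_j and - a_i at two places lie in the kernel of the first
  form; they make all two by two minors of the coefficients vanish.\<close>

lemma functional_multiple:
  fixes a1 :: "'b::field"
  assumes a: "a1 \<noteq> 0 \<or> a2 \<noteq> 0 \<or> a3 \<noteq> 0 \<or> a4 \<noteq> 0"
    and H: "\<And>x1 x2 x3 x4. a1 * x1 + a2 * x2 + a3 * x3 + a4 * x4 = 0 \<Longrightarrow> b1 * x1 + b2 * x2 + b3 * x3 + b4 * x4 = 0"
  shows "\<exists>k. b1 = k * a1 \<and> b2 = k * a2 \<and> b3 = k * a3 \<and> b4 = k * a4"
proof -
  have e: "b1 * a2 = b2 * a1" "b1 * a3 = b3 * a1" "b1 * a4 = b4 * a1" "b2 * a3 = b3 * a2" "b2 * a4 = b4 * a2" "b3 * a4 = b4 * a3"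
    using H[of a2 "- a1" 0 0] H[of a3 0 "- a1" 0] H[of a4 0 0 "- a1"] H[of 0 a3 "- a2" 0] H[of 0 a4 0 "- a2"] H[of 0 0 a4 "- a3"]
    by (simp_all add: algebra_simps)
  from a consider "a1 \<noteq> 0" | "a2 \<noteq> 0" | "a3 \<noteq> 0" | "a4 \<noteq> 0"
    by blast
  then show ?thesis
  proof cases
    case 1
    then show ?thesis
      using e by (intro exI[of _ "b1 / a1"]) (simp add: field_simps)
  next
    case 2
    then show ?thesis
      using e by (intro exI[of _ "b2 / a2"]) (simp add: field_simps)
  next
    case 3
    then show ?thesis
      using e by (intro exI[of _ "b3 / a3"]) (simp add: field_simps)
  next
    case 4
    then show ?thesis
      using e by (intro exI[of _ "b4 / a4"]) (simp add: field_simps)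
  qed
qed

lemma proportional:
  fixes u :: "'b::field"
  assumes "u \<noteq> 0 \<or> v \<noteq> 0" "h0 * v + h1 * u = 0"
  obtains k where "h0 = k * u" "h1 = - (k * v)"
proof (cases "u = 0")
  case True
  then show ?thesis
    using assms that[of "- h1 / v"] by auto
next
  case False
  have "h1 * u = - (h0 * v)"
    using assms(2) by (simp add: eq_neg_iff_add_eq_0 add.commute)
  then show ?thesis
    using False that[of "h0 / u"] by (simp add: field_simps)
qed

text \<open>The hypotheses say that h kills the four partial derivatives of the Segre map, which
  span the tangent space of the cone x_0 x_3 = x_1 x_2. So h is a multiple of the gradient of this
  equation.\<close>

lemma segre_annihilator:
  fixes u :: "'b::field"
  assumes st: "s \<noteq> 0 \<or> t \<noteq> 0" and uv: "u \<noteq> 0 \<or> v \<noteq> 0"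
    and h: "h0 * v + h1 * u = 0" "h2 * v + h3 * u = 0" "h1 * s + h3 * t = 0" "h0 * s + h2 * t = 0"
  shows "\<exists>k. h0 = k * (t * u) \<and> h1 = - (k * (t * v)) \<and> h2 = - (k * (s * u)) \<and> h3 = k * (s * v)"
proof -
  obtain a where a: "h0 = a * u" "h1 = - (a * v)"
    using proportional[OF uv h(1)] by blast
  obtain b where b: "h2 = b * u" "h3 = - (b * v)"
    using proportional[OF uv h(2)] by blast
  have "v * (a * s + b * t) = - (h1 * s + h3 * t)" "u * (a * s + b * t) = h0 * s + h2 * t"
    using a b by (simp_all add: algebra_simps)
  then have "v * (a * s + b * t) = 0" "u * (a * s + b * t) = 0"
    using h(3,4) by simp_all
  then have "a * s + b * t = 0"
    using uv by auto
  then obtain k where "a = k * t" "b = - (k * s)"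
    using proportional[of t s a b] st by blast
  then show ?thesis
    using a b by (intro exI[of _ k]) simp
qed

section \<open>The curve of bidegree (n, 2): ideal, geometric points and smoothness\<close>

locale bidegree_curve =
  fixes \<phi> :: "'k::field_char_0 \<Rightarrow> 'e::field" and n :: nat and c :: 'k and t w :: 'e
  assumes hom: "coeff_hom \<phi>" and n2: "n \<ge> 2" and c0: "c \<noteq> 0"
    and trans: "\<And>p. poly (map_poly \<phi> p) t = 0 \<Longrightarrow> p = 0"
    and w_eq: "w\<^sup>2 * (t ^ n - 1) = \<phi> c * (t ^ n + 1)"
begin

definition Y :: "'k proj_scheme" where
  "Y = \<lparr>amb = 3, van = vanishing_ideal \<phi> 3 (segre 1 t w 1)\<rparr>"

lemma amb_Y [simp]: "amb Y = 3" and van_Y: "van Y = vanishing_ideal \<phi> 3 (segre 1 t w 1)"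
  by (simp_all add: Y_def)

lemma projective_variety_Y: "projective_variety Y"
  unfolding Y_def by (rule projective_variety_vanishing_ideal[OF hom, of 0]) (auto simp: segre_def)

lemma biform_generic: "biform n (\<phi> c) 1 t w 1 = 0"
  using w_eq by (simp add: biform_def algebra_simps)

lemma n0: "n > 0"
  using n2 by simp

lemma of_nat_k: "of_nat n \<noteq> (0::'k)" "(2::'k) \<noteq> 0"
  using n2 by auto

text \<open>A normal form that is zero at the generic point has a norm polynomial with the
  transcendental root t, so its coefficients are zero. Membership in the ideal becomes a condition
  that no longer mentions the generic point.\<close>

lemma van_form_iff:
  assumes f: "f \<in> forms 3 d"
  shows "f \<in> van Y \<longleftrightarrow> (\<forall>ij\<in>normal_exps n d. nform n c f ij = 0)"
proof -
  have "peval \<phi> f (segre 1 t w 1) = (\<Sum>ij\<in>normal_exps n d. \<phi> (nform n c f ij) * bimon d 1 t w 1 ij)"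
    using form_congruence[OF hom f n0, of c 1 t w 1] biform_generic by simp
  moreover have "nform n c f ij = 0"
    if "(\<Sum>ij\<in>normal_exps n d. \<phi> (nform n c f ij) * bimon d 1 t w 1 ij) = 0" "ij \<in> normal_exps n d" for ij
  proof -
    have "poly (map_poly \<phi> (norm_poly n c d (nform n c f))) t = 0"
      by (rule norm_poly_root[OF of_nat_k c0 hom w_eq that(1)])
    then have "norm_poly n c d (nform n c f) = 0"
      by (rule trans)
    then show ?thesis
      by (rule norm_poly_zero[OF of_nat_k c0 _ that(2)])
  qed
  ultimately show ?thesis
    using coeff_hom.hom_zero[OF hom] by (auto simp: van_Y vanishing_ideal_form[OF hom f])
qed

lemma van_components: "f \<in> van Y \<Longrightarrow> hom_component d f \<in> van Y \<and> hom_component d f \<in> forms 3 d"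
  using projective_variety_Y hom_component_forms[of f 3 d] by (auto simp: projective_variety_def)

text \<open>By the vanishing of its normal form, an element of the ideal pulls back to a multiple of
  the equation for coordinates in any ring, not only at the generic point.\<close>

lemma van_dvd:
  assumes "coeff_hom \<psi>" "f \<in> van Y"
  shows "biform n (\<psi> c) s t' u v dvd peval \<psi> f (segre s t' u v)"
proof -
  interpret coeff_hom \<psi> by fact
  have "biform n (\<psi> c) s t' u v dvd peval \<psi> (hom_component d f) (segre s t' u v)" for d
  proof -
    have f: "hom_component d f \<in> forms 3 d" "hom_component d f \<in> van Y"
      using van_components assms(2) by auto
    have "(\<Sum>ij\<in>normal_exps n d. \<psi> (nform n c (hom_component d f) ij) * bimon d s t' u v ij) = 0"
      using van_form_iff[OF f(1)] f(2) by (simp add: hom_zero)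
    then show ?thesis
      using form_congruence[OF assms(1) f(1) n0, of c s t' u v] by simp
  qed
  moreover obtain N where "\<And>m. m \<in> Poly_Mapping.keys f \<Longrightarrow> mdeg m \<le> N"
    using mdeg_bounded[of f] by blast
  then have "f = (\<Sum>d\<le>N. hom_component d f)"
    using sum_hom_components[of f N] by simp
  then have "peval \<psi> f (segre s t' u v) = (\<Sum>d\<le>N. peval \<psi> (hom_component d f) (segre s t' u v))"
    using peval_sum by metis
  ultimately show ?thesis
    by (simp add: dvd_sum)
qed

definition Q :: "'k mpoly" where
  "Q = var_poly 0 * var_poly 3 - var_poly 1 * var_poly 2"

text \<open>The equation of bidegree (n, 2) is multiplied by u^j v^(n - 2 - j), to have bidegree (n,
  n) and so to come from a form of degree n on projective space.\<close>

definition G :: "nat \<Rightarrow> 'k mpoly" where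
  "G j = segre_mon n n (j + 2) - segre_mon n 0 (j + 2) - const_poly c * segre_mon n n j - const_poly c * segre_mon n 0 j"

lemma Q_form: "Q \<in> forms 3 2"
  unfolding Q_def using forms_mult[OF forms_var forms_var, of 0 3 3] forms_mult[OF forms_var forms_var, of 1 3 2]
  by (auto simp: numeral_2_eq_2 intro!: forms_diff)

lemma Q_peval: "coeff_hom \<psi> \<Longrightarrow> peval \<psi> Q x = x 0 * x 3 - x 1 * x 2"
  unfolding Q_def by (simp add: coeff_hom.peval_simps)

lemma G_form: "j \<le> n - 2 \<Longrightarrow> G j \<in> forms 3 n"
  unfolding G_def using n2 forms_mult[OF forms_const segre_mon_forms, of _ n _ c]
  by (auto intro!: forms_diff segre_mon_forms)

lemma G_peval:
  assumes "coeff_hom \<psi>" "j \<le> n - 2"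
  shows "peval \<psi> (G j) (segre s t' u v) = biform n (\<psi> c) s t' u v * (u ^ j * v ^ (n - 2 - j))"
proof -
  obtain k where n: "n = k + j + 2"
    using assms(2) n2 by (metis add.commute add.left_commute le_Suc_ex le_add_diff_inverse)
  show ?thesis
    using assms coeff_hom.peval_segre_mon[OF assms(1)]
    unfolding G_def by (simp add: coeff_hom.peval_simps[OF assms(1)] n bimon_def biform_def power_add power2_eq_square algebra_simps)
qed

lemma Q_van: "Q \<in> van Y"
  by (simp add: van_Y vanishing_ideal_form[OF hom Q_form] Q_peval[OF hom] segre_def)

lemma G_van: "j \<le> n - 2 \<Longrightarrow> G j \<in> van Y"
  by (simp add: van_Y vanishing_ideal_form[OF hom G_form] G_peval[OF hom] biform_generic)

abbreviation ca :: "'k alg_closure" where "ca \<equiv> to_ac c"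

lemma of_nat_K: "of_nat n \<noteq> (0::'k alg_closure)" "(2::'k alg_closure) \<noteq> 0" "ca \<noteq> 0"
proof -
  have z: "to_ac a \<noteq> 0" if "a \<noteq> 0" for a :: 'k
    using that field_hom_inj[OF coeff_hom_to_ac, of a 0] by simp
  show "of_nat n \<noteq> (0::'k alg_closure)"
    using z[OF of_nat_k(1)] by simp
  show "(2::'k alg_closure) \<noteq> 0"
    using z[OF of_nat_k(2)] by simp
  show "ca \<noteq> 0"
    using z[OF c0] .
qed

text \<open>The vanishing of \<open>Q\<close> puts x on the quadric, which the Segre map covers.
  \<open>G 0\<close> and \<open>G (n - 2)\<close> give the vanishing of \<open>biform\<close> times
  v^(n - 2) and times u^(n - 2), and u, v are not both zero.\<close>

lemma geometric_point:
  assumes "P \<in> zero_locus to_ac 3 (van Y)" "x \<in> P"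
  obtains s t' u v :: "'k alg_closure" where "x = segre s t' u v" "s \<noteq> 0 \<or> t' \<noteq> 0" "u \<noteq> 0 \<or> v \<noteq> 0"
    "biform n ca s t' u v = 0"
proof -
  have "P \<in> proj_space 3" and z: "\<And>f. f \<in> van Y \<Longrightarrow> peval to_ac f x = 0"
    using assms by (auto simp: zero_locus_def)
  then obtain v0 :: "nat \<Rightarrow> 'k alg_closure" and a where v0: "\<exists>i. v0 i \<noteq> 0" "\<forall>i>3. v0 i = 0" "a \<noteq> 0" "x = (\<lambda>i. a * v0 i)"
    using assms(2) by (auto simp: proj_space_def)
  have x3: "x i = 0" if "i > 3" for i
    using v0 that by simp
  have xn: "\<exists>i\<le>3. x i \<noteq> 0"
    using v0 by (metis linorder_not_le mult_eq_0_iff)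
  have q: "x 0 * x 3 = x 1 * x 2"
    using z[OF Q_van] Q_peval[OF coeff_hom_to_ac] by simp
  have "\<exists>s t' u v. x = segre s t' u v \<and> (s \<noteq> 0 \<or> t' \<noteq> 0) \<and> (u \<noteq> 0 \<or> v \<noteq> 0)"
  proof (cases "x 0 = 0 \<and> x 1 = 0")
    case True
    have xi: "x i = segre 0 1 (x 3) (x 2) i" for i
    proof (cases "i \<in> {..3}")
      case i: True
      with True show ?thesis
        unfolding atMost_3 by (auto simp: segre_def)
    next
      case False
      then show ?thesis
        using x3[of i] by (simp add: segre_def)
    qed
    have "x 3 \<noteq> 0 \<or> x 2 \<noteq> 0"
    proof -
      obtain i where "i \<in> {..3}" "x i \<noteq> 0"
        using xn by auto
      then show ?thesis
        using True unfolding atMost_3 by auto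
    qed
    moreover from xi have "x = segre 0 1 (x 3) (x 2)"
      by (rule ext)
    moreover have "(1::'k alg_closure) \<noteq> 0"
      by simp
    ultimately show ?thesis
      by metis
  next
    case False
    \<comment> \<open>The ratio of the rows (x_2, x_3) and (x_0, x_1), which are proportional
      because x lies on the quadric.\<close>
    define t' where "t' = (if x 0 \<noteq> 0 then x 2 / x 0 else x 3 / x 1)"
    have "x 2 = t' * x 0 \<and> x 3 = t' * x 1"
    proof (cases "x 0 = 0")
      case True
      then show ?thesis
        using False q by (simp add: t'_def)
    next
      case x0: False
      have "x 3 = x 2 * x 1 / x 0"
        using q x0 by (simp add: eq_divide_eq mult.commute)
      then show ?thesis
        using x0 by (simp add: t'_def)
    qed
    then have "x 2 = t' * x 0" "x 3 = t' * x 1"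
      by simp_all
    then have "x i = segre 1 t' (x 1) (x 0) i" for i
    proof (cases "i \<in> {..3}")
      case True
      with \<open>x 2 = t' * x 0\<close> \<open>x 3 = t' * x 1\<close> show ?thesis
        unfolding atMost_3 by (auto simp: segre_def)
    next
      case False
      then show ?thesis
        using x3[of i] by (simp add: segre_def)
    qed
    then have "x = segre 1 t' (x 1) (x 0)"
      by (rule ext)
    moreover have "(1::'k alg_closure) \<noteq> 0" "x 1 \<noteq> 0 \<or> x 0 \<noteq> 0"
      using False by auto
    ultimately show ?thesis
      by metis
  qed
  then obtain s t' u v where x: "x = segre s t' u v" "s \<noteq> 0 \<or> t' \<noteq> 0" "u \<noteq> 0 \<or> v \<noteq> 0"
    by blast
  have "biform n ca s t' u v * (u ^ j * v ^ (n - 2 - j)) = 0" if "j \<le> n - 2" for j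
    using z[OF G_van[OF that]] G_peval[OF coeff_hom_to_ac that, of s t' u v] x by simp
  from this[of 0] this[of "n - 2"] have "biform n ca s t' u v * v ^ (n - 2) = 0" "biform n ca s t' u v * u ^ (n - 2) = 0"
    by simp_all
  then have "biform n ca s t' u v = 0"
    using x(3) by (metis mult_eq_0_iff power_not_zero)
  then show ?thesis
    using that x by blast
qed

text \<open>Pulled back to the parameters s, t, u, v, the differential of every f in the ideal is a
  multiple of that of \<open>biform\<close>, which is nowhere zero on the curve; a suitable
  \<open>G j\<close> attains a nonzero multiple. What remains of f after subtracting a multiple of
  \<open>G j\<close> kills the tangent space of the quadric, hence is a multiple of the gradient of
  \<open>Q\<close>. So the gradients of \<open>Q\<close> and \<open>G j\<close> are a basis, of size
  2 = 3 - 1.\<close>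

lemma smooth_Y: "smooth_curve Y"
  unfolding smooth_curve_def
proof (intro ballI)
  fix P x assume "P \<in> zero_locus (to_ac :: 'k \<Rightarrow> _) (amb Y) (van Y)" and xP: "x \<in> P"
  then have P: "P \<in> zero_locus to_ac 3 (van Y)"
    by simp
  obtain s t' u v where x: "x = segre s t' u v" and st: "s \<noteq> 0 \<or> t' \<noteq> 0" and uv: "u \<noteq> 0 \<or> v \<noteq> 0"
    and F0: "biform n ca s t' u v = 0"
    by (rule geometric_point[OF P xP])
  interpret vs: vector_space "\<lambda>(c :: 'k alg_closure) w. (\<lambda>j :: nat. c * w j)"
    by unfold_locales (auto simp: fun_eq_iff algebra_simps)
  interpret H: coeff_hom "to_ac :: 'k \<Rightarrow> _" by (rule coeff_hom_to_ac)
  have HP: "coeff_hom (\<lambda>c :: 'k. [:to_ac c:])"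
    by (rule H.coeff_hom_const)
  define grad where "grad f = (\<lambda>j. if j \<le> 3 then peval to_ac (partial_deriv j f) x else 0)" for f :: "'k mpoly"
  \<comment> \<open>The partial derivatives of \<open>biform\<close> at (s, t', u, v).\<close>
  define pS pT pU pV where "pS = - (of_nat n * s ^ (n - 1) * (u\<^sup>2 + ca * v\<^sup>2))"
    and "pT = of_nat n * t' ^ (n - 1) * (u\<^sup>2 - ca * v\<^sup>2)"
    and "pU = 2 * u * (t' ^ n - s ^ n)" and "pV = - (2 * ca * v * (t' ^ n + s ^ n))"
  \<comment> \<open>If u or v is zero, both quadratic factors are nonzero and s = t' = 0. Otherwise
    t'^n = s^n = - s^n, with the same result.\<close>
  have p0: "pS \<noteq> 0 \<or> pT \<noteq> 0 \<or> pU \<noteq> 0 \<or> pV \<noteq> 0"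
  proof (rule ccontr)
    assume "\<not> ?thesis"
    then have z: "s ^ (n - 1) * (u\<^sup>2 + ca * v\<^sup>2) = 0" "t' ^ (n - 1) * (u\<^sup>2 - ca * v\<^sup>2) = 0"
      "u * (t' ^ n - s ^ n) = 0" "v * (t' ^ n + s ^ n) = 0"
      using of_nat_K by (auto simp: pS_def pT_def pU_def pV_def)
    have n1: "n - 1 > 0"
      using n2 by simp
    show False
    proof (cases "u = 0 \<or> v = 0")
      case True
      then have "u\<^sup>2 + ca * v\<^sup>2 \<noteq> 0" "u\<^sup>2 - ca * v\<^sup>2 \<noteq> 0"
        using uv of_nat_K by auto
      then show False
        using z n1 st by auto
    next
      case False
      then have e: "t' ^ n = s ^ n" "t' ^ n + s ^ n = 0"
        using z by auto
      then have "2 * s ^ n = 0"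
        by (metis mult_2)
      then have "s ^ n = 0"
        using of_nat_K by simp
      then have "s = 0" "t' = 0"
        using e(1) by (metis power_eq_0_iff)+
      then show False
        using st by simp
    qed
  qed
  \<comment> \<open>The derivative of the Segre map in the direction (a, b, e, f), taken as a
    coefficient of X.\<close>
  define tv where "tv a b e f = (\<lambda>j. coeff (segre [:s, a:] [:t', b:] [:u, e:] [:v, f:] j) 1)" for a b e f
  define L where "L g a b e f = (\<Sum>j\<le>3. g j * tv a b e f j)" for g :: "nat \<Rightarrow> 'k alg_closure" and a b e f
  have L: "L g a b e f = (g 0 * v + g 1 * u) * a + (g 2 * v + g 3 * u) * b + (g 1 * s + g 3 * t') * e + (g 0 * s + g 2 * t') * f"
    for g a b e f
    unfolding L_def atMost_3 by (simp add: tv_def segre_def coeff_mult algebra_simps)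
  have x_coeff: "(\<lambda>i. coeff (segre [:s, a:] [:t', b:] [:u, e:] [:v, f:] i) 0) = x" for a b e f
    unfolding x by (auto simp: segre_def fun_eq_iff coeff_mult_0)
  have Lg: "L (grad f) a b e k = coeff (peval (\<lambda>c. [:to_ac c:]) f (segre [:s, a:] [:t', b:] [:u, e:] [:v, k:])) 1"
    if "f \<in> van Y" for f a b e k
  proof -
    have "f \<in> poly_in 3"
      using that by (simp add: van_Y vanishing_ideal_def)
    from peval_curve[OF coeff_hom_to_ac this, of "segre [:s, a:] [:t', b:] [:u, e:] [:v, k:]"]
    show ?thesis
      unfolding x_coeff by (simp add: L_def grad_def tv_def)
  qed
  define B where "B a b e f = biform n [:ca:] [:s, a:] [:t', b:] [:u, e:] [:v, f:]" for a b e f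
  have B0: "coeff (B a b e f) 0 = 0" for a b e f
    using F0 by (simp add: B_def biform_def coeff_mult_0 coeff_0_power power2_eq_square mult_ac)
  have B1: "coeff (B a b e f) 1 = pS * a + pT * b + pU * e + pV * f" for a b e f
    unfolding B_def biform_def coeff_diff coeff_mult_1 coeff_mult_0 coeff_linear_power_1 coeff_0_power
    by (simp add: pS_def pT_def pU_def pV_def power2_eq_square algebra_simps)
  have tangent: "L (grad f) a b e k = 0" if f: "f \<in> van Y" and k: "pS * a + pT * b + pU * e + pV * k = 0" for f a b e k
  proof -
    have "B a b e k dvd peval (\<lambda>c. [:to_ac c:]) f (segre [:s, a:] [:t', b:] [:u, e:] [:v, k:])"
      unfolding B_def by (rule van_dvd[OF HP f])
    then obtain q where "peval (\<lambda>c. [:to_ac c:]) f (segre [:s, a:] [:t', b:] [:u, e:] [:v, k:]) = B a b e k * q"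
      by (elim dvdE)
    then show ?thesis
      unfolding Lg[OF f] using B0 B1 k by (simp add: coeff_mult_1 del: One_nat_def)
  qed
  \<comment> \<open>Of the two extreme exponents, one for which u^j v^(n - 2 - j) is not
    zero.\<close>
  define j where "j = (if u = 0 then 0 else n - 2)"
  have j: "j \<le> n - 2"
    by (simp add: j_def)
  define m where "m = u ^ j * v ^ (n - 2 - j)"
  have m0: "m \<noteq> 0"
    using uv by (auto simp: m_def j_def)
  have LG: "L (grad (G j)) a b e k = m * (pS * a + pT * b + pU * e + pV * k)" for a b e k
  proof -
    have "peval (\<lambda>c. [:to_ac c:]) (G j) (segre [:s, a:] [:t', b:] [:u, e:] [:v, k:])
        = B a b e k * ([:u, e:] ^ j * [:v, k:] ^ (n - 2 - j))"
      unfolding B_def by (rule G_peval[OF HP j])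
    then show ?thesis
      unfolding Lg[OF G_van[OF j]] by (simp only: coeff_mult_1 B0 B1 coeff_mult_0 coeff_0_power) (simp add: m_def)
  qed
  have gQ: "grad Q 0 = t' * u" "grad Q 1 = - (t' * v)" "grad Q 2 = - (s * u)" "grad Q 3 = s * v"
  proof -
    have "(\<Sum>j\<le>3. grad Q j * y j) = x 0 * y 3 + x 3 * y 0 - x 1 * y 2 - x 2 * y 1" for y
    proof -
      have "(\<Sum>j\<le>3. grad Q j * y j) = coeff (peval (\<lambda>c. [:to_ac c:]) Q (\<lambda>i. [:x i, y i:])) 1"
        using peval_curve[OF coeff_hom_to_ac forms_poly_in[OF Q_form], of "\<lambda>i. [:x i, y i:]"]
        by (simp add: grad_def)
      then show ?thesis
        unfolding Q_peval[OF HP] by (simp add: algebra_simps)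
    qed
    note * = this[unfolded atMost_3]
    show "grad Q 0 = t' * u" "grad Q 1 = - (t' * v)" "grad Q 2 = - (s * u)" "grad Q 3 = s * v"
      using *[of "\<lambda>i. if i = 0 then 1 else 0"] *[of "\<lambda>i. if i = 1 then 1 else 0"]
        *[of "\<lambda>i. if i = 2 then 1 else 0"] *[of "\<lambda>i. if i = 3 then 1 else 0"]
      by (simp_all add: x segre_def)
  qed
  have LQ: "L (grad Q) a b e k = 0" for a b e k
    unfolding L gQ by (simp add: algebra_simps)
  have span: "grad f \<in> vs.span {grad Q, grad (G j)}" if f: "f \<in> van Y" for f
  proof -
    obtain \<mu> where \<mu>: "grad f 0 * v + grad f 1 * u = \<mu> * pS" "grad f 2 * v + grad f 3 * u = \<mu> * pT"
      "grad f 1 * s + grad f 3 * t' = \<mu> * pU" "grad f 0 * s + grad f 2 * t' = \<mu> * pV"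
      using functional_multiple[OF p0, of "grad f 0 * v + grad f 1 * u" "grad f 2 * v + grad f 3 * u"
          "grad f 1 * s + grad f 3 * t'" "grad f 0 * s + grad f 2 * t'"] tangent[OF f] unfolding L by blast
    have G': "grad (G j) 0 * v + grad (G j) 1 * u = m * pS" "grad (G j) 2 * v + grad (G j) 3 * u = m * pT"
      "grad (G j) 1 * s + grad (G j) 3 * t' = m * pU" "grad (G j) 0 * s + grad (G j) 2 * t' = m * pV"
      using LG[of 1 0 0 0] LG[of 0 1 0 0] LG[of 0 0 1 0] LG[of 0 0 0 1] unfolding L by auto
    \<comment> \<open>With this multiple of the gradient of \<open>G j\<close> removed, the
      derivatives along all four parameters of the Segre map are zero.\<close>
    define h where "h i = grad f i - \<mu> / m * grad (G j) i" for i
    have "h 0 * v + h 1 * u = (grad f 0 * v + grad f 1 * u) - \<mu> / m * (grad (G j) 0 * v + grad (G j) 1 * u)"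
      "h 2 * v + h 3 * u = (grad f 2 * v + grad f 3 * u) - \<mu> / m * (grad (G j) 2 * v + grad (G j) 3 * u)"
      "h 1 * s + h 3 * t' = (grad f 1 * s + grad f 3 * t') - \<mu> / m * (grad (G j) 1 * s + grad (G j) 3 * t')"
      "h 0 * s + h 2 * t' = (grad f 0 * s + grad f 2 * t') - \<mu> / m * (grad (G j) 0 * s + grad (G j) 2 * t')"
      by (simp_all add: h_def algebra_simps)
    then have "h 0 * v + h 1 * u = 0" "h 2 * v + h 3 * u = 0" "h 1 * s + h 3 * t' = 0" "h 0 * s + h 2 * t' = 0"
      using m0 unfolding \<mu> G' by simp_all
    then obtain k where k: "h 0 = k * (t' * u)" "h 1 = - (k * (t' * v))" "h 2 = - (k * (s * u))" "h 3 = k * (s * v)"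
      using segre_annihilator[OF st uv] by blast
    have hi: "h i = k * grad Q i" if "i \<in> {..3}" for i
      using that k gQ unfolding atMost_3 by auto
    have "grad f i = k * grad Q i + \<mu> / m * grad (G j) i" for i
    proof (cases "i \<le> 3")
      case True
      then show ?thesis
        using hi[of i] by (simp add: h_def diff_eq_eq)
    qed (simp add: grad_def)
    then have "grad f = (\<lambda>i. k * grad Q i) + (\<lambda>i. \<mu> / m * grad (G j) i)"
      by (simp add: fun_eq_iff)
    moreover have "(\<lambda>i. k * grad Q i) + (\<lambda>i. \<mu> / m * grad (G j) i) \<in> vs.span {grad Q, grad (G j)}"
      by (intro vs.span_add vs.span_scale vs.span_base) auto
    ultimately show ?thesis
      by simp
  qed
  have G0: "grad (G j) \<notin> vs.span {grad Q}"
  proof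
    assume "grad (G j) \<in> vs.span {grad Q}"
    then obtain k where "grad (G j) = (\<lambda>i. k * grad Q i)"
      by (auto simp: vs.span_singleton)
    then have "L (grad (G j)) a b e f = k * L (grad Q) a b e f" for a b e f
      by (simp add: L_def sum_distrib_left mult.assoc)
    then have z: "pS * a + pT * b + pU * e + pV * f = 0" for a b e f
      using LG LQ m0 by simp
    show False
      using z[of 1 0 0 0] z[of 0 1 0 0] z[of 0 0 1 0] z[of 0 0 0 1] p0 by simp
  qed
  have "grad Q \<noteq> 0"
  proof
    assume "grad Q = 0"
    then have "t' * u = 0" "t' * v = 0" "s * u = 0" "s * v = 0"
      using gQ by auto
    then show False
      using st uv by auto
  qed
  then have "vs.independent {grad Q}"
    by (simp add: vs.dependent_single)
  then have ind: "vs.independent {grad (G j), grad Q}"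
    using G0 by (simp add: vs.independent_insert)
  have ne: "grad (G j) \<noteq> grad Q"
    using G0 vs.span_base[of "grad Q" "{grad Q}"] by auto
  have "vs.dim {grad f | f. f \<in> van Y} = 2"
  proof (rule vs.dim_unique[OF _ _ ind])
    show "{grad (G j), grad Q} \<subseteq> {grad f | f. f \<in> van Y}"
      using G_van[OF j] Q_van by auto
    show "{grad f | f. f \<in> van Y} \<subseteq> vs.span {grad (G j), grad Q}"
      using span by (auto simp: insert_commute)
    show "card {grad (G j), grad Q} = 2"
      using ne by simp
  qed
  then show "vs.dim {(\<lambda>j. if j \<le> amb Y then peval to_ac (partial_deriv j f) x else 0) | f. f \<in> van Y} + 1 = amb Y"
    by (simp add: grad_def)
qed

end

section \<open>Geometric connectedness\<close>

context bidegree_curve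
begin

definition geo_point :: "'k alg_closure \<Rightarrow> 'k alg_closure \<Rightarrow> (nat \<Rightarrow> 'k alg_closure) set" where
  "geo_point x y = {(\<lambda>i. a * segre 1 x y 1 i) | a. a \<noteq> 0}"

lemma geo_point_proj: "geo_point x y \<in> proj_space 3"
  unfolding geo_point_def proj_space_def
  by (intro CollectI exI[of _ "segre 1 x y 1"] conjI refl exI[of _ 0]) (auto simp: segre_def)

lemma geo_point_zero_locus:
  assumes "y\<^sup>2 * (x ^ n - 1) = ca * (x ^ n + 1)"
  shows "geo_point x y \<in> zero_locus to_ac 3 (van Y)"
proof -
  have "peval to_ac f z = 0" if f: "f \<in> van Y" and z: "z \<in> geo_point x y" for f z
  proof -
    obtain a where z: "z = (\<lambda>i. a * segre 1 x y 1 i)"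
      using z by (auto simp: geo_point_def)
    then have "z = segre 1 x (a * y) a"
      by (auto simp: segre_def)
    moreover have "biform n ca 1 x (a * y) a = a\<^sup>2 * (y\<^sup>2 * (x ^ n - 1) - ca * (x ^ n + 1))"
      by (simp add: biform_def power_mult_distrib algebra_simps)
    then have "biform n ca 1 x (a * y) a = 0"
      using assms by simp
    ultimately show ?thesis
      using van_dvd[OF coeff_hom_to_ac f, of 1 x "a * y" a] by simp
  qed
  then show ?thesis
    using geo_point_proj by (simp add: zero_locus_def)
qed

lemma infinite_K: "infinite (UNIV :: 'k alg_closure set)"
proof -
  have "inj (to_ac :: 'k \<Rightarrow> _)"
    using field_hom_inj[OF coeff_hom_to_ac] by (auto simp: inj_def)
  then have "infinite (range (to_ac :: 'k \<Rightarrow> _))"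
    by (simp add: finite_image_iff infinite_UNIV_char_0)
  then show ?thesis
    using finite_subset[OF subset_UNIV] by metis
qed

lemma square_root_K: obtains y :: "'k alg_closure" where "y\<^sup>2 = a"
proof -
  have "Polynomial.degree [:- a, 0, 1:] > 0"
    by simp
  then obtain y where "poly [:- a, 0, 1:] y = 0"
    using alg_closed_imp_poly_has_root by blast
  then show ?thesis
    using that[of y] by (simp add: power2_eq_square)
qed

text \<open>If f does not vanish at P, its normal form is not zero, and neither is its norm
  polynomial; the finitely many roots of the latter contain every x over which f has a zero.\<close>

lemma basic_open_cofinite:
  fixes f :: "'k alg_closure mpoly"
  assumes f: "f \<in> forms 3 d" and P: "P \<in> zero_locus to_ac 3 (van Y)" "P \<notin> zero_locus (\<lambda>c. c) 3 {f}"
  shows "\<exists>T. finite T \<and> (\<forall>x y. x \<notin> T \<longrightarrow> y\<^sup>2 * (x ^ n - 1) = ca * (x ^ n + 1) \<longrightarrow>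
    geo_point x y \<notin> zero_locus (\<lambda>c. c) 3 {f})"
proof -
  have "P \<in> proj_space 3"
    using P(1) by (simp add: zero_locus_def)
  then obtain v where v: "v \<in> P" "peval (\<lambda>c. c) f v \<noteq> 0"
    using P(2) by (auto simp: zero_locus_def)
  obtain s t' u v' where x: "v = segre s t' u v'" and F0: "biform n ca s t' u v' = 0"
    by (rule geometric_point[OF P(1) v(1)])
  define N where "N = nform n ca f"
  define p where "p = norm_poly n ca d N"
  have "peval (\<lambda>c. c) f (segre s t' u v') = (\<Sum>ij\<in>normal_exps n d. N ij * bimon d s t' u v' ij)"
    using form_congruence[OF coeff_hom_id f n0, of ca s t' u v'] F0 by (simp add: N_def)
  then have "\<exists>ij\<in>normal_exps n d. N ij \<noteq> 0"
    using v x by (metis (no_types, lifting) mult_zero_left sum.neutral)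
  then have p0: "p \<noteq> 0"
    using norm_poly_zero[OF of_nat_K, of d N] unfolding p_def by blast
  show ?thesis
  proof (intro exI[of _ "{x. poly p x = 0}"] conjI allI impI)
    show "finite {x. poly p x = 0}"
      using p0 by (rule poly_roots_finite)
    fix x y assume x: "x \<notin> {x. poly p x = 0}" and y: "y\<^sup>2 * (x ^ n - 1) = ca * (x ^ n + 1)"
    have "biform n ca 1 x y 1 = 0"
      using y by (simp add: biform_def algebra_simps)
    then have e: "peval (\<lambda>c. c) f (segre 1 x y 1) = (\<Sum>ij\<in>normal_exps n d. N ij * bimon d 1 x y 1 ij)"
      using form_congruence[OF coeff_hom_id f n0, of ca 1 x y 1] by (simp add: N_def)
    have "peval (\<lambda>c. c) f (segre 1 x y 1) \<noteq> 0"
    proof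
      assume "peval (\<lambda>c. c) f (segre 1 x y 1) = 0"
      then have "(\<Sum>ij\<in>normal_exps n d. N ij * bimon d 1 x y 1 ij) = 0"
        using e by simp
      from norm_poly_root[OF of_nat_K coeff_hom_id y this] have "poly p x = 0"
        by (simp add: p_def map_poly_idI')
      then show False
        using x by simp
    qed
    moreover have "segre 1 x y 1 \<in> geo_point x y"
      unfolding geo_point_def by (intro CollectI exI[of _ 1]) simp
    ultimately show "geo_point x y \<notin> zero_locus (\<lambda>c. c) 3 {f}"
      by (auto simp: zero_locus_def)
  qed
qed

lemma open_cofinite:
  assumes "openin (zariski 3) U" "U \<inter> zero_locus to_ac 3 (van Y) \<noteq> {}"
  shows "\<exists>T. finite T \<and> (\<forall>x y. x \<notin> T \<longrightarrow> y\<^sup>2 * (x ^ n - 1) = ca * (x ^ n + 1) \<longrightarrow> geo_point x y \<in> U)"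
proof -
  have "generate_topology_on {proj_space 3 - zero_locus (\<lambda>c. c) 3 {f} | f :: 'k alg_closure mpoly. \<exists>d. f \<in> forms 3 d} U"
    using assms(1) unfolding zariski_def openin_topology_generated_by_iff .
  then show ?thesis
    using assms(2)
  proof (induction rule: generate_topology_on.induct)
    case Empty
    then show ?case
      by simp
  next
    case (Int a b)
    then have "a \<inter> zero_locus to_ac 3 (van Y) \<noteq> {}" "b \<inter> zero_locus to_ac 3 (van Y) \<noteq> {}"
      by auto
    then obtain Ta Tb where "finite Ta" "\<And>x y. x \<notin> Ta \<Longrightarrow> y\<^sup>2 * (x ^ n - 1) = ca * (x ^ n + 1) \<Longrightarrow> geo_point x y \<in> a"
      "finite Tb" "\<And>x y. x \<notin> Tb \<Longrightarrow> y\<^sup>2 * (x ^ n - 1) = ca * (x ^ n + 1) \<Longrightarrow> geo_point x y \<in> b"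
      using Int.IH(1)[OF \<open>a \<inter> _ \<noteq> {}\<close>] Int.IH(2)[OF \<open>b \<inter> _ \<noteq> {}\<close>] by metis
    then show ?case
      by (intro exI[of _ "Ta \<union> Tb"]) simp
  next
    case (UN K)
    then obtain k where k: "k \<in> K" "k \<inter> zero_locus to_ac 3 (van Y) \<noteq> {}"
      by blast
    from UN.IH[OF this] obtain T where "finite T"
      "\<forall>x y. x \<notin> T \<longrightarrow> y\<^sup>2 * (x ^ n - 1) = ca * (x ^ n + 1) \<longrightarrow> geo_point x y \<in> k"
      by metis
    then show ?case
      using k(1) by (intro exI[of _ T]) (simp, metis UnionI)
  next
    case (Basis s)
    then obtain f :: "'k alg_closure mpoly" and d where f: "s = proj_space 3 - zero_locus (\<lambda>c. c) 3 {f}" "f \<in> forms 3 d"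
      by blast
    obtain P where P: "P \<in> s" "P \<in> zero_locus to_ac 3 (van Y)"
      using Basis.prems by blast
    then have P': "P \<notin> zero_locus (\<lambda>c. c) 3 {f}"
      using f by simp
    from basic_open_cofinite[OF f(2) P(2) P'] show ?case
      using geo_point_proj by (simp add: f(1))
  qed
qed

text \<open>Any two open sets that meet the curve meet on it, so the curve is even irreducible: for
  all but finitely many x, the points over x lie in both, and the field is infinite.\<close>

lemma geometrically_connected_Y: "geometrically_connected Y"
proof -
  let ?Z = "zero_locus (to_ac :: 'k \<Rightarrow> _) 3 (van Y)"
  have "?Z \<subseteq> topspace (zariski 3)"
  proof
    fix P assume P: "P \<in> ?Z"
    then have "P \<in> proj_space 3"
      by (simp add: zero_locus_def)
    then obtain v0 where v0: "P = {(\<lambda>i. c * v0 i) | c. c \<noteq> 0}" "\<exists>i. v0 i \<noteq> 0" "\<forall>i>3. v0 i = 0"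
      by (auto simp: proj_space_def)
    then obtain i where i: "v0 i \<noteq> 0" "i \<le> 3"
      by (metis linorder_not_le)
    have "v0 \<in> P"
      unfolding v0(1) by (intro CollectI exI[of _ 1]) simp
    then have "P \<notin> zero_locus (\<lambda>c. c) 3 {var_poly i}"
      using i coeff_hom.peval_var[OF coeff_hom_id, of i v0] unfolding zero_locus_def by fastforce
    moreover have "var_poly i \<in> forms 3 1"
      by (rule forms_var[OF i(2)])
    then have "openin (zariski 3) (proj_space 3 - zero_locus (\<lambda>c. c) 3 {var_poly i :: 'k alg_closure mpoly})"
      unfolding zariski_def by (intro topology_generated_by_Basis) blast
    ultimately show "P \<in> topspace (zariski 3)"
      using \<open>P \<in> proj_space 3\<close> openin_subset by blast
  qed
  moreover have "E1 \<inter> E2 \<inter> ?Z \<noteq> {}"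
    if E: "openin (zariski 3) E1" "openin (zariski 3) E2" "E1 \<inter> ?Z \<noteq> {}" "E2 \<inter> ?Z \<noteq> {}" for E1 E2
  proof -
    obtain T1 T2 where T: "finite T1" "finite T2"
      "\<And>x y. x \<notin> T1 \<Longrightarrow> y\<^sup>2 * (x ^ n - 1) = ca * (x ^ n + 1) \<Longrightarrow> geo_point x y \<in> E1"
      "\<And>x y. x \<notin> T2 \<Longrightarrow> y\<^sup>2 * (x ^ n - 1) = ca * (x ^ n + 1) \<Longrightarrow> geo_point x y \<in> E2"
      using open_cofinite[OF E(1,3)] open_cofinite[OF E(2,4)] by metis
    \<comment> \<open>Over a root of x^n = 1 there is no point in this chart; elsewhere a square
      root gives one.\<close>
    define R where "R = {x. poly (Ppoly n :: 'k alg_closure poly) x = 0}"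
    have "finite R"
      unfolding R_def using Ppoly_nonzero[OF of_nat_K] by (rule poly_roots_finite)
    then have "\<exists>x. x \<notin> T1 \<union> T2 \<union> R"
      using T infinite_K by (metis ex_new_if_finite finite_UnI)
    then obtain x where x: "x \<notin> T1" "x \<notin> T2" "x ^ n - 1 \<noteq> 0"
      by (auto simp: R_def poly_Ppoly)
    obtain y where "y\<^sup>2 = ca * (x ^ n + 1) / (x ^ n - 1)"
      by (rule square_root_K)
    then have y: "y\<^sup>2 * (x ^ n - 1) = ca * (x ^ n + 1)"
      using x by simp
    then have "geo_point x y \<in> E1 \<inter> E2 \<inter> ?Z"
      using T(3)[OF x(1) y] T(4)[OF x(2) y] geo_point_zero_locus[OF y] by simp
    then show ?thesis
      by blast
  qed
  ultimately show ?thesis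
    unfolding geometrically_connected_def amb_Y connectedin by blast
qed

section \<open>Hilbert function and genus\<close>

sublocale forms_space: vector_space "\<lambda>(c :: 'k) p. const_poly c * p"
  by unfold_locales
    (auto simp: algebra_simps const_poly_def single_add mult_single simp flip: mult.assoc)

lemma finite_exponents: "finite {m :: nat \<Rightarrow>\<^sub>0 nat. Poly_Mapping.keys m \<subseteq> {..3} \<and> mdeg m = d}"
proof (rule finite_subset)
  let ?f = "\<lambda>(a, b, c, e). Poly_Mapping.single 0 a + Poly_Mapping.single 1 b + Poly_Mapping.single 2 c
    + Poly_Mapping.single (3::nat) (e::nat)"
  show "finite (?f ` ({..d} \<times> {..d} \<times> {..d} \<times> {..d}))"
    by simp
  show "{m. Poly_Mapping.keys m \<subseteq> {..3} \<and> mdeg m = d} \<subseteq> ?f ` ({..d} \<times> {..d} \<times> {..d} \<times> {..d})"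
  proof
    fix m :: "nat \<Rightarrow>\<^sub>0 nat" assume "m \<in> {m. Poly_Mapping.keys m \<subseteq> {..3} \<and> mdeg m = d}"
    then have k: "Poly_Mapping.keys m \<subseteq> {..3}" and d: "mdeg m = d"
      by auto
    have z: "Poly_Mapping.lookup m i = 0" if "i \<notin> {..3}" for i
      using k that by (metis in_keys_iff subsetD)
    let ?l = "Poly_Mapping.lookup m"
    have "m = ?f (?l 0, ?l 1, ?l 2, ?l 3)"
    proof (rule poly_mapping_eqI)
      fix i
      show "?l i = Poly_Mapping.lookup (?f (?l 0, ?l 1, ?l 2, ?l 3)) i"
        using z[of i] unfolding atMost_3
        by (cases "i \<in> {0, 1, 2, 3}") (auto simp: lookup_add lookup_single when_def)
    qed
    moreover have "(?l 0, ?l 1, ?l 2, ?l 3) \<in> {..d} \<times> {..d} \<times> {..d} \<times> {..d}"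
      using mdeg_4[OF k] d by simp
    ultimately show "m \<in> ?f ` ({..d} \<times> {..d} \<times> {..d} \<times> {..d})"
      by blast
  qed
qed

text \<open>The normal monomials are a basis of the forms modulo the ideal: \<open>nform\<close>
  reads off their coefficients and is zero on the ideal, and a form minus its normal form lies in
  the ideal. Joined to a basis B of the ideal in degree d, they account for the difference of
  dimensions.\<close>

lemma hilbert_function_Y: "hilbert_function Y d = card (normal_exps n d)"
proof -
  let ?V = "forms 3 d :: 'k mpoly set" and ?N = "normal_exps n d"
  define I where "I = ?V \<inter> van Y"
  obtain B where B: "B \<subseteq> I" "forms_space.independent B" "I \<subseteq> forms_space.span B"
    by (rule forms_space.maximal_independent_subset[of I])
  have scale: "const_poly a * f \<in> ?V" if "f \<in> ?V" for a f
    using forms_mult[OF forms_const that, of a] by simp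
  define S where "S = (\<lambda>m. Poly_Mapping.single m (1::'k)) ` {m. Poly_Mapping.keys m \<subseteq> {..3} \<and> mdeg m = d}"
  have "finite S"
    unfolding S_def using finite_exponents by simp
  have spanS: "f \<in> forms_space.span S" if "f \<in> ?V" for f
  proof -
    have "(\<Sum>m\<in>Poly_Mapping.keys f. const_poly (Poly_Mapping.lookup f m) * Poly_Mapping.single m 1) \<in> forms_space.span S"
      using that
      by (intro forms_space.span_sum forms_space.span_scale forms_space.span_base)
        (auto simp: S_def forms_def poly_in_def)
    then show ?thesis
      by (simp add: const_poly_def mult_single sum_singles)
  qed
  have finB: "finite B"
    using forms_space.independent_span_bound[OF \<open>finite S\<close> B(2)] B(1) spanS by (auto simp: I_def)
  define M where "M ij = (segre_mon d (fst ij) (snd ij) :: 'k mpoly)" for ij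
  have M: "M ij \<in> ?V" "nform n c (M ij) kl = (if kl = ij then 1 else 0)" if "ij \<in> ?N" for ij kl
    using that nform_segre_mon[of "fst ij" "snd ij" n d c kl]
    by (auto simp: M_def normal_exps_def intro: segre_mon_forms)
  have zero_span: "nform n c f ij = 0"
    if "f \<in> forms_space.span A" "\<And>g. g \<in> A \<Longrightarrow> nform n c g ij = 0" for f A ij
    using that(1)
  proof (induction rule: forms_space.span_induct_alt)
    case base
    show ?case by (simp add: nform_def)
  next
    case (step a x y)
    then show ?case
      using that(2)[of x] by (simp add: nform_add nform_smult)
  qed
  have I0: "nform n c f ij = 0" if "f \<in> I" "ij \<in> ?N" for f ij
    using that van_form_iff[of f d] by (auto simp: I_def)
  have ind: "forms_space.independent (B \<union> M ` N') \<and> card (B \<union> M ` N') = card B + card N'" if "finite N'" "N' \<subseteq> ?N" for N'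
    using that
  proof (induction N')
    case empty
    then show ?case
      using B by simp
  next
    case (insert ij N')
    have IH: "forms_space.independent (B \<union> M ` N')" "card (B \<union> M ` N') = card B + card N'"
      using insert.IH insert.prems by simp_all
    have nspan: "M ij \<notin> forms_space.span (B \<union> M ` N')"
    proof
      assume *: "M ij \<in> forms_space.span (B \<union> M ` N')"
      have ij: "ij \<in> ?N"
        using insert.prems by simp
      have "nform n c (M ij) ij = 0"
      proof (rule zero_span[OF *])
        fix g assume "g \<in> B \<union> M ` N'"
        then consider "g \<in> I" | kl where "kl \<in> N'" "g = M kl"
          using B(1) by blast
        then show "nform n c g ij = 0"
        proof cases
          case 1
          then show ?thesis
            using I0 ij by blast
        next
          case 2
          then show ?thesis
            using M(2)[of kl ij] insert.hyps(2) insert.prems by auto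
        qed
      qed
      then show False
        using M(2)[of ij ij] insert.prems by simp
    qed
    then have "M ij \<notin> B \<union> M ` N'"
      using forms_space.span_base[of "M ij" "B \<union> M ` N'"] by argo
    then have "card (insert (M ij) (B \<union> M ` N')) = Suc (card (B \<union> M ` N'))"
      using finB insert.hyps(1) by (intro card_insert_disjoint) simp_all
    then have "card (insert (M ij) (B \<union> M ` N')) = card B + card (insert ij N')"
      using insert.hyps IH(2) by simp
    moreover have "forms_space.independent (insert (M ij) (B \<union> M ` N'))"
      by (rule forms_space.independent_insertI[OF nspan IH(1)])
    moreover have "B \<union> M ` insert ij N' = insert (M ij) (B \<union> M ` N')"
      by simp
    ultimately show ?case
      by (simp only: simp_thms)
  qed
  have "f \<in> forms_space.span (B \<union> M ` ?N)" if f: "f \<in> ?V" for f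
  proof -
    define r where "r = (\<Sum>ij\<in>?N. const_poly (nform n c f ij) * M ij)"
    have rV: "r \<in> ?V"
      unfolding r_def using M(1) scale by (intro forms_sum) auto
    have "nform n c (\<Sum>ij\<in>A. const_poly (nform n c f ij) * M ij) kl = (if kl \<in> A then nform n c f kl else 0)"
      if "finite A" "A \<subseteq> ?N" for A kl
      using that
    proof (induction A)
      case (insert ij A)
      then show ?case
        using M(2)[of ij kl] by (auto simp: nform_add nform_smult)
    qed (simp add: nform_def)
    then have "nform n c r kl = nform n c f kl" if "kl \<in> ?N" for kl
      using that by (simp add: r_def)
    moreover have "nform n c f kl = nform n c (f - r) kl + nform n c r kl" for kl
      using nform_add[of n c "f - r" r kl] by simp
    ultimately have "f - r \<in> I"
      using van_form_iff[OF forms_diff[OF f rV]] forms_diff[OF f rV] by (simp add: I_def)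
    then have "f - r \<in> forms_space.span (B \<union> M ` ?N)"
      using B(3) forms_space.span_mono[of B "B \<union> M ` ?N"] by blast
    moreover have "r \<in> forms_space.span (B \<union> M ` ?N)"
      unfolding r_def by (intro forms_space.span_sum forms_space.span_scale forms_space.span_base) auto
    ultimately show ?thesis
      using forms_space.span_add[of "f - r" _ r] by simp
  qed
  then have "forms_space.dim ?V = card B + card ?N"
    using ind[of ?N] B(1) M(1) by (intro forms_space.dim_unique[of "B \<union> M ` ?N"]) (auto simp: I_def)
  moreover have "forms_space.dim I = card B"
    using B by (intro forms_space.dim_unique[of B]) auto
  ultimately show ?thesis
    by (simp add: hilbert_function_def I_def)
qed

lemma card_normal_exps:
  assumes "d \<ge> n"
  shows "card (normal_exps n d) = n * (d + 1) + 2 * (d + 1 - n)"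
proof -
  have "normal_exps n d = {..<n} \<times> {..d} \<union> {n..d} \<times> {..<2}"
    using assms n2 by (auto simp: normal_exps_def)
  moreover have "({..<n} \<times> {..d}) \<inter> ({n..d} \<times> {..<2}) = {}"
    by auto
  ultimately have "card (normal_exps n d) = card ({..<n} \<times> {..d}) + card ({n..d} \<times> {..<2::nat})"
    by (simp add: card_Un_disjoint)
  then show ?thesis
    using assms by (simp add: card_cartesian_product)
qed

lemma genus_Y: "genus Y = of_nat (n - 1)"
proof -
  \<comment> \<open>This is n (d + 1) + 2 (d + 1 - n) as a polynomial in d, valid for d \<ge> n; its
    value 2 - n at 0 gives the genus n - 1.\<close>
  define p :: "rat poly" where "p = [:2 - of_nat n, of_nat n + 2:]"
  have "hilbert_function Y d = n * (d + 1) + 2 * (d + 1 - n)" if "d \<ge> n" for d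
    using hilbert_function_Y card_normal_exps[OF that] by simp
  then have "of_nat (hilbert_function Y d) = poly p (of_nat d)" if "d \<ge> n" for d
    using that by (simp add: p_def of_nat_diff algebra_simps)
  then have ev: "\<forall>\<^sub>F d in sequentially. of_nat (hilbert_function Y d) = poly p (of_nat d)"
    unfolding eventually_sequentially by blast
  have "hilbert_poly Y = p"
    unfolding hilbert_poly_def
  proof (rule the_equality[where P = "\<lambda>P. \<forall>\<^sub>F m in sequentially. of_nat (hilbert_function Y m) = poly P (of_nat m)", OF ev])
    fix q assume "\<forall>\<^sub>F d in sequentially. of_nat (hilbert_function Y d) = poly q (of_nat d :: rat)"
    with ev have "\<forall>\<^sub>F d in sequentially. poly (p - q) (of_nat d) = 0"
      by eventually_elim simp
    then obtain N where N: "\<And>d. d \<ge> N \<Longrightarrow> poly (p - q) (of_nat d) = 0"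
      by (auto simp: eventually_sequentially)
    have "infinite (of_nat ` {N..} :: rat set)"
      by (simp add: finite_image_iff infinite_Ici inj_on_def)
    moreover have "of_nat ` {N..} \<subseteq> {x. poly (p - q) x = 0}"
      using N by auto
    ultimately have "p - q = 0"
      using poly_roots_finite finite_subset by blast
    then show "q = p"
      by simp
  qed
  then show ?thesis
    using n2 by (simp add: genus_def p_def of_nat_diff)
qed

end

section \<open>The function field\<close>

locale proj_variety =
  fixes C :: "'k::field proj_scheme"
  assumes variety: "projective_variety C"
begin

abbreviation I :: "'k mpoly set" where "I \<equiv> van C"
abbreviation n :: nat where "n \<equiv> amb C"

lemma I_poly_in: "f \<in> I \<Longrightarrow> f \<in> poly_in n"
  and I_0: "0 \<in> I"
  and I_add: "f \<in> I \<Longrightarrow> g \<in> I \<Longrightarrow> f + g \<in> I"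
  and I_mult: "f \<in> I \<Longrightarrow> g \<in> poly_in n \<Longrightarrow> g * f \<in> I"
  and I_1: "1 \<notin> I"
  and I_prime: "f \<in> poly_in n \<Longrightarrow> g \<in> poly_in n \<Longrightarrow> f * g \<in> I \<Longrightarrow> f \<in> I \<or> g \<in> I"
  and I_hom: "f \<in> I \<Longrightarrow> hom_component d f \<in> I"
  and I_var: "\<exists>i\<le>n. var_poly i \<notin> I"
  using variety unfolding projective_variety_def by blast+

lemma I_uminus: "f \<in> I \<Longrightarrow> - f \<in> I"
proof -
  assume f: "f \<in> I"
  have "(- 1 :: 'k mpoly) \<in> poly_in n"
    by (intro poly_in_uminus poly_in_1)
  then show ?thesis
    using I_mult[OF f, of "- 1"] by simp
qed

lemma fractionsE:
  assumes "(f, g) \<in> fractions C"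
  obtains d where "f \<in> forms n d" "g \<in> forms n d" "g \<notin> I" "f \<in> poly_in n" "g \<in> poly_in n"
  using assms forms_poly_in that unfolding fractions_def by blast

lemma fractionsI: "f \<in> forms n d \<Longrightarrow> g \<in> forms n d \<Longrightarrow> g \<notin> I \<Longrightarrow> (f, g) \<in> fractions C"
  by (auto simp: fractions_def)

lemma fractions_mult:
  assumes "(f, g) \<in> fractions C" "(f', g') \<in> fractions C"
  shows "(f * f', g * g') \<in> fractions C"
proof -
  obtain d where d: "f \<in> forms n d" "g \<in> forms n d" "g \<notin> I" "f \<in> poly_in n" "g \<in> poly_in n"
    by (rule fractionsE[OF assms(1)])
  obtain e where e: "f' \<in> forms n e" "g' \<in> forms n e" "g' \<notin> I" "f' \<in> poly_in n" "g' \<in> poly_in n"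
    by (rule fractionsE[OF assms(2)])
  show ?thesis
    by (rule fractionsI[OF forms_mult[OF d(1) e(1)] forms_mult[OF d(2) e(2)]]) (use I_prime d e in blast)
qed

lemma fractions_add:
  assumes "(f, g) \<in> fractions C" "(f', g') \<in> fractions C"
  shows "(f * g' + f' * g, g * g') \<in> fractions C"
proof -
  obtain d where d: "f \<in> forms n d" "g \<in> forms n d" "g \<notin> I" "f \<in> poly_in n" "g \<in> poly_in n"
    by (rule fractionsE[OF assms(1)])
  obtain e where e: "f' \<in> forms n e" "g' \<in> forms n e" "g' \<notin> I" "f' \<in> poly_in n" "g' \<in> poly_in n"
    by (rule fractionsE[OF assms(2)])
  have "f' * g \<in> forms n (d + e)"
    using forms_mult[OF e(1) d(2)] by (simp add: add.commute)
  then show ?thesis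
    by (intro fractionsI[OF forms_add[OF forms_mult[OF d(1) e(2)]] forms_mult[OF d(2) e(2)]])
      (use I_prime d e in blast)+
qed

text \<open>The ideal is prime, so the denominator g' can be cancelled.\<close>

lemma fraction_trans:
  assumes "(f, g) \<in> fractions C" "(f', g') \<in> fractions C" "(f'', g'') \<in> fractions C"
    and "f * g' - f' * g \<in> I" "f' * g'' - f'' * g' \<in> I"
  shows "f * g'' - f'' * g \<in> I"
proof -
  have p: "f \<in> poly_in n" "g \<in> poly_in n" "f' \<in> poly_in n" "g' \<in> poly_in n" "f'' \<in> poly_in n" "g'' \<in> poly_in n" "g' \<notin> I"
    using assms(1-3) by (auto elim!: fractionsE)
  have "g'' * (f * g' - f' * g) + g * (f' * g'' - f'' * g') \<in> I"
    using I_add[OF I_mult[OF assms(4) p(6)] I_mult[OF assms(5) p(2)]] .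
  moreover have "g'' * (f * g' - f' * g) + g * (f' * g'' - f'' * g') = g' * (f * g'' - f'' * g)"
    by (simp add: algebra_simps)
  moreover have "f * g'' - f'' * g \<in> poly_in n"
    using p by (intro poly_in_diff poly_in_mult)
  ultimately show ?thesis
    using I_prime[OF p(4), of "f * g'' - f'' * g"] p(7) by auto
qed

lemma fraction_sym: "f * g' - f' * g \<in> I \<Longrightarrow> f' * g - f * g' \<in> I"
  using I_uminus[of "f * g' - f' * g"] by simp

lemma fraction_mem: "(a, b) \<in> fraction C f g \<longleftrightarrow> (a, b) \<in> fractions C \<and> f * b - a * g \<in> I"
  by (simp add: fraction_def)

lemma fraction_self: "(f, g) \<in> fractions C \<Longrightarrow> (f, g) \<in> fraction C f g"
  by (simp add: fraction_mem I_0)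

lemma fraction_eq_iff:
  assumes "(f, g) \<in> fractions C" "(f', g') \<in> fractions C"
  shows "fraction C f g = fraction C f' g' \<longleftrightarrow> f * g' - f' * g \<in> I"
proof
  assume "fraction C f g = fraction C f' g'"
  then have "(f', g') \<in> fraction C f g"
    using fraction_self[OF assms(2)] by simp
  then show "f * g' - f' * g \<in> I"
    by (simp add: fraction_mem)
next
  assume *: "f * g' - f' * g \<in> I"
  show "fraction C f g = fraction C f' g'"
  proof (rule Set.set_eqI)
    fix ab :: "'k mpoly \<times> 'k mpoly"
    obtain a b where ab: "ab = (a, b)"
      by (cases ab)
    show "ab \<in> fraction C f g \<longleftrightarrow> ab \<in> fraction C f' g'"
      unfolding ab fraction_mem
      using fraction_trans[OF assms(2,1) _ fraction_sym[OF *], of a b] fraction_trans[OF assms _ *, of a b] by blast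
  qed
qed

lemma fraction_mult:
  assumes "(f, g) \<in> fractions C" "(f', g') \<in> fractions C"
  shows "monoid.mult (function_field C) (fraction C f g) (fraction C f' g') = fraction C (f * f') (g * g')"
proof -
  have "fraction C (a * a') (b * b') = fraction C (f * f') (g * g')"
    if ab: "(a, b) \<in> fraction C f g" "(a', b') \<in> fraction C f' g'" for a b a' b'
  proof -
    have m: "(a, b) \<in> fractions C" "(a', b') \<in> fractions C" "f * b - a * g \<in> I" "f' * b' - a' * g' \<in> I"
      using ab by (auto simp: fraction_mem)
    have p: "f' * b' \<in> poly_in n" "a * g \<in> poly_in n"
      using assms m(1,2) by (auto elim!: fractionsE intro: poly_in_mult)
    have "(f' * b') * (f * b - a * g) + (a * g) * (f' * b' - a' * g') \<in> I"
      by (intro I_add I_mult m p)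
    moreover have "(f' * b') * (f * b - a * g) + (a * g) * (f' * b' - a' * g') = (f * f') * (b * b') - (a * a') * (g * g')"
      by (simp add: algebra_simps)
    ultimately show ?thesis
      using fraction_eq_iff[OF fractions_mult[OF assms] fractions_mult[OF m(1,2)]] by simp
  qed
  then have "(\<Union>(a, b)\<in>fraction C f g. \<Union>(a', b')\<in>fraction C f' g'. fraction C (a * a') (b * b'))
      = fraction C (f * f') (g * g')"
    using fraction_self[OF assms(1)] fraction_self[OF assms(2)] by fast
  then show ?thesis
    by (simp add: function_field_def)
qed

lemma fraction_add:
  assumes "(f, g) \<in> fractions C" "(f', g') \<in> fractions C"
  shows "add (function_field C) (fraction C f g) (fraction C f' g') = fraction C (f * g' + f' * g) (g * g')"
proof -
  have "fraction C (a * b' + a' * b) (b * b') = fraction C (f * g' + f' * g) (g * g')"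
    if ab: "(a, b) \<in> fraction C f g" "(a', b') \<in> fraction C f' g'" for a b a' b'
  proof -
    have m: "(a, b) \<in> fractions C" "(a', b') \<in> fractions C" "f * b - a * g \<in> I" "f' * b' - a' * g' \<in> I"
      using ab by (auto simp: fraction_mem)
    have p: "g' * b' \<in> poly_in n" "g * b \<in> poly_in n"
      using assms m(1,2) by (auto elim!: fractionsE intro: poly_in_mult)
    have "(g' * b') * (f * b - a * g) + (g * b) * (f' * b' - a' * g') \<in> I"
      by (intro I_add I_mult m p)
    moreover have "(g' * b') * (f * b - a * g) + (g * b) * (f' * b' - a' * g')
        = (f * g' + f' * g) * (b * b') - (a * b' + a' * b) * (g * g')"
      by (simp add: algebra_simps)
    ultimately show ?thesis
      using fraction_eq_iff[OF fractions_add[OF assms] fractions_add[OF m(1,2)]] by simp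
  qed
  then have "(\<Union>(a, b)\<in>fraction C f g. \<Union>(a', b')\<in>fraction C f' g'. fraction C (a * b' + a' * b) (b * b'))
      = fraction C (f * g' + f' * g) (g * g')"
    using fraction_self[OF assms(1)] fraction_self[OF assms(2)] by fast
  then show ?thesis
    by (simp add: function_field_def)
qed

lemma function_field_simps:
  "carrier (function_field C) = {fraction C f g | f g. (f, g) \<in> fractions C}"
  "one (function_field C) = fraction C 1 1" "zero (function_field C) = fraction C 0 1"
  by (simp_all add: function_field_def)

lemma fractions_const: "(const_poly c, 1) \<in> fractions C"
  by (rule fractionsI[of _ 0]) (auto simp: I_1)

end

lemma const_poly_simps:
  "const_poly (a + b) = const_poly a + const_poly (b :: 'k::comm_ring_1)"
  "const_poly (a * b) = const_poly a * const_poly (b :: 'k::comm_ring_1)"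
  "const_poly (1 :: 'k::comm_ring_1) = 1" "const_poly (0 :: 'k::comm_ring_1) = 0"
  by (simp_all add: const_poly_def single_add mult_single)

text \<open>\<eta> is a generic point of C with coordinates in a field type. Evaluation there
  identifies the function field with a subfield \<open>K\<close> of the type, in which classes of
  fractions are plain quotients.\<close>

locale generic_point = proj_variety C for C :: "'k::field proj_scheme" +
  fixes \<phi> :: "'k \<Rightarrow> 'e::field" and \<eta> :: "nat \<Rightarrow> 'e"
  assumes hom: "coeff_hom \<phi>" and van_eq: "van C = vanishing_ideal \<phi> (amb C) \<eta>"
begin

abbreviation ev :: "'k mpoly \<Rightarrow> 'e" where "ev f \<equiv> peval \<phi> f \<eta>"

lemmas ev_simps = coeff_hom.peval_simps[OF hom]

lemma form_van: "f \<in> forms n d \<Longrightarrow> f \<in> I \<longleftrightarrow> ev f = 0"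
  unfolding van_eq by (rule vanishing_ideal_form[OF hom])

lemma fractions_iff: "(f, g) \<in> fractions C \<longleftrightarrow> (\<exists>d. f \<in> forms n d \<and> g \<in> forms n d) \<and> ev g \<noteq> 0"
  unfolding fractions_def using form_van by blast

lemma fraction_eq_ev:
  assumes "(f, g) \<in> fractions C" "(f', g') \<in> fractions C"
  shows "fraction C f g = fraction C f' g' \<longleftrightarrow> ev f / ev g = ev f' / ev g'"
proof -
  obtain d where d: "f \<in> forms n d" "g \<in> forms n d"
    using assms(1) by (auto simp: fractions_iff)
  obtain e where e: "f' \<in> forms n e" "g' \<in> forms n e"
    using assms(2) by (auto simp: fractions_iff)
  have "f * g' - f' * g \<in> forms n (d + e)"
    using forms_diff[OF forms_mult[OF d(1) e(2)], of "f' * g"] forms_mult[OF e(1) d(2)] by (simp add: add.commute)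
  then have "f * g' - f' * g \<in> I \<longleftrightarrow> ev f * ev g' - ev f' * ev g = 0"
    using form_van by (simp add: ev_simps)
  moreover have "ev g \<noteq> 0" "ev g' \<noteq> 0"
    using assms by (auto simp: fractions_iff)
  ultimately show ?thesis
    using fraction_eq_iff[OF assms] by (simp add: frac_eq_eq)
qed

definition val :: "'k ratfun \<Rightarrow> 'e" where
  "val a = (let (f, g) = (SOME fg. fg \<in> fractions C \<and> a = fraction C (fst fg) (snd fg)) in ev f / ev g)"

lemma val_fraction: "(f, g) \<in> fractions C \<Longrightarrow> val (fraction C f g) = ev f / ev g"
proof -
  assume fg: "(f, g) \<in> fractions C"
  define fg' where "fg' = (SOME fg'. fg' \<in> fractions C \<and> fraction C f g = fraction C (fst fg') (snd fg'))"
  have "fg' \<in> fractions C \<and> fraction C f g = fraction C (fst fg') (snd fg')"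
    unfolding fg'_def by (rule someI[of _ "(f, g)"]) (use fg in simp)
  then have "ev f / ev g = ev (fst fg') / ev (snd fg')"
    using fraction_eq_ev[OF fg, of "fst fg'" "snd fg'"] by simp
  then show ?thesis
    by (simp add: val_def fg'_def[symmetric] case_prod_beta)
qed

definition K :: "'e set" where
  "K = {ev f / ev g | f g. (f, g) \<in> fractions C}"

lemma K_I: "(f, g) \<in> fractions C \<Longrightarrow> ev f / ev g \<in> K"
  by (auto simp: K_def)

lemma KE:
  assumes "z \<in> K"
  obtains f g where "(f, g) \<in> fractions C" "z = ev f / ev g"
  using assms by (auto simp: K_def)

lemma val_image: "val ` carrier (function_field C) = K"
  unfolding function_field_simps K_def using val_fraction by force

lemma val_inj: "inj_on val (carrier (function_field C))"
proof (rule inj_onI)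
  fix a b assume "a \<in> carrier (function_field C)" "b \<in> carrier (function_field C)" and e: "val a = val b"
  then obtain f g f' g' where fg: "(f, g) \<in> fractions C" "(f', g') \<in> fractions C"
    "a = fraction C f g" "b = fraction C f' g'"
    unfolding function_field_simps by blast
  then show "a = b"
    using fraction_eq_ev[OF fg(1,2)] val_fraction[OF fg(1)] val_fraction[OF fg(2)] e by simp
qed

lemma val_const: "val (const_fun C c) = \<phi> c"
  unfolding const_fun_def using val_fraction[OF fractions_const] by (simp add: ev_simps)

lemma val_mult: "a \<in> carrier (function_field C) \<Longrightarrow> b \<in> carrier (function_field C) \<Longrightarrow>
  val (monoid.mult (function_field C) a b) = val a * val b"
  unfolding function_field_simps
  by (auto simp: fraction_mult val_fraction fractions_mult ev_simps)

lemma val_add: "a \<in> carrier (function_field C) \<Longrightarrow> b \<in> carrier (function_field C) \<Longrightarrow>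
  val (add (function_field C) a b) = val a + val b"
proof -
  assume "a \<in> carrier (function_field C)" "b \<in> carrier (function_field C)"
  then obtain f g f' g' where fg: "(f, g) \<in> fractions C" "(f', g') \<in> fractions C"
    "a = fraction C f g" "b = fraction C f' g'"
    unfolding function_field_simps by blast
  moreover have "ev g \<noteq> 0" "ev g' \<noteq> 0"
    using fg by (auto simp: fractions_iff)
  ultimately show ?thesis
    by (simp add: fraction_add val_fraction fractions_add ev_simps add_frac_eq)
qed

lemma val_one: "val (one (function_field C)) = 1"
  unfolding function_field_simps using val_fraction[OF fractions_const[of 1]]
  by (simp add: const_poly_simps ev_simps)

lemma val_zero: "val (zero (function_field C)) = 0"
  unfolding function_field_simps using val_fraction[OF fractions_const[of 0]]
  by (simp add: const_poly_simps ev_simps)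

lemma val_hom: "val \<in> ring_hom (function_field C) ring_of_type_algebra"
  by (rule ring_hom_memI) (auto simp: val_mult val_add val_one)

lemma is_subfield_K: "is_subfield K"
  unfolding is_subfield_def
proof (intro conjI ballI)
  show "1 \<in> K"
    using K_I[OF fractions_const[of 1]] by (simp add: const_poly_simps ev_simps)
next
  fix x y assume "x \<in> K" "y \<in> K"
  then obtain f g f' g' where fg: "(f, g) \<in> fractions C" "x = ev f / ev g" "(f', g') \<in> fractions C" "y = ev f' / ev g'"
    by (metis KE)
  then have nz: "ev g \<noteq> 0" "ev g' \<noteq> 0"
    by (auto simp: fractions_iff)
  have "(- f', g') \<in> fractions C"
    using fg(3) by (auto simp: fractions_iff intro: forms_uminus)
  then have "ev (f * g' + (- f') * g) / ev (g * g') \<in> K"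
    using K_I[OF fractions_add[OF fg(1)]] by blast
  moreover have "ev (f * g' + (- f') * g) / ev (g * g') = x - y"
    using fg nz by (simp add: ev_simps diff_frac_eq)
  ultimately show "x - y \<in> K"
    by simp
  show "x * y \<in> K"
    using K_I[OF fractions_mult[OF fg(1,3)]] fg by (simp add: ev_simps)
next
  fix x assume "x \<in> K"
  then obtain f g where fg: "(f, g) \<in> fractions C" "x = ev f / ev g"
    by (rule KE)
  show "inverse x \<in> K"
  proof (cases "ev f = 0")
    case True
    then show ?thesis
      using fg \<open>x \<in> K\<close> by simp
  next
    case False
    then have "(g, f) \<in> fractions C"
      using fg by (auto simp: fractions_iff)
    then show ?thesis
      using K_I[of g f] fg by simp
  qed
qed

lemma range_in_K: "range \<phi> \<subseteq> K"
  using K_I[OF fractions_const] by (auto simp: ev_simps)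

text \<open>The field axioms are transported back from the subfield \<open>K\<close> along the
  bijection \<open>val\<close>, so that they need not be verified on classes of fractions.\<close>

lemma field_function_field: "field (function_field C)"
  and val_iso: "val \<in> ring_iso (function_field C) (ring_of_type_algebra\<lparr>carrier := K\<rparr>)"
proof -
  interpret E: field "ring_of_type_algebra :: 'e ring" by (rule field_from_type_algebra)
  let ?R = "ring_of_type_algebra\<lparr>carrier := K\<rparr> :: 'e ring" and ?F = "function_field C"
  have sK: "subfield K (ring_of_type_algebra :: 'e ring)"
    using is_subfield_K by (simp add: is_subfield_iff)
  interpret R: field ?R
    using E.subfield_iff(2)[OF sK] .
  have cl: "monoid.mult ?F a b \<in> carrier ?F" "add ?F a b \<in> carrier ?F"
    if "a \<in> carrier ?F" "b \<in> carrier ?F" for a b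
  proof -
    from that obtain f g f' g' where fg: "(f, g) \<in> fractions C" "(f', g') \<in> fractions C"
      "a = fraction C f g" "b = fraction C f' g'"
      unfolding function_field_simps by blast
    show "monoid.mult ?F a b \<in> carrier ?F" "add ?F a b \<in> carrier ?F"
      unfolding fg(3,4) fraction_mult[OF fg(1,2)] fraction_add[OF fg(1,2)]
      using fractions_mult[OF fg(1,2)] fractions_add[OF fg(1,2)] by (auto simp: function_field_simps)
  qed
  have z: "zero ?F \<in> carrier ?F" "one ?F \<in> carrier ?F"
    using fractions_const[of 0] fractions_const[of 1] by (auto simp: const_poly_simps function_field_simps)
  show iso: "val \<in> ring_iso ?F ?R"
    unfolding ring_iso_def
  proof (intro CollectI conjI ring_hom_memI)
    show "bij_betw val (carrier ?F) (carrier ?R)"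
      by (simp add: bij_betw_def val_inj val_image)
    show "val a \<in> carrier ?R" if "a \<in> carrier ?F" for a
      using that val_image by auto
  qed (simp_all add: val_mult val_add val_one)
  define r where "r = inv_into (carrier ?F) val"
  have r: "r z \<in> carrier ?F" "val (r z) = z" if "z \<in> K" for z
    using that unfolding r_def val_image[symmetric] by (simp_all add: inv_into_into f_inv_into_f)
  have rv: "r (val a) = a" if "a \<in> carrier ?F" for a
    using val_inj that by (simp add: r_def)
  have r_eq: "r z = a" if "z \<in> K" "a \<in> carrier ?F" "val a = z" for z a
    using that rv by auto
  have cK: "x * y \<in> K" "x + y \<in> K" if "x \<in> K" "y \<in> K" for x y
    using that sf_mult[OF is_subfield_K] sf_add[OF is_subfield_K] by auto
  have "r \<in> ring_iso ?R ?F"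
    unfolding ring_iso_def
  proof (intro CollectI conjI ring_hom_memI)
    show "bij_betw r (carrier ?R) (carrier ?F)"
      unfolding r_def using bij_betw_inv_into[of val "carrier ?F" K] val_inj val_image by (simp add: bij_betw_def)
    show "r (one ?R) = one ?F"
      using r_eq[of 1 "one ?F"] z val_one sf_1[OF is_subfield_K] by simp
    fix x assume x: "x \<in> carrier ?R"
    then show "r x \<in> carrier ?F"
      using r by simp
    fix y assume y: "y \<in> carrier ?R"
    have "r (x * y) = monoid.mult ?F (r x) (r y)"
      by (rule r_eq) (use x y r[of x] r[of y] cK[of x y] cl[of "r x" "r y"] in \<open>simp_all add: val_mult\<close>)
    then show "r (monoid.mult ?R x y) = monoid.mult ?F (r x) (r y)"
      by simp
    have "r (x + y) = add ?F (r x) (r y)"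
      by (rule r_eq) (use x y r[of x] r[of y] cK[of x y] cl[of "r x" "r y"] in \<open>simp_all add: val_add\<close>)
    then show "r (add ?R x y) = add ?F (r x) (r y)"
      by simp
  qed
  from R.ring_iso_imp_img_field[OF this] show "field ?F"
    using r_eq[of 0 "zero ?F"] r_eq[of 1 "one ?F"] z val_zero val_one sf_0[OF is_subfield_K] sf_1[OF is_subfield_K] by simp
qed

lemma algebraic_iff:
  assumes M: "subfield M (function_field C)" and u: "u \<in> carrier (function_field C)"
  shows "is_subfield (val ` M)" and "ring.algebraic (function_field C) M u \<longleftrightarrow> alg_over (val ` M) (val u)"
proof -
  interpret E: field "ring_of_type_algebra :: 'e ring" by (rule field_from_type_algebra)
  interpret F: field "function_field C" by (rule field_function_field)
  let ?R = "ring_of_type_algebra\<lparr>carrier := K\<rparr> :: 'e ring"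
  have sK: "subfield K (ring_of_type_algebra :: 'e ring)"
    using is_subfield_K by (simp add: is_subfield_iff)
  interpret R: field ?R
    using E.subfield_iff(2)[OF sK] .
  interpret H: ring_hom_ring "function_field C" "ring_of_type_algebra :: 'e ring" val
    by (rule ring_hom_ringI2[OF F.is_ring E.is_ring val_hom])
  have "subfield (val ` M) ring_of_type_algebra"
    using H.img_is_subfield(2)[OF M] by simp
  then show sf: "is_subfield (val ` M)"
    by (simp add: is_subfield_iff)
  show "ring.algebraic (function_field C) M u \<longleftrightarrow> alg_over (val ` M) (val u)"
  proof
    assume "ring.algebraic (function_field C) M u"
    then have "(E.algebraic over (val ` M)) (val u)"
      using algebraic_hom[OF val_hom field_function_field E.field_axioms M u] by (simp add: over_def)
    then show "alg_over (val ` M) (val u)"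
      using algebraic_rota[OF sf] by (simp add: over_def)
  next
    assume "alg_over (val ` M) (val u)"
    then have "E.algebraic (val ` M) (val u)"
      using algebraic_rota[OF sf] by simp
    then have a: "ring.algebraic ?R (val ` M) (val u)"
      using fun_cong[OF fun_cong[OF E.algebraic_consistent[OF subfieldE(1)[OF sK]]], of "val ` M" "val u"] by simp
    define r where "r = inv_into (carrier (function_field C)) val"
    have r: "r \<in> ring_hom ?R (function_field C)"
      using ring_iso_set_sym[OF F.is_ring val_iso] unfolding r_def ring_iso_def by blast
    have ru: "r (val a) = a" if "a \<in> carrier (function_field C)" for a
      using val_inj that by (simp add: r_def)
    have MF: "M \<subseteq> carrier (function_field C)"
      using subfieldE(3)[OF M] .
    have "val ` M \<subseteq> K"
      using MF val_image by blast
    have "subfield (val ` M) ?R"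
    proof -
      interpret H': ring_hom_ring "function_field C" ?R val
        using val_iso by (intro ring_hom_ringI2[OF F.is_ring R.is_ring]) (simp add: ring_iso_def)
      show ?thesis
        using H'.img_is_subfield(2)[OF M] by simp
    qed
    moreover have "val u \<in> carrier ?R"
      using u val_image by auto
    ultimately have "(F.algebraic over (r ` val ` M)) (r (val u))"
      using algebraic_hom[OF r R.field_axioms field_function_field] a by (simp add: over_def)
    moreover have "r ` val ` M = M"
    proof -
      have "(\<lambda>a. r (val a)) ` M = (\<lambda>a. a) ` M"
        using ru MF by (intro image_cong refl) (simp add: subset_iff)
      then show ?thesis
        by (simp add: image_image)
    qed
    ultimately show "ring.algebraic (function_field C) M u"
      using ru[OF u] by (simp add: over_def)
  qed
qed

end

text \<open>The coordinates are the images of the variables divided by a fixed variable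
  \<open>x0\<close> outside the ideal. The image of a form of degree d over \<open>x0 ^ d\<close> is
  then the value of the form.\<close>

lemma (in proj_variety) generic_point_exists:
  fixes \<iota> :: "'k ratfun \<Rightarrow> 'e::field"
  assumes \<iota>: "\<iota> \<in> ring_hom (function_field C) ring_of_type_algebra"
  obtains \<eta> where "generic_point C (\<lambda>c. \<iota> (const_fun C c)) \<eta>"
    "\<And>a. a \<in> carrier (function_field C) \<Longrightarrow> \<iota> a = generic_point.val C (\<lambda>c. \<iota> (const_fun C c)) \<eta> a"
proof -
  let ?F = "function_field C"
  have cF: "fraction C f g \<in> carrier ?F" if "(f, g) \<in> fractions C" for f g
    using that by (auto simp: function_field_simps)
  have im: "\<iota> (fraction C (f * f') (g * g')) = \<iota> (fraction C f g) * \<iota> (fraction C f' g')"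
    if "(f, g) \<in> fractions C" "(f', g') \<in> fractions C" for f g f' g'
    using ring_hom_mult[OF \<iota> cF[OF that(1)] cF[OF that(2)]] fraction_mult[OF that] by simp
  have ia: "\<iota> (fraction C (f * g' + f' * g) (g * g')) = \<iota> (fraction C f g) + \<iota> (fraction C f' g')"
    if "(f, g) \<in> fractions C" "(f', g') \<in> fractions C" for f g f' g'
    using ring_hom_add[OF \<iota> cF[OF that(1)] cF[OF that(2)]] fraction_add[OF that] by simp
  have i1: "\<iota> (fraction C 1 1) = 1"
    using ring_hom_one[OF \<iota>] by (simp add: function_field_simps)
  define \<phi> where "\<phi> c = \<iota> (const_fun C c)" for c
  have hom: "coeff_hom \<phi>"
  proof
    show "\<phi> (a + b) = \<phi> a + \<phi> b" "\<phi> (a * b) = \<phi> a * \<phi> b" for a b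
      using ia[OF fractions_const fractions_const, of a b] im[OF fractions_const fractions_const, of a b]
      by (simp_all add: \<phi>_def const_fun_def const_poly_simps)
    show "\<phi> 1 = 1"
      using i1 by (simp add: \<phi>_def const_fun_def const_poly_simps)
  qed
  interpret \<phi>: coeff_hom \<phi> by (rule hom)
  have isame: "\<iota> (fraction C (f + f') g) = \<iota> (fraction C f g) + \<iota> (fraction C f' g)"
    if fg: "(f, g) \<in> fractions C" "(f', g) \<in> fractions C" "(f + f', g) \<in> fractions C" for f f' g
  proof -
    have e: "(f * g + f' * g) * g - (f + f') * (g * g) = 0"
      by (simp add: algebra_simps)
    have "fraction C (f * g + f' * g) (g * g) = fraction C (f + f') g"
      using fraction_eq_iff[OF fractions_add[OF fg(1,2)] fg(3)] unfolding e using I_0 by simp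
    then show ?thesis
      using ia[OF fg(1,2)] by simp
  qed
  \<comment> \<open>Seen on fractions, f/g times g/f being 1, without using that the function field
    is a field.\<close>
  have izero: "\<iota> (fraction C f g) = 0 \<longleftrightarrow> f \<in> I" if fg: "(f, g) \<in> fractions C" for f g
  proof
    assume f: "f \<in> I"
    have g: "(0, g) \<in> fractions C" "g \<in> poly_in n"
      using fg by (auto elim!: fractionsE intro: fractionsI)
    have "\<iota> (fraction C 0 g) = 0"
      using isame[OF g(1) g(1), unfolded add_0_left, OF g(1)] by (metis add_cancel_right_right)
    moreover have "fraction C f g = fraction C 0 g"
      using fraction_eq_iff[OF fg g(1)] I_mult[OF f g(2)] by (simp add: mult.commute)
    ultimately show "\<iota> (fraction C f g) = 0"
      by simp
  next
    assume z: "\<iota> (fraction C f g) = 0"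
    show "f \<in> I"
    proof (rule ccontr)
      assume "f \<notin> I"
      then have gf: "(g, f) \<in> fractions C" "(f, f) \<in> fractions C" "(g, g) \<in> fractions C"
        using fg by (auto elim!: fractionsE intro: fractionsI)
      have "fraction C (f * g) (g * f) = fraction C 1 1"
        using fraction_eq_iff[OF fractions_mult[OF fg gf(1)] fractions_const[of 1]] I_0
        by (simp add: const_poly_simps mult.commute)
      then show False
        using im[OF fg gf(1)] i1 z by simp
    qed
  qed
  obtain i0 where i0: "i0 \<le> n" "var_poly i0 \<notin> I"
    using I_var by blast
  define x0 where "x0 = (var_poly i0 :: 'k mpoly)"
  have x0: "x0 ^ d \<in> forms n d" "x0 ^ d \<notin> I" for d
  proof -
    show "x0 ^ d \<in> forms n d"
      using forms_power[OF forms_var[OF i0(1)], of d] by (simp add: x0_def)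
    show "x0 ^ d \<notin> I"
    proof (induction d)
      case (Suc d)
      then show ?case
        using I_prime[of x0 "x0 ^ d"] i0 poly_in_power[of x0 n d] by (auto simp: x0_def)
    qed (simp add: I_1)
  qed
  have fr: "(f, x0 ^ d) \<in> fractions C" if "f \<in> forms n d" for f d
    by (rule fractionsI[OF that x0])
  define \<eta> where "\<eta> i = \<iota> (fraction C (var_poly i) (x0 ^ 1))" for i
  have key: "\<iota> (fraction C (hom_component d f) (x0 ^ d)) = peval \<phi> (hom_component d f) \<eta>"
    if "f \<in> poly_in n" for f d
    using that
  proof (induction f arbitrary: d rule: mpoly_induct)
    case (const c)
    show ?case
    proof (cases "d = 0")
      case True
      then show ?thesis
        by (simp add: hom_component_form[OF forms_const[of c n]] \<phi>.peval_const)
          (simp add: \<phi>_def const_fun_def)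
    next
      case False
      then have "hom_component d (const_poly c :: 'k mpoly) = 0"
        by (simp add: hom_component_form[OF forms_const[of c n]])
      then show ?thesis
        using izero[OF fr[OF forms_0]] I_0 by (simp add: \<phi>.peval_0)
    qed
  next
    case (var i m c)
    let ?s = "Poly_Mapping.single m c" and ?e = "mdeg m"
    have s: "?s \<in> forms n ?e"
      by (rule forms_single[OF var.hyps(2) refl])
    have vs: "var_poly i * ?s \<in> forms n (1 + ?e)"
      by (rule forms_mult[OF forms_var[OF var.hyps(1)] s])
    show ?case
    proof (cases "d = 1 + ?e")
      case True
      have "\<iota> (fraction C (var_poly i * ?s) (x0 ^ 1 * x0 ^ ?e)) = \<eta> i * \<iota> (fraction C ?s (x0 ^ ?e))"
        unfolding \<eta>_def by (rule im[OF fr[OF forms_var[OF var.hyps(1)]] fr[OF s]])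
      moreover have "\<iota> (fraction C ?s (x0 ^ ?e)) = peval \<phi> ?s \<eta>"
        using var.IH[of ?e] by (simp add: hom_component_form[OF s])
      ultimately show ?thesis
        using True by (simp add: hom_component_form[OF vs] \<phi>.peval_mult \<phi>.peval_var)
    next
      case False
      then have "hom_component d (var_poly i * ?s) = 0"
        by (simp add: hom_component_form[OF vs])
      then show ?thesis
        using izero[OF fr[OF forms_0]] I_0 by (simp add: \<phi>.peval_0)
    qed
  next
    case (add p q)
    then show ?case
      using isame[OF fr[OF hom_component_forms] fr[OF hom_component_forms], of p q d]
        fr[OF forms_add[OF hom_component_forms hom_component_forms], of p q d]
      by (simp add: hom_component_add \<phi>.peval_add)
  qed
  have key': "\<iota> (fraction C f (x0 ^ d)) = peval \<phi> f \<eta>" if "f \<in> forms n d" for f d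
    using key[OF forms_poly_in[OF that], of d] by (simp add: hom_component_form[OF that])
  have hv: "f \<in> I \<longleftrightarrow> f \<in> poly_in n \<and> (\<forall>d. hom_component d f \<in> I)" for f
  proof
    assume "f \<in> I"
    then show "f \<in> poly_in n \<and> (\<forall>d. hom_component d f \<in> I)"
      using I_poly_in I_hom by blast
  next
    assume f: "f \<in> poly_in n \<and> (\<forall>d. hom_component d f \<in> I)"
    obtain N where N: "\<And>m. m \<in> Poly_Mapping.keys f \<Longrightarrow> mdeg m \<le> N"
      using mdeg_bounded[of f] by blast
    have "(\<Sum>d\<in>A. hom_component d f) \<in> I" for A :: "nat set"
      using f by (induction A rule: infinite_finite_induct) (auto intro: I_add I_0)
    from this[of "{..N}"] show "f \<in> I"
      using sum_hom_components[of f N] N by simp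
  qed
  have "generic_point C \<phi> \<eta>"
  proof
    show "van C = vanishing_ideal \<phi> n \<eta>"
    proof (rule Set.set_eqI)
      fix f
      have "hom_component d f \<in> I \<longleftrightarrow> peval \<phi> (hom_component d f) \<eta> = 0" if "f \<in> poly_in n" for d
        using izero[OF fr[OF hom_component_forms[OF that]]] key[OF that] by simp
      then show "f \<in> van C \<longleftrightarrow> f \<in> vanishing_ideal \<phi> n \<eta>"
        using hv[of f] by (auto simp: vanishing_ideal_def)
    qed
  qed
  then interpret G: generic_point C \<phi> \<eta> .
  have "\<iota> a = G.val a" if a: "a \<in> carrier ?F" for a
  proof -
    obtain f g where fg: "(f, g) \<in> fractions C" "a = fraction C f g"
      using a by (auto simp: function_field_simps)
    then obtain d where d: "f \<in> forms n d" "g \<in> forms n d" "g \<notin> I"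
      by (auto elim: fractionsE)
    have gx: "(g, x0 ^ d) \<in> fractions C" and fx: "(f, x0 ^ d) \<in> fractions C"
      using fr d by auto
    have e: "(f * g) * x0 ^ d - f * (g * x0 ^ d) = 0"
      by (simp add: mult.assoc)
    have "fraction C (f * g) (g * x0 ^ d) = fraction C f (x0 ^ d)"
      using fraction_eq_iff[OF fractions_mult[OF fg(1) gx] fx] unfolding e using I_0 by simp
    then have "\<iota> a * peval \<phi> g \<eta> = peval \<phi> f \<eta>"
      using im[OF fg(1) gx] key'[OF d(1)] key'[OF d(2)] fg(2) by simp
    moreover have "peval \<phi> g \<eta> \<noteq> 0"
      using fg(1) by (simp add: G.fractions_iff)
    ultimately have "\<iota> a = peval \<phi> f \<eta> / peval \<phi> g \<eta>"
      by (simp add: nonzero_eq_divide_eq)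
    then show ?thesis
      using G.val_fraction[OF fg(1)] fg(2) by simp
  qed
  then show ?thesis
    using that \<open>generic_point C \<phi> \<eta>\<close> unfolding \<phi>_def by blast
qed

section \<open>Transcendence degree one\<close>

lemma poly_altdef_le: "Polynomial.degree p \<le> N \<Longrightarrow> poly p x = (\<Sum>i\<le>N. coeff p i * x ^ i)"
  for x :: "'a::{comm_semiring_0, semiring_1}"
  unfolding poly_altdef by (intro sum.mono_neutral_left) (auto simp: coeff_eq_0)

section \<open>Algebraic dependence over k\<close>

locale field_extension_hom = coeff_hom \<phi> for \<phi> :: "'k::field \<Rightarrow> 'e::field"
begin

abbreviation kalg :: "'e \<Rightarrow> bool" where "kalg \<equiv> alg_over (range \<phi>)"

definition pev :: "'k poly \<Rightarrow> 'e \<Rightarrow> 'e" where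
  "pev p a = poly (map_poly \<phi> p) a"

lemma coeff_hom': "coeff_hom \<phi>"
  by (rule coeff_hom_axioms)

lemma kalg_iff: "kalg a \<longleftrightarrow> (\<exists>p. p \<noteq> 0 \<and> pev p a = 0)"
  unfolding pev_def by (rule alg_over_inj_range[OF coeff_hom'])

lemma pev_simps: "pev (p + q) a = pev p a + pev q a" "pev (p - q) a = pev p a - pev q a"
  "pev (p * q) a = pev p a * pev q a" "pev 0 a = 0" "pev 1 a = 1" "pev [:c:] a = \<phi> c" "pev [:0, 1:] a = a"
  by (simp_all add: pev_def map_poly_hom map_poly_pCons hom_zero hom_one)

lemma pev_sum: "Polynomial.degree p \<le> N \<Longrightarrow> pev p a = (\<Sum>i\<le>N. \<phi> (coeff p i) * a ^ i)"
proof -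
  assume N: "Polynomial.degree p \<le> N"
  have "Polynomial.degree (map_poly \<phi> p) \<le> N"
    by (rule degree_le) (use N in \<open>auto simp: coeff_map_poly hom_zero coeff_eq_0\<close>)
  then show ?thesis
    unfolding pev_def using poly_altdef_le[of "map_poly \<phi> p" N a] by (simp add: coeff_map_poly hom_zero)
qed

lemma pev_in: "is_subfield M \<Longrightarrow> range \<phi> \<subseteq> M \<Longrightarrow> a \<in> M \<Longrightarrow> pev p a \<in> M"
  unfolding pev_def by (intro poly_over_poly) (auto simp: poly_over_def coeff_map_poly hom_zero)

text \<open>The field k(a), whether a is algebraic or not.\<close>

definition gen :: "'e \<Rightarrow> 'e set" where
  "gen a = {pev p a / pev q a | p q. pev q a \<noteq> 0}"

lemma genI: "pev q a \<noteq> 0 \<Longrightarrow> pev p a / pev q a \<in> gen a"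
  by (auto simp: gen_def)

lemma gen_pev: "pev p a \<in> gen a"
  using genI[of 1 a p] by (simp add: pev_simps)

lemma gen_range: "range \<phi> \<subseteq> gen a"
  using gen_pev[of "[:_:]" a] by (auto simp: pev_simps)

lemma gen_const: "\<phi> c \<in> gen a"
  using gen_range by blast

lemma gen_self: "a \<in> gen a"
  using gen_pev[of "[:0, 1:]" a] by (simp add: pev_simps)

lemma is_subfield_gen: "is_subfield (gen a)"
  unfolding is_subfield_def
proof (intro conjI ballI)
  show "1 \<in> gen a"
    using gen_pev[of 1 a] by (simp add: pev_simps)
next
  fix x y assume "x \<in> gen a" "y \<in> gen a"
  then obtain p q p' q' where pq: "x = pev p a / pev q a" "pev q a \<noteq> 0" "y = pev p' a / pev q' a" "pev q' a \<noteq> 0"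
    by (auto simp: gen_def)
  have "x - y = pev (p * q' - p' * q) a / pev (q * q') a" "x * y = pev (p * p') a / pev (q * q') a"
    using pq by (simp_all add: pev_simps diff_frac_eq)
  moreover have "pev (q * q') a \<noteq> 0"
    using pq by (simp add: pev_simps)
  ultimately show "x - y \<in> gen a" "x * y \<in> gen a"
    using genI by auto
next
  fix x assume "x \<in> gen a"
  then obtain p q where pq: "x = pev p a / pev q a" "pev q a \<noteq> 0"
    by (auto simp: gen_def)
  show "inverse x \<in> gen a"
  proof (cases "pev p a = 0")
    case True
    then show ?thesis
      using pq gen_pev[of 0 a] by (simp add: pev_simps)
  next
    case False
    then show ?thesis
      using pq genI[of p a q] by simp
  qed
qed

lemma gen_minimal: "is_subfield M \<Longrightarrow> range \<phi> \<subseteq> M \<Longrightarrow> a \<in> M \<Longrightarrow> gen a \<subseteq> M"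
  by (auto simp: gen_def intro!: sf_divide pev_in)

text \<open>Algebraic dependence of two elements, in a form that is symmetric in them.\<close>

definition dep :: "'e \<Rightarrow> 'e \<Rightarrow> bool" where
  "dep a b \<longleftrightarrow> (\<exists>N c. (\<exists>i\<le>N. \<exists>j\<le>N. c i j \<noteq> 0) \<and> (\<Sum>i\<le>N. \<Sum>j\<le>N. \<phi> (c i j) * a ^ i * b ^ j) = 0)"

lemma dep_sym: "dep a b \<Longrightarrow> dep b a"
proof -
  assume "dep a b"
  then obtain N and c :: "nat \<Rightarrow> nat \<Rightarrow> 'k" and i j where c: "i \<le> N" "j \<le> N" "c i j \<noteq> 0"
    "(\<Sum>i\<le>N. \<Sum>j\<le>N. \<phi> (c i j) * a ^ i * b ^ j) = 0"
    by (auto simp: dep_def)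
  have "(\<Sum>j\<le>N. \<Sum>i\<le>N. \<phi> (c i j) * b ^ j * a ^ i) = 0"
    using c(4) by (subst sum.swap) (simp add: mult_ac)
  then show "dep b a"
    unfolding dep_def using c(1-3) by (intro exI[of _ N] exI[of _ "\<lambda>i j. c j i"]) auto
qed

lemma common_denominator:
  fixes m :: nat and x :: "nat \<Rightarrow> 'e"
  assumes "\<And>j. j < m \<Longrightarrow> x j \<in> gen a"
  shows "\<exists>D p. pev D a \<noteq> 0 \<and> (\<forall>j<m. pev D a * x j = pev (p j) a)"
  using assms
proof (induction m)
  case 0
  show ?case
    by (intro exI[of _ 1]) (simp add: pev_simps)
next
  case (Suc m)
  then obtain D p where D: "pev D a \<noteq> 0" "\<forall>j<m. pev D a * x j = pev (p j) a"
    by (meson less_SucI)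
  obtain u v where uv: "x m = pev u a / pev v a" "pev v a \<noteq> 0"
    using Suc.prems[of m] by (auto simp: gen_def)
  show ?case
  proof (intro exI[of _ "D * v"] exI[of _ "\<lambda>j. if j = m then u * D else p j * v"] conjI allI impI)
    show "pev (D * v) a \<noteq> 0"
      using D uv by (simp add: pev_simps)
    fix j assume "j < Suc m"
    then show "pev (D * v) a * x j = pev (if j = m then u * D else p j * v) a"
      using D(2) uv by (cases "j = m") (auto simp: pev_simps mult_ac)
  qed
qed

text \<open>A relation is sorted by powers of b: the coefficients are polynomials in a, not all zero
  because a is transcendental. Conversely, coefficients in k(a) are given a common
  denominator.\<close>

lemma dep_iff:
  assumes a: "\<not> kalg a"
  shows "dep a b \<longleftrightarrow> alg_over (gen a) b"
proof
  assume "dep a b"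
  then obtain N and c :: "nat \<Rightarrow> nat \<Rightarrow> 'k" and i0 j0 where c: "i0 \<le> N" "j0 \<le> N" "c i0 j0 \<noteq> 0"
    "(\<Sum>i\<le>N. \<Sum>j\<le>N. \<phi> (c i j) * a ^ i * b ^ j) = 0"
    by (auto simp: dep_def)
  define p where "p j = (\<Sum>i\<le>N. monom (c i j) i)" for j
  have cp: "coeff (p j) i = (if i \<le> N then c i j else 0)" for i j
    by (simp add: p_def coeff_sum)
  have dp: "Polynomial.degree (p j) \<le> N" for j
    by (rule degree_le) (simp add: cp)
  have ep: "pev (p j) a = (\<Sum>i\<le>N. \<phi> (c i j) * a ^ i)" for j
    using pev_sum[OF dp, of j a] by (simp add: cp)
  define q where "q = (\<Sum>j\<le>N. monom (pev (p j) a) j)"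
  have cq: "coeff q j = (if j \<le> N then pev (p j) a else 0)" for j
    by (simp add: q_def coeff_sum)
  have "coeff (p j0) i0 \<noteq> 0"
    using c by (simp add: cp)
  then have "p j0 \<noteq> 0"
    by auto
  then have "coeff q j0 \<noteq> 0"
    using a c(2) kalg_iff by (auto simp: cq)
  then have "q \<noteq> 0"
    by auto
  moreover have "poly_over (gen a) q"
    using sf_0[OF is_subfield_gen] gen_pev by (simp add: poly_over_def cq)
  moreover have "poly q b = (\<Sum>j\<le>N. \<Sum>i\<le>N. \<phi> (c i j) * a ^ i * b ^ j)"
    by (simp add: q_def poly_sum poly_monom ep sum_distrib_right)
  then have "poly q b = 0"
    using c(4) by (subst (asm) sum.swap) simp
  ultimately show "alg_over (gen a) b"
    by (auto simp: alg_over_def)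
next
  assume "alg_over (gen a) b"
  then obtain q where q: "q \<noteq> 0" "poly_over (gen a) q" "poly q b = 0"
    by (auto simp: alg_over_def)
  define m where "m = Polynomial.degree q"
  obtain D p where D: "pev D a \<noteq> 0" "\<And>j. j < Suc m \<Longrightarrow> pev D a * coeff q j = pev (p j) a"
    using common_denominator[of "Suc m" "coeff q" a] q(2) by (auto simp: poly_over_def)
  define N where "N = m + (\<Sum>j\<le>m. Polynomial.degree (p j))"
  have N: "m \<le> N" "\<And>j. j \<le> m \<Longrightarrow> Polynomial.degree (p j) \<le> N"
    using member_le_sum[of _ "{..m}" "\<lambda>j. Polynomial.degree (p j)"] by (auto simp: N_def intro: trans_le_add2)
  define c where "c i j = (if j \<le> m then coeff (p j) i else 0)" for i j
  have "pev (p m) a \<noteq> 0"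
    using D(1) D(2)[of m] q(1) by (simp add: m_def flip: D(2))
  then have "p m \<noteq> 0"
    by (auto simp: pev_simps)
  then have "c (Polynomial.degree (p m)) m \<noteq> 0"
    by (simp add: c_def)
  moreover have "(\<Sum>i\<le>N. \<Sum>j\<le>N. \<phi> (c i j) * a ^ i * b ^ j) = 0"
  proof -
    have "(\<Sum>i\<le>N. \<Sum>j\<le>N. \<phi> (c i j) * a ^ i * b ^ j) = (\<Sum>j\<le>N. (\<Sum>i\<le>N. \<phi> (c i j) * a ^ i) * b ^ j)"
      by (subst sum.swap) (simp add: sum_distrib_right)
    also have "\<dots> = (\<Sum>j\<le>N. pev D a * (coeff q j * b ^ j))"
    proof (intro sum.cong refl)
      fix j
      show "(\<Sum>i\<le>N. \<phi> (c i j) * a ^ i) * b ^ j = pev D a * (coeff q j * b ^ j)"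
      proof (cases "j \<le> m")
        case True
        then have "(\<Sum>i\<le>N. \<phi> (c i j) * a ^ i) = pev D a * coeff q j"
          using D(2)[of j] pev_sum[OF N(2)[OF True], of a] by (simp add: c_def)
        then show ?thesis
          by simp
      next
        case False
        then show ?thesis
          by (simp add: c_def hom_zero m_def coeff_eq_0)
      qed
    qed
    also have "\<dots> = pev D a * poly q b"
      using N(1) by (simp add: poly_altdef_le[of q N] m_def sum_distrib_left)
    finally show ?thesis
      using q by simp
  qed
  ultimately show "dep a b"
    unfolding dep_def using N by (intro exI[of _ N] exI[of _ c]) blast
qed

text \<open>Steinitz exchange: by the symmetry of \<open>dep\<close>, t is algebraic over k(u), and
  so is everything algebraic over k(t).\<close>

lemma exchange:
  assumes t: "\<not> kalg t" and u: "\<not> kalg u" "alg_over (gen t) u" and x: "alg_over (gen t) x"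
  shows "alg_over (gen u) x"
proof -
  have "alg_over (gen u) t"
    using dep_iff[OF t] dep_iff[OF u(1)] u(2) dep_sym by blast
  moreover have "range \<phi> \<subseteq> {x. alg_over (gen u) x}"
    using gen_range alg_over_self[OF is_subfield_gen] by blast
  ultimately have "gen t \<subseteq> {x. alg_over (gen u) x}"
    by (intro gen_minimal is_subfield_algebraic is_subfield_gen) simp_all
  then show ?thesis
    using alg_over_trans[OF is_subfield_gen _ x, of u] by blast
qed

lemma peval_in_subfield:
  assumes "is_subfield M" "range \<phi> \<subseteq> M" "f \<in> poly_in n" "\<And>i. i \<le> n \<Longrightarrow> v i \<in> M"
  shows "peval \<phi> f v \<in> M"
  using assms(3)
proof (induction f rule: mpoly_induct)
  case (const c)
  then show ?case
    using assms(2) by (auto simp: peval_const)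
next
  case (var i m c)
  then show ?case
    using assms by (simp add: peval_mult peval_var sf_mult)
next
  case (add p q)
  then show ?case
    using assms by (simp add: peval_add sf_add)
qed

end

context generic_point
begin

sublocale field_extension_hom \<phi>
  using hom by (rule field_extension_hom.intro)

lemma subfield_of_val:
  assumes M: "M \<subseteq> carrier (function_field C)" and sf: "is_subfield (val ` M)"
  shows "subfield M (function_field C)"
proof -
  interpret F: field "function_field C" by (rule field_function_field)
  have mem: "x \<in> M \<longleftrightarrow> val x \<in> val ` M" if "x \<in> carrier (function_field C)" for x
    using inj_on_image_mem_iff[OF val_inj that M] by simp
  have neg: "val (a_inv (function_field C) x) = - val x" if "x \<in> carrier (function_field C)" for x
  proof -
    have "val (add (function_field C) (a_inv (function_field C) x) x) = 0"
      using that F.l_neg[of x] val_zero by simp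
    then show ?thesis
      using val_add[of "a_inv (function_field C) x" x] that by (simp add: eq_neg_iff_add_eq_0)
  qed
  have inv: "val (m_inv (function_field C) x) = inverse (val x)"
    if "x \<in> carrier (function_field C)" "x \<noteq> zero (function_field C)" for x
  proof -
    have u: "x \<in> Units (function_field C)"
      using that by (simp add: F.field_Units)
    have "val (monoid.mult (function_field C) x (m_inv (function_field C) x)) = 1"
      using F.Units_r_inv[OF u] val_one by simp
    then have "val x * val (m_inv (function_field C) x) = 1"
      using val_mult[OF that(1) F.Units_inv_closed[OF u]] by simp
    then show ?thesis
      by (simp add: inverse_unique)
  qed
  show ?thesis
  proof (rule F.subfieldI')
    show "subring M (function_field C)"
    proof (rule F.subringI)
      show "M \<subseteq> carrier (function_field C)"
        by (rule M)
      show "one (function_field C) \<in> M"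
        using mem[OF F.one_closed] val_one sf_1[OF sf] by simp
      show "a_inv (function_field C) h \<in> M" if "h \<in> M" for h
      proof -
        have hc: "h \<in> carrier (function_field C)"
          using that M by blast
        show ?thesis
          using mem[OF F.a_inv_closed[OF hc]] neg[OF hc] sf_uminus[OF sf, of "val h"] that by simp
      qed
      fix a b assume ab: "a \<in> M" "b \<in> M"
      then have c: "a \<in> carrier (function_field C)" "b \<in> carrier (function_field C)"
        using M by blast+
      show "monoid.mult (function_field C) a b \<in> M"
        using mem[OF F.m_closed[OF c]] val_mult[OF c] sf_mult[OF sf, of "val a" "val b"] ab by simp
      show "add (function_field C) a b \<in> M"
        using mem[OF F.a_closed[OF c]] val_add[OF c] sf_add[OF sf, of "val a" "val b"] ab by simp
    qed
    fix k assume k: "k \<in> M - {zero (function_field C)}"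
    then have kc: "k \<in> carrier (function_field C)" "k \<noteq> zero (function_field C)"
      using M by blast+
    then have "m_inv (function_field C) k \<in> carrier (function_field C)"
      by (intro F.Units_inv_closed) (simp add: F.field_Units)
    then show "m_inv (function_field C) k \<in> M"
      using mem inv[OF kc] sf_inverse[OF sf, of "val k"] k by simp
  qed
qed

lemma val_range_const: "val ` range (const_fun C) = range \<phi>"
  by (simp add: image_image val_const)

lemma range_const_carrier: "range (const_fun C) \<subseteq> carrier (function_field C)"
  using fractions_const by (auto simp: const_fun_def function_field_simps)

text \<open>Both fields are least among the subfields with the given generators; each inclusion uses
  minimality on one side of \<open>val\<close>.\<close>

lemma val_generate:
  assumes t: "t \<in> carrier (function_field C)"
  shows "val ` generate_field (function_field C) (insert t (range (const_fun C))) = gen (val t)"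
    and "subfield (generate_field (function_field C) (insert t (range (const_fun C)))) (function_field C)"
proof -
  interpret F: field "function_field C" by (rule field_function_field)
  let ?S = "insert t (range (const_fun C))"
  let ?G = "generate_field (function_field C) ?S"
  have S: "?S \<subseteq> carrier (function_field C)"
    using t range_const_carrier by simp
  show sG: "subfield ?G (function_field C)"
    by (rule F.generate_field_is_subfield[OF S])
  have SG: "?S \<subseteq> ?G"
    by (auto intro: generate_field.incl)
  have "range \<phi> \<subseteq> val ` ?G"
    using SG by (auto simp flip: val_const)
  then have 1: "gen (val t) \<subseteq> val ` ?G"
    using SG t by (intro gen_minimal algebraic_iff(1)[OF sG t]) auto
  define M where "M = {x \<in> carrier (function_field C). val x \<in> gen (val t)}"
  have "gen (val t) \<subseteq> K"
    using t val_image range_in_K by (intro gen_minimal is_subfield_K) auto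
  then have "val ` M = gen (val t)"
    unfolding M_def val_image[symmetric] by auto
  then have "subfield M (function_field C)"
    using is_subfield_gen by (intro subfield_of_val) (auto simp: M_def)
  moreover have "?S \<subseteq> M"
    using t range_const_carrier by (auto simp: M_def val_const gen_self gen_const)
  ultimately have "?G \<subseteq> M"
    using F.generate_field_min_subfield1[OF S] by blast
  then show "val ` ?G = gen (val t)"
    using 1 \<open>val ` M = gen (val t)\<close> by blast
qed

lemma one_dimensional_iff:
  "one_dimensional C \<longleftrightarrow> (\<exists>t\<in>K. \<not> kalg t \<and> (\<forall>u\<in>K. alg_over (gen t) u))"
proof -
  have sk: "subfield (range (const_fun C)) (function_field C)"
    by (rule subfield_of_val[OF range_const_carrier])
      (simp add: val_range_const is_subfield_range[OF hom])
  have 1: "ring.algebraic (function_field C) (range (const_fun C)) t \<longleftrightarrow> kalg (val t)"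
    if "t \<in> carrier (function_field C)" for t
    using algebraic_iff(2)[OF sk that] by (simp add: val_range_const)
  have 2: "ring.algebraic (function_field C) (generate_field (function_field C) (insert t (range (const_fun C)))) u
      \<longleftrightarrow> alg_over (gen (val t)) (val u)" if "t \<in> carrier (function_field C)" "u \<in> carrier (function_field C)" for t u
    using algebraic_iff(2)[OF val_generate(2)[OF that(1)] that(2)] val_generate(1)[OF that(1)] by simp
  have "one_dimensional C \<longleftrightarrow> (\<exists>t\<in>carrier (function_field C). \<not> kalg (val t) \<and>
      (\<forall>u\<in>carrier (function_field C). alg_over (gen (val t)) (val u)))"
    unfolding one_dimensional_def Let_def using 1 2 by (metis (no_types, lifting))
  then show ?thesis
    unfolding val_image[symmetric] by simp
qed

end

context bidegree_curve
begin

sublocale Y: generic_point Y \<phi> "segre 1 t w 1"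
proof
  show "projective_variety Y"
    by (rule projective_variety_Y)
qed (use hom in \<open>simp_all add: van_Y coeff_hom_def\<close>)

lemma t_in_K: "t \<in> Y.K" and w_in_K: "w \<in> Y.K"
proof -
  have 1: "(var_poly i, var_poly 0) \<in> fractions Y" if "i \<le> 3" for i
    unfolding Y.fractions_iff amb_Y
    using forms_var[of i 3] forms_var[of 0 3] that by (intro conjI exI[of _ 1]) (simp_all add: Y.ev_simps segre_def)
  show "t \<in> Y.K"
    using Y.K_I[OF 1[of 2]] by (simp add: Y.ev_simps segre_def)
  show "w \<in> Y.K"
    using Y.K_I[OF 1[of 1]] by (simp add: Y.ev_simps segre_def)
qed

lemma t_trans: "\<not> Y.kalg t"
  using trans Y.kalg_iff by (auto simp: Y.pev_def)

lemma t_power: "t ^ n - 1 \<noteq> 0"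
proof
  assume "t ^ n - 1 = 0"
  moreover have "map_poly \<phi> (monom 1 n - 1) = monom 1 n - 1"
    using coeff_hom.map_poly_hom[OF hom] coeff_hom.hom_zero[OF hom] coeff_hom.hom_one[OF hom]
    by (simp add: map_poly_monom)
  ultimately have "poly (map_poly \<phi> (monom 1 n - 1)) t = 0"
    by (simp add: poly_monom)
  then have "monom 1 n - 1 = (0 :: 'k poly)"
    by (rule trans)
  then have "coeff (monom 1 n - 1 :: 'k poly) n = 0"
    by simp
  then show False
    using n0 by (simp add: coeff_1)
qed

lemma K_algebraic: "u \<in> Y.K \<Longrightarrow> alg_over (Y.gen t) u"
proof -
  assume u: "u \<in> Y.K"
  let ?A = "{x. alg_over (Y.gen t) x}"
  have sA: "is_subfield ?A"
    by (rule is_subfield_algebraic[OF Y.is_subfield_gen])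
  have gA: "Y.gen t \<subseteq> ?A"
    using alg_over_self[OF Y.is_subfield_gen] by blast
  have tn: "t ^ n - 1 \<in> Y.gen t" "- (\<phi> c * (t ^ n + 1)) \<in> Y.gen t"
    using Y.gen_self[of t] Y.gen_range[of t] by (auto intro!: sf_intros[OF Y.is_subfield_gen])
  have "alg_over (Y.gen t) w"
    unfolding alg_over_def
  proof (intro exI[of _ "[:- (\<phi> c * (t ^ n + 1)), 0, t ^ n - 1:]"] conjI)
    show "poly_over (Y.gen t) [:- (\<phi> c * (t ^ n + 1)), 0, t ^ n - 1:]"
      using tn sf_0[OF Y.is_subfield_gen] by (simp add: poly_over_pCons[OF Y.is_subfield_gen] poly_over_0[OF Y.is_subfield_gen])
    show "poly [:- (\<phi> c * (t ^ n + 1)), 0, t ^ n - 1:] w = 0"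
      using w_eq by (simp add: power2_eq_square algebra_simps)
  qed (use t_power in simp)
  then have "segre 1 t w 1 i \<in> ?A" for i
    using gA Y.gen_self[of t] sf_1[OF sA] sf_0[OF sA] sf_mult[OF sA, of t w] by (auto simp: segre_def)
  then have e: "Y.ev f \<in> ?A" if "f \<in> poly_in 3" for f
    using Y.peval_in_subfield[OF sA _ that] gA Y.gen_range[of t] by blast
  from u obtain f g where "(f, g) \<in> fractions Y" "u = Y.ev f / Y.ev g"
    by (rule Y.KE)
  then show ?thesis
    using e[of f] e[of g] sf_divide[OF sA, of "Y.ev f" "Y.ev g"] forms_poly_in by (auto simp: Y.fractions_iff)
qed

theorem smooth_projective_curve_Y: "smooth_projective_curve Y"
  unfolding smooth_projective_curve_def
  using projective_variety_Y smooth_Y geometrically_connected_Y Y.one_dimensional_iff t_in_K t_trans K_algebraic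
  by blast

end

section \<open>Valuation rings\<close>

text \<open>The valuation is one of the whole field type, and \<open>V_total\<close> needs no
  exception since \<open>inverse 0 = 0\<close>. The trivial case V = UNIV is allowed.\<close>

locale valring =
  fixes V :: "'e::field set"
  assumes V_1: "1 \<in> V" and V_diff: "x \<in> V \<Longrightarrow> y \<in> V \<Longrightarrow> x - y \<in> V"
    and V_mult: "x \<in> V \<Longrightarrow> y \<in> V \<Longrightarrow> x * y \<in> V" and V_total: "x \<in> V \<or> inverse x \<in> V"
begin

lemma V_0: "0 \<in> V"
  using V_diff[OF V_1 V_1] by simp

lemma V_uminus: "x \<in> V \<Longrightarrow> - x \<in> V"
  using V_diff[OF V_0] by simp

lemma V_add: "x \<in> V \<Longrightarrow> y \<in> V \<Longrightarrow> x + y \<in> V"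
  using V_diff[of x "- y"] V_uminus by simp

lemma V_sum: "(\<And>i. i \<in> A \<Longrightarrow> f i \<in> V) \<Longrightarrow> sum f A \<in> V"
  by (induction A rule: infinite_finite_induct) (auto simp: V_0 V_add)

lemma V_power: "x \<in> V \<Longrightarrow> x ^ k \<in> V"
  by (induction k) (auto simp: V_1 V_mult)

definition \<mm> :: "'e set" where
  "\<mm> = {x \<in> V. x = 0 \<or> inverse x \<notin> V}"

lemma m_V: "x \<in> \<mm> \<Longrightarrow> x \<in> V"
  by (simp add: \<mm>_def)

lemma m_0: "0 \<in> \<mm>"
  by (simp add: \<mm>_def V_0)

lemma m_1: "1 \<notin> \<mm>"
  by (simp add: \<mm>_def V_1)

lemma unit: "x \<in> V \<Longrightarrow> x \<notin> \<mm> \<Longrightarrow> x \<noteq> 0 \<and> inverse x \<in> V"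
  by (auto simp: \<mm>_def)

lemma not_V: "x \<notin> V \<Longrightarrow> inverse x \<in> \<mm>"
  using V_total[of x] by (auto simp: \<mm>_def)

lemma m_mult: "x \<in> V \<Longrightarrow> y \<in> \<mm> \<Longrightarrow> x * y \<in> \<mm>"
proof -
  assume x: "x \<in> V" and y: "y \<in> \<mm>"
  have "x * y \<in> V"
    using x y by (simp add: V_mult m_V)
  moreover have "x * y = 0 \<or> inverse (x * y) \<notin> V"
  proof (rule ccontr)
    assume "\<not> ?thesis"
    then have nz: "x * y \<noteq> 0" and iV: "x * inverse (x * y) \<in> V"
      using x by (auto intro: V_mult)
    have "x * inverse (x * y) = inverse y"
      using nz by (simp add: field_simps)
    then have "inverse y \<in> V"
      using iV by metis
    then show False
      using y nz by (auto simp: \<mm>_def)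
  qed
  ultimately show ?thesis
    by (simp add: \<mm>_def)
qed

lemma m_uminus: "x \<in> \<mm> \<Longrightarrow> - x \<in> \<mm>"
  using m_mult[of "- 1" x] V_uminus[OF V_1] by simp

lemma m_add: "x \<in> \<mm> \<Longrightarrow> y \<in> \<mm> \<Longrightarrow> x + y \<in> \<mm>"
proof -
  have *: "x + y \<in> \<mm>" if "x \<in> \<mm>" "y \<in> \<mm>" "x / y \<in> V" "y \<noteq> 0" for x y
  proof -
    have "(x / y + 1) * y \<in> \<mm>"
      using that by (intro m_mult V_add V_1)
    then show ?thesis
      using that(4) by (simp add: distrib_right)
  qed
  assume xy: "x \<in> \<mm>" "y \<in> \<mm>"
  show ?thesis
  proof (cases "x = 0 \<or> y = 0")
    case True
    then show ?thesis
      using xy by auto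
  next
    case False
    then show ?thesis
      using *[OF xy] *[OF xy(2,1)] V_total[of "x / y"] by (auto simp: add.commute)
  qed
qed

lemma m_diff: "x \<in> \<mm> \<Longrightarrow> y \<in> \<mm> \<Longrightarrow> x - y \<in> \<mm>"
  using m_add[of x "- y"] m_uminus by simp

lemma m_prime: "x \<in> V \<Longrightarrow> y \<in> V \<Longrightarrow> x * y \<in> \<mm> \<Longrightarrow> x \<in> \<mm> \<or> y \<in> \<mm>"
proof (rule ccontr)
  assume a: "x \<in> V" "y \<in> V" "x * y \<in> \<mm>" "\<not> (x \<in> \<mm> \<or> y \<in> \<mm>)"
  then have xy: "inverse x * (x * y) \<in> \<mm>" "x \<noteq> 0"
    using unit m_mult by blast+
  have "inverse x * (x * y) = y"
    using xy(2) by (simp flip: mult.assoc)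
  then show False
    using a xy by metis
qed

lemma m_power: "x \<in> \<mm> \<Longrightarrow> x ^ Suc k \<in> \<mm>"
  using m_mult[OF V_power[OF m_V], of x x k] by (simp add: mult.commute)

lemma m_inverse: "x \<in> \<mm> \<Longrightarrow> x \<noteq> 0 \<Longrightarrow> inverse x \<notin> V"
  by (simp add: \<mm>_def)

lemma m_unit_diff: "x \<in> V \<Longrightarrow> x \<notin> \<mm> \<Longrightarrow> y \<in> \<mm> \<Longrightarrow> x + y \<notin> \<mm>"
  using m_diff[of "x + y" y] by auto

end

section \<open>Valuation rings that contain k\<close>

locale place = field_extension_hom \<phi> + valring V for \<phi> :: "'k::field \<Rightarrow> 'e::field" and V :: "'e set" +
  assumes k_V: "\<phi> c \<in> V"
begin

lemma k_m: "\<phi> c \<in> \<mm> \<longleftrightarrow> c = 0"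
proof
  assume m: "\<phi> c \<in> \<mm>"
  show "c = 0"
  proof (rule ccontr)
    assume "c \<noteq> 0"
    then have "\<phi> (inverse c) * \<phi> c = 1"
      by (simp flip: hom_mult add: hom_one)
    then show False
      using m_mult[OF k_V m, of "inverse c"] m_1 by simp
  qed
qed (simp add: hom_zero m_0)

lemma pev_V: "x \<in> V \<Longrightarrow> pev p x \<in> V"
proof -
  assume x: "x \<in> V"
  have "pev p x = (\<Sum>i\<le>Polynomial.degree p. \<phi> (coeff p i) * x ^ i)"
    by (rule pev_sum) simp
  then show ?thesis
    using x k_V by (auto intro!: V_sum V_mult V_power)
qed

lemma pev_pCons: "pev (pCons a p) x = \<phi> a + x * pev p x"
  by (simp add: pev_def map_poly_pCons hom_zero)

text \<open>p(x) is a power of x times the value of a polynomial with nonzero constant term, and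
  that value is a unit. So V behaves on k[x] like the order at x = 0.\<close>

lemma pev_order:
  assumes x: "x \<in> \<mm>" "x \<noteq> 0" and "p \<noteq> 0"
  shows "pev p x \<noteq> 0 \<and> (\<exists>e. x ^ e / pev p x \<in> V)"
  using assms(3)
proof (induction p)
  case (pCons a p)
  show ?case
  proof (cases "a = 0")
    case True
    then have p: "pev (pCons a p) x = x * pev p x" "p \<noteq> 0"
      using pCons.prems by (auto simp: pev_pCons hom_zero)
    then obtain e where e: "pev p x \<noteq> 0" "x ^ e / pev p x \<in> V"
      using pCons.IH by blast
    then have "x ^ Suc e / pev (pCons a p) x \<in> V"
      using x p by simp
    moreover have "pev (pCons a p) x \<noteq> 0"
      using p e x by simp
    ultimately show ?thesis
      by blast
  next
    case False
    have "x * pev p x \<in> \<mm>"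
      using m_mult[OF pev_V[OF m_V[OF x(1)]] x(1), of p] by (simp add: mult.commute)
    then have "pev (pCons a p) x \<notin> \<mm>"
      unfolding pev_pCons using False k_m k_V m_unit_diff by blast
    then have "pev (pCons a p) x \<noteq> 0 \<and> inverse (pev (pCons a p) x) \<in> V"
      by (intro unit pev_V m_V x)
    then show ?thesis
      by (metis divide_inverse mult_1 power_0)
  qed
qed simp

lemma kalg_m: "kalg x \<Longrightarrow> x \<in> \<mm> \<Longrightarrow> x = 0"
  using pev_order kalg_iff by blast

lemma kalg_V: "kalg x \<Longrightarrow> x \<in> V"
proof (rule ccontr)
  assume x: "kalg x" "x \<notin> V"
  have "is_subfield {x. kalg x}"
    by (rule is_subfield_algebraic[OF is_subfield_range[OF coeff_hom']])
  then have "kalg (inverse x)"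
    using sf_inverse x(1) by blast
  then have "inverse x = 0"
    using kalg_m not_V[OF x(2)] by blast
  then show False
    using x V_0 by simp
qed

text \<open>Denominators are cleared in the minimal equation of y over k(\<pi>). Its constant term,
  a nonzero polynomial in \<pi>, is y times an element of V, hence divisible by all powers of \<pi>,
  against \<open>pev_order\<close>. This takes the place of discreteness, which a nontrivial V in an
  algebraically closed field does not have.\<close>

lemma not_infinitely_divisible:
  assumes \<pi>: "\<pi> \<in> \<mm>" "\<pi> \<noteq> 0" and y: "y \<noteq> 0" "\<And>k. y / \<pi> ^ k \<in> V"
  shows "\<not> alg_over (gen \<pi>) y"
proof
  assume "alg_over (gen \<pi>) y"
  then obtain q where q: "poly_over (gen \<pi>) q" "q \<noteq> 0" "poly q y = 0"
    and min: "\<And>q'. poly_over (gen \<pi>) q' \<Longrightarrow> q' \<noteq> 0 \<Longrightarrow> poly q' y = 0 \<Longrightarrow> Polynomial.degree q \<le> Polynomial.degree q'"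
    using minimal_polynomial by blast
  obtain r q' where qc: "q = pCons r q'"
    by (cases q)
  have r0: "r \<noteq> 0"
  proof
    assume "r = 0"
    then have "poly_over (gen \<pi>) q'" "q' \<noteq> 0" "poly q' y = 0"
      using q y qc by (auto simp: poly_over_pCons[OF is_subfield_gen])
    then show False
      using min[of q'] qc by simp
  qed
  obtain D p where D: "pev D \<pi> \<noteq> 0" "\<And>j. j < Suc (Polynomial.degree q) \<Longrightarrow> pev D \<pi> * coeff q j = pev (p j) \<pi>"
    using common_denominator[of "Suc (Polynomial.degree q)" "coeff q" \<pi>] q(1) by (auto simp: poly_over_def)
  have cV: "pev D \<pi> * coeff q j \<in> V" for j
    using D(2)[of j] pev_V[OF m_V[OF \<pi>(1)]] V_0 by (cases "j < Suc (Polynomial.degree q)") (auto simp: coeff_eq_0)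
  have yV: "y \<in> V"
    using y(2)[of 0] by simp
  have "pev D \<pi> * poly q' y \<in> V"
  proof -
    have "pev D \<pi> * poly q' y = (\<Sum>i\<le>Polynomial.degree q'. (pev D \<pi> * coeff q (Suc i)) * y ^ i)"
      by (simp add: poly_altdef sum_distrib_left qc mult.assoc)
    moreover have "(\<Sum>i\<le>Polynomial.degree q'. (pev D \<pi> * coeff q (Suc i)) * y ^ i) \<in> V"
      by (intro V_sum V_mult[OF cV V_power[OF yV]])
    ultimately show ?thesis
      by metis
  qed
  moreover have "pev D \<pi> * r = - (y * (pev D \<pi> * poly q' y))"
  proof -
    have "r = - (y * poly q' y)"
      using q(3) qc by (simp add: eq_neg_iff_add_eq_0)
    then show ?thesis
      by simp
  qed
  moreover have "p 0 \<noteq> 0" "pev D \<pi> * r = pev (p 0) \<pi>"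
    using D r0 D(2)[of 0] qc by (auto simp: pev_simps)
  then obtain e where e: "pev (p 0) \<pi> \<noteq> 0" "\<pi> ^ e / pev (p 0) \<pi> \<in> V"
    using pev_order[OF \<pi>] by blast
  define s where "s = pev D \<pi> * poly q' y"
  have "pev (p 0) \<pi> = - (y * s)"
    using calculation(2) \<open>pev D \<pi> * r = pev (p 0) \<pi>\<close> by (simp add: s_def)
  then have s: "y \<noteq> 0" "s \<noteq> 0" "\<pi> ^ e / (y * s) \<in> V"
    using e V_uminus[OF e(2)] by auto
  have sV: "s \<in> V"
    unfolding s_def by fact
  have "(y / \<pi> ^ Suc e * s) * (\<pi> ^ e / (y * s)) \<in> V"
    by (rule V_mult[OF V_mult[OF y(2) sV] s(3)])
  moreover have "(y / \<pi> ^ Suc e * s) * (\<pi> ^ e / (y * s)) = inverse \<pi>"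
    using s(1,2) \<pi>(2) by (simp add: field_simps)
  ultimately show False
    using m_inverse[OF \<pi>] by simp
qed

text \<open>R is a local ring with maximal ideal R \<inter> \<mm>. One generator y_s at a time is
  eliminated: its own coefficient c_s lies in \<mm>, so 1 - c_s is invertible in R and the equation
  can be solved for y_s.\<close>

lemma nakayama:
  fixes y :: "nat \<Rightarrow> 'e"
  assumes R: "R \<subseteq> V" "1 \<in> R" "\<And>a b. a \<in> R \<Longrightarrow> b \<in> R \<Longrightarrow> a - b \<in> R" "\<And>a b. a \<in> R \<Longrightarrow> b \<in> R \<Longrightarrow> a * b \<in> R"
      "\<And>a. a \<in> R \<Longrightarrow> a \<notin> \<mm> \<Longrightarrow> inverse a \<in> R"
    and "finite S" and y: "\<And>i. i \<in> S \<Longrightarrow> \<exists>p\<in>R. \<exists>c. (\<forall>l\<in>S. c l \<in> R \<inter> \<mm>) \<and> y i = p * \<pi> + (\<Sum>l\<in>S. c l * y l)"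
  shows "\<forall>i\<in>S. \<exists>p\<in>R. y i = p * \<pi>"
  using assms(6,7)
proof (induction S)
  case (insert s S)
  have R0: "0 \<in> R"
    using R(3)[OF R(2) R(2)] by simp
  have Radd: "a + b \<in> R" if "a \<in> R" "b \<in> R" for a b
    using R(3)[OF that(1) R(3)[OF R0 that(2)]] by simp
  obtain p c where pc: "p \<in> R" "\<And>l. l \<in> insert s S \<Longrightarrow> c l \<in> R \<inter> \<mm>" "y s = p * \<pi> + (\<Sum>l\<in>insert s S. c l * y l)"
    using insert.prems[of s] by auto
  define u where "u = inverse (1 - c s)"
  have "1 - c s \<notin> \<mm>"
    using m_add[of "1 - c s" "c s"] m_1 pc(2)[of s] by auto
  moreover have "1 - c s \<in> R"
    using R(2,3) pc(2)[of s] by auto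
  ultimately have u: "u \<in> R" "1 - c s \<noteq> 0"
    using R(1,5) unit m_0 by (auto simp: u_def)
  have "(1 - c s) * y s = p * \<pi> + (\<Sum>l\<in>S. c l * y l)"
    using pc(3) insert.hyps by (simp add: algebra_simps)
  then have ys: "y s = u * (p * \<pi> + (\<Sum>l\<in>S. c l * y l))"
    using u(2) by (simp add: u_def field_simps)
  have IH: "\<forall>i\<in>S. \<exists>p\<in>R. y i = p * \<pi>"
  proof (rule insert.IH)
    fix i assume i: "i \<in> S"
    obtain p' d where pd: "p' \<in> R" "\<And>l. l \<in> insert s S \<Longrightarrow> d l \<in> R \<inter> \<mm>" "y i = p' * \<pi> + (\<Sum>l\<in>insert s S. d l * y l)"
      using insert.prems[of i] i by auto
    have "y i = p' * \<pi> + d s * y s + (\<Sum>l\<in>S. d l * y l)"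
      using pd(3) insert.hyps by simp
    also have "\<dots> = (p' + d s * u * p) * \<pi> + (\<Sum>l\<in>S. (d l + d s * u * c l) * y l)"
      by (simp add: ys algebra_simps sum.distrib sum_distrib_left)
    finally have "y i = (p' + d s * u * p) * \<pi> + (\<Sum>l\<in>S. (d l + d s * u * c l) * y l)" .
    moreover have "p' + d s * u * p \<in> R"
      using pd u pc R by (auto intro!: Radd)
    moreover have "d l + d s * u * c l \<in> R \<inter> \<mm>" if "l \<in> S" for l
    proof -
      have "d s * u \<in> R" "d s * u \<in> V"
        using pd(2)[of s] u R(1,4) by auto
      then show ?thesis
        using pd(2)[of l] pc(2)[of l] that R(4) by (auto intro!: Radd m_add m_mult)
    qed
    ultimately show "\<exists>p\<in>R. \<exists>c. (\<forall>l\<in>S. c l \<in> R \<inter> \<mm>) \<and> y i = p * \<pi> + (\<Sum>l\<in>S. c l * y l)"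
      by (intro bexI[of _ "p' + d s * u * p"] exI[of _ "\<lambda>l. d l + d s * u * c l"]) auto
  qed
  then obtain q where q: "\<And>i. i \<in> S \<Longrightarrow> q i \<in> R \<and> y i = q i * \<pi>"
    by metis
  have "(\<Sum>l\<in>S. c l * y l) = (\<Sum>l\<in>S. c l * q l) * \<pi>"
    using q by (simp add: sum_distrib_right mult.assoc)
  then have "y s = u * (p + (\<Sum>l\<in>S. c l * q l)) * \<pi>"
    by (simp add: ys algebra_simps)
  moreover have "(\<Sum>l\<in>A. c l * q l) \<in> R" if "A \<subseteq> S" for A
    using that q pc(2) R(4) R0 by (induction A rule: infinite_finite_induct) (auto intro!: Radd)
  then have "u * (p + (\<Sum>l\<in>S. c l * q l)) \<in> R"
    using u pc(1) R(4) Radd by blast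
  ultimately show ?case
    using IH by auto
qed simp

end

section \<open>Rational linear combinations\<close>

lemma sum_fun_apply: "(\<Sum>i\<in>A. f i) x = (\<Sum>i\<in>A. f i x)"
  for f :: "'i \<Rightarrow> 'a \<Rightarrow> 'b::comm_monoid_add"
  by (induction A rule: infinite_finite_induct) simp_all

text \<open>A k-linear map l from the algebraic closure to k with l(1) = 1 is applied to the
  coefficients; it leaves entries in k alone.\<close>

lemma rational_combination:
  fixes T :: "(nat \<Rightarrow> 'k::field) set" and z :: "nat \<Rightarrow> 'k"
  assumes "(\<lambda>j. to_ac (z j)) = (\<Sum>g\<in>T. (\<lambda>j. \<kappa> g * to_ac (g j)))"
  shows "\<exists>\<mu>. z = (\<Sum>g\<in>T. (\<lambda>j. \<mu> g * g j))"
proof -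
  interpret vk: vector_space "\<lambda>(c :: 'k) x. to_ac c * x"
    by unfold_locales (auto simp: algebra_simps)
  interpret vk1: vector_space "(*) :: 'k \<Rightarrow> 'k \<Rightarrow> 'k"
    by unfold_locales (auto simp: algebra_simps)
  interpret vp: vector_space_pair "\<lambda>(c :: 'k) x. to_ac c * x" "(*) :: 'k \<Rightarrow> 'k \<Rightarrow> 'k" ..
  have "vk.independent {1}"
    by (simp add: vk.dependent_single)
  then obtain l where l: "Vector_Spaces.linear (\<lambda>(c :: 'k) x. to_ac c * x) (*) l" "l 1 = (1 :: 'k)"
    using vp.linear_independent_extend[of "{1}" "\<lambda>_. 1"] by auto
  interpret l: Vector_Spaces.linear "\<lambda>(c :: 'k) x. to_ac c * x" "(*)" l
    by (rule l(1))
  have lc: "l (to_ac c * x) = c * l x" for c x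
    using l.scale[of c x] by simp
  have "z j = (\<Sum>g\<in>T. l (\<kappa> g) * g j)" for j
  proof -
    have "to_ac (z j) = (\<Sum>g\<in>T. \<kappa> g * to_ac (g j))"
      using fun_cong[OF assms, of j] by (simp add: sum_fun_apply)
    then have "l (to_ac (z j) * 1) = (\<Sum>g\<in>T. l (to_ac (g j) * \<kappa> g))"
      by (simp add: l.sum mult.commute)
    then show ?thesis
      unfolding lc l(2) by (simp add: mult.commute)
  qed
  then have "z = (\<Sum>g\<in>T. (\<lambda>j. l (\<kappa> g) * g j))"
    by (simp add: fun_eq_iff sum_fun_apply)
  then show ?thesis
    by (intro exI[of _ "\<lambda>g. l (\<kappa> g)"])
qed

section \<open>The local ring at the center of a valuation\<close>

text \<open>The gradients span dimension n - 1 and are orthogonal to a, which \<open>e j0\<close> is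
  not; together they span dimension n, and one more unit vector completes them to n + 1. The
  dimension is taken over the algebraic closure, as in the Jacobian criterion, and the combinations
  obtained are brought down to k.\<close>

lemma exists_parameter:
  fixes T :: "(nat \<Rightarrow> 'k::field) set" and a :: "nat \<Rightarrow> 'k"
  defines "lift \<equiv> \<lambda>(g :: nat \<Rightarrow> 'k) j. to_ac (g j)"
  defines "e \<equiv> \<lambda>i j :: nat. if j = i then (1::'k) else 0"
  assumes dim: "vector_space.dim (\<lambda>(c :: 'k alg_closure) w. (\<lambda>j :: nat. c * w j)) (lift ` T) + 1 = n"
    and supp: "\<And>g j. g \<in> T \<Longrightarrow> j > n \<Longrightarrow> g j = 0"
    and orth: "\<And>g. g \<in> T \<Longrightarrow> (\<Sum>j\<le>n. a j * g j) = 0" and a: "a j0 = 1" "j0 \<le> n"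
  shows "\<exists>j1\<le>n. \<forall>i\<le>n. \<exists>T' \<mu>. finite T' \<and> T' \<subseteq> insert (e j1) (insert (e j0) T) \<and> e i = (\<Sum>g\<in>T'. (\<lambda>j. \<mu> g * g j))"
proof -
  interpret vs: vector_space "\<lambda>(c :: 'k alg_closure) w. (\<lambda>j :: nat. c * w j)"
    by unfold_locales (auto simp: fun_eq_iff algebra_simps)
  interpret ac: coeff_hom "to_ac :: 'k \<Rightarrow> _"
    by (rule coeff_hom_to_ac)
  have inj: "inj lift"
    using field_hom_inj[OF coeff_hom_to_ac] by (auto simp: inj_def lift_def fun_eq_iff)
  define E where "E = lift ` e ` {..n}"
  have "finite E" and cardE: "card E \<le> n + 1"
    unfolding E_def using card_image_le[of "{..n}" "\<lambda>i. lift (e i)"] by (simp_all add: image_image)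
  have spanE: "lift g \<in> vs.span E" if "\<And>j. j > n \<Longrightarrow> g j = 0" for g
  proof -
    have "lift g = (\<Sum>i\<le>n. (\<lambda>j. to_ac (g i) * lift (e i) j))"
    proof
      fix j
      have "(\<Sum>i\<le>n. to_ac (g i) * lift (e i) j) = (\<Sum>i\<le>n. if i = j then to_ac (g j) else 0)"
        by (intro sum.cong refl) (simp add: lift_def e_def)
      then show "lift g j = (\<Sum>i\<le>n. (\<lambda>j. to_ac (g i) * lift (e i) j)) j"
        using that[of j] by (simp add: sum_fun_apply lift_def)
    qed
    moreover have "(\<Sum>i\<le>n. (\<lambda>j. to_ac (g i) * lift (e i) j)) \<in> vs.span E"
      by (intro vs.span_sum vs.span_scale vs.span_base) (auto simp: E_def)
    ultimately show ?thesis
      by metis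
  qed
  obtain B where B: "B \<subseteq> lift ` T" "vs.independent B" "lift ` T \<subseteq> vs.span B"
    by (rule vs.maximal_independent_subset[of "lift ` T"])
  have "B \<subseteq> vs.span E"
    using B(1) spanE supp by blast
  then have finB: "finite B"
    using vs.independent_span_bound[OF \<open>finite E\<close> B(2)] by simp
  have "vs.dim (lift ` T) = card B"
    by (rule vs.dim_unique[OF B(1,3,2) refl])
  then have cB: "card B + 1 = n"
    using dim by simp
  define L where "L w = (\<Sum>j\<le>n. to_ac (a j) * w j)" for w
  have L0: "L w = 0" if "w \<in> vs.span B" for w
    using that
  proof (induction rule: vs.span_induct_alt)
    case base
    then show ?case
      by (simp add: L_def)
  next
    case (step c x y)
    then obtain g where g: "g \<in> T" "x = lift g"
      using B(1) by blast
    have "L x = to_ac (\<Sum>j\<le>n. a j * g j)"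
      by (simp add: L_def g lift_def ac.hom_sum)
    moreover have "L (\<lambda>j. c * x j + y j) = c * L x + L y"
      by (simp add: L_def algebra_simps sum.distrib sum_distrib_left)
    ultimately show ?case
      using orth[OF g(1)] step by (simp add: plus_fun_def)
  qed
  have "L (lift (e j0)) = (\<Sum>j\<le>n. if j = j0 then 1 else 0)"
    unfolding L_def using a by (intro sum.cong refl) (simp add: lift_def e_def)
  then have "L (lift (e j0)) \<noteq> 0"
    using a by simp
  then have j0: "lift (e j0) \<notin> vs.span B"
    using L0 by blast
  define B0 where "B0 = insert (lift (e j0)) B"
  have B0: "vs.independent B0" "card B0 = n" "finite B0"
  proof -
    show "vs.independent B0"
      unfolding B0_def by (rule vs.independent_insertI[OF j0 B(2)])
    have "lift (e j0) \<notin> B"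
      using j0 vs.span_base by blast
    then show "card B0 = n" "finite B0"
      using cB finB by (simp_all add: B0_def)
  qed
  have eE: "lift (e i) \<in> E" if "i \<le> n" for i
    using that by (simp add: E_def)
  have B0E: "B0 \<subseteq> vs.span E"
    using \<open>B \<subseteq> vs.span E\<close> eE[OF a(2)] vs.span_base by (auto simp: B0_def)
  obtain j1 where j1: "j1 \<le> n" "\<And>i. i \<le> n \<Longrightarrow> lift (e i) \<in> vs.span (insert (lift (e j1)) B0)"
  proof (cases "\<forall>i\<le>n. lift (e i) \<in> vs.span B0")
    case True
    then show ?thesis
      using that[of j0] a vs.span_mono[of B0 "insert (lift (e j0)) B0"] by blast
  next
    case False
    then obtain j1 where j1: "j1 \<le> n" "lift (e j1) \<notin> vs.span B0"
      by blast
    let ?B1 = "insert (lift (e j1)) B0"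
    have "lift (e j1) \<notin> B0"
      using j1(2) vs.span_base by blast
    then have B1: "vs.independent ?B1" "card ?B1 = n + 1" "finite ?B1"
      using vs.independent_insertI[OF j1(2) B0(1)] B0(2,3) by simp_all
    have "lift (e i) \<in> vs.span ?B1" if "i \<le> n" for i
    proof (rule ccontr)
      assume *: "lift (e i) \<notin> vs.span ?B1"
      then have "lift (e i) \<notin> ?B1"
        using vs.span_base by blast
      then have "card (insert (lift (e i)) ?B1) = n + 2"
        using B1 by (subst card_insert_disjoint) simp_all
      moreover have "insert (lift (e i)) ?B1 \<subseteq> vs.span E"
        using B0E eE[OF that] eE[OF j1(1)] vs.span_base by auto
      ultimately show False
        using vs.independent_span_bound[OF \<open>finite E\<close> vs.independent_insertI[OF * B1(1)]] cardE by simp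
    qed
    then show ?thesis
      using that j1(1) by blast
  qed
  let ?T = "insert (e j1) (insert (e j0) T)"
  have sub: "insert (lift (e j1)) B0 \<subseteq> lift ` ?T"
    using B(1) by (auto simp: B0_def)
  have "\<exists>T' \<mu>. finite T' \<and> T' \<subseteq> ?T \<and> e i = (\<Sum>g\<in>T'. (\<lambda>j. \<mu> g * g j))" if i: "i \<le> n" for i
  proof -
    have "lift (e i) \<in> vs.span (lift ` ?T)"
      using j1(2)[OF i] vs.span_mono[OF sub] by blast
    then obtain t r where t: "finite t" "t \<subseteq> lift ` ?T" "lift (e i) = (\<Sum>x\<in>t. (\<lambda>j. r x * x j))"
      unfolding vs.span_explicit by blast
    then obtain T' where T': "T' \<subseteq> ?T" "finite T'" "t = lift ` T'"
      by (meson finite_subset_image)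
    have "lift (e i) = (\<Sum>g\<in>T'. (\<lambda>j. r (lift g) * lift g j))"
      using t(3) unfolding T'(3) by (subst (asm) sum.reindex) (use inj in \<open>auto intro: inj_on_subset\<close>)
    then have "(\<lambda>j. to_ac (e i j)) = (\<Sum>g\<in>T'. (\<lambda>j. r (lift g) * to_ac (g j)))"
      by (simp add: lift_def)
    from rational_combination[where \<kappa> = "\<lambda>g. r (lift g)", OF this] show ?thesis
      using T' by blast
  qed
  then show ?thesis
    using j1(1) by blast
qed

text \<open>V is centered at the rational point with coordinates a in the affine chart
  \<open>j0\<close>, where \<open>\<eta> j0\<close> has the least valuation of all coordinates.
  \<open>dependent\<close> expresses transcendence degree one, and \<open>VK\<close> that V is not
  trivial on \<open>K\<close>.\<close>

locale centered = generic_point C \<phi> \<eta> + place \<phi> V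
  for C :: "'k::field_char_0 proj_scheme" and \<phi> :: "'k \<Rightarrow> 'e::field" and \<eta> V +
  fixes j0 :: nat and a :: "nat \<Rightarrow> 'k"
  assumes smooth: "smooth_curve C" and j0: "j0 \<le> n" "\<eta> j0 \<noteq> 0"
    and integral: "i \<le> n \<Longrightarrow> \<eta> i / \<eta> j0 \<in> V"
    and center: "i \<le> n \<Longrightarrow> \<eta> i / \<eta> j0 - \<phi> (a i) \<in> \<mm>"
    and a_j0: "a j0 = 1" and a_0: "i > n \<Longrightarrow> a i = 0"
    and dependent: "x \<in> K \<Longrightarrow> u \<in> K \<Longrightarrow> \<not> kalg u \<Longrightarrow> alg_over (gen u) x"
    and VK: "\<not> K \<subseteq> V"
begin

definition \<theta> :: "nat \<Rightarrow> 'e" where "\<theta> i = \<eta> i / \<eta> j0"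
text \<open>Local coordinates at the center; \<open>\<theta>\<close> is the vector of affine
  coordinates of the generic point.\<close>

definition y :: "nat \<Rightarrow> 'e" where "y i = \<theta> i - \<phi> (a i)"

abbreviation pth :: "'k mpoly \<Rightarrow> 'e" where "pth f \<equiv> peval \<phi> f \<theta>"
abbreviation pa :: "'k mpoly \<Rightarrow> 'k" where "pa f \<equiv> peval (\<lambda>c. c) f a"

lemmas pa_simps = coeff_hom.peval_simps[OF coeff_hom_id]

lemma theta_j0: "\<theta> j0 = 1"
  using j0 by (simp add: \<theta>_def)

lemma y_m: "i \<le> n \<Longrightarrow> y i \<in> \<mm>"
  using center by (simp add: y_def \<theta>_def)

lemma y_j0: "y j0 = 0"
  by (simp add: y_def theta_j0 a_j0 hom_one)

lemma theta_V: "i \<le> n \<Longrightarrow> \<theta> i \<in> V"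
  using integral by (simp add: \<theta>_def)

lemma pth_V: "f \<in> poly_in n \<Longrightarrow> pth f \<in> V"
proof (induction f rule: mpoly_induct)
  case (const c)
  then show ?case by (simp add: peval_const k_V)
next
  case (var i m c)
  then show ?case
    using V_mult[OF theta_V[OF var.hyps(1)] var.IH] by (simp add: peval_mult peval_var)
next
  case (add p q)
  then show ?case by (simp add: peval_add V_add)
qed

lemma pth_pa: "f \<in> poly_in n \<Longrightarrow> pth f - \<phi> (pa f) \<in> \<mm>"
proof (induction f rule: mpoly_induct)
  case (const c)
  then show ?case by (simp add: peval_const pa_simps m_0)
next
  case (var i m c)
  let ?s = "Poly_Mapping.single m c"
  have "\<theta> i * (pth ?s - \<phi> (pa ?s)) + \<phi> (pa ?s) * y i \<in> \<mm>"
    by (rule m_add[OF m_mult[OF theta_V[OF var.hyps(1)] var.IH] m_mult[OF k_V y_m[OF var.hyps(1)]]])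
  then show ?case
    by (simp add: peval_mult peval_var pa_simps hom_mult y_def algebra_simps)
next
  case (add p q)
  then show ?case
    using m_add[OF add.IH] by (simp add: peval_add pa_simps hom_add algebra_simps)
qed

lemma pth_m: "f \<in> poly_in n \<Longrightarrow> pth f \<in> \<mm> \<longleftrightarrow> pa f = 0"
  using pth_pa[of f] m_diff[of "pth f" "pth f - \<phi> (pa f)"] m_add[of "pth f - \<phi> (pa f)" "\<phi> (pa f)"] k_m[of "pa f"]
  by auto

lemma ev_pth: "f \<in> forms n d \<Longrightarrow> ev f = \<eta> j0 ^ d * pth f"
  using peval_scale[of f n d "\<eta> j0" \<theta>] j0 by (simp add: \<theta>_def)

lemma van_pth: "f \<in> van C \<Longrightarrow> pth f = 0"
proof -
  assume f: "f \<in> van C"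
  obtain N where N: "\<And>m. m \<in> Poly_Mapping.keys f \<Longrightarrow> mdeg m \<le> N"
    using mdeg_bounded[of f] by blast
  have "pth (hom_component d f) = 0" for d
  proof -
    have "ev (hom_component d f) = 0"
      using f by (simp add: van_eq vanishing_ideal_def)
    then show ?thesis
      using ev_pth[OF hom_component_forms[OF I_poly_in[OF f]], of d] j0 by simp
  qed
  then have "pth (\<Sum>d\<le>N. hom_component d f) = 0"
    by (simp add: peval_sum)
  then show ?thesis
    using sum_hom_components[of f N, OF N] by simp
qed

lemma van_pa: "f \<in> van C \<Longrightarrow> pa f = 0"
  using van_pth pth_m I_poly_in m_0 by metis

text \<open>Each component is multiplied by a power of the variable with index \<open>j0\<close>,
  which is 1 both at \<open>\<theta>\<close> and at a. The degree N can be prescribed, so that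
  numerator and denominator become forms of equal degree.\<close>

lemma homogenize:
  assumes f: "f \<in> poly_in n" and N: "\<And>m. m \<in> Poly_Mapping.keys f \<Longrightarrow> mdeg m \<le> N"
  shows "\<exists>F\<in>forms n N. pth F = pth f \<and> pa F = pa f"
proof (intro bexI conjI)
  let ?F = "\<Sum>d\<le>N. hom_component d f * var_poly j0 ^ (N - d)"
  have fs: "f = (\<Sum>d\<le>N. hom_component d f)"
    using sum_hom_components[of f N, OF N] by simp
  show "?F \<in> forms n N"
  proof (rule forms_sum)
    fix d assume "d \<in> {..N}"
    then show "hom_component d f * var_poly j0 ^ (N - d) \<in> forms n N"
      using forms_mult[OF hom_component_forms[OF f, of d] forms_power[OF forms_var[OF j0(1)], of "N - d"]] by simp
  qed
  show "pth ?F = pth f"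
    by (subst (2) fs) (simp add: peval_simps theta_j0)
  show "pa ?F = pa f"
    by (subst (2) fs) (simp add: pa_simps a_j0)
qed

text \<open>The local ring of C at the center, written in the affine chart: the value of a
  polynomial at \<open>\<theta>\<close> is in \<open>\<mm>\<close> exactly if the polynomial
  vanishes at a.\<close>

definition R :: "'e set" where
  "R = {pth f / pth g | f g. f \<in> poly_in n \<and> g \<in> poly_in n \<and> pth g \<notin> \<mm>}"

lemma R_I: "f \<in> poly_in n \<Longrightarrow> g \<in> poly_in n \<Longrightarrow> pth g \<notin> \<mm> \<Longrightarrow> pth f / pth g \<in> R"
  by (auto simp: R_def)

lemma RE:
  assumes "z \<in> R"
  obtains f g where "f \<in> poly_in n" "g \<in> poly_in n" "pth g \<notin> \<mm>" "pth g \<noteq> 0" "inverse (pth g) \<in> V" "z = pth f / pth g"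
  using assms unit[OF pth_V] unfolding R_def by blast

lemma R_pth: "f \<in> poly_in n \<Longrightarrow> pth f \<in> R"
  using R_I[of f 1] m_1 by (simp add: peval_1)

lemma R_const: "\<phi> c \<in> R"
  using R_pth[of "const_poly c"] by (simp add: peval_const)

lemma R_1: "1 \<in> R"
  using R_const[of 1] by (simp add: hom_one)

lemma R_V: "R \<subseteq> V"
  by (auto elim!: RE simp: divide_inverse intro!: V_mult pth_V)

lemma R_diff_mult:
  assumes "x \<in> R" "z \<in> R"
  shows "x - z \<in> R" "x * z \<in> R"
proof -
  obtain f g where fg: "f \<in> poly_in n" "g \<in> poly_in n" "pth g \<notin> \<mm>" "pth g \<noteq> 0" "x = pth f / pth g"
    by (rule RE[OF assms(1)])
  obtain f' g' where fg': "f' \<in> poly_in n" "g' \<in> poly_in n" "pth g' \<notin> \<mm>" "pth g' \<noteq> 0" "z = pth f' / pth g'"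
    by (rule RE[OF assms(2)])
  have g: "g * g' \<in> poly_in n" "pth (g * g') \<notin> \<mm>"
    using fg fg' m_prime[OF pth_V pth_V, of g g'] by (auto simp: peval_mult intro: poly_in_mult)
  have "x - z = pth (f * g' - f' * g) / pth (g * g')" "x * z = pth (f * f') / pth (g * g')"
    using fg fg' by (simp_all add: peval_simps diff_frac_eq)
  moreover have "f * g' - f' * g \<in> poly_in n" "f * f' \<in> poly_in n"
    using fg fg' by (auto intro: poly_in_mult poly_in_diff)
  ultimately show "x - z \<in> R" "x * z \<in> R"
    using R_I g by auto
qed

lemma R_0: "0 \<in> R"
  using R_diff_mult(1)[OF R_1 R_1] by simp

lemma R_add: "x \<in> R \<Longrightarrow> z \<in> R \<Longrightarrow> x + z \<in> R"
  using R_diff_mult(1)[of x "- z"] R_diff_mult(1)[OF R_0, of z] by simp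

lemma R_sum: "(\<And>i. i \<in> A \<Longrightarrow> f i \<in> R) \<Longrightarrow> sum f A \<in> R"
  by (induction A rule: infinite_finite_induct) (auto simp: R_0 R_add)

lemma R_inverse: "z \<in> R \<Longrightarrow> z \<notin> \<mm> \<Longrightarrow> inverse z \<in> R"
proof -
  assume z: "z \<in> R" "z \<notin> \<mm>"
  obtain f g where fg: "f \<in> poly_in n" "g \<in> poly_in n" "pth g \<noteq> 0" "inverse (pth g) \<in> V" "z = pth f / pth g"
    by (rule RE[OF z(1)])
  have "pth f \<notin> \<mm>"
    using z(2) fg m_mult[OF fg(4), of "pth f"] by (auto simp: divide_inverse mult.commute)
  then show ?thesis
    using R_I[OF fg(2,1)] fg(5) by simp
qed

lemma R_y: "i \<le> n \<Longrightarrow> y i \<in> R"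
  using R_diff_mult(1)[OF R_pth[of "var_poly i"] R_const[of "a i"]] by (simp add: y_def peval_var)

text \<open>The square of the maximal ideal R \<inter> \<mm>, which turns out to be generated by the
  y_l.\<close>

definition M2 :: "'e set" where
  "M2 = {\<Sum>l\<le>n. c l * y l | c. \<forall>l\<le>n. c l \<in> R \<inter> \<mm>}"

lemma M2_I: "(\<And>l. l \<le> n \<Longrightarrow> c l \<in> R \<and> c l \<in> \<mm>) \<Longrightarrow> (\<Sum>l\<le>n. c l * y l) \<in> M2"
  unfolding M2_def by blast

lemma M2_0: "0 \<in> M2"
  using M2_I[of "\<lambda>_. 0"] by (simp add: R_0 m_0)

lemma M2_add: "x \<in> M2 \<Longrightarrow> z \<in> M2 \<Longrightarrow> x + z \<in> M2"
proof -
  assume "x \<in> M2" "z \<in> M2"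
  then obtain c d where "\<forall>l\<le>n. c l \<in> R \<inter> \<mm>" "x = (\<Sum>l\<le>n. c l * y l)" "\<forall>l\<le>n. d l \<in> R \<inter> \<mm>" "z = (\<Sum>l\<le>n. d l * y l)"
    unfolding M2_def by blast
  moreover from this have "(\<Sum>l\<le>n. (c l + d l) * y l) \<in> M2"
    by (intro M2_I) (simp add: R_add m_add)
  ultimately show ?thesis
    by (simp add: distrib_right sum.distrib)
qed

lemma M2_mult: "r \<in> R \<Longrightarrow> x \<in> M2 \<Longrightarrow> r * x \<in> M2"
proof -
  assume r: "r \<in> R" and "x \<in> M2"
  then obtain c where c: "\<forall>l\<le>n. c l \<in> R \<inter> \<mm>" "x = (\<Sum>l\<le>n. c l * y l)"
    unfolding M2_def by blast
  have "(\<Sum>l\<le>n. (r * c l) * y l) \<in> M2"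
    using c(1) r R_V by (intro M2_I) (auto intro: R_diff_mult(2) m_mult)
  then show ?thesis
    using c(2) by (simp add: sum_distrib_left mult.assoc)
qed

lemma M2_sum: "(\<And>i. i \<in> A \<Longrightarrow> f i \<in> M2) \<Longrightarrow> sum f A \<in> M2"
  by (induction A rule: infinite_finite_induct) (auto simp: M2_0 M2_add)

text \<open>The linear part of the Taylor expansion at a.\<close>

definition D :: "'k mpoly \<Rightarrow> 'e" where
  "D f = (\<Sum>j\<le>n. \<phi> (pa (partial_deriv j f)) * y j)"

lemma taylor: "f \<in> poly_in n \<Longrightarrow> pth f - \<phi> (pa f) - D f \<in> M2"
proof (induction f rule: mpoly_induct)
  case (const c)
  then show ?case
    by (simp add: peval_const pa_simps D_def partial_deriv_const hom_zero M2_0)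
next
  case (var i m c)
  let ?s = "Poly_Mapping.single m c"
  have "D (var_poly i * ?s) = (\<Sum>j\<le>n. (if i = j then \<phi> (pa ?s) * y j else 0)
      + \<phi> (a i) * (\<phi> (pa (partial_deriv j ?s)) * y j))"
    unfolding D_def
    by (intro sum.cong refl)
      (simp add: partial_deriv_var_mult pa_simps hom_add hom_mult hom_zero algebra_simps)
  also have "\<dots> = \<phi> (pa ?s) * y i + \<phi> (a i) * D ?s"
    using var.hyps by (simp add: sum.distrib sum_distrib_left D_def)
  finally have Ds: "D (var_poly i * ?s) = \<phi> (pa ?s) * y i + \<phi> (a i) * D ?s" .
  have "(\<Sum>j\<le>n. (y i * \<phi> (pa (partial_deriv j ?s))) * y j) \<in> M2"
    using var.hyps R_y[of i] y_m[of i] R_const k_V by (intro M2_I) (auto intro: R_diff_mult(2) simp: mult.commute[of "y i"] m_mult)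
  then have "y i * D ?s \<in> M2"
    by (simp add: D_def sum_distrib_left mult.assoc)
  moreover have "\<theta> i \<in> R"
    using R_pth[of "var_poly i"] var.hyps by (simp add: peval_var)
  ultimately have "\<theta> i * (pth ?s - \<phi> (pa ?s) - D ?s) + y i * D ?s \<in> M2"
    using M2_add[OF M2_mult[OF _ var.IH]] by blast
  moreover have "\<theta> i * (pth ?s - \<phi> (pa ?s) - D ?s) + y i * D ?s
      = pth (var_poly i * ?s) - \<phi> (pa (var_poly i * ?s)) - D (var_poly i * ?s)"
    unfolding Ds by (simp add: peval_mult peval_var pa_simps hom_mult y_def algebra_simps)
  ultimately show ?case
    by metis
next
  case (add p q)
  have "D (p + q) = D p + D q"
    by (simp add: D_def partial_deriv_add pa_simps hom_add algebra_simps sum.distrib)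
  then have "pth (p + q) - \<phi> (pa (p + q)) - D (p + q) = (pth p - \<phi> (pa p) - D p) + (pth q - \<phi> (pa q) - D q)"
    by (simp add: peval_add pa_simps hom_add)
  then show ?case
    using M2_add[OF add.IH] by metis
qed

text \<open>By Taylor expansion the numerator is its linear part plus an element of
  \<open>M2\<close>, and both are combinations of the y_l.\<close>

lemma m_generated:
  assumes "z \<in> R" "z \<in> \<mm>"
  shows "\<exists>h. (\<forall>l\<le>n. h l \<in> R) \<and> z = (\<Sum>l\<le>n. h l * y l)"
proof -
  obtain f g where fg: "f \<in> poly_in n" "g \<in> poly_in n" "pth g \<notin> \<mm>" "pth g \<noteq> 0" "z = pth f / pth g"
    by (rule RE[OF assms(1)])
  have "pth f = pth g * z"
    using fg by simp
  then have "pth f \<in> \<mm>"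
    using m_mult[OF pth_V[OF fg(2)] assms(2)] by simp
  then have "pth f - D f \<in> M2"
    using taylor[OF fg(1)] pth_m[OF fg(1)] by (simp add: hom_zero)
  then obtain c where c: "\<forall>l\<le>n. c l \<in> R \<inter> \<mm>" "pth f - D f = (\<Sum>l\<le>n. c l * y l)"
    unfolding M2_def by blast
  have ig: "inverse (pth g) \<in> R"
    using R_inverse[OF R_pth[OF fg(2)] fg(3)] .
  have "pth f = (\<Sum>l\<le>n. (\<phi> (pa (partial_deriv l f)) + c l) * y l)"
    using c(2) by (simp add: D_def distrib_right sum.distrib algebra_simps)
  moreover have "z = inverse (pth g) * pth f"
    using fg(5) by (simp add: divide_inverse mult.commute)
  ultimately have "z = (\<Sum>l\<le>n. (inverse (pth g) * (\<phi> (pa (partial_deriv l f)) + c l)) * y l)"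
    by (simp only: sum_distrib_left mult.assoc)
  moreover have "inverse (pth g) * (\<phi> (pa (partial_deriv l f)) + c l) \<in> R" if "l \<le> n" for l
    using c(1) that by (intro R_diff_mult(2)[OF ig] R_add R_const) auto
  ultimately show ?thesis
    by (intro exI[of _ "\<lambda>l. inverse (pth g) * (\<phi> (pa (partial_deriv l f)) + c l)"]) simp
qed

definition point :: "(nat \<Rightarrow> 'k) set" where
  "point = {(\<lambda>i. c * a i) | c. c \<noteq> 0}"

lemma point_rational: "point \<in> rational_points C"
proof -
  have "point \<in> proj_space n"
    unfolding proj_space_def point_def using a_j0 a_0
    by (intro CollectI exI[of _ a] conjI refl) (auto intro: exI[of _ j0])
  moreover have "peval (\<lambda>c. c) f v = 0" if f: "f \<in> van C" and v: "v \<in> point" for f v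
  proof -
    obtain c where v: "v = (\<lambda>i. c * a i)"
      using v by (auto simp: point_def)
    obtain N where N: "\<And>m. m \<in> Poly_Mapping.keys f \<Longrightarrow> mdeg m \<le> N"
      using mdeg_bounded[of f] by blast
    have "peval (\<lambda>c. c) (hom_component d f) v = 0" for d
      using coeff_hom.peval_scale[OF coeff_hom_id hom_component_forms[OF I_poly_in[OF f]], of d c a]
        van_pa[OF I_hom[OF f], of d] v by simp
    then have "peval (\<lambda>c. c) (\<Sum>d\<le>N. hom_component d f) v = 0"
      by (simp add: pa_simps)
    then show ?thesis
      using sum_hom_components[of f N, OF N] by simp
  qed
  ultimately show ?thesis
    by (simp add: rational_points_def zero_locus_def)
qed

lemma regular_iff: "g \<in> forms n d \<Longrightarrow> (\<forall>v\<in>point. peval (\<lambda>c. c) g v \<noteq> 0) \<longleftrightarrow> pa g \<noteq> 0"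
proof -
  assume g: "g \<in> forms n d"
  have "a \<in> point"
    unfolding point_def by (intro CollectI exI[of _ 1]) simp
  moreover have "peval (\<lambda>c. c) g (\<lambda>i. c * a i) = c ^ d * pa g" for c
    by (rule coeff_hom.peval_scale[OF coeff_hom_id g])
  then have "peval (\<lambda>c. c) g v \<noteq> 0" if "v \<in> point" "pa g \<noteq> 0" for v
    using that by (auto simp: point_def)
  ultimately show ?thesis
    by blast
qed

lemma local_ring_R: "val ` local_ring C point = R"
proof (intro Set.set_eqI iffI)
  fix z assume "z \<in> val ` local_ring C point"
  then obtain f g where fg: "(f, g) \<in> fractions C" "\<forall>v\<in>point. peval (\<lambda>c. c) g v \<noteq> 0" "z = ev f / ev g"
    using val_fraction by (auto simp: local_ring_def)
  then obtain d where d: "f \<in> forms n d" "g \<in> forms n d"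
    by (auto simp: fractions_iff)
  have "pth g \<notin> \<mm>"
    using pth_m[OF forms_poly_in[OF d(2)]] regular_iff[OF d(2)] fg(2) by simp
  moreover have "z = pth f / pth g"
    using fg(3) ev_pth[OF d(1)] ev_pth[OF d(2)] j0 by simp
  ultimately show "z \<in> R"
    using R_I d forms_poly_in by blast
next
  fix z assume "z \<in> R"
  then obtain f g where fg: "f \<in> poly_in n" "g \<in> poly_in n" "pth g \<notin> \<mm>" "pth g \<noteq> 0" "z = pth f / pth g"
    by (rule RE)
  obtain N1 where N1: "\<And>m. m \<in> Poly_Mapping.keys f \<Longrightarrow> mdeg m \<le> N1"
    using mdeg_bounded[of f] by blast
  obtain N2 where N2: "\<And>m. m \<in> Poly_Mapping.keys g \<Longrightarrow> mdeg m \<le> N2"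
    using mdeg_bounded[of g] by blast
  obtain F where F: "F \<in> forms n (N1 + N2)" "pth F = pth f"
    using homogenize[OF fg(1), of "N1 + N2"] N1 by (meson trans_le_add1)
  obtain G where G: "G \<in> forms n (N1 + N2)" "pth G = pth g" "pa G = pa g"
    using homogenize[OF fg(2), of "N1 + N2"] N2 by (meson trans_le_add2)
  have evG: "ev G \<noteq> 0"
    using ev_pth[OF G(1)] G(2) fg(4) j0 by simp
  have fr: "(F, G) \<in> fractions C"
    using F G evG by (auto simp: fractions_iff)
  have "pa G \<noteq> 0"
    using G pth_m[OF fg(2)] fg(3) by simp
  then have "\<forall>v\<in>point. peval (\<lambda>c. c) G v \<noteq> 0"
    using regular_iff[OF G(1)] by simp
  then have "fraction C F G \<in> local_ring C point"
    using fr by (auto simp: local_ring_def)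
  moreover have "val (fraction C F G) = z"
    using val_fraction[OF fr] ev_pth[OF F(1)] ev_pth[OF G(1)] F G fg j0 by simp
  ultimately show "z \<in> val ` local_ring C point"
    by blast
qed

text \<open>Smoothness makes the cotangent space at most one-dimensional. The map that sends the
  unit vectors e_i to y_i modulo \<open>M2\<close> kills the gradients of the ideal, by Taylor
  expansion, and \<open>e j0\<close>, since \<open>y j0 = 0\<close>; by
  \<open>exists_parameter\<close> a single unit vector \<open>e j1\<close> remains.\<close>

lemma parameter_mod: "\<exists>j1\<le>n. \<forall>i\<le>n. \<exists>c. y i - \<phi> c * y j1 \<in> M2"
proof -
  define grad where "grad f = (\<lambda>j. if j \<le> n then pa (partial_deriv j f) else 0)" for f
  define T where "T = grad ` van C"
  define P where "P = {(\<lambda>i. c * to_ac (a i)) | c :: 'k alg_closure. c \<noteq> 0}"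
  define a' where "a' = (\<lambda>i. to_ac (a i))"
  have pa': "peval to_ac f a' = to_ac (pa f)" for f
    unfolding a'_def using hom_peval[OF coeff_hom_to_ac, of "\<lambda>c. c" f a] by simp
  have "P \<in> proj_space n"
    unfolding proj_space_def P_def using a_j0 a_0
    by (intro CollectI exI[of _ a'] conjI) (auto simp: a'_def intro: exI[of _ j0])
  moreover have "peval to_ac f v = 0" if f: "f \<in> van C" and v: "v \<in> P" for f v
  proof -
    obtain c where v: "v = (\<lambda>i. c * a' i)"
      using v by (auto simp: P_def a'_def)
    obtain N where N: "\<And>m. m \<in> Poly_Mapping.keys f \<Longrightarrow> mdeg m \<le> N"
      using mdeg_bounded[of f] by blast
    have "peval to_ac (hom_component d f) v = 0" for d
      using coeff_hom.peval_scale[OF coeff_hom_to_ac hom_component_forms[OF I_poly_in[OF f]], of d c a']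
        van_pa[OF I_hom[OF f], of d] v by (simp add: pa')
    then have "peval to_ac (\<Sum>d\<le>N. hom_component d f) v = 0"
      by (simp add: coeff_hom.peval_sum[OF coeff_hom_to_ac])
    then show ?thesis
      using sum_hom_components[of f N, OF N] by simp
  qed
  ultimately have "P \<in> zero_locus to_ac n (van C)"
    by (simp add: zero_locus_def)
  moreover have "a' \<in> P"
    unfolding P_def a'_def by (intro CollectI exI[of _ 1]) simp
  ultimately have dim: "vector_space.dim (\<lambda>(c :: 'k alg_closure) w. (\<lambda>j :: nat. c * w j))
      {(\<lambda>j. if j \<le> n then peval to_ac (partial_deriv j f) a' else 0) | f. f \<in> van C} + 1 = n"
    using smooth unfolding smooth_curve_def by blast
  have "{(\<lambda>j. if j \<le> n then peval to_ac (partial_deriv j f) a' else 0) | f. f \<in> van C}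
      = (\<lambda>g j. to_ac (g j)) ` T"
    unfolding T_def grad_def pa' image_image setcompr_eq_image by (intro image_cong refl) auto
  then have dim': "vector_space.dim (\<lambda>(c :: 'k alg_closure) w. (\<lambda>j :: nat. c * w j)) ((\<lambda>g j. to_ac (g j)) ` T) + 1 = n"
    using dim by simp
  \<comment> \<open>Euler's identity, from the vanishing of f along (1 + X) a, a line in the cone
    over C.\<close>
  have euler: "(\<Sum>j\<le>n. a j * g j) = 0" if gT: "g \<in> T" for g
  proof -
    obtain f where f: "f \<in> van C" "g = grad f"
      using gT by (auto simp: T_def)
    have "(\<Sum>j\<le>n. pa (partial_deriv j f) * a j) = coeff (peval (\<lambda>c. [:c:]) f (\<lambda>i. [:a i, a i:])) 1"
      using peval_curve[OF coeff_hom_id I_poly_in[OF f(1)], of "\<lambda>i. [:a i, a i:]"] by simp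
    also have "peval (\<lambda>c. [:c:]) f (\<lambda>i. [:a i, a i:]) = 0"
    proof -
      have h: "coeff_hom (\<lambda>c :: 'k. [:c:])"
        by (rule coeff_hom.coeff_hom_const[OF coeff_hom_id])
      obtain N where N: "\<And>m. m \<in> Poly_Mapping.keys f \<Longrightarrow> mdeg m \<le> N"
        using mdeg_bounded[of f] by blast
      have "peval (\<lambda>c. [:c:]) (hom_component d f) (\<lambda>i. [:a i, a i:]) = 0" for d
      proof -
        have "(\<lambda>i. [:a i, a i:]) = (\<lambda>i. [:1, 1:] * [:a i:])"
          by simp
        moreover have "peval (\<lambda>c. [:c:]) (hom_component d f) (\<lambda>i. [:a i:]) = [:pa (hom_component d f):]"
          using hom_peval[OF h, of "\<lambda>c. c" "hom_component d f" a] by simp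
        ultimately show ?thesis
          using coeff_hom.peval_scale[OF h hom_component_forms[OF I_poly_in[OF f(1)]], of d "[:1, 1:]" "\<lambda>i. [:a i:]"]
            van_pa[OF I_hom[OF f(1)], of d] by simp
      qed
      then have "peval (\<lambda>c. [:c:]) (\<Sum>d\<le>N. hom_component d f) (\<lambda>i. [:a i, a i:]) = 0"
        by (simp add: coeff_hom.peval_sum[OF h])
      then show ?thesis
        using sum_hom_components[of f N, OF N] by simp
    qed
    finally have "(\<Sum>j\<le>n. pa (partial_deriv j f) * a j) = 0"
      by simp
    moreover have "(\<Sum>j\<le>n. a j * g j) = (\<Sum>j\<le>n. pa (partial_deriv j f) * a j)"
      by (intro sum.cong refl) (simp add: f(2) grad_def mult.commute)
    ultimately show ?thesis
      by simp
  qed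
  have supp: "g j = 0" if "g \<in> T" "j > n" for g j
    using that by (auto simp: T_def grad_def)
  define e where "e i = (\<lambda>j :: nat. if j = i then (1::'k) else 0)" for i :: nat
  have "\<exists>j1\<le>n. \<forall>i\<le>n. \<exists>T' \<mu>. finite T' \<and> T' \<subseteq> insert (e j1) (insert (e j0) T)
      \<and> e i = (\<Sum>g\<in>T'. (\<lambda>j. \<mu> g * g j))"
    unfolding e_def
  proof (rule exists_parameter[where a = a])
    show "vector_space.dim (\<lambda>(c :: 'k alg_closure) w. (\<lambda>j :: nat. c * w j)) ((\<lambda>g j. to_ac (g j)) ` T) + 1 = n"
      by (rule dim')
  qed (use supp euler a_j0 j0 in auto)
  then obtain j1 where j1: "j1 \<le> n" "\<And>i. i \<le> n \<Longrightarrow> \<exists>T' \<mu>. finite T' \<and> T' \<subseteq> insert (e j1) (insert (e j0) T)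
      \<and> e i = (\<Sum>g\<in>T'. (\<lambda>j. \<mu> g * g j))"
    by (elim exE conjE) simp
  define \<Phi> where "\<Phi> u = (\<Sum>j\<le>n. \<phi> (u j) * y j)" for u
  have \<Phi>e: "\<Phi> (e i) = y i" if "i \<le> n" for i
  proof -
    have "\<Phi> (e i) = (\<Sum>j\<le>n. if j = i then y i else 0)"
      unfolding \<Phi>_def e_def by (intro sum.cong refl) (simp add: hom_one hom_zero)
    then show ?thesis
      using that by simp
  qed
  have \<Phi>T: "\<Phi> g \<in> M2" if gT: "g \<in> T" for g
  proof -
    obtain f where f: "f \<in> van C" "g = grad f"
      using gT by (auto simp: T_def)
    have "\<Phi> g = D f"
      unfolding \<Phi>_def D_def by (intro sum.cong refl) (simp add: f(2) grad_def)
    moreover have "- D f \<in> M2"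
      using taylor[OF I_poly_in[OF f(1)]] van_pth[OF f(1)] van_pa[OF f(1)] by (simp add: hom_zero)
    then have "(0 - 1) * - D f \<in> M2"
      by (rule M2_mult[OF R_diff_mult(1)[OF R_0 R_1]])
    ultimately show ?thesis
      by simp
  qed
  have "\<exists>c. y i - \<phi> c * y j1 \<in> M2" if i: "i \<le> n" for i
  proof -
    obtain T' \<mu> where T': "finite T'" "T' \<subseteq> insert (e j1) (insert (e j0) T)" "e i = (\<Sum>g\<in>T'. (\<lambda>j. \<mu> g * g j))"
      using j1(2)[OF i] by blast
    have "y i = (\<Sum>j\<le>n. \<phi> (\<Sum>g\<in>T'. \<mu> g * g j) * y j)"
      using \<Phi>e[OF i] T'(3) by (simp add: \<Phi>_def sum_fun_apply)
    also have "\<dots> = (\<Sum>g\<in>T'. \<phi> (\<mu> g) * \<Phi> g)"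
      by (simp add: \<Phi>_def hom_sum hom_mult sum_distrib_left sum_distrib_right mult.assoc) (rule sum.swap)
    finally have yi: "y i = (\<Sum>g\<in>T'. \<phi> (\<mu> g) * \<Phi> g)" .
    define c where "c = (if e j1 \<in> T' then \<mu> (e j1) else 0)"
    have "(\<Sum>g\<in>T' - {e j1}. \<phi> (\<mu> g) * \<Phi> g) \<in> M2"
    proof (intro M2_sum M2_mult R_const)
      fix g assume "g \<in> T' - {e j1}"
      then have "g = e j0 \<or> g \<in> T"
        using T'(2) by auto
      then show "\<Phi> g \<in> M2"
        using \<Phi>T \<Phi>e[OF j0(1)] y_j0 M2_0 by auto
    qed
    moreover have "y i = \<phi> c * y j1 + (\<Sum>g\<in>T' - {e j1}. \<phi> (\<mu> g) * \<Phi> g)"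
      unfolding yi c_def using sum.remove[OF T'(1), of "e j1" "\<lambda>g. \<phi> (\<mu> g) * \<Phi> g"] \<Phi>e[OF j1(1)]
      by (auto simp: hom_zero)
    ultimately show ?thesis
      by (intro exI[of _ c]) simp
  qed
  then show ?thesis
    using j1(1) by blast
qed

text \<open>By \<open>parameter_mod\<close> every y_i is a multiple of \<open>y j1\<close> modulo
  the square of the maximal ideal; Nakayama's lemma makes it one in R.\<close>

lemma uniformizer: "\<exists>\<pi>. \<pi> \<in> R \<and> \<pi> \<in> \<mm> \<and> (\<forall>z\<in>R \<inter> \<mm>. \<exists>p\<in>R. z = p * \<pi>)"
proof -
  obtain j1 where j1: "j1 \<le> n" "\<And>i. i \<le> n \<Longrightarrow> \<exists>c. y i - \<phi> c * y j1 \<in> M2"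
    using parameter_mod by metis
  have "\<forall>i\<in>{..n}. \<exists>p\<in>R. y i = p * y j1"
  proof (rule nakayama[where R = R and y = y and \<pi> = "y j1"])
    fix i assume "i \<in> {..n}"
    then obtain c where "y i - \<phi> c * y j1 \<in> M2"
      using j1(2) by auto
    then obtain d where "\<forall>l\<le>n. d l \<in> R \<inter> \<mm>" "y i - \<phi> c * y j1 = (\<Sum>l\<le>n. d l * y l)"
      unfolding M2_def by blast
    then show "\<exists>p\<in>R. \<exists>c. (\<forall>l\<in>{..n}. c l \<in> R \<inter> \<mm>) \<and> y i = p * y j1 + (\<Sum>l\<in>{..n}. c l * y l)"
      by (intro bexI[of _ "\<phi> c"] exI[of _ d] conjI) (auto simp: R_const algebra_simps)
  qed (use R_V R_1 R_diff_mult R_inverse in auto)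
  then obtain q where q: "\<And>i. i \<le> n \<Longrightarrow> q i \<in> R \<and> y i = q i * y j1"
    by (metis atMost_iff)
  show ?thesis
  proof (intro exI[of _ "y j1"] conjI ballI)
    show "y j1 \<in> R" "y j1 \<in> \<mm>"
      using j1(1) R_y y_m by auto
    fix z assume "z \<in> R \<inter> \<mm>"
    then have "z \<in> R" "z \<in> \<mm>"
      by auto
    then obtain h where h: "\<And>l. l \<le> n \<Longrightarrow> h l \<in> R" "z = (\<Sum>l\<le>n. h l * y l)"
      using m_generated by metis
    have "(\<Sum>l\<le>n. h l * y l) = (\<Sum>l\<le>n. (h l * q l) * y j1)"
      using q by (intro sum.cong refl) (simp add: mult.assoc)
    then have "z = (\<Sum>l\<le>n. h l * q l) * y j1"
      using h(2) by (simp add: sum_distrib_right)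
    moreover have "(\<Sum>l\<le>n. h l * q l) \<in> R"
      using h(1) q by (intro R_sum R_diff_mult(2)) auto
    ultimately show "\<exists>p\<in>R. z = p * y j1"
      by blast
  qed
qed

lemma K_quotient:
  assumes "z \<in> K"
  obtains x u where "x \<in> R" "u \<in> R" "u \<noteq> 0" "z = x / u"
proof -
  obtain f g where fg: "(f, g) \<in> fractions C" "z = ev f / ev g"
    by (rule KE[OF assms])
  then obtain d where d: "f \<in> forms n d" "g \<in> forms n d" "ev g \<noteq> 0"
    by (auto simp: fractions_iff)
  then have "z = pth f / pth g" "pth g \<noteq> 0"
    using ev_pth[OF d(1)] ev_pth[OF d(2)] j0 fg(2) by auto
  then show ?thesis
    using that[of "pth f" "pth g"] R_pth d forms_poly_in by blast
qed

lemma R_K: "R \<subseteq> K"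
proof -
  have "local_ring C point \<subseteq> carrier (function_field C)"
    by (auto simp: local_ring_def function_field_simps)
  then show ?thesis
    unfolding local_ring_R[symmetric] val_image[symmetric] by (rule image_mono)
qed

text \<open>Every nonzero element of R is a power of \<pi> times a unit, so an element of
  \<open>K\<close> outside R is the inverse of a nonunit of R and cannot lie in V.\<close>

theorem V_K: "V \<inter> K = R"
proof (intro Set.set_eqI iffI)
  fix z assume "z \<in> R"
  then show "z \<in> V \<inter> K"
    using R_V R_K by blast
next
  fix z assume z: "z \<in> V \<inter> K"
  obtain \<pi> where \<pi>: "\<pi> \<in> R" "\<pi> \<in> \<mm>" and gen\<pi>: "\<And>z. z \<in> R \<Longrightarrow> z \<in> \<mm> \<Longrightarrow> \<exists>p\<in>R. z = p * \<pi>"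
    using uniformizer by (metis IntI)
  \<comment> \<open>Otherwise R would be a field, hence all of \<open>K\<close>, against
    \<open>VK\<close>.\<close>
  have \<pi>0: "\<pi> \<noteq> 0"
  proof
    assume "\<pi> = 0"
    then have "u \<notin> \<mm>" if "u \<in> R" "u \<noteq> 0" for u
      using gen\<pi>[OF that(1)] that(2) by auto
    then have "z \<in> R" if z: "z \<in> K" for z
    proof -
      obtain x u where "x \<in> R" "u \<in> R" "u \<noteq> 0" "z = x / u"
        by (rule K_quotient[OF z])
      then show ?thesis
        using \<open>\<And>u. u \<in> R \<Longrightarrow> u \<noteq> 0 \<Longrightarrow> u \<notin> \<mm>\<close> R_inverse R_diff_mult(2) by (simp add: divide_inverse)
    qed
    then show False
      using VK R_V by blast
  qed
  \<comment> \<open>An element without an order would be divisible by all powers of \<pi>, which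
    \<open>not_infinitely_divisible\<close> and transcendence degree one exclude.\<close>
  have order: "\<exists>k u. u \<in> R \<and> u \<notin> \<mm> \<and> x = \<pi> ^ k * u" if x: "x \<in> R" "x \<noteq> 0" for x
  proof (rule ccontr)
    assume c: "\<not> ?thesis"
    have "\<exists>r\<in>R. x = \<pi> ^ k * r" for k
    proof (induction k)
      case 0
      then show ?case
        using x by auto
    next
      case (Suc k)
      then obtain r where r: "r \<in> R" "x = \<pi> ^ k * r"
        by blast
      then have "r \<in> \<mm>"
        using c by blast
      then obtain p where "p \<in> R" "r = p * \<pi>"
        using gen\<pi> r by blast
      then show ?case
        using r by (intro bexI[of _ p]) (auto simp: mult_ac)
    qed
    then have "x / \<pi> ^ k \<in> V" for k
      using R_V \<pi>0 by (metis nonzero_mult_div_cancel_left power_not_zero subsetD)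
    then have "\<not> alg_over (gen \<pi>) x"
      using not_infinitely_divisible[OF \<pi>(2) \<pi>0 x(2)] by blast
    moreover have "\<not> kalg \<pi>"
      using kalg_m \<pi>(2) \<pi>0 by blast
    ultimately show False
      using dependent[of x \<pi>] x \<pi> R_K by blast
  qed
  obtain x v where xv: "x \<in> R" "v \<in> R" "v \<noteq> 0" "z = x / v"
    using K_quotient z by blast
  show "z \<in> R"
  proof (cases "x = 0")
    case True
    then show ?thesis
      using xv R_0 by simp
  next
    case False
    obtain k u where ku: "u \<in> R" "u \<notin> \<mm>" "x = \<pi> ^ k * u"
      using order[OF xv(1) False] by blast
    obtain k' u' where ku': "u' \<in> R" "u' \<notin> \<mm>" "v = \<pi> ^ k' * u'"
      using order[OF xv(2,3)] by blast
    have nz: "u \<noteq> 0" "u' \<noteq> 0"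
      using ku ku' m_0 by auto
    have pR: "\<pi> ^ j \<in> R" for j
      by (induction j) (auto simp: R_1 \<pi>(1) intro: R_diff_mult(2))
    show ?thesis
    proof (cases "k' \<le> k")
      case True
      then have "\<pi> ^ k = \<pi> ^ (k - k') * \<pi> ^ k'"
        by (simp flip: power_add)
      then have "z = \<pi> ^ (k - k') * (u * inverse u')"
        using xv(4) ku ku' nz \<pi>0 by (simp add: field_simps)
      then show ?thesis
        using pR ku ku' R_inverse R_diff_mult(2) by simp
    next
      case False
      then obtain j where j: "k' = k + Suc j"
        by (metis add_Suc_right less_imp_Suc_add not_le)
      have "z * ((\<pi> ^ Suc j * u') * inverse u) = 1"
        using xv(4) ku ku' nz \<pi>0 j by (simp add: field_simps power_add)
      moreover have "z * ((u' * inverse u) * \<pi> ^ Suc j) \<in> \<mm>"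
        using z ku ku' R_V R_inverse[OF ku(1,2)] by (intro m_mult V_mult m_power[OF \<pi>(2)]) auto
      ultimately show ?thesis
        using m_1 by (simp add: mult_ac)
    qed
  qed
qed

end

section \<open>Invariant valuation rings\<close>

text \<open>Up to a unit, the value of q at z is a product of factors z - r with z and r in V, and
  \<mm> is prime.\<close>

lemma (in place) root_residue:
  fixes q :: "'e poly"
  assumes "q \<noteq> 0" "Polynomial.lead_coeff q \<in> V" "Polynomial.lead_coeff q \<notin> \<mm>" "\<And>r. poly q r = 0 \<Longrightarrow> r \<in> V"
    and z: "z \<in> V" and closed: "\<And>p :: 'e poly. Polynomial.degree p > 0 \<Longrightarrow> \<exists>r. poly p r = 0"
  shows "poly q z \<in> V \<and> (poly q z \<in> \<mm> \<longrightarrow> (\<exists>r. poly q r = 0 \<and> z - r \<in> \<mm>))"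
  using assms(1-4)
proof (induction "Polynomial.degree q" arbitrary: q rule: less_induct)
  case less
  show ?case
  proof (cases "Polynomial.degree q = 0")
    case True
    then obtain c where "q = [:c:]"
      by (meson degree_eq_zeroE)
    then show ?thesis
      using less.prems by simp
  next
    case False
    then obtain r where r: "poly q r = 0"
      using closed by blast
    then obtain q' where q': "q = [:- r, 1:] * q'"
      by (auto simp: poly_eq_0_iff_dvd)
    have q'0: "q' \<noteq> 0"
      using less.prems q' by auto
    have "Polynomial.degree q' < Polynomial.degree q"
      unfolding q' using q'0 by (subst degree_mult_eq) auto
    moreover have "Polynomial.lead_coeff q = Polynomial.lead_coeff q'"
      unfolding q' by (simp only: lead_coeff_mult) simp
    ultimately have IH: "poly q' z \<in> V \<and> (poly q' z \<in> \<mm> \<longrightarrow> (\<exists>r. poly q' r = 0 \<and> z - r \<in> \<mm>))"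
      using less.hyps[of q'] less.prems q'0 q' by simp
    have pq: "poly q z = (z - r) * poly q' z"
      by (simp add: q' algebra_simps)
    have zr: "z - r \<in> V"
      using z less.prems(4)[OF r] by (rule V_diff)
    show ?thesis
    proof (intro conjI impI)
      show "poly q z \<in> V"
        using pq zr IH by (simp add: V_mult)
      assume "poly q z \<in> \<mm>"
      then consider "z - r \<in> \<mm>" | "poly q' z \<in> \<mm>"
        using m_prime[OF zr, of "poly q' z"] IH pq by auto
      then show "\<exists>r. poly q r = 0 \<and> z - r \<in> \<mm>"
      proof cases
        case 1
        then show ?thesis using r by blast
      next
        case 2
        then obtain r' where "poly q' r' = 0" "z - r' \<in> \<mm>"
          using IH by blast
        then show ?thesis
          by (intro exI[of _ r']) (simp add: q')
      qed
    qed
  qed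
qed

text \<open>In a relation between u and z the least power of u is divided out; modulo \<mm> a
  nonzero polynomial over k in the residue of z is left. So the residues on a field of transcendence
  degree one are algebraic over k.\<close>

lemma (in place) residue_algebraic:
  assumes u: "u \<in> \<mm>" "u \<noteq> 0" and z: "z \<in> V" and d: "dep u z"
  shows "\<exists>p. p \<noteq> 0 \<and> pev p z \<in> \<mm>"
proof -
  obtain N c where "(\<exists>i\<le>N. \<exists>j\<le>N. c i j \<noteq> 0) \<and> (\<Sum>i\<le>N. \<Sum>j\<le>N. \<phi> (c i j) * u ^ i * z ^ j) = 0"
    using d[unfolded dep_def] by (elim exE)
  note c = this[THEN conjunct1] this[THEN conjunct2]
  define P where "P i \<longleftrightarrow> i \<le> N \<and> (\<exists>j\<le>N. c i j \<noteq> 0)" for i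
  define i0 where "i0 = (LEAST i. P i)"
  have i0: "P i0"
  proof -
    have "\<exists>i. P i"
      using c(1) unfolding P_def by blast
    then show ?thesis
      unfolding i0_def by (rule LeastI_ex)
  qed
  have min: "\<not> P i" if "i < i0" for i
    using that unfolding i0_def by (rule not_less_Least)
  define b where "b i = (\<Sum>j\<le>N. \<phi> (c i j) * z ^ j)" for i
  have bV: "b i \<in> V" for i
    unfolding b_def using z k_V by (intro V_sum V_mult V_power)
  have b0: "b i = 0" if "i < i0" "i \<le> N" for i
    using min[OF that(1)] that(2) by (simp add: P_def b_def hom_zero)
  have "(\<Sum>i\<le>N. u ^ i * b i) = 0"
    using c(2) by (simp add: b_def sum_distrib_left mult_ac)
  moreover have "(\<Sum>i\<le>N. u ^ i * b i) = (\<Sum>i\<in>{i0..N}. u ^ i * b i)"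
    using b0 by (intro sum.mono_neutral_right) auto
  moreover have "{i0..N} = insert i0 {i0<..N}"
    using i0 by (auto simp: P_def)
  ultimately have "u ^ i0 * b i0 + (\<Sum>i\<in>{i0<..N}. u ^ i * b i) = 0"
    by simp
  moreover have "(\<Sum>i\<in>{i0<..N}. u ^ i * b i) = u ^ i0 * (u * (\<Sum>i\<in>{i0<..N}. u ^ (i - Suc i0) * b i))"
  proof -
    have "u ^ i * b i = u ^ i0 * (u * (u ^ (i - Suc i0) * b i))" if "i \<in> {i0<..N}" for i
    proof -
      have "i = i0 + Suc (i - Suc i0)"
        using that by simp
      then have "u ^ i = u ^ i0 * (u * u ^ (i - Suc i0))"
        by (metis power_Suc power_add)
      then show ?thesis
        by (simp add: mult.assoc)
    qed
    then show ?thesis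
      unfolding sum_distrib_left by (intro sum.cong refl)
  qed
  ultimately have "u ^ i0 * (b i0 + u * (\<Sum>i\<in>{i0<..N}. u ^ (i - Suc i0) * b i)) = 0"
    by (simp add: distrib_left)
  then have "b i0 = - ((\<Sum>i\<in>{i0<..N}. u ^ (i - Suc i0) * b i) * u)"
    using u(2) by (simp add: eq_neg_iff_add_eq_0 mult.commute)
  moreover have "(\<Sum>i\<in>{i0<..N}. u ^ (i - Suc i0) * b i) \<in> V"
    by (intro V_sum V_mult V_power bV m_V[OF u(1)])
  ultimately have bm: "b i0 \<in> \<mm>"
    using m_uminus m_mult u(1) by simp
  define p where "p = (\<Sum>j\<le>N. monom (c i0 j) j)"
  have cp: "coeff p j = (if j \<le> N then c i0 j else 0)" for j
    by (simp add: p_def coeff_sum)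
  have "p \<noteq> 0"
    using i0 cp unfolding P_def by (metis coeff_0)
  moreover have "pev p z = b i0"
    using pev_sum[of p N z] by (simp add: cp b_def degree_le)
  ultimately show ?thesis
    using bm by auto
qed

text \<open>z is congruent to an element r algebraic over k. For \<sigma> in \<Gamma>, \<sigma> r -
  r is algebraic over k and lies in \<mm>, hence is zero; so r is fixed by \<Gamma> and lies in
  k.\<close>

lemma (in place) residue_rational:
  fixes \<Gamma> :: "('e \<Rightarrow> 'e) set"
  assumes closed: "\<And>p :: 'e poly. Polynomial.degree p > 0 \<Longrightarrow> \<exists>r. poly p r = 0"
    and \<Gamma>: "\<And>\<sigma>. \<sigma> \<in> \<Gamma> \<Longrightarrow> coeff_hom \<sigma>" "\<And>\<sigma>. \<sigma> \<in> \<Gamma> \<Longrightarrow> \<sigma> ` V = V" "\<And>\<sigma> c. \<sigma> \<in> \<Gamma> \<Longrightarrow> \<sigma> (\<phi> c) = \<phi> c"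
    and fix_k: "\<And>r. kalg r \<Longrightarrow> (\<And>\<sigma>. \<sigma> \<in> \<Gamma> \<Longrightarrow> \<sigma> r = r) \<Longrightarrow> r \<in> range \<phi>"
    and u: "u \<in> \<mm>" "u \<noteq> 0" and z: "z \<in> V" "dep u z" "\<And>\<sigma>. \<sigma> \<in> \<Gamma> \<Longrightarrow> \<sigma> z = z"
  shows "\<exists>a. z - \<phi> a \<in> \<mm>"
proof -
  obtain p where p: "p \<noteq> 0" "pev p z \<in> \<mm>"
    using residue_algebraic[OF u z(1,2)] by blast
  define q where "q = map_poly \<phi> p"
  have lc: "\<phi> (Polynomial.lead_coeff p) \<notin> \<mm>"
    using p(1) k_m by simp
  have cq: "coeff q i = \<phi> (coeff p i)" for i
    by (simp add: q_def coeff_map_poly hom_zero)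
  have "\<phi> x \<noteq> 0" if "x \<noteq> 0" for x
    using that field_hom_inj[OF coeff_hom', of x 0] hom_zero by simp
  then have dq: "Polynomial.degree q = Polynomial.degree p"
    unfolding q_def by (rule degree_map_poly)
  have q0: "q \<noteq> 0"
    using lc m_0 cq by (metis coeff_0)
  have kr: "kalg r" if "poly q r = 0" for r
    using that p(1) kalg_iff by (auto simp: q_def pev_def)
  have "poly q z \<in> V \<and> (poly q z \<in> \<mm> \<longrightarrow> (\<exists>r. poly q r = 0 \<and> z - r \<in> \<mm>))"
    by (rule root_residue[OF q0 _ _ _ z(1) closed]) (use lc k_V dq cq kr kalg_V in auto)
  then obtain r where r: "poly q r = 0" "z - r \<in> \<mm>"
    using p(2) by (auto simp: q_def pev_def)
  have "\<sigma> r = r" if \<sigma>: "\<sigma> \<in> \<Gamma>" for \<sigma>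
  proof -
    interpret \<sigma>: coeff_hom \<sigma>
      by (rule \<Gamma>(1)[OF \<sigma>])
    have m: "\<sigma> x \<in> \<mm>" if x: "x \<in> \<mm>" for x
    proof (cases "x = 0")
      case True
      then show ?thesis by (simp add: \<sigma>.hom_zero m_0)
    next
      case False
      have "\<sigma> x \<in> V"
        using \<Gamma>(2)[OF \<sigma>] m_V[OF x] by blast
      moreover have "inverse (\<sigma> x) \<notin> V"
      proof
        assume "inverse (\<sigma> x) \<in> V"
        then have "\<sigma> (inverse x) \<in> \<sigma> ` V"
          using \<Gamma>(2)[OF \<sigma>] field_hom_inverse[OF \<Gamma>(1)[OF \<sigma>], of x] by simp
        then obtain v where "v \<in> V" "\<sigma> (inverse x) = \<sigma> v"
          by blast
        then have "inverse x \<in> V"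
          using field_hom_inj[OF \<Gamma>(1)[OF \<sigma>]] by simp
        then show False
          using m_inverse[OF x False] by simp
      qed
      ultimately show ?thesis
        by (simp add: \<mm>_def)
    qed
    have "\<sigma> (z - r) = z - \<sigma> r"
      using z(3)[OF \<sigma>] by (simp add: \<sigma>.hom_diff)
    then have "z - \<sigma> r \<in> \<mm>"
      using m[OF r(2)] by simp
    then have "(z - r) - (z - \<sigma> r) \<in> \<mm>"
      by (rule m_diff[OF r(2)])
    then have d: "\<sigma> r - r \<in> \<mm>"
      by simp
    have "\<sigma> (pev p r) = pev p (\<sigma> r)"
      using \<Gamma>(3)[OF \<sigma>] pev_sum[OF order_refl, of p] by (simp add: \<sigma>.hom_sum \<sigma>.hom_mult \<sigma>.hom_power)
    then have "poly q (\<sigma> r) = 0"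
      using r(1) by (simp add: q_def pev_def \<sigma>.hom_zero)
    then have "kalg (\<sigma> r - r)"
      using kr r(1) sf_diff[OF is_subfield_algebraic[OF is_subfield_range[OF coeff_hom']]] by simp
    then have "\<sigma> r - r = 0"
      using kalg_m d by blast
    then show ?thesis
      by simp
  qed
  then obtain a where "r = \<phi> a"
    using fix_k[OF kr[OF r(1)]] by blast
  then show ?thesis
    using r(2) by blast
qed

theorem center_exists:
  fixes C :: "'k::field_char_0 proj_scheme" and \<phi> :: "'k \<Rightarrow> 'e::alg_closed_field" and \<Gamma> :: "('e \<Rightarrow> 'e) set"
  assumes "generic_point C \<phi> \<eta>" and curve: "smooth_projective_curve C" and V: "valring V" "\<And>c. \<phi> c \<in> V"
    and VK: "\<not> generic_point.K C \<phi> \<eta> \<subseteq> V"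
    and \<Gamma>: "\<And>\<sigma>. \<sigma> \<in> \<Gamma> \<Longrightarrow> coeff_hom \<sigma>" "\<And>\<sigma>. \<sigma> \<in> \<Gamma> \<Longrightarrow> \<sigma> ` V = V"
      "\<And>\<sigma> z. \<sigma> \<in> \<Gamma> \<Longrightarrow> z \<in> generic_point.K C \<phi> \<eta> \<Longrightarrow> \<sigma> z = z"
    and fix_k: "\<And>r. alg_over (range \<phi>) r \<Longrightarrow> (\<And>\<sigma>. \<sigma> \<in> \<Gamma> \<Longrightarrow> \<sigma> r = r) \<Longrightarrow> r \<in> range \<phi>"
  shows "\<exists>x\<in>rational_points C. V \<inter> generic_point.K C \<phi> \<eta> = generic_point.val C \<phi> \<eta> ` local_ring C x"
proof -
  interpret generic_point C \<phi> \<eta> by fact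
  interpret V: valring V by fact
  interpret P: place \<phi> V
    by unfold_locales (rule V(2))
  obtain t where t: "t \<in> K" "\<not> kalg t" "\<And>u. u \<in> K \<Longrightarrow> alg_over (gen t) u"
    using curve one_dimensional_iff unfolding smooth_projective_curve_def by blast
  have dependent: "alg_over (gen u) x" if "x \<in> K" "u \<in> K" "\<not> kalg u" for x u
    using exchange[OF t(2) that(3) t(3)[OF that(2)] t(3)[OF that(1)]] .
  obtain z0 where z0: "z0 \<in> K" "z0 \<notin> V"
    using VK by blast
  define u where "u = inverse z0"
  have u: "u \<in> V.\<mm>" "u \<noteq> 0" "u \<in> K"
    using V.not_V[OF z0(2)] z0 V.V_0 sf_inverse[OF is_subfield_K] by (auto simp: u_def)
  have nu: "\<not> kalg u"
    using P.kalg_m u by blast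
  have residue: "\<exists>a. z - \<phi> a \<in> V.\<mm>" if z: "z \<in> K" "z \<in> V" for z
  proof (rule P.residue_rational[where \<Gamma> = \<Gamma>, OF _ \<Gamma>(1,2) _ fix_k u(1,2) z(2)])
    show "\<exists>r. poly p r = 0" if "Polynomial.degree p > 0" for p :: "'e poly"
      using that alg_closed_imp_poly_has_root by blast
    show "\<sigma> (\<phi> c) = \<phi> c" if "\<sigma> \<in> \<Gamma>" for \<sigma> c
      using \<Gamma>(3)[OF that] range_in_K by blast
    show "dep u z"
      using dep_iff[OF nu] dependent[OF z(1) u(3) nu] by blast
    show "\<sigma> z = z" if "\<sigma> \<in> \<Gamma>" for \<sigma>
      using \<Gamma>(3)[OF that z(1)] .
  qed
  have ev_var: "ev (var_poly i) = \<eta> i" for i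
    by (simp add: ev_simps)
  obtain i0 where i0: "i0 \<le> n" "\<eta> i0 \<noteq> 0"
    using I_var form_van[OF forms_var] ev_var by metis
  \<comment> \<open>A coordinate of least valuation, found by adding the indices one at a
    time.\<close>
  have "\<exists>j\<le>n. \<eta> j \<noteq> 0 \<and> (\<forall>i\<in>A. \<eta> i / \<eta> j \<in> V)" if "finite A" "A \<subseteq> {..n}" for A
    using that
  proof (induction A)
    case empty
    then show ?case
      using i0 by blast
  next
    case (insert i A)
    then obtain j where j: "j \<le> n" "\<eta> j \<noteq> 0" "\<forall>i\<in>A. \<eta> i / \<eta> j \<in> V"
      by auto
    show ?case
    proof (cases "\<eta> i / \<eta> j \<in> V")
      case True
      then show ?thesis
        using j by auto
    next
      case False
      then have i: "\<eta> i \<noteq> 0" "\<eta> j / \<eta> i \<in> V"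
        using V.V_total[of "\<eta> i / \<eta> j"] V.V_0 by auto
      have "\<eta> l / \<eta> i \<in> V" if "l \<in> A" for l
      proof -
        have "\<eta> l / \<eta> j * (\<eta> j / \<eta> i) \<in> V"
          using j(3) that i(2) by (intro V.V_mult) auto
        then show ?thesis
          using j(2) by simp
      qed
      then show ?thesis
        using insert.prems i V.V_1 by (intro exI[of _ i]) auto
    qed
  qed
  from this[of "{..n}"] obtain j0 where j0: "j0 \<le> n" "\<eta> j0 \<noteq> 0" "\<And>i. i \<le> n \<Longrightarrow> \<eta> i / \<eta> j0 \<in> V"
    by auto
  have \<theta>K: "\<eta> i / \<eta> j0 \<in> K" if "i \<le> n" for i
  proof -
    have "(var_poly i, var_poly j0) \<in> fractions C"
      unfolding fractions_iff using forms_var[OF that] forms_var[OF j0(1)] j0(2) ev_var by auto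
    then show ?thesis
      using K_I ev_var by metis
  qed
  have "\<forall>i. \<exists>a. (i \<le> n \<longrightarrow> \<eta> i / \<eta> j0 - \<phi> a \<in> V.\<mm>)"
    using residue \<theta>K j0(3) by metis
  then obtain a0 where a0: "\<And>i. i \<le> n \<Longrightarrow> \<eta> i / \<eta> j0 - \<phi> (a0 i) \<in> V.\<mm>"
    by metis
  \<comment> \<open>The chosen residue at \<open>j0\<close> is replaced by 1 itself, and zeros are
    put beyond n, as a vector of homogeneous coordinates requires.\<close>
  define a where "a i = (if i > n then 0 else if i = j0 then 1 else a0 i)" for i
  interpret centered C \<phi> \<eta> V j0 a
  proof
    show "smooth_curve C"
      using curve by (simp add: smooth_projective_curve_def)
    show "j0 \<le> n" "\<eta> j0 \<noteq> 0"
      using j0 by auto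
    show "\<eta> i / \<eta> j0 \<in> V" if "i \<le> n" for i
      using j0(3)[OF that] .
    show "\<eta> i / \<eta> j0 - \<phi> (a i) \<in> V.\<mm>" if "i \<le> n" for i
      using a0[OF that] that j0(2) V.m_0 hom_one by (simp add: a_def)
    show "a j0 = 1" "\<And>i. i > n \<Longrightarrow> a i = 0"
      using j0(1) by (auto simp: a_def)
    show "alg_over (gen u) x" if "x \<in> K" "u \<in> K" "\<not> kalg u" for x u
      using dependent[OF that] .
    show "\<not> K \<subseteq> V"
      by (rule VK)
  qed
  show ?thesis
    using point_rational V_K local_ring_R by metis
qed

section \<open>Twisting by a quadratic character\<close>

text \<open>Hilbert 90 for a quadratic character that is trivial on the automorphisms fixing B. The
  elements of B are treated one at a time: the stabilizer of b has a solution b' by induction, and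
  sums over the orbit of b turn b' w into an element invariant under all of \<Gamma>.\<close>

lemma (in field_extension_hom) twist:
  fixes \<Gamma> :: "('e \<Rightarrow> 'e) set"
  assumes "finite B" "\<And>b. b \<in> B \<Longrightarrow> kalg b"
    and "\<And>\<sigma>. \<sigma> \<in> \<Gamma> \<Longrightarrow> coeff_hom \<sigma>" "\<And>\<sigma> c. \<sigma> \<in> \<Gamma> \<Longrightarrow> \<sigma> (\<phi> c) = \<phi> c"
    and "(\<lambda>x. x) \<in> \<Gamma>" "\<And>\<sigma> \<tau>. \<sigma> \<in> \<Gamma> \<Longrightarrow> \<tau> \<in> \<Gamma> \<Longrightarrow> (\<lambda>x. \<sigma> (\<tau> x)) \<in> \<Gamma>"
      "\<And>\<sigma>. \<sigma> \<in> \<Gamma> \<Longrightarrow> \<exists>\<tau>\<in>\<Gamma>. \<forall>x. \<tau> (\<sigma> x) = x \<and> \<sigma> (\<tau> x) = x"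
    and w: "w \<noteq> 0" "\<And>\<sigma>. \<sigma> \<in> \<Gamma> \<Longrightarrow> \<sigma> w = w \<or> \<sigma> w = - w"
      "\<And>\<sigma>. \<sigma> \<in> \<Gamma> \<Longrightarrow> (\<And>b. b \<in> B \<Longrightarrow> \<sigma> b = b) \<Longrightarrow> \<sigma> w = w"
  shows "\<exists>b. kalg b \<and> b \<noteq> 0 \<and> (\<forall>\<sigma>\<in>\<Gamma>. \<sigma> (b * w) = b * w)"
  using assms(1-7) w(2,3)
proof (induction B arbitrary: \<Gamma>)
  case empty
  have "kalg 1"
    using alg_over_self[OF is_subfield_range[OF coeff_hom'], of 1] sf_1[OF is_subfield_range[OF coeff_hom']] by simp
  then show ?case
    using empty.prems(8) by (intro exI[of _ 1]) auto
next
  case (insert b B)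
  note hom = insert.prems(2) and fixk = insert.prems(3) and idG = insert.prems(4) and comp = insert.prems(5)
    and inverse = insert.prems(6) and wpm = insert.prems(7)
  have sM: "is_subfield {x. kalg x}"
    by (rule is_subfield_algebraic[OF is_subfield_range[OF coeff_hom']])
  have \<sigma>_pev: "\<sigma> (pev p x) = pev p (\<sigma> x)" if "\<sigma> \<in> \<Gamma>" for \<sigma> p x
  proof -
    interpret \<sigma>: coeff_hom \<sigma>
      by (rule hom[OF that])
    show ?thesis
      using fixk[OF that] pev_sum[OF order_refl, of p] by (simp add: \<sigma>.hom_sum \<sigma>.hom_mult \<sigma>.hom_power)
  qed
  have \<sigma>_kalg: "kalg (\<sigma> x)" if "\<sigma> \<in> \<Gamma>" "kalg x" for \<sigma> x
    using that \<sigma>_pev coeff_hom.hom_zero[OF hom[OF that(1)]] unfolding kalg_iff by metis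
  define \<Gamma>' where "\<Gamma>' = {\<sigma>\<in>\<Gamma>. \<sigma> b = b}"
  have "\<exists>b'. kalg b' \<and> b' \<noteq> 0 \<and> (\<forall>\<sigma>\<in>\<Gamma>'. \<sigma> (b' * w) = b' * w)"
  proof (rule insert.IH)
    show "\<exists>\<tau>\<in>\<Gamma>'. \<forall>x. \<tau> (\<sigma> x) = x \<and> \<sigma> (\<tau> x) = x" if \<sigma>: "\<sigma> \<in> \<Gamma>'" for \<sigma>
    proof -
      have \<sigma>': "\<sigma> \<in> \<Gamma>" "\<sigma> b = b"
        using \<sigma> by (simp_all add: \<Gamma>'_def)
      obtain \<tau> where \<tau>: "\<tau> \<in> \<Gamma>" "\<forall>x. \<tau> (\<sigma> x) = x \<and> \<sigma> (\<tau> x) = x"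
        using inverse[OF \<sigma>'(1)] by blast
      then have "\<tau> (\<sigma> b) = b"
        by blast
      then have "\<tau> \<in> \<Gamma>'"
        using \<tau>(1) \<sigma>'(2) by (simp add: \<Gamma>'_def)
      then show ?thesis
        using \<tau>(2) by blast
    qed
    show "\<sigma> w = w" if "\<sigma> \<in> \<Gamma>'" "\<And>b. b \<in> B \<Longrightarrow> \<sigma> b = b" for \<sigma>
      using insert.prems(8)[of \<sigma>] that by (auto simp: \<Gamma>'_def)
  qed (use insert.prems in \<open>auto simp: \<Gamma>'_def\<close>)
  then obtain b' where b': "kalg b'" "b' \<noteq> 0" "\<And>\<sigma>. \<sigma> \<in> \<Gamma>' \<Longrightarrow> \<sigma> (b' * w) = b' * w"
    by blast
  define orb where "orb = (\<lambda>\<sigma>. \<sigma> b) ` \<Gamma>"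
  have "finite orb"
  proof -
    obtain p where p: "p \<noteq> 0" "pev p b = 0"
      using insert.prems(1)[of b] kalg_iff by auto
    have "map_poly \<phi> p \<noteq> 0"
      using p(1) field_hom_inj[OF coeff_hom', of "Polynomial.lead_coeff p" 0] hom_zero
      by (metis coeff_0 coeff_map_poly leading_coeff_0_iff)
    moreover have "orb \<subseteq> {x. poly (map_poly \<phi> p) x = 0}"
      using \<sigma>_pev[of _ p b] p(2) coeff_hom.hom_zero[OF hom] by (auto simp: orb_def pev_def)
    ultimately show ?thesis
      using poly_roots_finite finite_subset by blast
  qed
  define rep where "rep x = (SOME \<sigma>. \<sigma> \<in> \<Gamma> \<and> \<sigma> b = x)" for x
  have rep: "rep x \<in> \<Gamma>" "rep x b = x" if "x \<in> orb" for x
    using that someI_ex[of "\<lambda>\<sigma>. \<sigma> \<in> \<Gamma> \<and> \<sigma> b = x"] by (auto simp: orb_def rep_def)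
  \<comment> \<open>The image of b' w under any \<sigma> that takes b to x; it does not depend on
    \<sigma>, because the stabilizer of b fixes b' w.\<close>
  define F where "F x = rep x (b' * w)" for x
  have F_eq: "\<sigma> (b' * w) = F (\<sigma> b)" if \<sigma>: "\<sigma> \<in> \<Gamma>" for \<sigma>
  proof -
    have x: "\<sigma> b \<in> orb"
      using \<sigma> by (auto simp: orb_def)
    obtain \<tau> where \<tau>: "\<tau> \<in> \<Gamma>" "\<forall>x. \<tau> (\<sigma> x) = x \<and> \<sigma> (\<tau> x) = x"
      using inverse[OF \<sigma>] by blast
    have "(\<lambda>x. \<tau> (rep (\<sigma> b) x)) \<in> \<Gamma>'"
      using comp[OF \<tau>(1) rep(1)[OF x]] rep(2)[OF x] \<tau>(2) by (simp add: \<Gamma>'_def)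
    then have "\<tau> (rep (\<sigma> b) (b' * w)) = b' * w"
      by (rule b'(3))
    then show ?thesis
      using \<tau>(2) unfolding F_def by metis
  qed
  have F_kalg: "kalg (F x / w)" "F x \<noteq> 0" if x: "x \<in> orb" for x
  proof -
    interpret r: coeff_hom "rep x"
      by (rule hom[OF rep(1)[OF x]])
    have "F x = rep x b' * rep x w"
      by (simp add: F_def r.hom_mult)
    then have "F x / w = rep x b' \<or> F x / w = - rep x b'"
      using wpm[OF rep(1)[OF x]] w(1) by auto
    moreover have k: "kalg (rep x b')"
      by (rule \<sigma>_kalg[OF rep(1)[OF x] b'(1)])
    then have "kalg (- rep x b')"
      using sf_uminus[OF sM, of "rep x b'"] by simp
    ultimately show "kalg (F x / w)"
      using k by metis
    have "rep x b' \<noteq> 0"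
      using field_hom_inj[OF hom[OF rep(1)[OF x]], of b' 0] b'(2) r.hom_zero by simp
    then show "F x \<noteq> 0"
      using \<open>F x / w = _ \<or> _\<close> by auto
  qed
  \<comment> \<open>Invariant under \<Gamma>, which permutes the orbit. Not all of these sums
    vanish, as in a Vandermonde argument: a polynomial that is zero on the orbit except at b
    isolates the nonzero \<open>F b\<close>.\<close>
  define W where "W j = (\<Sum>x\<in>orb. x ^ j * F x)" for j
  have W_fix: "\<sigma> (W j) = W j" if \<sigma>: "\<sigma> \<in> \<Gamma>" for \<sigma> j
  proof -
    interpret s: coeff_hom \<sigma>
      by (rule hom[OF \<sigma>])
    have sF: "\<sigma> (F x) = F (\<sigma> x)" if x: "x \<in> orb" for x
      using F_eq[OF comp[OF \<sigma> rep(1)[OF x]]] rep(2)[OF x] by (simp add: F_def)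
    have "bij_betw \<sigma> orb orb"
    proof (rule bij_betwI')
      show "\<sigma> x = \<sigma> y \<longleftrightarrow> x = y" for x y
        by (rule field_hom_inj[OF hom[OF \<sigma>]])
      show "\<sigma> x \<in> orb" if "x \<in> orb" for x
        using that comp[OF \<sigma>] by (force simp: orb_def)
      show "\<exists>x\<in>orb. y = \<sigma> x" if yO: "y \<in> orb" for y
      proof -
        obtain \<rho> where \<rho>: "\<rho> \<in> \<Gamma>" "y = \<rho> b"
          using yO by (auto simp: orb_def)
        obtain \<tau> where \<tau>: "\<tau> \<in> \<Gamma>" "\<forall>x. \<tau> (\<sigma> x) = x \<and> \<sigma> (\<tau> x) = x"
          using inverse[OF \<sigma>] by blast
        have "\<tau> (\<rho> b) \<in> orb"
          using comp[OF \<tau>(1) \<rho>(1)] by (force simp: orb_def)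
        then show ?thesis
          using \<tau>(2) \<rho>(2) by metis
      qed
    qed
    then have "(\<Sum>x\<in>orb. \<sigma> x ^ j * F (\<sigma> x)) = W j"
      unfolding W_def by (rule sum.reindex_bij_betw)
    then show ?thesis
      using sF by (simp add: W_def s.hom_sum s.hom_mult s.hom_power)
  qed
  have "\<exists>j. W j \<noteq> 0"
  proof (rule ccontr)
    assume "\<not> ?thesis"
    then have W0: "W j = 0" for j
      by simp
    have q0: "(\<Sum>x\<in>orb. poly q x * F x) = 0" for q
    proof -
      have "(\<Sum>x\<in>orb. poly q x * F x) = (\<Sum>x\<in>orb. \<Sum>j\<le>Polynomial.degree q. coeff q j * (x ^ j * F x))"
        by (simp add: poly_altdef sum_distrib_right mult.assoc)
      also have "\<dots> = (\<Sum>j\<le>Polynomial.degree q. coeff q j * W j)"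
        by (subst sum.swap) (simp add: W_def sum_distrib_left)
      finally show ?thesis
        by (simp add: W0)
    qed
    have bO: "b \<in> orb"
      using idG by (force simp: orb_def)
    define q where "q = (\<Prod>y\<in>orb - {b}. [:- y, 1:])"
    have "poly q x * F x = 0" if "x \<in> orb - {b}" for x
      using that \<open>finite orb\<close> by (auto simp: q_def poly_prod)
    then have "(\<Sum>x\<in>orb - {b}. poly q x * F x) = 0"
      by (intro sum.neutral ballI)
    then have "(\<Sum>x\<in>orb. poly q x * F x) = poly q b * F b"
      using sum.remove[OF \<open>finite orb\<close> bO, of "\<lambda>x. poly q x * F x"] by simp
    moreover have "poly q b \<noteq> 0"
      using \<open>finite orb\<close> by (auto simp: q_def poly_prod)
    ultimately show False
      using q0[of q] F_kalg(2)[OF bO] by simp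
  qed
  then obtain j where j: "W j \<noteq> 0"
    by blast
  have xk: "kalg x" if "x \<in> orb" for x
    using that \<sigma>_kalg insert.prems(1) by (auto simp: orb_def)
  have "W j / w = (\<Sum>x\<in>orb. x ^ j * (F x / w))"
    by (simp add: W_def sum_divide_distrib)
  moreover have "(\<Sum>x\<in>orb. x ^ j * (F x / w)) \<in> {x. kalg x}"
    using F_kalg xk by (intro sf_sum[OF sM] sf_mult[OF sM] sf_power[OF sM]) auto
  ultimately have "kalg (W j / w)"
    by simp
  moreover have "W j / w \<noteq> 0" "W j / w * w = W j"
    using j w(1) by auto
  ultimately show ?case
    using W_fix by (intro exI[of _ "W j / w"]) simp
qed

section \<open>Galois groups\<close>

lemma poly_over_hom:
  fixes M :: "'e::field set"
  assumes M: "is_subfield M" and F: "F \<subseteq> M"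
    and g: "\<And>x y. x \<in> M \<Longrightarrow> y \<in> M \<Longrightarrow> g (x + y) = g x + g y \<and> g (x * y) = g x * g y"
    and gF: "\<And>x. x \<in> F \<Longrightarrow> g x = x" and F0: "is_subfield F" and x: "x \<in> M"
  shows "poly_over F p \<Longrightarrow> g (poly p x) = poly p (g x)"
proof (induction p)
  case 0
  then show ?case
    using gF sf_0[OF F0] by simp
next
  case (pCons a p)
  then have a: "a \<in> F" "poly_over F p"
    by (simp_all add: poly_over_pCons[OF F0])
  moreover have pM: "poly p x \<in> M"
    using poly_over_poly[OF M poly_over_mono[OF F a(2)] x] .
  ultimately show ?case
    using pCons.IH g[of a "x * poly p x"] g[OF x pM] gF[OF a(1)] F sf_mult[OF M x pM] by auto
qed

text \<open>A minimal polynomial is separable in characteristic 0: at a double root its derivative,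
  of lower degree and not zero, would vanish. It is not linear either, since r is not in F.\<close>

lemma second_root:
  fixes F :: "'e::alg_closed_field set"
  assumes F: "is_subfield F" and p: "poly_over F p" "p \<noteq> 0" "poly p r = 0"
    and min: "\<And>q. poly_over F q \<Longrightarrow> q \<noteq> 0 \<Longrightarrow> poly q r = 0 \<Longrightarrow> Polynomial.degree p \<le> Polynomial.degree q"
    and char: "\<And>m :: nat. m > 0 \<Longrightarrow> of_nat m \<noteq> (0 :: 'e)" and r: "r \<notin> F"
  shows "\<exists>r'. poly p r' = 0 \<and> r' \<noteq> r"
proof -
  define d where "d = Polynomial.degree p"
  obtain q where q: "p = [:- r, 1:] * q"
    using p(3) by (auto simp: poly_eq_0_iff_dvd)
  have q0: "q \<noteq> 0"
    using p(2) q by auto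
  have d: "d = Suc (Polynomial.degree q)"
    unfolding d_def q using q0 by (subst degree_mult_eq) auto
  have "Polynomial.degree q \<noteq> 0"
  proof
    assume "Polynomial.degree q = 0"
    then obtain c where c: "q = [:c:]"
      by (meson degree_eq_zeroE)
    then have "p = [:- r * c, c:]"
      using q by simp
    then have "c \<in> F" "- r * c \<in> F" "c \<noteq> 0"
      using p F by (auto simp: poly_over_pCons[OF F])
    then have "- (- r * c / c) \<in> F"
      using F by (intro sf_uminus sf_divide)
    then show False
      using \<open>c \<noteq> 0\<close> r by simp
  qed
  then obtain r' where r': "poly q r' = 0"
    using alg_closed_imp_poly_has_root by blast
  have "poly q r \<noteq> 0"
  proof
    assume "poly q r = 0"
    then have z: "poly (pderiv p) r = 0"
      unfolding q by (simp only: pderiv_mult) (simp add: pderiv_pCons)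
    have "(of_nat i :: 'e) \<in> F" for i
      by (induction i) (auto intro!: sf_0[OF F] sf_add[OF F] sf_1[OF F])
    then have "poly_over F (pderiv p)"
      using p(1) F by (auto simp: poly_over_def coeff_pderiv intro!: sf_mult simp del: of_nat_Suc)
    moreover have "coeff (pderiv p) (d - 1) = of_nat d * Polynomial.lead_coeff p"
      using d by (simp add: coeff_pderiv del: of_nat_Suc flip: d_def)
    then have "coeff (pderiv p) (d - 1) \<noteq> 0"
      using p(2) d char[of d] by (simp del: of_nat_Suc)
    then have "pderiv p \<noteq> 0"
      by auto
    moreover have "Polynomial.degree (pderiv p) \<le> d - 1"
      by (rule degree_le) (auto simp: coeff_pderiv d_def coeff_eq_0)
    ultimately show False
      using min[of "pderiv p"] z d d_def by auto
  qed
  then have "r' \<noteq> r"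
    using r' by auto
  then show ?thesis
    using r' q by (intro exI[of _ r']) simp
qed

text \<open>r is sent to another root of its minimal polynomial, and the embedding is extended to
  all elements algebraic over k. It is onto since it maps the finite set of roots of any nonzero
  polynomial over k injectively into itself.\<close>

lemma conjugate_automorphism:
  fixes \<phi> :: "'k::field_char_0 \<Rightarrow> 'e::alg_closed_field"
  assumes \<phi>: "coeff_hom \<phi>" and r: "alg_over (range \<phi>) r" "r \<notin> range \<phi>"
  defines "M \<equiv> {x. alg_over (range \<phi>) x}"
  shows "\<exists>g. bij_betw g M M \<and> (\<forall>x\<in>M. \<forall>y\<in>M. g (x + y) = g x + g y \<and> g (x * y) = g x * g y) \<and>
    (\<forall>c. g (\<phi> c) = \<phi> c) \<and> g r \<noteq> r"
proof -
  let ?F = "range \<phi>" and ?R = "ring_of_type_algebra :: 'e ring"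
  interpret R: field ?R by (rule field_from_type_algebra)
  have F: "is_subfield ?F"
    by (rule is_subfield_range[OF \<phi>])
  have M: "is_subfield M"
    unfolding M_def by (rule is_subfield_algebraic[OF F])
  have FM: "?F \<subseteq> M"
    unfolding M_def using alg_over_self[OF F] by blast
  have char: "of_nat m \<noteq> (0 :: 'e)" if "m > 0" for m :: nat
    using field_hom_inj[OF \<phi>, of "of_nat m" 0] that coeff_hom.hom_of_nat[OF \<phi>, of m] coeff_hom.hom_zero[OF \<phi>] by simp
  obtain p where p: "poly_over ?F p" "p \<noteq> 0" "poly p r = 0"
    and min: "\<And>q. poly_over ?F q \<Longrightarrow> q \<noteq> 0 \<Longrightarrow> poly q r = 0 \<Longrightarrow> Polynomial.degree p \<le> Polynomial.degree q"
    using minimal_polynomial[OF r(1)] by blast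
  obtain r' where r': "poly p r' = 0" "r' \<noteq> r"
    using second_root[OF F p min char r(2)] by blast
  define G0 where "G0 = {(x :: 'e, x) | x. x \<in> ?F}"
  have "field_emb ?R ?F (\<lambda>x. x)"
    by unfold_locales (auto simp: F a_minus_def)
  then have G0: "R.hom_graph G0"
    unfolding G0_def by (rule R.emb_hom_graph)
  have D0: "Domain G0 = ?F"
    unfolding G0_def by blast
  have f0: "R.fun_of G0 x = x" if "x \<in> ?F" for x
    using R.fun_of_iff[OF G0, of x x] that D0 by (simp add: G0_def)
  interpret E0: field_emb ?R "Domain G0" "R.fun_of G0"
    by (rule R.hom_graph_emb[OF G0])
  have T: "E0.T b q = poly q b" if q: "poly_over (Domain G0) q" for b q
  proof -
    have "set (coeffs q) \<subseteq> ?F"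
      using q D0 by (auto simp: poly_over_def coeffs_def split: if_splits)
    then have "map (R.fun_of G0) (rev (coeffs q)) = rev (coeffs q)"
      using f0 by (intro map_idI) auto
    then show ?thesis
      using E0.eval_emb_coeffs[OF _ q, of b] by (simp add: eval_rota)
  qed
  have "E0.T r' q = \<zero>\<^bsub>?R\<^esub> \<longleftrightarrow> poly q r = 0" if q: "poly_over (Domain G0) q" for q
    by (rule E0.root_iff[OF _ _ p(2,3) _ _ q]) (use p(1) r' min in \<open>simp_all add: D0 T\<close>)
  then obtain G1 where G1: "R.hom_graph G1" "G0 \<subseteq> G1" "(r, r') \<in> G1"
    "\<And>N. is_subfield N \<Longrightarrow> Domain G0 \<subseteq> N \<Longrightarrow> r \<in> N \<Longrightarrow> Domain G1 \<subseteq> N"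
    using R.hom_graph_simple_extension[OF G0, of r' r] by (metis UNIV_I rota_simps(1))
  have "Domain G1 \<subseteq> M"
    using G1(4)[OF M] D0 FM r(1) by (simp add: M_def)
  moreover have "alg_over (Domain G1) a" if "a \<in> M" for a
    using that alg_over_mono[OF Domain_mono[OF G1(2)]] D0 by (simp add: M_def)
  ultimately obtain G where G: "R.hom_graph G" "G1 \<subseteq> G" "Domain G = M"
    using R.extend_embedding[OF rota_has_roots G1(1) M] by (metis rota_simps(1))
  define g where "g = R.fun_of G"
  interpret E: field_emb ?R M g
    unfolding g_def using R.hom_graph_emb[OF G(1)] G(3) by simp
  have gG: "g x = y" if "(x, y) \<in> G" for x y
    using R.fun_of_iff[OF G(1), of x y] that by (auto simp: g_def)
  have hom: "g (x + y) = g x + g y \<and> g (x * y) = g x * g y" if "x \<in> M" "y \<in> M" for x y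
    using E.emb_add[OF that] E.emb_mult[OF that] by simp
  have gF: "g x = x" if "x \<in> ?F" for x
    using gG[of x x] that G0_def G1(2) G(2) by blast
  have inj: "inj_on g M"
  proof (rule inj_onI)
    fix x y assume xy: "x \<in> M" "y \<in> M" "g x = g y"
    then have "g (x - y) = 0"
      using E.emb_diff[OF xy(1,2)] by (simp add: a_minus_def)
    then show "x = y"
      using E.emb_nonzero[OF sf_diff[OF M xy(1,2)]] by auto
  qed
  have "\<exists>S. finite S \<and> y \<in> S \<and> S \<subseteq> M \<and> g ` S \<subseteq> S" if "y \<in> M" for y
  proof -
    obtain q where q: "q \<noteq> 0" "poly_over ?F q" "poly q y = 0"
      using \<open>y \<in> M\<close> by (auto simp: M_def alg_over_def)
    let ?S = "{x. poly q x = 0}"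
    have S: "?S \<subseteq> M"
      unfolding M_def alg_over_def using q by blast
    have "poly q (g x) = 0" if "poly q x = 0" for x
      using poly_over_hom[OF M FM hom gF F _ q(2), of x] S that gF[OF sf_0[OF F]] by auto
    then show ?thesis
      using poly_roots_finite[OF q(1)] S q(3) by (intro exI[of _ ?S]) blast
  qed
  note orbit = this
  have "g ` M = M"
  proof (intro subset_antisym subsetI)
    fix y assume "y \<in> g ` M"
    then obtain x where x: "x \<in> M" "y = g x"
      by blast
    then show "y \<in> M"
      using orbit[OF x(1)] by blast
  next
    fix y assume "y \<in> M"
    then obtain S where S: "finite S" "y \<in> S" "S \<subseteq> M" "g ` S \<subseteq> S"
      using orbit by blast
    then have "g ` S = S"
      using endo_inj_surj[OF S(1,4) inj_on_subset[OF inj S(3)]] by simp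
    then show "y \<in> g ` M"
      using S(2,3) by blast
  qed
  moreover have "g r \<noteq> r"
    using gG[of r r'] G1(3) G(2) r'(2) by blast
  ultimately show ?thesis
    using inj hom gF by (intro exI[of _ g]) (auto simp: bij_betw_def)
qed

section \<open>Galois groups as groups, and the Krull topology\<close>

lemma galois_group_simps:
  "carrier (galois_group E F) = {\<sigma> \<in> ring_iso E E \<inter> extensional (carrier E). \<forall>x\<in>F. \<sigma> x = x}"
  "monoid.mult (galois_group E F) \<sigma> \<tau> = compose (carrier E) \<sigma> \<tau>"
  "one (galois_group E F) = (\<lambda>x\<in>carrier E. x)"
  by (simp_all add: galois_group_def)

lemma (in ring) restrict_galois:
  assumes "f \<in> ring_iso R R" "F \<subseteq> carrier R" "\<And>x. x \<in> F \<Longrightarrow> f x = x"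
  shows "restrict f (carrier R) \<in> carrier (galois_group R F)"
proof -
  have "restrict f (carrier R) \<in> ring_iso R R"
    using assms(1) by (rule ring_iso_restrict) simp
  then show ?thesis
    using assms(2,3) by (auto simp: galois_group_simps)
qed

lemma (in ring) group_galois_group:
  assumes F: "F \<subseteq> carrier R"
  shows "group (galois_group R F)"
proof (rule groupI)
  fix \<sigma> \<tau> assume s: "\<sigma> \<in> carrier (galois_group R F)" "\<tau> \<in> carrier (galois_group R F)"
  then have "\<sigma> \<circ> \<tau> \<in> ring_iso R R" "\<And>x. x \<in> F \<Longrightarrow> (\<sigma> \<circ> \<tau>) x = x"
    using ring_iso_set_trans[of \<tau> R R \<sigma> R] by (auto simp: galois_group_simps)
  from restrict_galois[OF this(1) F this(2)] show "\<sigma> \<otimes>\<^bsub>galois_group R F\<^esub> \<tau> \<in> carrier (galois_group R F)"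
    by (simp add: galois_group_simps compose_def o_def)
next
  have "id \<in> ring_iso R R"
    by (rule ring_iso_memI) auto
  from restrict_galois[OF this F] show "\<one>\<^bsub>galois_group R F\<^esub> \<in> carrier (galois_group R F)"
    by (simp add: galois_group_simps id_def)
next
  fix \<rho> \<sigma> \<tau> assume "\<rho> \<in> carrier (galois_group R F)" "\<sigma> \<in> carrier (galois_group R F)" "\<tau> \<in> carrier (galois_group R F)"
  moreover have "\<tau> x \<in> carrier R" if "\<tau> \<in> carrier (galois_group R F)" "x \<in> carrier R" for \<tau> x
    using that ring_iso_memE(1)[of \<tau> R R x] by (simp add: galois_group_simps)
  ultimately show "\<rho> \<otimes>\<^bsub>galois_group R F\<^esub> \<sigma> \<otimes>\<^bsub>galois_group R F\<^esub> \<tau> = \<rho> \<otimes>\<^bsub>galois_group R F\<^esub> (\<sigma> \<otimes>\<^bsub>galois_group R F\<^esub> \<tau>)"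
    by (auto simp: galois_group_simps(2) compose_def restrict_def)
next
  fix \<tau> assume t: "\<tau> \<in> carrier (galois_group R F)"
  then show "\<one>\<^bsub>galois_group R F\<^esub> \<otimes>\<^bsub>galois_group R F\<^esub> \<tau> = \<tau>"
    using ring_iso_memE(1)[of \<tau> R R]
    by (auto simp: galois_group_simps compose_def restrict_def extensional_def)
  have \<tau>: "\<tau> \<in> ring_iso R R" "\<And>x. x \<in> F \<Longrightarrow> \<tau> x = x"
    using t by (auto simp: galois_group_simps)
  have b: "inj_on \<tau> (carrier R)"
    using ring_iso_memE(5)[OF \<tau>(1)] by (rule bij_betw_imp_inj_on)
  define \<rho> where "\<rho> = restrict (inv_into (carrier R) \<tau>) (carrier R)"
  have "\<rho> \<in> carrier (galois_group R F)"
    unfolding \<rho>_def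
  proof (rule restrict_galois[OF ring_iso_set_sym[OF ring_axioms \<tau>(1)] F])
    show "inv_into (carrier R) \<tau> x = x" if "x \<in> F" for x
      using inv_into_f_f[OF b, of x] \<tau>(2)[OF that] F that by auto
  qed
  moreover have "\<rho> \<otimes>\<^bsub>galois_group R F\<^esub> \<tau> = \<one>\<^bsub>galois_group R F\<^esub>"
    using b ring_iso_memE(1)[OF \<tau>(1)] by (auto simp: galois_group_simps \<rho>_def compose_def restrict_def)
  ultimately show "\<exists>\<rho>\<in>carrier (galois_group R F). \<rho> \<otimes>\<^bsub>galois_group R F\<^esub> \<tau> = \<one>\<^bsub>galois_group R F\<^esub>"
    by blast
qed

text \<open>The Krull topology is that of pointwise convergence: an automorphism is determined on a
  finite extension by its values on a finite basis, and a finite set of algebraic elements generates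
  a finite extension. Intermediate fields, which depend on F, disappear from the
  description.\<close>

lemma (in field) openin_krull_iff:
  assumes F: "subfield F R" and alg: "\<And>x. x \<in> carrier R \<Longrightarrow> (algebraic over F) x"
  defines "G \<equiv> carrier (galois_group R F)"
  shows "openin (krull_topology R F) U \<longleftrightarrow>
    U \<subseteq> G \<and> (\<forall>\<tau>0\<in>U. \<exists>B. finite B \<and> B \<subseteq> carrier R \<and> (\<forall>\<tau>\<in>G. (\<forall>b\<in>B. \<tau> b = \<tau>0 b) \<longrightarrow> \<tau> \<in> U))"
    (is "_ \<longleftrightarrow> ?P U")
proof
  have G: "\<tau> \<in> ring_hom R R" "\<And>x. x \<in> F \<Longrightarrow> \<tau> x = x" if "\<tau> \<in> G" for \<tau>
    using that unfolding G_def galois_group_simps ring_iso_def by blast+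
  have FR: "F \<subseteq> carrier R"
    using subfieldE(3)[OF F] .
  show "?P U" if "openin (krull_topology R F) U"
    using that unfolding krull_topology_def openin_topology_generated_by_iff
  proof (induction rule: generate_topology_on.induct)
    case Empty
    then show ?case by simp
  next
    case (Int a b)
    show ?case
    proof (intro conjI ballI)
      show "a \<inter> b \<subseteq> G"
        using Int by blast
      fix \<tau>0 assume "\<tau>0 \<in> a \<inter> b"
      then have "\<tau>0 \<in> a" "\<tau>0 \<in> b"
        by simp_all
      obtain A where A: "finite A" "A \<subseteq> carrier R" "\<forall>\<tau>\<in>G. (\<forall>b\<in>A. \<tau> b = \<tau>0 b) \<longrightarrow> \<tau> \<in> a"
        using bspec[OF conjunct2[OF Int.IH(1)] \<open>\<tau>0 \<in> a\<close>] by blast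
      obtain B where B: "finite B" "B \<subseteq> carrier R" "\<forall>\<tau>\<in>G. (\<forall>b\<in>B. \<tau> b = \<tau>0 b) \<longrightarrow> \<tau> \<in> b"
        using bspec[OF conjunct2[OF Int.IH(2)] \<open>\<tau>0 \<in> b\<close>] by blast
      show "\<exists>B. finite B \<and> B \<subseteq> carrier R \<and> (\<forall>\<tau>\<in>G. (\<forall>b\<in>B. \<tau> b = \<tau>0 b) \<longrightarrow> \<tau> \<in> a \<inter> b)"
      proof (intro exI[of _ "A \<union> B"] conjI ballI impI IntI)
        fix \<tau> assume t: "\<tau> \<in> G" "\<forall>b\<in>A \<union> B. \<tau> b = \<tau>0 b"
        show "\<tau> \<in> a"
          using A(3) t by simp
        show "\<tau> \<in> b"
          using B(3) t by simp
      qed (use A B in simp_all)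
    qed
  next
    case (UN K)
    show ?case
    proof (intro conjI ballI)
      show "\<Union>K \<subseteq> G"
        using UN.IH by blast
      fix \<tau>0 assume "\<tau>0 \<in> \<Union>K"
      then obtain k where k: "k \<in> K" "\<tau>0 \<in> k"
        by (rule UnionE)
      obtain B where B: "finite B" "B \<subseteq> carrier R" "\<forall>\<tau>\<in>G. (\<forall>b\<in>B. \<tau> b = \<tau>0 b) \<longrightarrow> \<tau> \<in> k"
        using bspec[OF conjunct2[OF UN.IH[OF k(1)]] k(2)] by blast
      show "\<exists>B. finite B \<and> B \<subseteq> carrier R \<and> (\<forall>\<tau>\<in>G. (\<forall>b\<in>B. \<tau> b = \<tau>0 b) \<longrightarrow> \<tau> \<in> \<Union>K)"
        using B UnionI[OF k(1)] by (intro exI[of _ B]) simp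
    qed
  next
    case (Basis s)
    then obtain \<sigma> M where s: "s = {\<tau> \<in> G. \<forall>x\<in>M. \<tau> x = \<sigma> x}" and M: "finite_dimension F M"
      unfolding G_def by blast
    obtain n where "dimension n F M"
      using finite_dimensionE[OF F M] by blast
    then obtain Vs where Vs: "set Vs \<subseteq> carrier R" "Span F Vs = M"
      using exists_base[OF F] by blast
    have agree: "\<forall>x\<in>Span F Us. \<tau> x = \<tau>' x"
      if t: "\<tau> \<in> G" "\<tau>' \<in> G" "set Us \<subseteq> carrier R" "\<forall>b\<in>set Us. \<tau> b = \<tau>' b" for \<tau> \<tau>' Us
      using t(3,4)
    proof (induction Us)
      case Nil
      then show ?case
        using G(2)[OF t(1)] G(2)[OF t(2)] subringE(2)[OF subfieldE(1)[OF F]] by simp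
    next
      case (Cons u Us)
      show ?case
      proof
        fix x assume "x \<in> Span F (u # Us)"
        then obtain k v where kv: "k \<in> F" "v \<in> Span F Us" "x = k \<otimes> u \<oplus> v"
          using line_extension_mem_iff by auto
        have vR: "v \<in> carrier R"
          using Span_in_carrier[OF FR, of Us] kv(2) Cons.prems by auto
        have x: "\<rho> x = k \<otimes> \<rho> u \<oplus> \<rho> v" if "\<rho> \<in> G" for \<rho>
          using G[OF that] kv vR FR Cons.prems by (auto simp: ring_hom_add ring_hom_mult)
        have "\<tau> v = \<tau>' v" "\<tau> u = \<tau>' u"
          using Cons.IH Cons.prems kv(2) by simp_all
        then show "\<tau> x = \<tau>' x"
          unfolding x[OF t(1)] x[OF t(2)] by simp
      qed
    qed
    show ?case
    proof (intro conjI ballI)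
      show "s \<subseteq> G"
        using s by blast
      fix \<tau>0 assume t0: "\<tau>0 \<in> s"
      have "\<tau> \<in> s" if "\<tau> \<in> G" "\<forall>b\<in>set Vs. \<tau> b = \<tau>0 b" for \<tau>
        using agree[OF that(1) _ Vs(1) that(2)] that(1) t0 Vs(2) unfolding s by simp
      then show "\<exists>B. finite B \<and> B \<subseteq> carrier R \<and> (\<forall>\<tau>\<in>G. (\<forall>b\<in>B. \<tau> b = \<tau>0 b) \<longrightarrow> \<tau> \<in> s)"
        using Vs(1) by (intro exI[of _ "set Vs"]) simp
    qed
  qed
  show "openin (krull_topology R F) U" if P: "?P U"
  proof (subst openin_subopen, intro ballI)
    fix \<tau>0 assume t0: "\<tau>0 \<in> U"
    then obtain B where B: "finite B" "B \<subseteq> carrier R" "\<forall>\<tau>\<in>G. (\<forall>b\<in>B. \<tau> b = \<tau>0 b) \<longrightarrow> \<tau> \<in> U"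
      using P by blast
    obtain bs where bs: "set bs = B"
      using finite_list[OF B(1)] by blast
    define M where "M = finite_extension F bs"
    have bR: "set bs \<subseteq> carrier R" and ba: "\<And>x. x \<in> set bs \<Longrightarrow> (algebraic over F) x"
      using bs B(2) alg by auto
    have M: "subfield M R" "F \<subseteq> M" "finite_dimension F M" "B \<subseteq> M"
      unfolding M_def using finite_extension_is_subfield[OF F bR ba] finite_extension_incl[OF FR bR]
        finite_extension_finite_dimension(1)[OF F bR ba] finite_extension_mem[OF subfieldE(1)[OF F] bR] bs by simp_all
    define T where "T = {\<tau> \<in> G. \<forall>x\<in>M. \<tau> x = \<tau>0 x}"
    have "openin (krull_topology R F) T"
      unfolding krull_topology_def T_def G_def
      by (intro topology_generated_by_Basis CollectI exI[of _ \<tau>0] exI[of _ M]) (use P t0 M in \<open>auto simp: G_def\<close>)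
    moreover have "\<tau>0 \<in> T"
      using P t0 by (auto simp: T_def)
    moreover have "T \<subseteq> U"
    proof
      fix \<tau> assume "\<tau> \<in> T"
      then have "\<tau> \<in> G" "\<forall>b\<in>B. \<tau> b = \<tau>0 b"
        using M(4) unfolding T_def by blast+
      then show "\<tau> \<in> U"
        using B(3) by blast
    qed
    ultimately show "\<exists>T. openin (krull_topology R F) T \<and> \<tau>0 \<in> T \<and> T \<subseteq> U"
      by blast
  qed
qed

lemma (in field) topspace_krull:
  assumes "subfield F R" "\<And>x. x \<in> carrier R \<Longrightarrow> (algebraic over F) x"
  shows "topspace (krull_topology R F) = carrier (galois_group R F)"
proof -
  have "openin (krull_topology R F) (carrier (galois_group R F))"
    using openin_krull_iff[OF assms] by blast
  moreover have "topspace (krull_topology R F) \<subseteq> carrier (galois_group R F)"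
    using openin_krull_iff[OF assms] openin_topspace by blast
  ultimately show ?thesis
    using openin_subset by blast
qed

section \<open>Transport of Galois sections\<close>

text \<open>The algebraically closed field L, a record, is matched with an isomorphic field type.
  Groups and topologies stay on L; subfields and valuation rings move to the type.\<close>

locale transport = field_extension_hom \<phi> + L: algebraically_closed L
  for \<phi> :: "'k::field_char_0 \<Rightarrow> 'e::alg_closed_field" and L :: "'l ring" +
  fixes h :: "'e \<Rightarrow> 'l"
  assumes h_bij: "bij_betw h UNIV (carrier L)" and h_hom: "h \<in> ring_hom ring_of_type_algebra L"
begin

lemma h_closed: "h x \<in> carrier L"
  using h_bij by (auto simp: bij_betw_def)

lemma h_simps: "h (x + y) = h x \<oplus>\<^bsub>L\<^esub> h y" "h (x * y) = h x \<otimes>\<^bsub>L\<^esub> h y" "h 1 = \<one>\<^bsub>L\<^esub>"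
  using ring_hom_add[OF h_hom, of x y] ring_hom_mult[OF h_hom, of x y] ring_hom_one[OF h_hom] by simp_all

lemma h_eq_iff: "h x = h y \<longleftrightarrow> x = y"
  using h_bij by (auto simp: bij_betw_def inj_def)

definition hi :: "'l \<Rightarrow> 'e" where "hi = inv_into UNIV h"

lemma hi_h: "hi (h x) = x"
  using h_bij by (simp add: hi_def bij_betw_def)

lemma h_hi: "y \<in> carrier L \<Longrightarrow> h (hi y) = y"
  using h_bij by (auto simp: hi_def bij_betw_def intro!: f_inv_into_f)

lemma h_ring_hom: "ring_hom_ring (ring_of_type_algebra :: 'e ring) L h"
  by (rule ring_hom_ringI2[OF ring_from_type_algebra L.ring_axioms h_hom])

lemma h_zero: "h 0 = \<zero>\<^bsub>L\<^esub>"
proof -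
  interpret H: ring_hom_ring "ring_of_type_algebra :: 'e ring" L h
    by (rule h_ring_hom)
  show ?thesis
    using H.hom_zero by simp
qed

lemma h_diff: "h (x - y) = h x \<ominus>\<^bsub>L\<^esub> h y"
proof -
  have "h x = h (x - y) \<oplus>\<^bsub>L\<^esub> h y"
    using h_simps(1)[of "x - y" y] by simp
  then show ?thesis
    using h_closed by (metis a_minus_def L.a_inv_closed L.add.inv_solve_right' L.minus_minus)
qed

lemma h_inverse: "x \<noteq> 0 \<Longrightarrow> inv\<^bsub>L\<^esub> (h x) = h (inverse x)"
  by (rule L.comm_inv_char) (simp_all add: h_closed flip: h_simps)

lemma h_iso: "h \<in> ring_iso ring_of_type_algebra L"
  using h_bij h_hom by (simp add: ring_iso_def)

lemma hi_hom: "hi \<in> ring_hom L ring_of_type_algebra"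
  using ring_iso_set_sym[OF ring_from_type_algebra h_iso] by (simp add: ring_iso_def hi_def)

lemma subfield_h:
  assumes "is_subfield F"
  shows "subfield (h ` F) L"
proof -
  interpret H: ring_hom_ring "ring_of_type_algebra :: 'e ring" L h
    by (rule h_ring_hom)
  have "subfield F (ring_of_type_algebra :: 'e ring)"
    using assms by (simp add: is_subfield_iff)
  from H.img_is_subfield(2)[OF this] show ?thesis
    using L.one_not_zero by simp
qed

lemma algebraic_h:
  assumes F: "is_subfield F"
  shows "ring.algebraic L (h ` F) (h x) \<longleftrightarrow> alg_over F x"
proof
  have hiF: "hi ` h ` F = F"
    by (simp add: image_image hi_h)
  assume "ring.algebraic L (h ` F) (h x)"
  then have "ring.algebraic (ring_of_type_algebra :: 'e ring) (hi ` h ` F) (hi (h x))"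
    using algebraic_hom[OF hi_hom L.field_axioms field_from_type_algebra subfield_h[OF F] h_closed, of x]
    by (simp add: over_def)
  then show "alg_over F x"
    unfolding hiF hi_h using algebraic_rota[OF F] by simp
next
  have "subfield F (ring_of_type_algebra :: 'e ring)"
    using F by (simp add: is_subfield_iff)
  moreover assume "alg_over F x"
  ultimately show "ring.algebraic L (h ` F) (h x)"
    using algebraic_hom[OF h_hom field_from_type_algebra L.field_axioms, of F x] algebraic_rota[OF F]
    by (simp add: over_def)
qed

abbreviation kM :: "'e set" where "kM \<equiv> {x. kalg x}"
abbreviation KF :: "'l ring" where "KF \<equiv> L\<lparr>carrier := h ` kM\<rparr>"
abbreviation Gk :: "('l \<Rightarrow> 'l) monoid" where "Gk \<equiv> galois_group KF (h ` range \<phi>)"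

text \<open>The notion of Galois section, with the function field replaced by an arbitrary subfield
  M. M enters only through the target group and its topology, \<open>Gk\<close> being the same for
  all M.\<close>

definition section_over :: "'e set \<Rightarrow> (('l \<Rightarrow> 'l) \<Rightarrow> 'l \<Rightarrow> 'l) \<Rightarrow> bool" where
  "section_over M s \<longleftrightarrow> s \<in> hom Gk (galois_group L (h ` M)) \<and>
     continuous_map (krull_topology KF (h ` range \<phi>)) (krull_topology L (h ` M)) s \<and>
     (\<forall>\<tau>\<in>carrier Gk. restrict (s \<tau>) (h ` kM) = \<tau>)"

definition act :: "('l \<Rightarrow> 'l) \<Rightarrow> 'e \<Rightarrow> 'e" where
  "act \<sigma> x = hi (\<sigma> (h x))"

text \<open>The automorphisms of the field type by which G_k acts through s, as plain
  functions.\<close>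

definition \<Gamma> :: "(('l \<Rightarrow> 'l) \<Rightarrow> 'l \<Rightarrow> 'l) \<Rightarrow> ('e \<Rightarrow> 'e) set" where
  "\<Gamma> s = (\<lambda>\<tau>. act (s \<tau>)) ` carrier Gk"

lemma h_act: "\<sigma> \<in> carrier (galois_group L F) \<Longrightarrow> h (act \<sigma> x) = \<sigma> (h x)"
  using ring_iso_memE(1)[of \<sigma> L L "h x"] h_hi h_closed by (simp add: act_def galois_group_simps)

lemma act_hom:
  assumes \<sigma>: "\<sigma> \<in> carrier (galois_group L F)"
  shows "coeff_hom (act \<sigma>)"
proof -
  have i: "\<sigma> \<in> ring_iso L L"
    using \<sigma> by (simp add: galois_group_simps)
  show ?thesis
  proof
    show "act \<sigma> (x + y) = act \<sigma> x + act \<sigma> y" for x y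
      unfolding h_eq_iff[symmetric, of "act \<sigma> (x + y)"] h_act[OF \<sigma>] h_simps
      using ring_iso_memE(3)[OF i] h_closed by blast
    show "act \<sigma> (x * y) = act \<sigma> x * act \<sigma> y" for x y
      unfolding h_eq_iff[symmetric, of "act \<sigma> (x * y)"] h_act[OF \<sigma>] h_simps
      using ring_iso_memE(2)[OF i] h_closed by blast
    show "act \<sigma> 1 = 1"
      unfolding h_eq_iff[symmetric, of "act \<sigma> 1"] h_act[OF \<sigma>] h_simps
      by (rule ring_iso_memE(4)[OF i])
  qed
qed

lemma act_fix: "\<sigma> \<in> carrier (galois_group L (h ` M)) \<Longrightarrow> x \<in> M \<Longrightarrow> act \<sigma> x = x"
  by (simp add: act_def galois_group_simps hi_h)

lemma is_subfield_k: "is_subfield (range \<phi>)" and is_subfield_kM: "is_subfield kM" and k_kM: "range \<phi> \<subseteq> kM"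
  using is_subfield_range[OF coeff_hom'] is_subfield_algebraic[OF is_subfield_range[OF coeff_hom']]
    alg_over_self[OF is_subfield_range[OF coeff_hom']] by blast+

lemma field_KF: "field KF"
  by (rule L.subfield_iff(2)[OF subfield_h[OF is_subfield_kM]])

lemma subfield_KF: "subfield (h ` range \<phi>) KF"
proof -
  interpret KF: field KF by (rule field_KF)
  have "field (KF\<lparr>carrier := h ` range \<phi>\<rparr>)"
    using L.subfield_iff(2)[OF subfield_h[OF is_subfield_k]] by simp
  then show ?thesis
    by (rule KF.subfield_iff(1)) (use image_mono[OF k_kM, of h] in simp)
qed

lemma algebraic_KF:
  assumes "x \<in> carrier KF"
  shows "ring.algebraic KF (h ` range \<phi>) x"
proof -
  obtain y where y: "kalg y" "x = h y"
    using assms by auto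
  then have "ring.algebraic L (h ` range \<phi>) x"
    using algebraic_h[OF is_subfield_k] by simp
  then show ?thesis
    using fun_cong[OF fun_cong[OF L.algebraic_consistent[OF subfieldE(1)[OF subfield_h[OF is_subfield_kM]]]]] by simp
qed

lemma openin_KF: "openin (krull_topology KF (h ` range \<phi>)) U \<longleftrightarrow>
    U \<subseteq> carrier Gk \<and> (\<forall>\<tau>0\<in>U. \<exists>B. finite B \<and> B \<subseteq> carrier KF \<and> (\<forall>\<tau>\<in>carrier Gk. (\<forall>b\<in>B. \<tau> b = \<tau>0 b) \<longrightarrow> \<tau> \<in> U))"
  by (rule field.openin_krull_iff[OF field_KF subfield_KF]) (unfold over_def, rule algebraic_KF)

lemma topspace_KF: "topspace (krull_topology KF (h ` range \<phi>)) = carrier Gk"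
  by (rule field.topspace_krull[OF field_KF subfield_KF]) (unfold over_def, rule algebraic_KF)

context
  fixes M :: "'e set"
  assumes M: "is_subfield M" and alg: "\<And>x. alg_over M x"
begin

lemma algebraic_L: "x \<in> carrier L \<Longrightarrow> (L.algebraic over (h ` M)) x"
  using algebraic_h[OF M, of "hi x"] alg h_hi by (simp add: over_def)

lemma openin_L: "openin (krull_topology L (h ` M)) U \<longleftrightarrow>
    U \<subseteq> carrier (galois_group L (h ` M)) \<and> (\<forall>\<tau>0\<in>U. \<exists>B. finite B \<and> B \<subseteq> carrier L \<and>
      (\<forall>\<tau>\<in>carrier (galois_group L (h ` M)). (\<forall>b\<in>B. \<tau> b = \<tau>0 b) \<longrightarrow> \<tau> \<in> U))"
  by (rule L.openin_krull_iff[OF subfield_h[OF M] algebraic_L])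

lemma topspace_L: "topspace (krull_topology L (h ` M)) = carrier (galois_group L (h ` M))"
  by (rule L.topspace_krull[OF subfield_h[OF M] algebraic_L])

context
  fixes s
  assumes s: "section_over M s"
begin

lemma s_closed: "\<tau> \<in> carrier Gk \<Longrightarrow> s \<tau> \<in> carrier (galois_group L (h ` M))"
  using s by (auto simp: section_over_def hom_def)

lemma s_restrict:
  assumes "\<tau> \<in> carrier Gk" "kalg x"
  shows "s \<tau> (h x) = \<tau> (h x)"
proof -
  have "restrict (s \<tau>) (h ` kM) (h x) = \<tau> (h x)"
    using s assms(1) by (simp add: section_over_def)
  then show ?thesis
    using assms(2) by simp
qed

lemma \<Gamma>_hom: "\<sigma> \<in> \<Gamma> s \<Longrightarrow> coeff_hom \<sigma>"
  using act_hom[OF s_closed] unfolding \<Gamma>_def by blast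

lemma \<Gamma>_fix: "\<sigma> \<in> \<Gamma> s \<Longrightarrow> x \<in> M \<Longrightarrow> \<sigma> x = x"
  using act_fix[OF s_closed] unfolding \<Gamma>_def by blast

lemma group_hom_s: "group_hom Gk (galois_group L (h ` M)) s"
proof (intro group_hom.intro group_hom_axioms.intro)
  show "group Gk"
    using field_KF image_mono[OF k_kM] by (intro ring.group_galois_group) (simp_all add: field.is_ring)
  show "group (galois_group L (h ` M))"
    using h_closed by (intro L.group_galois_group) auto
  show "s \<in> hom Gk (galois_group L (h ` M))"
    using s by (simp add: section_over_def)
qed

lemma \<Gamma>_id: "(\<lambda>x. x) \<in> \<Gamma> s"
proof -
  interpret s: group_hom Gk "galois_group L (h ` M)" s
    by (rule group_hom_s)
  have "act (s \<one>\<^bsub>Gk\<^esub>) = (\<lambda>x. x)"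
    unfolding s.hom_one by (intro ext) (simp add: act_def galois_group_simps h_closed hi_h)
  then show ?thesis
    unfolding \<Gamma>_def using s.G.one_closed by (intro image_eqI[of _ _ "\<one>\<^bsub>Gk\<^esub>"]) simp_all
qed

lemma act_mult:
  assumes "\<tau> \<in> carrier Gk" "\<tau>' \<in> carrier Gk"
  shows "act (s (\<tau> \<otimes>\<^bsub>Gk\<^esub> \<tau>')) x = act (s \<tau>) (act (s \<tau>') x)"
proof -
  interpret s: group_hom Gk "galois_group L (h ` M)" s
    by (rule group_hom_s)
  have "s (\<tau> \<otimes>\<^bsub>Gk\<^esub> \<tau>') = compose (carrier L) (s \<tau>) (s \<tau>')"
    using s.hom_mult[OF assms] by (simp add: galois_group_simps)
  then have "act (s (\<tau> \<otimes>\<^bsub>Gk\<^esub> \<tau>')) x = hi (s \<tau> (s \<tau>' (h x)))"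
    by (simp add: act_def compose_def h_closed)
  also have "\<dots> = hi (s \<tau> (h (act (s \<tau>') x)))"
    by (simp only: h_act[OF s_closed[OF assms(2)]])
  finally show ?thesis
    by (simp add: act_def)
qed

lemma \<Gamma>_comp: "\<sigma> \<in> \<Gamma> s \<Longrightarrow> \<sigma>' \<in> \<Gamma> s \<Longrightarrow> (\<lambda>x. \<sigma> (\<sigma>' x)) \<in> \<Gamma> s"
proof -
  assume "\<sigma> \<in> \<Gamma> s" "\<sigma>' \<in> \<Gamma> s"
  then obtain \<tau> \<tau>' where t: "\<tau> \<in> carrier Gk" "\<tau>' \<in> carrier Gk" "\<sigma> = act (s \<tau>)" "\<sigma>' = act (s \<tau>')"
    unfolding \<Gamma>_def by blast
  interpret s: group_hom Gk "galois_group L (h ` M)" s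
    by (rule group_hom_s)
  have "(\<lambda>x. \<sigma> (\<sigma>' x)) = act (s (\<tau> \<otimes>\<^bsub>Gk\<^esub> \<tau>'))"
    unfolding t(3,4) by (intro ext) (rule act_mult[OF t(1,2), symmetric])
  moreover have "\<tau> \<otimes>\<^bsub>Gk\<^esub> \<tau>' \<in> carrier Gk"
    using t(1,2) by (rule s.G.m_closed)
  ultimately show ?thesis
    unfolding \<Gamma>_def by blast
qed

lemma \<Gamma>_inverse: "\<sigma> \<in> \<Gamma> s \<Longrightarrow> \<exists>\<tau>\<in>\<Gamma> s. \<forall>x. \<tau> (\<sigma> x) = x \<and> \<sigma> (\<tau> x) = x"
proof -
  assume "\<sigma> \<in> \<Gamma> s"
  then obtain \<tau> where t: "\<tau> \<in> carrier Gk" "\<sigma> = act (s \<tau>)"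
    unfolding \<Gamma>_def by blast
  interpret s: group_hom Gk "galois_group L (h ` M)" s
    by (rule group_hom_s)
  define \<rho> where "\<rho> = inv\<^bsub>Gk\<^esub> \<tau>"
  have r: "\<rho> \<in> carrier Gk" "\<rho> \<otimes>\<^bsub>Gk\<^esub> \<tau> = \<one>\<^bsub>Gk\<^esub>" "\<tau> \<otimes>\<^bsub>Gk\<^esub> \<rho> = \<one>\<^bsub>Gk\<^esub>"
    unfolding \<rho>_def using t(1) by (rule s.G.inv_closed s.G.l_inv s.G.r_inv)+
  have one: "act (s \<one>\<^bsub>Gk\<^esub>) x = x" for x
    unfolding s.hom_one by (simp add: act_def galois_group_simps h_closed hi_h)
  have "act (s \<rho>) (\<sigma> x) = x \<and> \<sigma> (act (s \<rho>) x) = x" for x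
    using act_mult[OF r(1) t(1), of x] act_mult[OF t(1) r(1), of x] by (simp only: t(2) r(2,3) one)
  then show ?thesis
    using r(1) unfolding \<Gamma>_def by blast
qed

text \<open>On \<open>kbar\<close> the values of the section restrict to all automorphisms over k,
  and by \<open>conjugate_automorphism\<close> one of these moves r if r is not in k.\<close>

lemma \<Gamma>_fix_k:
  assumes r: "kalg r" and fixed: "\<And>\<sigma>. \<sigma> \<in> \<Gamma> s \<Longrightarrow> \<sigma> r = r"
  shows "r \<in> range \<phi>"
proof (rule ccontr)
  assume "r \<notin> range \<phi>"
  from conjugate_automorphism[OF coeff_hom' r this]
  obtain g where g: "bij_betw g kM kM" "\<forall>x\<in>kM. \<forall>y\<in>kM. g (x + y) = g x + g y \<and> g (x * y) = g x * g y"
    "\<forall>c. g (\<phi> c) = \<phi> c" "g r \<noteq> r"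
    by blast
  interpret KF: field KF by (rule field_KF)
  define f where "f y = h (g (hi y))" for y
  have f: "f (h x) = h (g x)" for x
    by (simp add: f_def hi_h)
  have "f \<in> ring_iso KF KF"
  proof (rule ring_iso_memI)
    have "g x \<in> kM" if "x \<in> kM" for x
      using g(1) that by (auto simp: bij_betw_def)
    then show "f y \<in> carrier KF" if "y \<in> carrier KF" for y
      using that f by auto
    show "f (y \<otimes>\<^bsub>KF\<^esub> y') = f y \<otimes>\<^bsub>KF\<^esub> f y'" "f (y \<oplus>\<^bsub>KF\<^esub> y') = f y \<oplus>\<^bsub>KF\<^esub> f y'"
      if "y \<in> carrier KF" "y' \<in> carrier KF" for y y'
    proof -
      obtain x x' where x: "x \<in> kM" "x' \<in> kM" "y = h x" "y' = h x'"
        using \<open>y \<in> carrier KF\<close> \<open>y' \<in> carrier KF\<close> by auto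
      then have "g (x + x') = g x + g x'" "g (x * x') = g x * g x'"
        using g(2) by blast+
      then show "f (y \<otimes>\<^bsub>KF\<^esub> y') = f y \<otimes>\<^bsub>KF\<^esub> f y'" "f (y \<oplus>\<^bsub>KF\<^esub> y') = f y \<oplus>\<^bsub>KF\<^esub> f y'"
        using f[of "x * x'"] f[of "x + x'"] f x(3,4) by (simp_all add: h_simps)
    qed
    have "g 1 = 1"
      using g(3) hom_one by metis
    then show "f \<one>\<^bsub>KF\<^esub> = \<one>\<^bsub>KF\<^esub>"
      using f[of 1] by (simp add: h_simps(3))
    have "inj_on f (h ` kM)"
      using bij_betw_imp_inj_on[OF g(1)] f h_eq_iff by (auto simp: inj_on_def)
    moreover have "f ` h ` kM = h ` g ` kM"
      by (simp add: image_image f)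
    then have "f ` h ` kM = h ` kM"
      using bij_betw_imp_surj_on[OF g(1)] by simp
    ultimately show "bij_betw f (carrier KF) (carrier KF)"
      by (simp add: bij_betw_def)
  qed
  moreover have "h ` range \<phi> \<subseteq> carrier KF"
    using image_mono[OF k_kM, of h] by simp
  moreover have "f y = y" if "y \<in> h ` range \<phi>" for y
    using that f g(3) by auto
  ultimately have "restrict f (carrier KF) \<in> carrier Gk"
    by (rule KF.restrict_galois)
  then have t: "restrict f (h ` kM) \<in> carrier Gk"
    by simp
  have "act (s (restrict f (h ` kM))) r = hi (restrict f (h ` kM) (h r))"
    unfolding act_def using s_restrict[OF t r] by simp
  also have "\<dots> = g r"
    using r by (simp add: f hi_h)
  finally show False
    using fixed[of "act (s (restrict f (h ` kM)))"] t g(4) by (auto simp: \<Gamma>_def)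
qed

lemma s_continuous:
  assumes \<tau>0: "\<tau>0 \<in> carrier Gk" and B: "finite B" "B \<subseteq> carrier L"
  shows "\<exists>B'. finite B' \<and> B' \<subseteq> h ` kM \<and>
    (\<forall>\<tau>\<in>carrier Gk. (\<forall>b\<in>B'. \<tau> b = \<tau>0 b) \<longrightarrow> (\<forall>b\<in>B. s \<tau> b = s \<tau>0 b))"
proof -
  define U where "U = {\<sigma> \<in> carrier (galois_group L (h ` M)). \<forall>b\<in>B. \<sigma> b = s \<tau>0 b}"
  have "openin (krull_topology L (h ` M)) U"
    unfolding openin_L
  proof (intro conjI ballI)
    show "U \<subseteq> carrier (galois_group L (h ` M))"
      by (simp add: U_def)
    show "\<exists>B. finite B \<and> B \<subseteq> carrier L \<and>
        (\<forall>\<tau>\<in>carrier (galois_group L (h ` M)). (\<forall>b\<in>B. \<tau> b = \<rho> b) \<longrightarrow> \<tau> \<in> U)" if "\<rho> \<in> U" for \<rho>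
      by (rule exI[of _ B]) (use that B in \<open>simp add: U_def\<close>)
  qed
  moreover have "continuous_map (krull_topology KF (h ` range \<phi>)) (krull_topology L (h ` M)) s"
    using s by (simp add: section_over_def)
  ultimately have "openin (krull_topology KF (h ` range \<phi>)) {\<tau> \<in> carrier Gk. s \<tau> \<in> U}"
    unfolding continuous_map_def topspace_KF by blast
  moreover have "\<tau>0 \<in> {\<tau> \<in> carrier Gk. s \<tau> \<in> U}"
    using \<tau>0 s_closed by (simp add: U_def)
  ultimately obtain B' where B': "finite B'" "B' \<subseteq> carrier KF"
    "\<forall>\<tau>\<in>carrier Gk. (\<forall>b\<in>B'. \<tau> b = \<tau>0 b) \<longrightarrow> \<tau> \<in> {\<tau> \<in> carrier Gk. s \<tau> \<in> U}"
    unfolding openin_KF by meson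
  show ?thesis
  proof (intro exI[of _ B'] conjI ballI impI)
    show "s \<tau> b = s \<tau>0 b" if "\<tau> \<in> carrier Gk" "\<forall>b\<in>B'. \<tau> b = \<tau>0 b" "b \<in> B" for \<tau> b
      using B'(3) that by (simp add: U_def)
  qed (use B' in simp_all)
qed

text \<open>The stabilizer of w is open, so s maps into it a neighbourhood of 1 in G_k, given by
  finitely many elements of \<open>kbar\<close>. These form the set B that \<open>twist\<close> asks
  for.\<close>

lemma \<Gamma>_continuous:
  "\<exists>B. finite B \<and> (\<forall>b\<in>B. kalg b) \<and> (\<forall>\<sigma>\<in>\<Gamma> s. (\<forall>b\<in>B. \<sigma> b = b) \<longrightarrow> \<sigma> w = w)"
proof -
  interpret s: group_hom Gk "galois_group L (h ` M)" s
    by (rule group_hom_s)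
  obtain B' where B': "finite B'" "B' \<subseteq> h ` kM"
    "\<forall>\<tau>\<in>carrier Gk. (\<forall>b\<in>B'. \<tau> b = \<one>\<^bsub>Gk\<^esub> b) \<longrightarrow> (\<forall>b\<in>{h w}. s \<tau> b = s \<one>\<^bsub>Gk\<^esub> b)"
    using s_continuous[OF s.G.one_closed, of "{h w}"] h_closed by blast
  have s1: "s \<one>\<^bsub>Gk\<^esub> (h w) = h w"
    unfolding s.hom_one by (simp add: galois_group_simps h_closed)
  have hiB: "kalg (hi b)" "h (hi b) = b" if "b \<in> B'" for b
    using B'(2) that by (auto simp: hi_h)
  have "\<sigma> w = w" if \<sigma>: "\<sigma> \<in> \<Gamma> s" "\<forall>b\<in>hi ` B'. \<sigma> b = b" for \<sigma>
  proof -
    obtain \<tau> where t: "\<tau> \<in> carrier Gk" "\<sigma> = act (s \<tau>)"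
      using \<sigma>(1) unfolding \<Gamma>_def by blast
    have "\<tau> b = \<one>\<^bsub>Gk\<^esub> b" if b: "b \<in> B'" for b
    proof -
      have "s \<tau> b = h (\<sigma> (hi b))"
        using h_act[OF s_closed[OF t(1)], of "hi b"] hiB(2)[OF b] t(2) by simp
      also have "\<dots> = b"
        using \<sigma>(2) b hiB(2)[OF b] by simp
      finally have "\<tau> b = b"
        using s_restrict[OF t(1) hiB(1)[OF b]] hiB(2)[OF b] by simp
      moreover have "b \<in> h ` kM"
        using B'(2) b by blast
      ultimately show ?thesis
        by (simp add: galois_group_simps)
    qed
    then have "s \<tau> (h w) = h w"
      using B'(3) t(1) s1 by simp
    then show ?thesis
      by (simp add: t(2) act_def hi_h)
  qed
  then show ?thesis
    using B'(1) hiB(1) by (intro exI[of _ "hi ` B'"]) simp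
qed

end

end

text \<open>The values of s fix M' as well, and in either Krull topology a neighbourhood is given by
  finitely many elements of L, so continuity carries over from M to M'.\<close>

lemma section_over_change:
  assumes M: "is_subfield M" "\<And>x. alg_over M x" and s: "section_over M s"
    and M': "is_subfield M'" "\<And>x. alg_over M' x" and fixed: "\<And>\<sigma> x. \<sigma> \<in> \<Gamma> s \<Longrightarrow> x \<in> M' \<Longrightarrow> \<sigma> x = x"
  shows "section_over M' s"
  unfolding section_over_def
proof (intro conjI ballI)
  let ?G = "galois_group L (h ` M')"
  have c: "s \<tau> \<in> carrier ?G" if t: "\<tau> \<in> carrier Gk" for \<tau>
  proof -
    have "s \<tau> (h x) = h x" if "x \<in> M'" for x
      using h_act[OF s_closed[OF M s t], of x] fixed[OF _ that, of "act (s \<tau>)"] t by (simp add: \<Gamma>_def)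
    then show ?thesis
      using s_closed[OF M s t] by (auto simp: galois_group_simps)
  qed
  show "s \<in> hom Gk ?G"
    using c s by (auto simp: section_over_def hom_def galois_group_simps(2))
  show "restrict (s \<tau>) (h ` kM) = \<tau>" if "\<tau> \<in> carrier Gk" for \<tau>
    using s that by (simp add: section_over_def)
  note op = openin_L[OF M'] topspace_L[OF M']
  show "continuous_map (krull_topology KF (h ` range \<phi>)) (krull_topology L (h ` M')) s"
    unfolding continuous_map_def topspace_KF op(2)
  proof (intro conjI allI impI)
    show "s \<in> carrier Gk \<rightarrow> carrier ?G"
      using c by blast
    fix U assume "openin (krull_topology L (h ` M')) U"
    then have U: "\<forall>\<tau>0\<in>U. \<exists>B. finite B \<and> B \<subseteq> carrier L \<and> (\<forall>\<tau>\<in>carrier ?G. (\<forall>b\<in>B. \<tau> b = \<tau>0 b) \<longrightarrow> \<tau> \<in> U)"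
      unfolding op(1) by (rule conjunct2)
    show "openin (krull_topology KF (h ` range \<phi>)) {\<tau> \<in> carrier Gk. s \<tau> \<in> U}"
      unfolding openin_KF
    proof (intro conjI ballI)
      show "{\<tau> \<in> carrier Gk. s \<tau> \<in> U} \<subseteq> carrier Gk"
        by blast
      fix \<tau>0 assume "\<tau>0 \<in> {\<tau> \<in> carrier Gk. s \<tau> \<in> U}"
      then have t0: "\<tau>0 \<in> carrier Gk" "s \<tau>0 \<in> U"
        by simp_all
      obtain B where B: "finite B" "B \<subseteq> carrier L" "\<forall>\<tau>\<in>carrier ?G. (\<forall>b\<in>B. \<tau> b = s \<tau>0 b) \<longrightarrow> \<tau> \<in> U"
        using bspec[OF U t0(2)] by blast
      obtain B' where B': "finite B'" "B' \<subseteq> h ` kM"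
        "\<forall>\<tau>\<in>carrier Gk. (\<forall>b\<in>B'. \<tau> b = \<tau>0 b) \<longrightarrow> (\<forall>b\<in>B. s \<tau> b = s \<tau>0 b)"
        using s_continuous[OF M s t0(1) B(1,2)] by blast
      show "\<exists>B. finite B \<and> B \<subseteq> carrier KF \<and>
          (\<forall>\<tau>\<in>carrier Gk. (\<forall>b\<in>B. \<tau> b = \<tau>0 b) \<longrightarrow> \<tau> \<in> {\<tau> \<in> carrier Gk. s \<tau> \<in> U})"
      proof (intro exI[of _ B'] conjI ballI impI CollectI)
        show "s \<tau> \<in> U" if "\<tau> \<in> carrier Gk" "\<forall>b\<in>B'. \<tau> b = \<tau>0 b" for \<tau>
          using B(3) c[OF that(1)] bspec[OF B'(3) that(1)] that(2) by simp
      qed (use B' in simp_all)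
    qed
  qed
qed

end

section \<open>Local rings of rational points\<close>

lemma (in generic_point) K_minimal:
  assumes M: "is_subfield M" "range \<phi> \<subseteq> M" "\<And>i. i \<le> n \<Longrightarrow> \<eta> i \<in> M"
  shows "K \<subseteq> M"
proof
  fix x assume "x \<in> K"
  then obtain f g where fg: "(f, g) \<in> fractions C" "x = ev f / ev g"
    by (rule KE)
  have "f \<in> poly_in n" "g \<in> poly_in n"
    by (rule fractionsE[OF fg(1)], assumption)+
  then have "ev f \<in> M" "ev g \<in> M"
    using M(3) by (blast intro: peval_in_subfield[OF M(1,2)])+
  then show "x \<in> M"
    unfolding fg(2) by (rule sf_divide[OF M(1)])
qed

lemma rational_pointE:
  assumes "x \<in> rational_points C"
  obtains v j where "x = {(\<lambda>i. c * v i) | c. c \<noteq> 0}" "v \<in> x" "j \<le> amb C" "v j \<noteq> 0" "\<forall>i>amb C. v i = 0"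
proof -
  obtain v where v: "x = {(\<lambda>i. c * v i) | c. c \<noteq> 0}" "\<exists>i. v i \<noteq> 0" "\<forall>i>amb C. v i = 0"
    using assms unfolding rational_points_def zero_locus_def proj_space_def by blast
  then obtain j where "v j \<noteq> 0"
    by blast
  moreover from this have "j \<le> amb C"
    using v(3) not_le by blast
  moreover have "(\<lambda>i. 1 * v i) \<in> x"
    unfolding v(1) by (intro CollectI exI[of _ 1]) simp
  ultimately show ?thesis
    using that v by simp
qed

lemma rational_point_zero: "x \<in> rational_points C \<Longrightarrow> v \<in> x \<Longrightarrow> f \<in> van C \<Longrightarrow> peval (\<lambda>c. c) f v = 0"
  by (simp add: rational_points_def zero_locus_def)

lemmas peval_id_simps = coeff_hom.peval_simps[OF coeff_hom_id]

context generic_point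
begin

lemma regular:
  assumes fg: "(f, g) \<in> fractions C" and x: "x \<in> rational_points C" "v \<in> x" and g: "peval (\<lambda>c. c) g v \<noteq> 0"
  shows "ev f / ev g \<in> val ` local_ring C x"
proof -
  obtain d where d: "g \<in> forms n d"
    using fractionsE[OF fg] by blast
  obtain u j where u: "x = {(\<lambda>i. c * u i) | c. c \<noteq> 0}" "u \<in> x" "j \<le> n" "u j \<noteq> 0" "\<forall>i>n. u i = 0"
    by (rule rational_pointE[OF x(1)])
  then obtain c0 where c0: "c0 \<noteq> 0" "v = (\<lambda>i. c0 * u i)"
    using x(2) u(1) by blast
  have "peval (\<lambda>c. c) g v' \<noteq> 0" if v': "v' \<in> x" for v'
  proof -
    obtain c where c: "v' = (\<lambda>i. c * u i)" "c \<noteq> 0"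
      using v' unfolding u(1) by (elim CollectE exE conjE)
    have "v' = (\<lambda>i. c / c0 * v i)"
      using c0 c by (simp add: fun_eq_iff)
    then show ?thesis
      using coeff_hom.peval_scale[OF coeff_hom_id d, of "c / c0" v] g c(2) c0(1) by simp
  qed
  then have "fraction C f g \<in> local_ring C x"
    unfolding local_ring_def using fg by blast
  then show ?thesis
    using val_fraction[OF fg] by (metis imageI)
qed

lemma pole:
  assumes fg: "(f, g) \<in> fractions C" and x: "x \<in> rational_points C" "v \<in> x"
    and v: "peval (\<lambda>c. c) f v \<noteq> 0" "peval (\<lambda>c. c) g v = 0"
  shows "ev f / ev g \<notin> val ` local_ring C x"
proof
  assume "ev f / ev g \<in> val ` local_ring C x"
  then obtain f' g' where f': "(f', g') \<in> fractions C" "\<forall>v\<in>x. peval (\<lambda>c. c) g' v \<noteq> 0"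
    "ev f / ev g = val (fraction C f' g')"
    unfolding local_ring_def by blast
  then have "fraction C f g = fraction C f' g'"
    using fraction_eq_ev[OF fg f'(1)] val_fraction[OF f'(1)] by simp
  then have "f * g' - f' * g \<in> I"
    using fraction_eq_iff[OF fg f'(1)] by simp
  then have "peval (\<lambda>c. c) (f * g' - f' * g) v = 0"
    by (rule rational_point_zero[OF x])
  then show False
    using v f'(2) x(2) by (simp add: peval_id_simps)
qed

lemma const_local_ring: "x \<in> rational_points C \<Longrightarrow> \<phi> c \<in> val ` local_ring C x"
proof -
  assume x: "x \<in> rational_points C"
  then obtain v j where "x = {(\<lambda>i. c * v i) | c. c \<noteq> 0}" "v \<in> x" "j \<le> amb C" "v j \<noteq> 0" "\<forall>i>amb C. v i = 0"
    by (rule rational_pointE)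
  then show ?thesis
    using regular[OF fractions_const x, of v c] by (simp add: peval_id_simps ev_simps)
qed

text \<open>A linear form that vanishes at v. For fixed j with \<open>v j \<noteq> 0\<close>, these
  forms cut out the point v.\<close>

abbreviation minor :: "(nat \<Rightarrow> 'k) \<Rightarrow> nat \<Rightarrow> nat \<Rightarrow> 'k mpoly" where
  "minor v j b \<equiv> const_poly (v j) * var_poly b - const_poly (v b) * var_poly j"

lemma minor_forms: "j \<le> n \<Longrightarrow> b \<le> n \<Longrightarrow> minor v j b \<in> forms n 1"
  using forms_mult[OF forms_const forms_var[of b n]] forms_mult[OF forms_const forms_var[of j n]]
  by (intro forms_diff) simp_all

text \<open>Some minor of v does not vanish at the other point. The variable with index j divided by
  it has a pole at v and is regular at the other point.\<close>

lemma local_ring_separates: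
  assumes x: "x \<in> rational_points C" "x' \<in> rational_points C" "x \<noteq> x'"
  shows "\<exists>z\<in>K. z \<notin> val ` local_ring C x \<and> z \<in> val ` local_ring C x'"
proof -
  obtain v j where v: "x = {(\<lambda>i. c * v i) | c. c \<noteq> 0}" "v \<in> x" "j \<le> n" "v j \<noteq> 0" "\<forall>i>n. v i = 0"
    by (rule rational_pointE[OF x(1)])
  obtain v' j' where v': "x' = {(\<lambda>i. c * v' i) | c. c \<noteq> 0}" "v' \<in> x'" "j' \<le> n" "v' j' \<noteq> 0" "\<forall>i>n. v' i = 0"
    by (rule rational_pointE[OF x(2)])
  have "\<exists>b\<le>n. v j * v' b - v b * v' j \<noteq> 0"
  proof (rule ccontr)
    assume "\<not> ?thesis"
    then have e: "v j * v' b = v b * v' j" for b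
      using v(5) v'(5) by (cases "b \<le> n") auto
    define c where "c = v' j / v j"
    have vc: "v' = (\<lambda>i. c * v i)"
      using e v(4) by (simp add: c_def fun_eq_iff field_simps)
    have c0: "c \<noteq> 0"
      using v'(4) vc by auto
    have "x' = x"
    proof (intro subset_antisym subsetI)
      fix u assume "u \<in> x'"
      then obtain a where "a \<noteq> 0" "u = (\<lambda>i. a * v' i)"
        using v'(1) by blast
      then have "a * c \<noteq> 0" "u = (\<lambda>i. a * c * v i)"
        using vc c0 by (simp_all add: mult.assoc)
      then show "u \<in> x"
        unfolding v(1) by blast
    next
      fix u assume "u \<in> x"
      then obtain a where "a \<noteq> 0" "u = (\<lambda>i. a * v i)"
        using v(1) by blast
      then have "a / c \<noteq> 0" "u = (\<lambda>i. a / c * v' i)"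
        using vc c0 by (simp_all add: mult.assoc)
      then show "u \<in> x'"
        unfolding v'(1) by blast
    qed
    then show False
      using x(3) by simp
  qed
  then obtain b where b: "b \<le> n" "v j * v' b - v b * v' j \<noteq> 0"
    by blast
  have p: "peval (\<lambda>c. c) (minor v j b) u = v j * u b - v b * u j" for u
    by (simp add: peval_id_simps)
  have "minor v j b \<notin> I"
    using rational_point_zero[OF x(2) v'(2), of "minor v j b"] b(2) p by auto
  then have fr: "(var_poly j, minor v j b) \<in> fractions C"
    using fractionsI[OF forms_var[OF v(3)] minor_forms[OF v(3) b(1), of v]] by simp
  show ?thesis
  proof (intro bexI[of _ "ev (var_poly j) / ev (minor v j b)"] conjI)
    show "ev (var_poly j) / ev (minor v j b) \<in> K"
      by (rule K_I[OF fr])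
    show "ev (var_poly j) / ev (minor v j b) \<notin> val ` local_ring C x"
      by (rule pole[OF fr x(1) v(2)]) (use p v(4) in \<open>simp_all add: peval_id_simps\<close>)
    show "ev (var_poly j) / ev (minor v j b) \<in> val ` local_ring C x'"
      by (rule regular[OF fr x(2) v'(2)]) (use p b(2) in simp)
  qed
qed

text \<open>If all minors of v vanished at the generic point, that point would be v and
  \<open>K\<close> would be k. A minor that does not vanish is the denominator of a function with a
  pole at v.\<close>

lemma local_ring_proper:
  assumes x: "x \<in> rational_points C" and K: "\<not> K \<subseteq> range \<phi>"
  shows "\<exists>z\<in>K. z \<notin> val ` local_ring C x"
proof -
  obtain v j where v: "x = {(\<lambda>i. c * v i) | c. c \<noteq> 0}" "v \<in> x" "j \<le> n" "v j \<noteq> 0" "\<forall>i>n. v i = 0"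
    by (rule rational_pointE[OF x])
  have "\<exists>b\<le>n. ev (minor v j b) \<noteq> 0"
  proof (rule ccontr)
    assume "\<not> ?thesis"
    then have e: "\<phi> (v j) * \<eta> b = \<phi> (v b) * \<eta> j" if "b \<le> n" for b
      using that by (simp add: ev_simps)
    have p0: "\<phi> (v j) \<noteq> 0"
      using v(4) field_hom_inj[OF hom, of "v j" 0] hom_zero by simp
    obtain i0 where i0: "i0 \<le> n" "\<eta> i0 \<noteq> 0"
      using I_var form_van[OF forms_var] by (auto simp: ev_simps)
    then have j0: "\<eta> j \<noteq> 0"
      using e[OF i0(1)] p0 by auto
    have "\<eta> b / \<eta> j = \<phi> (v b / v j)" if "b \<le> n" for b
    proof -
      show ?thesis
        unfolding field_hom_divide[OF hom] using e[OF that] p0 j0 by (simp add: frac_eq_eq mult.commute)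
    qed
    then have r: "peval \<phi> f (\<lambda>i. \<eta> i / \<eta> j) \<in> range \<phi>" if "f \<in> poly_in n" for f
      using peval_in_subfield[OF is_subfield_range[OF hom] order_refl that] by auto
    have "z \<in> range \<phi>" if "z \<in> K" for z
    proof -
      obtain f g where fg: "(f, g) \<in> fractions C" "z = ev f / ev g"
        using \<open>z \<in> K\<close> by (rule KE)
      obtain d where d: "f \<in> forms n d" "g \<in> forms n d" "f \<in> poly_in n" "g \<in> poly_in n"
        by (rule fractionsE[OF fg(1)])
      have "(\<lambda>i. \<eta> j * (\<eta> i / \<eta> j)) = \<eta>"
        using j0 by simp
      then have "z = peval \<phi> f (\<lambda>i. \<eta> i / \<eta> j) / peval \<phi> g (\<lambda>i. \<eta> i / \<eta> j)"
        using coeff_hom.peval_scale[OF hom d(1), of "\<eta> j" "\<lambda>i. \<eta> i / \<eta> j"]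
          coeff_hom.peval_scale[OF hom d(2), of "\<eta> j" "\<lambda>i. \<eta> i / \<eta> j"] fg(2) j0 by simp
      then show ?thesis
        using sf_divide[OF is_subfield_range[OF hom] r[OF d(3)] r[OF d(4)]] by simp
    qed
    then show False
      using K by blast
  qed
  then obtain b where b: "b \<le> n" "ev (minor v j b) \<noteq> 0"
    by blast
  then have "minor v j b \<notin> I"
    using form_van[OF minor_forms[OF v(3) b(1), of v]] by simp
  then have fr: "(var_poly j, minor v j b) \<in> fractions C"
    using fractionsI[OF forms_var[OF v(3)] minor_forms[OF v(3) b(1), of v]] by simp
  have "ev (var_poly j) / ev (minor v j b) \<notin> val ` local_ring C x"
    by (rule pole[OF fr x v(2)]) (use v(4) in \<open>simp_all add: peval_id_simps\<close>)
  then show ?thesis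
    using K_I[OF fr] by blast
qed

end

text \<open>For x outside V and y its inverse, y^d p(x) is congruent modulo \<mm> to the leading
  coefficient of p, d being the degree. If p(x) = 0, this coefficient lies in \<mm>, although it is
  a nonzero element of F and hence a unit of V.\<close>

lemma (in valring) integrally_closed:
  assumes F: "is_subfield F" "F \<subseteq> V" and x: "alg_over F x"
  shows "x \<in> V"
proof (rule ccontr)
  assume xV: "x \<notin> V"
  define y where "y = inverse x"
  have x0: "x \<noteq> 0"
    using xV V_0 by auto
  then have y: "y \<in> \<mm>" "y * x = 1"
    using not_V[OF xV] by (simp_all add: y_def)
  have lead: "y ^ Polynomial.degree p * poly p x - Polynomial.lead_coeff p \<in> \<mm>" if "poly_over F p" for p
    using that
  proof (induction p)
    case 0
    then show ?case
      by (simp add: m_0)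
  next
    case (pCons a p)
    then have a: "a \<in> V" "poly_over F p"
      using F by (auto simp: poly_over_pCons[OF F(1)])
    show ?case
    proof (cases "p = 0")
      case True
      then show ?thesis
        by (simp add: m_0)
    next
      case False
      have "y ^ Suc (Polynomial.degree p) * (a + x * poly p x) - Polynomial.lead_coeff p =
          a * y ^ Suc (Polynomial.degree p) + ((y * x) * y ^ Polynomial.degree p * poly p x - Polynomial.lead_coeff p)"
        by (simp add: algebra_simps)
      also have "\<dots> \<in> \<mm>"
        unfolding y(2) using pCons.IH[OF a(2)] m_mult[OF a(1) m_power[OF y(1)]] by (intro m_add) simp_all
      finally show ?thesis
        using False by simp
    qed
  qed
  obtain p where p: "p \<noteq> 0" "poly_over F p" "poly p x = 0"
    using x by (auto simp: alg_over_def)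
  then have "- Polynomial.lead_coeff p \<in> \<mm>"
    using lead[OF p(2)] by simp
  then have "Polynomial.lead_coeff p \<in> \<mm>"
    using m_uminus by fastforce
  moreover have "inverse (Polynomial.lead_coeff p) \<in> V"
    using p(2) F sf_inverse[OF F(1)] unfolding poly_over_def by blast
  ultimately show False
    using m_inverse p(1) by simp
qed

section \<open>The separable closure as a field type\<close>

text \<open>Here L is not yet a field type, so there is no generic point to use; injectivity is seen
  on fractions, and the field axioms come from the image, a subfield of L.\<close>

lemma (in proj_variety) embedding_field:
  fixes L :: "('l, 'm) ring_scheme"
  assumes "field L" and \<iota>: "\<iota> \<in> ring_hom (function_field C) L"
    and sub: "subfield (\<iota> ` carrier (function_field C)) L"
  shows "inj_on \<iota> (carrier (function_field C))" "field (function_field C)"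
proof -
  interpret L: field L by fact
  let ?F = "function_field C" and ?S = "L\<lparr>carrier := \<iota> ` carrier (function_field C)\<rparr>"
  have cF: "fraction C f g \<in> carrier ?F" if "(f, g) \<in> fractions C" for f g
    using that unfolding function_field_simps by blast
  have cFE: "\<exists>f g. (f, g) \<in> fractions C \<and> a = fraction C f g" if "a \<in> carrier ?F" for a
    using that unfolding function_field_simps by blast
  have mult_closed: "a \<otimes>\<^bsub>?F\<^esub> b \<in> carrier ?F" and add_closed: "a \<oplus>\<^bsub>?F\<^esub> b \<in> carrier ?F"
    if ab: "a \<in> carrier ?F" "b \<in> carrier ?F" for a b
  proof -
    obtain f g f' g' where fg: "(f, g) \<in> fractions C" "a = fraction C f g" "(f', g') \<in> fractions C" "b = fraction C f' g'"
      using cFE[OF ab(1)] cFE[OF ab(2)] by metis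
    show "a \<otimes>\<^bsub>?F\<^esub> b \<in> carrier ?F"
      unfolding fg(2,4) fraction_mult[OF fg(1,3)] by (rule cF[OF fractions_mult[OF fg(1,3)]])
    show "a \<oplus>\<^bsub>?F\<^esub> b \<in> carrier ?F"
      unfolding fg(2,4) fraction_add[OF fg(1,3)] by (rule cF[OF fractions_add[OF fg(1,3)]])
  qed
  have cl: "\<iota> a \<in> carrier L" if "a \<in> carrier ?F" for a
    using ring_hom_closed[OF \<iota> that] .
  have zF: "\<zero>\<^bsub>?F\<^esub> \<in> carrier ?F" and oF: "\<one>\<^bsub>?F\<^esub> \<in> carrier ?F"
    using cF[OF fractions_const[of 0]] cF[OF fractions_const[of 1]]
    by (simp_all add: function_field_simps const_poly_simps)
  have "\<zero>\<^bsub>?F\<^esub> \<oplus>\<^bsub>?F\<^esub> \<zero>\<^bsub>?F\<^esub> = \<zero>\<^bsub>?F\<^esub>"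
    using fraction_add[OF fractions_const[of 0] fractions_const[of 0]]
    by (simp add: function_field_simps const_poly_simps)
  then have \<iota>0: "\<iota> \<zero>\<^bsub>?F\<^esub> = \<zero>\<^bsub>L\<^esub>"
    using ring_hom_add[OF \<iota> zF zF] L.add.l_cancel_one[OF cl[OF zF] cl[OF zF]] by simp
  show inj: "inj_on \<iota> (carrier ?F)"
  proof (rule inj_onI)
    fix a b assume ab: "a \<in> carrier ?F" "b \<in> carrier ?F" "\<iota> a = \<iota> b"
    obtain f g f' g' where fg: "(f, g) \<in> fractions C" "a = fraction C f g" "(f', g') \<in> fractions C" "b = fraction C f' g'"
      using cFE[OF ab(1)] cFE[OF ab(2)] by metis
    define u where "u = f * g' - f' * g"
    obtain d where d: "f \<in> forms n d" "g \<in> forms n d" "g \<notin> I" "g \<in> poly_in n"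
      by (rule fractionsE[OF fg(1)])
    obtain e where e: "f' \<in> forms n e" "g' \<in> forms n e" "g' \<notin> I" "g' \<in> poly_in n"
      by (rule fractionsE[OF fg(3)])
    have u: "u \<in> forms n (d + e)"
      unfolding u_def using forms_mult[OF d(1) e(2)] forms_mult[OF e(1) d(2)] by (intro forms_diff) (simp_all add: add.commute)
    have gg: "g * g' \<in> forms n (d + e)" "g * g' \<notin> I"
      using forms_mult[OF d(2) e(2)] I_prime[OF d(4) e(4)] d(3) e(3) by auto
    have ug: "(u, g * g') \<in> fractions C"
      by (rule fractionsI[OF u gg])
    have "fraction C u (g * g') \<oplus>\<^bsub>?F\<^esub> b = a"
      unfolding fg(2,4) fraction_add[OF ug fg(3)]
      by (subst fraction_eq_iff[OF fractions_add[OF ug fg(3)] fg(1)]) (simp add: u_def algebra_simps I_0)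
    then have "\<iota> (fraction C u (g * g')) \<oplus>\<^bsub>L\<^esub> \<iota> b = \<iota> b"
      using ring_hom_add[OF \<iota> cF[OF ug] ab(2)] ab(3) by simp
    then have z: "\<iota> (fraction C u (g * g')) = \<zero>\<^bsub>L\<^esub>"
      using L.add.r_cancel_one[OF cl[OF ab(2)] cl[OF cF[OF ug]]] by simp
    have "u \<in> I"
    proof (rule ccontr)
      assume "u \<notin> I"
      then have gu: "(g * g', u) \<in> fractions C"
        by (rule fractionsI[OF gg(1) u])
      have "(1, 1) \<in> fractions C"
        using fractions_const[of 1] by (simp add: const_poly_simps)
      then have "fraction C u (g * g') \<otimes>\<^bsub>?F\<^esub> fraction C (g * g') u = \<one>\<^bsub>?F\<^esub>"
        unfolding fraction_mult[OF ug gu] function_field_simps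
        by (subst fraction_eq_iff[OF fractions_mult[OF ug gu]]) (simp_all add: algebra_simps I_0)
      then have "\<zero>\<^bsub>L\<^esub> \<otimes>\<^bsub>L\<^esub> \<iota> (fraction C (g * g') u) = \<one>\<^bsub>L\<^esub>"
        using ring_hom_mult[OF \<iota> cF[OF ug] cF[OF gu]] ring_hom_one[OF \<iota>] z by simp
      then show False
        using cl[OF cF[OF gu]] by simp
    qed
    then show "a = b"
      unfolding fg(2,4) fraction_eq_iff[OF fg(1,3)] u_def .
  qed
  interpret S: field ?S
    by (rule L.subfield_iff(2)[OF sub])
  define r where "r = inv_into (carrier ?F) \<iota>"
  have r: "r (\<iota> a) = a" if "a \<in> carrier ?F" for a
    using inj that by (simp add: r_def)
  have "r \<in> ring_iso ?S ?F"
  proof (rule ring_iso_memI)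
    show "r x \<in> carrier ?F" if "x \<in> carrier ?S" for x
      using that r by auto
    show "r (x \<otimes>\<^bsub>?S\<^esub> y) = r x \<otimes>\<^bsub>?F\<^esub> r y" "r (x \<oplus>\<^bsub>?S\<^esub> y) = r x \<oplus>\<^bsub>?F\<^esub> r y"
      if xy: "x \<in> carrier ?S" "y \<in> carrier ?S" for x y
    proof -
      obtain a b where ab: "a \<in> carrier ?F" "b \<in> carrier ?F" "x = \<iota> a" "y = \<iota> b"
        using xy by auto
      show "r (x \<otimes>\<^bsub>?S\<^esub> y) = r x \<otimes>\<^bsub>?F\<^esub> r y"
        using r[OF mult_closed[OF ab(1,2)]] ring_hom_mult[OF \<iota> ab(1,2)] r[OF ab(1)] r[OF ab(2)] ab(3,4) by simp
      show "r (x \<oplus>\<^bsub>?S\<^esub> y) = r x \<oplus>\<^bsub>?F\<^esub> r y"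
        using r[OF add_closed[OF ab(1,2)]] ring_hom_add[OF \<iota> ab(1,2)] r[OF ab(1)] r[OF ab(2)] ab(3,4) by simp
    qed
    show "r \<one>\<^bsub>?S\<^esub> = \<one>\<^bsub>?F\<^esub>"
      using r[OF oF] ring_hom_one[OF \<iota>] by simp
    show "bij_betw r (carrier ?S) (carrier ?F)"
      using bij_betw_inv_into[OF inj_on_imp_bij_betw[OF inj]] by (simp add: r_def)
  qed
  from S.ring_iso_imp_img_field[OF this] show "field ?F"
    using r[OF oF] r[OF zF] ring_hom_one[OF \<iota>] \<iota>0 by simp
qed

lemma generate_field_hom:
  assumes "ring_hom_ring R S f" "field R" "field S" "inj_on f (carrier R)" "A \<subseteq> carrier R" "u \<in> generate_field R A"
  shows "f u \<in> generate_field S (f ` A)"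
  using assms(6)
proof (induction rule: generate_field.induct)
  interpret f: ring_hom_ring R S f by fact
  interpret R: field R by fact
  interpret S: field S by fact
  note cl = R.generate_field_in_carrier[OF assms(5)]
  {
    case one
    then show ?case
      using generate_field.one by simp
  next
    case (incl u)
    then show ?case
      by (intro generate_field.incl) simp
  next
    case (a_inv u)
    then show ?case
      using generate_field.a_inv[OF a_inv.IH] cl by simp
  next
    case (m_inv u)
    have u: "u \<in> carrier R"
      by (rule cl[OF m_inv.hyps(1)])
    have iv: "inv\<^bsub>R\<^esub> u \<in> carrier R" "u \<otimes>\<^bsub>R\<^esub> inv\<^bsub>R\<^esub> u = \<one>\<^bsub>R\<^esub>"
      using u m_inv.hyps(2) by (auto simp: R.field_Units)
    have "f u \<otimes>\<^bsub>S\<^esub> f (inv\<^bsub>R\<^esub> u) = \<one>\<^bsub>S\<^esub>"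
      using iv f.hom_mult[OF u iv(1)] by simp
    then have "inv\<^bsub>S\<^esub> (f u) = f (inv\<^bsub>R\<^esub> u)" "f u \<noteq> \<zero>\<^bsub>S\<^esub>"
      using u iv(1) by (auto intro!: S.comm_inv_char)
    then show ?case
      using generate_field.m_inv[OF m_inv.IH] by simp
  next
    case (eng_add u v)
    then show ?case
      using generate_field.eng_add[OF eng_add.IH] cl by simp
  next
    case (eng_mult u v)
    then show ?case
      using generate_field.eng_mult[OF eng_mult.IH] cl by simp
  }
qed

lemma (in field) algebraic_tower:
  assumes K: "subfield K R" and M: "subring M R" "\<And>x. x \<in> M \<Longrightarrow> x \<in> carrier R \<and> (algebraic over K) x"
    and a: "(algebraic over M) a" "a \<in> carrier R"
  shows "(algebraic over K) a"
proof -
  obtain p where p: "p \<in> carrier (M[X])" "p \<noteq> []" "eval p a = \<zero>"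
    by (rule algebraicE[OF M(1) a(2,1)])
  then have "set p \<subseteq> M" "hd p \<noteq> \<zero>"
    by (auto simp: univ_poly_def polynomial_def)
  then show ?thesis
    using algebraic_trans[OF K M(2) _ p(2) _ p(3) a(2)] by blast
qed

text \<open>L is algebraic over the function field, and the latter over k(t) for some t; so L is an
  algebraic closure of k(t), and \<open>alg_closure_iso\<close> applies. The resulting type depends
  on k alone.\<close>

theorem separable_closure_model:
  fixes C :: "'k::field_char_0 proj_scheme"
  assumes C: "smooth_projective_curve C" and sc: "separable_closure C L \<iota>"
  shows "\<exists>(\<phi> :: 'k \<Rightarrow> 'k poly fract alg_closure) h \<eta>. transport \<phi> L h \<and> generic_point C \<phi> \<eta> \<and>
    (\<forall>a\<in>carrier (function_field C). \<iota> a = h (generic_point.val C \<phi> \<eta> a)) \<and>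
    (\<forall>x. alg_over (generic_point.K C \<phi> \<eta>) x)"
proof -
  let ?F = "function_field C" and ?k = "range (const_fun C)" and ?M = "\<iota> ` carrier (function_field C)"
  interpret V: proj_variety C
    using C by unfold_locales (simp add: smooth_projective_curve_def)
  have \<iota>: "\<iota> \<in> ring_hom ?F L" and "algebraic_closure L ?M"
    using sc by (simp_all add: separable_closure_def)
  interpret L: algebraic_closure L ?M by fact
  have sfM: "subfield ?M L"
    by (rule L.subfield_axioms)
  note F = V.embedding_field[OF L.field_axioms \<iota> sfM]
  interpret F: field ?F by (rule F(2))
  interpret i: ring_hom_ring ?F L \<iota>
    by (rule ring_hom_ringI2[OF F.ring_axioms L.ring_axioms \<iota>])
  interpret K: field "ring_of_type_algebra :: 'k ring" by (rule field_from_type_algebra)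
  have ck: "const_fun C c \<in> carrier ?F" for c
    unfolding V.function_field_simps const_fun_def using V.fractions_const by blast
  define \<phi>' where "\<phi>' c = \<iota> (const_fun C c)" for c
  have "const_fun C \<in> ring_hom ring_of_type_algebra ?F"
  proof (rule ring_hom_memI)
    show "const_fun C (x \<otimes>\<^bsub>ring_of_type_algebra\<^esub> y) = const_fun C x \<otimes>\<^bsub>?F\<^esub> const_fun C y" for x y
      unfolding const_fun_def V.fraction_mult[OF V.fractions_const V.fractions_const] by (simp add: const_poly_simps)
    show "const_fun C (x \<oplus>\<^bsub>ring_of_type_algebra\<^esub> y) = const_fun C x \<oplus>\<^bsub>?F\<^esub> const_fun C y" for x y
      unfolding const_fun_def V.fraction_add[OF V.fractions_const V.fractions_const] by (simp add: const_poly_simps)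
    show "const_fun C \<one>\<^bsub>ring_of_type_algebra\<^esub> = \<one>\<^bsub>?F\<^esub>"
      by (simp add: const_fun_def V.function_field_simps const_poly_simps)
  qed (rule ck)
  moreover have "\<phi>' = \<iota> \<circ> const_fun C"
    by (simp add: fun_eq_iff \<phi>'_def)
  ultimately have \<phi>': "\<phi>' \<in> ring_hom ring_of_type_algebra L"
    using ring_hom_trans[OF _ \<iota>] by simp
  obtain t where t: "t \<in> carrier ?F" "F.transcendental ?k t"
    "\<And>u. u \<in> carrier ?F \<Longrightarrow> F.algebraic (generate_field ?F (insert t ?k)) u"
    using C unfolding smooth_projective_curve_def one_dimensional_def Let_def by blast
  have img: "\<iota> ` insert t ?k = insert (\<iota> t) (range \<phi>')"
    by (auto simp: \<phi>'_def)
  have kF: "insert t ?k \<subseteq> carrier ?F"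
    using t(1) ck by auto
  have LL: "algebraically_closed L"
    by (rule L.algebraically_closed_axioms)
  \<comment> \<open>Algebraicity over k in L is restricted to the image of the function field, where
    \<iota> can be inverted.\<close>
  have trans: "L.transcendental (range \<phi>') (\<iota> t)"
  proof (rule ccontr)
    let ?S = "L\<lparr>carrier := ?M\<rparr>"
    assume "\<not> L.transcendental (range \<phi>') (\<iota> t)"
    then have "L.algebraic (range \<phi>') (\<iota> t)"
      by (simp add: over_def)
    then have a: "ring.algebraic ?S (range \<phi>') (\<iota> t)"
      using fun_cong[OF fun_cong[OF L.algebraic_consistent[OF subfieldE(1)[OF sfM]]]] by simp
    interpret S: field ?S
      by (rule L.subfield_iff(2)[OF sfM])
    have iS: "\<iota> \<in> ring_iso ?F ?S"
      using ring_hom_memE[OF \<iota>] F(1) by (intro ring_iso_memI) (auto simp: bij_betw_def)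
    define r where "r = inv_into (carrier ?F) \<iota>"
    have r: "r \<in> ring_hom ?S ?F" "\<And>a. a \<in> carrier ?F \<Longrightarrow> r (\<iota> a) = a"
      using ring_iso_set_sym[OF F.ring_axioms iS] F(1) by (simp_all add: r_def ring_iso_def)
    have "\<phi>' \<in> ring_hom ring_of_type_algebra ?S"
      using ring_hom_memE[OF \<phi>'] ck by (intro ring_hom_memI) (auto simp: \<phi>'_def)
    then interpret p: ring_hom_ring "ring_of_type_algebra :: 'k ring" ?S \<phi>'
      by (rule ring_hom_ringI2[OF K.ring_axioms S.ring_axioms])
    have "subfield (range \<phi>') ?S"
      using p.img_is_subfield(2)[OF K.carrier_is_subfield] S.one_not_zero by simp
    then have "(F.algebraic over (r ` range \<phi>')) (r (\<iota> t))"
      using algebraic_hom[OF r(1) S.field_axioms F.field_axioms, of "range \<phi>'" "\<iota> t"] a t(1) by (simp add: over_def)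
    moreover have "r ` range \<phi>' = ?k"
      by (simp add: image_image \<phi>'_def r(2)[OF ck])
    ultimately show False
      using t(2) r(2)[OF t(1)] by (simp add: over_def)
  qed
  let ?G = "generate_field L (insert (\<iota> t) (range \<phi>'))"
  have GL: "insert (\<iota> t) (range \<phi>') \<subseteq> carrier L"
    unfolding img[symmetric] using kF by auto
  have sG: "subfield ?G L"
    by (rule L.generate_field_is_subfield[OF GL])
  have GF: "subfield (generate_field ?F (insert t ?k)) ?F"
    by (rule F.generate_field_is_subfield[OF kF])
  have M: "x \<in> carrier L \<and> (L.algebraic over ?G) x" if x: "x \<in> ?M" for x
  proof -
    obtain u where u: "u \<in> carrier ?F" "x = \<iota> u"
      using x by blast
    have "(L.algebraic over (\<iota> ` generate_field ?F (insert t ?k))) x"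
      using algebraic_hom[OF \<iota> F.field_axioms L.field_axioms GF u(1)] t(3)[OF u(1)] u(2) by (simp add: over_def)
    moreover have "\<iota> ` generate_field ?F (insert t ?k) \<subseteq> ?G"
    proof
      fix y assume "y \<in> \<iota> ` generate_field ?F (insert t ?k)"
      then obtain v where "v \<in> generate_field ?F (insert t ?k)" "y = \<iota> v"
        by (rule imageE)
      then show "y \<in> ?G"
        using generate_field_hom[OF i.ring_hom_ring_axioms F.field_axioms L.field_axioms F(1) kF] img by simp
    qed
    ultimately have "(L.algebraic over ?G) x"
      by (rule L.algebraic_mono[rotated])
    then show ?thesis
      using u i.hom_closed by simp
  qed
  have alg: "L.algebraic ?G x" if x: "x \<in> carrier L" for x
  proof -
    have "(L.algebraic over ?G) x"
      by (rule L.algebraic_tower[OF sG subfieldE(1)[OF sfM] M L.algebraic_extension[OF x] x])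
    then show ?thesis
      unfolding over_def .
  qed
  obtain h :: "'k poly fract alg_closure \<Rightarrow> 'k sepcl" where h: "bij_betw h UNIV (carrier L)" "h \<in> ring_hom ring_of_type_algebra L"
    using alg_closure_iso[OF LL \<phi>' i.hom_closed[OF t(1)] trans alg] by metis
  define hi where "hi = inv_into UNIV h"
  have hi: "hi \<in> ring_hom L ring_of_type_algebra"
    using ring_iso_set_sym[OF ring_from_type_algebra, of h L] h by (simp add: ring_iso_def hi_def)
  have h_hi: "h (hi y) = y" if "y \<in> carrier L" for y
    using h(1) that by (auto simp: hi_def bij_betw_def intro!: f_inv_into_f)
  define \<phi> where "\<phi> = (\<lambda>c. hi (\<iota> (const_fun C c)))"
  have i': "(\<lambda>a. hi (\<iota> a)) \<in> ring_hom ?F ring_of_type_algebra"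
    using ring_hom_trans[OF \<iota> hi] by (simp add: comp_def)
  have "\<exists>\<eta>. generic_point C \<phi> \<eta> \<and> (\<forall>a\<in>carrier ?F. hi (\<iota> a) = generic_point.val C \<phi> \<eta> a)"
  proof (rule V.generic_point_exists[OF i'])
    fix \<eta>
    assume "generic_point C (\<lambda>c. hi (\<iota> (const_fun C c))) \<eta>"
      "\<And>a. a \<in> carrier ?F \<Longrightarrow> hi (\<iota> a) = generic_point.val C (\<lambda>c. hi (\<iota> (const_fun C c))) \<eta> a"
    then show ?thesis
      unfolding \<phi>_def by blast
  qed
  then obtain \<eta> where \<eta>: "generic_point C \<phi> \<eta>"
    "\<And>a. a \<in> carrier ?F \<Longrightarrow> hi (\<iota> a) = generic_point.val C \<phi> \<eta> a"
    by blast
  interpret G: generic_point C \<phi> \<eta>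
    by (rule \<eta>(1))
  have T: "transport \<phi> L h"
    by (intro transport.intro field_extension_hom.intro transport_axioms.intro G.hom LL h)
  interpret T: transport \<phi> L h by (rule T)
  have v: "\<iota> a = h (G.val a)" if "a \<in> carrier ?F" for a
    using \<eta>(2)[OF that] h_hi[OF i.hom_closed[OF that]] by simp
  have "?M = h ` G.K"
    unfolding G.val_image[symmetric] image_image using v by (intro image_cong) simp_all
  then have "alg_over G.K x" for x
    using L.algebraic_extension[OF T.h_closed[of x]] T.algebraic_h[OF G.is_subfield_K, of x] by (simp add: over_def)
  then show ?thesis
    using T G.generic_point_axioms v by blast
qed

section \<open>Sections and decomposition groups in the field type\<close>

locale sep_transport = transport \<phi> L h
  for \<phi> :: "'k::field_char_0 \<Rightarrow> 'e::alg_closed_field" and L :: "'k sepcl ring" and h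
begin

text \<open>The point x belongs to s, expressed in the field type: the action stabilizes a valuation
  ring over the local ring at x.\<close>

definition fixed_at :: "'k proj_scheme \<Rightarrow> (nat \<Rightarrow> 'e) \<Rightarrow> (('k sepcl \<Rightarrow> 'k sepcl) \<Rightarrow> 'k sepcl \<Rightarrow> 'k sepcl) \<Rightarrow> (nat \<Rightarrow> 'k) set \<Rightarrow> bool" where
  "fixed_at C \<eta> s x \<longleftrightarrow> (\<exists>V. valring V \<and> (\<forall>\<sigma>\<in>\<Gamma> s. \<sigma> ` V = V) \<and>
     V \<inter> generic_point.K C \<phi> \<eta> = generic_point.val C \<phi> \<eta> ` local_ring C x)"

context
  fixes C :: "'k proj_scheme" and \<eta> and \<iota>
  assumes gp: "generic_point C \<phi> \<eta>"
    and \<iota>: "\<And>a. a \<in> carrier (function_field C) \<Longrightarrow> \<iota> a = h (generic_point.val C \<phi> \<eta> a)"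
begin

interpretation G: generic_point C \<phi> \<eta> by (rule gp)

lemma K_img_eq: "K_img C \<iota> = h ` G.K"
  unfolding K_img_def G.val_image[symmetric] image_image using \<iota> by (intro image_cong) simp_all

lemma k_img_eq: "k_img C \<iota> = h ` range \<phi>"
proof -
  have "const_fun C c \<in> carrier (function_field C)" for c
    unfolding G.function_field_simps const_fun_def using G.fractions_const by blast
  then show ?thesis
    unfolding k_img_def image_image using \<iota> G.val_const by (intro image_cong) simp_all
qed

lemma kbar_eq: "kbar C L \<iota> = h ` kM"
proof -
  have "a \<in> kbar C L \<iota> \<longleftrightarrow> a \<in> h ` kM" for a
  proof
    assume "a \<in> kbar C L \<iota>"
    then have a: "a \<in> carrier L" "ring.algebraic L (h ` range \<phi>) a"
      by (simp_all add: kbar_def k_img_eq)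
    then have "kalg (hi a)"
      using algebraic_h[OF is_subfield_k, of "hi a"] h_hi by simp
    then show "a \<in> h ` kM"
      using h_hi[OF a(1)] by (metis imageI mem_Collect_eq)
  next
    assume "a \<in> h ` kM"
    then show "a \<in> kbar C L \<iota>"
      using algebraic_h[OF is_subfield_k] h_closed by (auto simp: kbar_def k_img_eq)
  qed
  then show ?thesis
    by (rule Set.set_eqI)
qed

lemma galois_section_iff: "galois_section C L \<iota> s \<longleftrightarrow> section_over G.K s"
  unfolding galois_section_def pr_X_def K_img_eq k_img_eq kbar_eq section_over_def ..

text \<open>L can serve as the separable closure of every curve over whose function field it is
  algebraic.\<close>

lemma separable_closureI:
  assumes alg: "\<And>x. alg_over G.K x"
  shows "separable_closure C L \<iota>"
proof -
  have "(\<lambda>a. h (G.val a)) \<in> ring_hom (function_field C) L"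
    using ring_hom_trans[OF G.val_hom h_hom] by (simp add: comp_def)
  then have "\<iota> \<in> ring_hom (function_field C) L"
    using ring.ring_hom_restrict[OF field.is_ring[OF G.field_function_field]] \<iota> by metis
  moreover have "\<iota> ` carrier (function_field C) = h ` G.K"
    using K_img_eq by (simp add: K_img_def)
  moreover have sf: "subfield (h ` G.K) L"
    by (rule subfield_h[OF G.is_subfield_K])
  moreover have "algebraic_closure L (h ` G.K)"
  proof (intro algebraic_closure.intro algebraic_closure_axioms.intro L.field_axioms sf)
    show "(L.algebraic over (h ` G.K)) x" if "x \<in> carrier L" for x
      by (rule algebraic_L[OF G.is_subfield_K alg that])
    show "L.splitted P" if "P \<in> carrier (univ_poly L (h ` G.K))" for P
      by (rule L.roots_over_carrier) (use L.carrier_polynomial_shell[OF subfieldE(1)[OF sf] that] in simp)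
  qed
  ultimately show ?thesis
    by (simp add: separable_closure_def)
qed

text \<open>h matches subsets of the type with subsets of L and respects each clause: being a
  valuation ring, being stable under s, and lying over the local ring.\<close>

lemma decomposition_iff:
  assumes s: "\<And>\<tau>. \<tau> \<in> carrier Gk \<Longrightarrow> s \<tau> \<in> carrier (galois_group L (h ` G.K))"
  shows "(\<exists>D. decomposition_subgroup C L \<iota> x D \<and> s ` carrier (G_k C L \<iota>) \<subseteq> D) \<longleftrightarrow> fixed_at C \<eta> s x"
proof -
  have hV: "h ` V = h ` W \<longleftrightarrow> V = W" for V W
    using h_eq_iff by (simp add: inj_image_eq_iff inj_def)
  have 1: "valuation_ring L (h ` V) \<longleftrightarrow> valring V" for V
  proof
    assume v: "valuation_ring L (h ` V)"
    then have V: "subring (h ` V) L"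
      by (simp add: valuation_ring_def)
    have mem: "h x \<in> h ` V \<longleftrightarrow> x \<in> V" for x
      using h_eq_iff by auto
    show "valring V"
    proof
      show "1 \<in> V"
        using subringE(3)[OF V] h_simps(3) mem by metis
      show "x - y \<in> V" if "x \<in> V" "y \<in> V" for x y
      proof -
        have "h x \<ominus>\<^bsub>L\<^esub> h y \<in> h ` V"
          unfolding a_minus_def using that mem subringE(5,7)[OF V] by simp
        then show ?thesis
          using mem h_diff by metis
      qed
      show "x * y \<in> V" if "x \<in> V" "y \<in> V" for x y
        using subringE(6)[OF V, of "h x" "h y"] that mem h_simps(2) by metis
      show "x \<in> V \<or> inverse x \<in> V" for x
      proof (cases "x = 0")
        case True
        have "h 0 \<in> h ` V"
          unfolding h_zero by (rule subringE(2)[OF V])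
        then show ?thesis
          using True mem by simp
      next
        case False
        then have "h x \<noteq> \<zero>\<^bsub>L\<^esub>"
          using h_eq_iff[of x 0] h_zero by simp
        then have "h x \<in> h ` V \<or> inv\<^bsub>L\<^esub> (h x) \<in> h ` V"
          using v h_closed unfolding valuation_ring_def by blast
        then show ?thesis
          using mem h_inverse[OF False] by metis
      qed
    qed
  next
    assume "valring V"
    then interpret V: valring V .
    have "subring (h ` V) L"
    proof (rule L.subringI)
      show "\<ominus>\<^bsub>L\<^esub> y \<in> h ` V" if y: "y \<in> h ` V" for y
      proof -
        obtain x where x: "x \<in> V" "y = h x"
          using y by blast
        have "\<ominus>\<^bsub>L\<^esub> y = h (0 - x)"
          unfolding h_diff h_zero x(2) using h_closed by (simp add: a_minus_def)
        then show ?thesis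
          using V.V_diff[OF V.V_0 x(1)] by blast
      qed
    qed (auto simp: h_closed simp flip: h_simps intro: V.V_1 V.V_mult V.V_add)
    moreover have "y \<in> h ` V \<or> inv\<^bsub>L\<^esub> y \<in> h ` V" if y: "y \<in> carrier L" "y \<noteq> \<zero>\<^bsub>L\<^esub>" for y
    proof -
      obtain x where x: "y = h x"
        using h_hi[OF y(1)] by metis
      then have "x \<noteq> 0"
        using y(2) h_zero by auto
      then show ?thesis
        using V.V_total[of x] h_inverse x by auto
    qed
    ultimately show "valuation_ring L (h ` V)"
      by (simp add: valuation_ring_def)
  qed
  have 2: "s \<tau> ` h ` V = h ` V \<longleftrightarrow> act (s \<tau>) ` V = V" if "\<tau> \<in> carrier Gk" for \<tau> V
  proof -
    have "s \<tau> ` h ` V = h ` act (s \<tau>) ` V"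
      by (simp add: image_image h_act[OF s[OF that]])
    then show ?thesis
      using hV by simp
  qed
  have 3: "h ` V \<inter> K_img C \<iota> = \<iota> ` local_ring C x \<longleftrightarrow> V \<inter> G.K = G.val ` local_ring C x" for V
  proof -
    have "h ` V \<inter> K_img C \<iota> = h ` (V \<inter> G.K)"
      unfolding K_img_eq using h_eq_iff by (intro image_Int[symmetric]) (simp add: inj_def)
    moreover have "local_ring C x \<subseteq> carrier (function_field C)"
      unfolding local_ring_def G.function_field_simps by blast
    then have "\<iota> ` local_ring C x = h ` G.val ` local_ring C x"
      unfolding image_image using \<iota> by (intro image_cong) auto
    ultimately show ?thesis
      using hV by simp
  qed
  have 4: "s ` carrier Gk \<subseteq> {\<sigma> \<in> carrier (galois_group L (h ` G.K)). \<sigma> ` h ` V = h ` V} \<longleftrightarrow> (\<forall>\<sigma>\<in>\<Gamma> s. \<sigma> ` V = V)" for V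
  proof -
    have "s ` carrier Gk \<subseteq> {\<sigma> \<in> carrier (galois_group L (h ` G.K)). \<sigma> ` h ` V = h ` V} \<longleftrightarrow>
        (\<forall>\<tau>\<in>carrier Gk. s \<tau> ` h ` V = h ` V)"
      unfolding image_subset_iff mem_Collect_eq using s by blast
    also have "\<dots> \<longleftrightarrow> (\<forall>\<tau>\<in>carrier Gk. act (s \<tau>) ` V = V)"
      by (rule ball_cong[OF refl]) (rule 2)
    also have "\<dots> \<longleftrightarrow> (\<forall>\<sigma>\<in>\<Gamma> s. \<sigma> ` V = V)"
      unfolding \<Gamma>_def ball_simps ..
    finally show ?thesis .
  qed
  have 5: "\<exists>V. W = h ` V" if "valuation_ring L W" for W
  proof -
    have W: "W \<subseteq> carrier L"
      using that subringE(1) unfolding valuation_ring_def by blast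
    have "(\<lambda>y. h (hi y)) ` W = (\<lambda>y. y) ` W"
      by (intro image_cong refl h_hi) (rule subsetD[OF W])
    then show ?thesis
      by (intro exI[of _ "hi ` W"]) (simp add: image_image)
  qed
  show ?thesis
  proof
    assume "\<exists>D. decomposition_subgroup C L \<iota> x D \<and> s ` carrier (G_k C L \<iota>) \<subseteq> D"
    then obtain D where D: "decomposition_subgroup C L \<iota> x D" "s ` carrier (G_k C L \<iota>) \<subseteq> D"
      by (elim exE conjE)
    from D(1) obtain W where W: "valuation_ring L W" "W \<inter> K_img C \<iota> = \<iota> ` local_ring C x"
      "D = {\<sigma> \<in> carrier (G_X C L \<iota>). \<sigma> ` W = W}"
      unfolding decomposition_subgroup_def by (elim exE conjE)
    obtain V where V: "W = h ` V"
      using 5[OF W(1)] by (rule exE)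
    have "s ` carrier Gk \<subseteq> {\<sigma> \<in> carrier (galois_group L (h ` G.K)). \<sigma> ` h ` V = h ` V}"
      using D(2) unfolding W(3) K_img_eq k_img_eq kbar_eq V .
    from iffD1[OF 4 this] show "fixed_at C \<eta> s x"
      unfolding fixed_at_def
      by (intro exI[of _ V] conjI iffD1[OF 1 W(1)[unfolded V]] iffD1[OF 3 W(2)[unfolded V]])
  next
    assume "fixed_at C \<eta> s x"
    then obtain V where V: "valring V" "\<forall>\<sigma>\<in>\<Gamma> s. \<sigma> ` V = V" "V \<inter> G.K = G.val ` local_ring C x"
      unfolding fixed_at_def by (elim exE conjE)
    define D where "D = {\<sigma> \<in> carrier (G_X C L \<iota>). \<sigma> ` h ` V = h ` V}"
    have "decomposition_subgroup C L \<iota> x D"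
      unfolding decomposition_subgroup_def D_def
      by (intro exI[of _ "h ` V"] conjI iffD2[OF 1 V(1)] iffD2[OF 3 V(3)] refl)
    moreover have "s ` carrier (G_k C L \<iota>) \<subseteq> D"
      unfolding D_def K_img_eq k_img_eq kbar_eq by (rule iffD2[OF 4 V(2)])
    ultimately show "\<exists>D. decomposition_subgroup C L \<iota> x D \<and> s ` carrier (G_k C L \<iota>) \<subseteq> D"
      by (intro exI[of _ D] conjI)
  qed
qed

end

text \<open>The hypothesis is applied with the closure L at hand and with \<iota> = h composed with
  \<open>val\<close>. This is possible for a curve other than the one L came from, since the type of
  L involves only k.\<close>

lemma BGASC_fixed_at:
  assumes gp: "generic_point C \<phi> \<eta>" and alg: "\<And>x. alg_over (generic_point.K C \<phi> \<eta>) x"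
    and s: "section_over (generic_point.K C \<phi> \<eta>) s" and "BGASC C"
  shows "\<exists>!x. x \<in> rational_points C \<and> fixed_at C \<eta> s x"
proof -
  let ?\<iota> = "\<lambda>a. h (generic_point.val C \<phi> \<eta> a)"
  have sc: "separable_closure C L ?\<iota>"
    by (rule separable_closureI[OF gp refl alg])
  have gs: "galois_section C L ?\<iota> s"
    by (rule iffD2[OF galois_section_iff[OF gp refl] s])
  have "\<exists>!x. x \<in> rational_points C \<and> (\<exists>D. decomposition_subgroup C L ?\<iota> x D \<and> s ` carrier (G_k C L ?\<iota>) \<subseteq> D)"
    by (rule \<open>BGASC C\<close>[unfolded BGASC_def, THEN spec, THEN spec, THEN spec, THEN mp, THEN mp, OF sc gs])
  moreover have "(\<exists>D. decomposition_subgroup C L ?\<iota> x D \<and> s ` carrier (G_k C L ?\<iota>) \<subseteq> D) \<longleftrightarrow> fixed_at C \<eta> s x" for x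
    by (rule decomposition_iff[OF gp refl s_closed[OF generic_point.is_subfield_K[OF gp] alg s]])
  ultimately show ?thesis
    by (simp only:)
qed

end

section \<open>Curves of a given genus through a function\<close>

context sep_transport
begin

text \<open>What is handed from one curve to another: it mentions no curve, and V \<noteq> UNIV
  ensures that V is not trivial on any function field over which the type is algebraic.\<close>

definition stable :: "(('k sepcl \<Rightarrow> 'k sepcl) \<Rightarrow> 'k sepcl \<Rightarrow> 'k sepcl) \<Rightarrow> 'e set \<Rightarrow> bool" where
  "stable s V \<longleftrightarrow> valring V \<and> (\<forall>\<sigma>\<in>\<Gamma> s. \<sigma> ` V = V) \<and> range \<phi> \<subseteq> V \<and> V \<noteq> UNIV"

text \<open>The local ring at x contains k and, since \<open>K\<close> is larger than k, is not all
  of \<open>K\<close>; so V contains k and is not everything.\<close>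

lemma fixed_at_stable:
  assumes gp: "generic_point C \<phi> \<eta>" and x: "x \<in> rational_points C" "fixed_at C \<eta> s x"
    and K: "\<not> generic_point.K C \<phi> \<eta> \<subseteq> range \<phi>"
  shows "\<exists>V. stable s V \<and> V \<inter> generic_point.K C \<phi> \<eta> = generic_point.val C \<phi> \<eta> ` local_ring C x"
proof -
  interpret G: generic_point C \<phi> \<eta> by fact
  obtain V where V: "valring V" "\<forall>\<sigma>\<in>\<Gamma> s. \<sigma> ` V = V" "V \<inter> G.K = G.val ` local_ring C x"
    using x(2) unfolding fixed_at_def by (elim exE conjE)
  obtain z where z: "z \<in> G.K" "z \<notin> G.val ` local_ring C x"
    using G.local_ring_proper[OF x(1) K] by (elim bexE)
  then have "V \<noteq> UNIV"
    using V(3) by auto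
  moreover have "\<phi> c \<in> V" for c
    using G.const_local_ring[OF x(1), of c] unfolding V(3)[symmetric] by (rule IntD1)
  then have "range \<phi> \<subseteq> V"
    by (simp add: image_subset_iff)
  ultimately show ?thesis
    unfolding stable_def using V by (intro exI[of _ V] conjI)
qed

text \<open>\<open>K\<close> cannot lie in V: the whole field is algebraic over \<open>K\<close> and
  V is integrally closed, so V would be everything. This is the nontriviality that
  \<open>center_exists\<close> requires.\<close>

lemma stable_center:
  assumes gp: "generic_point C \<phi> \<eta>" and curve: "smooth_projective_curve C"
    and alg: "\<And>x. alg_over (generic_point.K C \<phi> \<eta>) x"
    and s: "section_over (generic_point.K C \<phi> \<eta>) s" and V: "stable s V"
  shows "\<exists>x\<in>rational_points C. V \<inter> generic_point.K C \<phi> \<eta> = generic_point.val C \<phi> \<eta> ` local_ring C x"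
proof -
  interpret G: generic_point C \<phi> \<eta> by fact
  have V': "valring V" "\<And>\<sigma>. \<sigma> \<in> \<Gamma> s \<Longrightarrow> \<sigma> ` V = V" "\<And>c. \<phi> c \<in> V" "V \<noteq> UNIV"
    using V unfolding stable_def by blast+
  have "\<not> G.K \<subseteq> V"
    using valring.integrally_closed[OF V'(1) G.is_subfield_K _ alg] V'(4) by blast
  show ?thesis
  proof (rule center_exists[OF gp curve V'(1,3) \<open>\<not> G.K \<subseteq> V\<close>, where \<Gamma> = "\<Gamma> s"])
    show "coeff_hom \<sigma>" if "\<sigma> \<in> \<Gamma> s" for \<sigma>
      by (rule \<Gamma>_hom[OF G.is_subfield_K alg s that])
    show "\<sigma> ` V = V" if "\<sigma> \<in> \<Gamma> s" for \<sigma>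
      by (rule V'(2)[OF that])
    show "\<sigma> z = z" if "\<sigma> \<in> \<Gamma> s" "z \<in> G.K" for \<sigma> z
      by (rule \<Gamma>_fix[OF G.is_subfield_K alg s that])
    show "r \<in> range \<phi>" if "kalg r" "\<And>\<sigma>. \<sigma> \<in> \<Gamma> s \<Longrightarrow> \<sigma> r = r" for r
      by (rule \<Gamma>_fix_k[OF G.is_subfield_K alg s]) (use that in blast)+
  qed
qed

lemma kalg_power:
  assumes "n > 0" "t ^ n = \<phi> e"
  shows "kalg t"
proof -
  have "pev (monom 1 n - [:e:]) t = 0"
    using assms(2) by (simp add: pev_simps) (simp add: pev_def map_poly_monom hom_zero hom_one poly_monom)
  moreover have "coeff (monom 1 n - [:e:] :: 'k poly) n = 1"
    using assms(1) by (simp add: coeff_pCons split: nat.split)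
  then have "monom 1 n - [:e:] \<noteq> (0 :: 'k poly)"
    by (metis coeff_0 zero_neq_one)
  ultimately show ?thesis
    using kalg_iff by blast
qed

text \<open>A twist of the double cover of the projective line with coordinate \<open>t\<close> that is branched over
  the zeros of \<open>t\<^sup>2\<^sup>n - 1\<close>, together with the lift of the section to it.\<close>

lemma genus_cover:
  fixes g :: nat
  assumes g: "g \<ge> 1" and gp: "generic_point C \<phi> \<eta>" and curve: "smooth_projective_curve C"
    and alg: "\<And>x. alg_over (generic_point.K C \<phi> \<eta>) x" and s: "section_over (generic_point.K C \<phi> \<eta>) s"
    and t: "t \<in> generic_point.K C \<phi> \<eta>" "\<not> kalg t"
  shows "\<exists>Y \<zeta>. smooth_projective_curve Y \<and> genus Y = of_nat g \<and> generic_point Y \<phi> \<zeta> \<and>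
    (\<forall>x. alg_over (generic_point.K Y \<phi> \<zeta>) x) \<and> section_over (generic_point.K Y \<phi> \<zeta>) s \<and>
    t \<in> generic_point.K Y \<phi> \<zeta>"
proof -
  interpret G: generic_point C \<phi> \<eta> by fact
  note M = G.is_subfield_K alg s
  note sf = G.is_subfield_K
  have fix_k: "\<sigma> (\<phi> c) = \<phi> c" if "\<sigma> \<in> \<Gamma> s" for \<sigma> c
    using \<Gamma>_fix[OF M that] G.range_in_K by blast
  define n where "n = g + 1"
  have n: "n \<ge> 2" "n > 0"
    using g by (simp_all add: n_def)
  have "\<phi> (0 - 1) = - 1"
    using hom_diff[of 0 1] hom_zero hom_one by simp
  \<comment> \<open>If t^n were 1 or -1, then t would be algebraic over k.\<close>
  then have t1: "t ^ n - 1 \<noteq> 0" "t ^ n + 1 \<noteq> 0"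
    using kalg_power[OF n(2), of t 1] kalg_power[OF n(2), of t "0 - 1"] t(2) hom_one
    by (auto simp: add_eq_0_iff2)
  define a where "a = (t ^ n + 1) / (t ^ n - 1)"
  have aK: "a \<in> G.K"
    unfolding a_def using t(1) by (intro sf_divide[OF sf] sf_add[OF sf] sf_diff[OF sf] sf_power[OF sf] sf_1[OF sf])
  obtain w0 where "poly [:- a, 0, 1:] w0 = 0"
    using alg_closed_imp_poly_has_root[of "[:- a, 0, 1:]"] by auto
  then have w0: "w0\<^sup>2 = a"
    by (simp add: power2_eq_square)
  have a0: "a \<noteq> 0"
    using t1 by (simp add: a_def)
  have w0_0: "w0 \<noteq> 0"
    using w0 a0 by auto
  have \<sigma>_w0: "(\<sigma> w0)\<^sup>2 = w0\<^sup>2" if "\<sigma> \<in> \<Gamma> s" for \<sigma>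
    using coeff_hom.hom_power[OF \<Gamma>_hom[OF M that], of w0 2] \<Gamma>_fix[OF M that aK] w0 by simp
  obtain B where B: "finite B" "\<forall>b\<in>B. kalg b" "\<forall>\<sigma>\<in>\<Gamma> s. (\<forall>b\<in>B. \<sigma> b = b) \<longrightarrow> \<sigma> w0 = w0"
    using \<Gamma>_continuous[OF M, of w0] by (elim exE conjE)
  have "\<exists>b. kalg b \<and> b \<noteq> 0 \<and> (\<forall>\<sigma>\<in>\<Gamma> s. \<sigma> (b * w0) = b * w0)"
  proof (rule twist[where B = B])
    show "\<sigma> w0 = w0 \<or> \<sigma> w0 = - w0" if "\<sigma> \<in> \<Gamma> s" for \<sigma>
      using \<sigma>_w0[OF that] by (simp add: power2_eq_iff)
    show "\<sigma> w0 = w0" if "\<sigma> \<in> \<Gamma> s" "\<And>b. b \<in> B \<Longrightarrow> \<sigma> b = b" for \<sigma>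
      using B(3) that by blast
    show "\<exists>\<tau>\<in>\<Gamma> s. \<forall>x. \<tau> (\<sigma> x) = x \<and> \<sigma> (\<tau> x) = x" if "\<sigma> \<in> \<Gamma> s" for \<sigma>
      by (rule \<Gamma>_inverse[OF M that])
  qed (use B(1,2) w0_0 \<Gamma>_hom[OF M] fix_k \<Gamma>_id[OF M] \<Gamma>_comp[OF M] in blast)+
  then obtain b where b: "kalg b" "b \<noteq> 0" "\<forall>\<sigma>\<in>\<Gamma> s. \<sigma> (b * w0) = b * w0"
    by (elim exE conjE)
  define w where "w = b * w0"
  have \<sigma>_w: "\<sigma> w = w" if "\<sigma> \<in> \<Gamma> s" for \<sigma>
    using b(3) that by (simp add: w_def)
  have "\<sigma> (b\<^sup>2) = b\<^sup>2" if \<sigma>: "\<sigma> \<in> \<Gamma> s" for \<sigma>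
  proof -
    interpret \<sigma>: coeff_hom \<sigma> by (rule \<Gamma>_hom[OF M \<sigma>])
    have "\<sigma> (b\<^sup>2) * w0\<^sup>2 = (\<sigma> (b * w0))\<^sup>2"
      using \<sigma>_w0[OF \<sigma>] by (simp add: \<sigma>.hom_power \<sigma>.hom_mult power_mult_distrib)
    also have "\<dots> = b\<^sup>2 * w0\<^sup>2"
      unfolding bspec[OF b(3) \<sigma>] by (rule power_mult_distrib)
    finally show ?thesis
      using w0_0 by simp
  qed
  moreover have "kalg (b\<^sup>2)"
    using sf_power[OF is_subfield_kM, of b 2] b(1) by simp
  ultimately have "b\<^sup>2 \<in> range \<phi>"
    using \<Gamma>_fix_k[OF M] by blast
  \<comment> \<open>b^2 is fixed because \<sigma> changes b and w0 by the same sign. So the twisted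
    root w satisfies an equation over k(t), with the constant c = b^2 in k.\<close>
  then obtain c where c: "b\<^sup>2 = \<phi> c"
    by blast
  have bc: "bidegree_curve \<phi> n c t w"
  proof (rule bidegree_curve.intro)
    show "coeff_hom \<phi>"
      by (rule coeff_hom')
    show "2 \<le> n"
      by (rule n(1))
    show "c \<noteq> 0"
      using c b(2) hom_zero by auto
    show "p = 0" if "poly (map_poly \<phi> p) t = 0" for p
      using that t(2) kalg_iff unfolding pev_def by blast
    have "w\<^sup>2 * (t ^ n - 1) = \<phi> c * (a * (t ^ n - 1))"
      by (simp add: w_def power_mult_distrib w0 c)
    also have "a * (t ^ n - 1) = t ^ n + 1"
      using t1 by (simp add: a_def)
    finally show "w\<^sup>2 * (t ^ n - 1) = \<phi> c * (t ^ n + 1)" .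
  qed
  interpret D: bidegree_curve \<phi> n c t w by (rule bc)
  have sY: "is_subfield D.Y.K"
    by (rule D.Y.is_subfield_K)
  have tY: "t \<in> D.Y.K"
    by (rule D.t_in_K)
  obtain t0 where t0: "t0 \<in> G.K" "\<not> kalg t0" "\<forall>u\<in>G.K. alg_over (gen t0) u"
    using curve G.one_dimensional_iff unfolding smooth_projective_curve_def by blast
  \<comment> \<open>By exchange, the function field of C is algebraic over k(t), which lies in that
    of Y.\<close>
  have algY: "alg_over D.Y.K x" for x
  proof (rule alg_over_trans[OF sY _ alg])
    fix u assume "u \<in> G.K"
    then have "alg_over (gen t) u"
      using exchange[OF t0(2) t(2)] t0(3) t(1) by blast
    moreover have "gen t \<subseteq> D.Y.K"
      by (rule gen_minimal[OF sY D.Y.range_in_K tY])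
    ultimately show "alg_over D.Y.K u"
      using alg_over_mono by blast
  qed
  have fixed: "\<sigma> x = x" if \<sigma>: "\<sigma> \<in> \<Gamma> s" and x: "x \<in> D.Y.K" for \<sigma> x
  proof -
    interpret \<sigma>: coeff_hom \<sigma> by (rule \<Gamma>_hom[OF M \<sigma>])
    have sF: "is_subfield {x. \<sigma> x = x}"
      unfolding is_subfield_def using \<sigma>.hom_one field_hom_inverse[OF \<Gamma>_hom[OF M \<sigma>]]
      by (simp add: \<sigma>.hom_diff \<sigma>.hom_mult)
    have "D.Y.K \<subseteq> {x. \<sigma> x = x}"
    proof (rule D.Y.K_minimal[OF sF])
      show "range \<phi> \<subseteq> {x. \<sigma> x = x}"
        using fix_k[OF \<sigma>] by blast
      show "segre 1 t w 1 i \<in> {x. \<sigma> x = x}" for i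
        using \<Gamma>_fix[OF M \<sigma> t(1)] \<sigma>_w[OF \<sigma>] by (simp add: segre_def \<sigma>.hom_mult \<sigma>.hom_one \<sigma>.hom_zero)
    qed
    then show ?thesis
      using x by blast
  qed
  have "section_over D.Y.K s"
    by (rule section_over_change[OF M sY algY]) (rule fixed)
  moreover have "genus D.Y = of_nat g"
    using D.genus_Y by (simp add: n_def)
  ultimately show ?thesis
    using D.smooth_projective_curve_Y D.Y.generic_point_axioms algY tY by blast
qed

theorem unique_fixed_point:
  fixes g :: nat
  assumes g: "g \<ge> 1" and BG: "\<And>Y :: 'k proj_scheme. smooth_projective_curve Y \<Longrightarrow> genus Y = of_nat g \<Longrightarrow> BGASC Y"
    and gp: "generic_point C \<phi> \<eta>" and curve: "smooth_projective_curve C"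
    and alg: "\<And>x. alg_over (generic_point.K C \<phi> \<eta>) x" and s: "section_over (generic_point.K C \<phi> \<eta>) s"
  shows "\<exists>!x. x \<in> rational_points C \<and> fixed_at C \<eta> s x"
proof -
  interpret G: generic_point C \<phi> \<eta> by fact
  have nK: "\<not> generic_point.K Z \<phi> \<zeta> \<subseteq> range \<phi>" if "t \<in> generic_point.K Z \<phi> \<zeta>" "\<not> kalg t" for t Z \<zeta>
    using that k_kM by blast
  have fixed: "fixed_at Z \<zeta> s x"
    if "stable s V" "V \<inter> generic_point.K Z \<phi> \<zeta> = generic_point.val Z \<phi> \<zeta> ` local_ring Z x" for Z \<zeta> x V
    using that unfolding fixed_at_def stable_def by blast
  obtain t0 where t0: "t0 \<in> G.K" "\<not> kalg t0"
    using curve G.one_dimensional_iff unfolding smooth_projective_curve_def by blast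
  show ?thesis
  proof (rule ex_ex1I)
    obtain Y \<zeta> where Y: "smooth_projective_curve Y" "genus Y = of_nat g" "generic_point Y \<phi> \<zeta>"
      "\<forall>x. alg_over (generic_point.K Y \<phi> \<zeta>) x" "section_over (generic_point.K Y \<phi> \<zeta>) s" "t0 \<in> generic_point.K Y \<phi> \<zeta>"
      using genus_cover[OF g gp curve alg s t0] by (elim exE conjE)
    from BGASC_fixed_at[OF Y(3) _ Y(5) BG[OF Y(1,2)]] Y(4)
    obtain y where y: "y \<in> rational_points Y" "fixed_at Y \<zeta> s y"
      by blast
    obtain V where V: "stable s V"
      using fixed_at_stable[OF Y(3) y nK[OF Y(6) t0(2)]] by blast
    then show "\<exists>x. x \<in> rational_points C \<and> fixed_at C \<eta> s x"
      using stable_center[OF gp curve alg s V] fixed[OF V] by blast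
  next
    fix x x' assume x: "x \<in> rational_points C \<and> fixed_at C \<eta> s x" "x' \<in> rational_points C \<and> fixed_at C \<eta> s x'"
    show "x = x'"
    proof (rule ccontr)
      assume "x \<noteq> x'"
      then obtain z where z: "z \<in> G.K" "z \<notin> G.val ` local_ring C x" "z \<in> G.val ` local_ring C x'"
        using G.local_ring_separates x by blast
      obtain V where V: "stable s V" "V \<inter> G.K = G.val ` local_ring C x"
        using fixed_at_stable[OF gp _ _ nK[OF t0]] x(1) by blast
      obtain V' where V': "stable s V'" "V' \<inter> G.K = G.val ` local_ring C x'"
        using fixed_at_stable[OF gp _ _ nK[OF t0]] x(2) by blast
      have zV: "z \<notin> V" "z \<in> V'"
        using z V(2) V'(2) by blast+
      \<comment> \<open>Elements algebraic over k lie in every such V; so z, being outside V, is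
        transcendental and can serve as the coordinate of the double cover.\<close>
      have "place \<phi> V"
        using V(1) field_extension_hom_axioms unfolding stable_def place_def place_axioms_def by blast
      then have nz: "\<not> kalg z"
        using place.kalg_V zV(1) by blast
      obtain Y \<zeta> where Y: "smooth_projective_curve Y" "genus Y = of_nat g" "generic_point Y \<phi> \<zeta>"
        "\<forall>x. alg_over (generic_point.K Y \<phi> \<zeta>) x" "section_over (generic_point.K Y \<phi> \<zeta>) s" "z \<in> generic_point.K Y \<phi> \<zeta>"
        using genus_cover[OF g gp curve alg s z(1) nz] by (elim exE conjE)
      have u: "\<exists>!y. y \<in> rational_points Y \<and> fixed_at Y \<zeta> s y"
        using BGASC_fixed_at[OF Y(3) _ Y(5) BG[OF Y(1,2)]] Y(4) by blast
      obtain y where y: "y \<in> rational_points Y" "V \<inter> generic_point.K Y \<phi> \<zeta> = generic_point.val Y \<phi> \<zeta> ` local_ring Y y"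
        using stable_center[OF Y(3,1) _ Y(5) V(1)] Y(4) by blast
      obtain y' where y': "y' \<in> rational_points Y" "V' \<inter> generic_point.K Y \<phi> \<zeta> = generic_point.val Y \<phi> \<zeta> ` local_ring Y y'"
        using stable_center[OF Y(3,1) _ Y(5) V'(1)] Y(4) by blast
      have "y = y'"
        using u y(1) y'(1) fixed[OF V(1) y(2)] fixed[OF V'(1) y'(2)] by blast
      then have "V \<inter> generic_point.K Y \<phi> \<zeta> = V' \<inter> generic_point.K Y \<phi> \<zeta>"
        using y(2) y'(2) by simp
      then show False
        using zV Y(6) by blast
    qed
  qed
qed

end

theorem corollary2p3:
  fixes g :: nat
  assumes "finitely_generated_over_Q TYPE('k::field_char_0)"
    and "g \<ge> 1"
    and "\<forall>Y :: 'k proj_scheme. smooth_projective_curve Y \<and> genus Y = of_nat g \<longrightarrow> BGASC Y"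
  shows "\<forall>C :: 'k proj_scheme. smooth_projective_curve C \<longrightarrow> BGASC C"
proof (intro allI impI)
  fix C :: "'k proj_scheme" assume curve: "smooth_projective_curve C"
  show "BGASC C"
    unfolding BGASC_def
  proof (intro allI impI)
    fix L \<iota> s assume sc: "separable_closure C L \<iota>" and gs: "galois_section C L \<iota> s"
    obtain \<phi> :: "'k \<Rightarrow> 'k poly fract alg_closure" and h \<eta> where
      T: "transport \<phi> L h" and gp: "generic_point C \<phi> \<eta>" and
      \<iota>: "\<forall>a\<in>carrier (function_field C). \<iota> a = h (generic_point.val C \<phi> \<eta> a)" and
      alg: "\<forall>x. alg_over (generic_point.K C \<phi> \<eta>) x"
      using separable_closure_model[OF curve sc] by (elim exE conjE)
    interpret sep_transport \<phi> L h
      by (rule sep_transport.intro[OF T])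
    have \<iota>': "\<iota> a = h (generic_point.val C \<phi> \<eta> a)" if "a \<in> carrier (function_field C)" for a
      using \<iota> that by blast
    have alg': "alg_over (generic_point.K C \<phi> \<eta>) x" for x
      using alg by blast
    have s: "section_over (generic_point.K C \<phi> \<eta>) s"
      using galois_section_iff[OF gp \<iota>'] gs by blast
    note sK = s_closed[OF generic_point.is_subfield_K[OF gp] alg' s]
    have "\<exists>!x. x \<in> rational_points C \<and> fixed_at C \<eta> s x"
      by (rule unique_fixed_point[OF assms(2) _ gp curve alg' s]) (use assms(3) in blast)
    moreover have "(\<exists>D. decomposition_subgroup C L \<iota> x D \<and> s ` carrier (G_k C L \<iota>) \<subseteq> D) \<longleftrightarrow> fixed_at C \<eta> s x" for x
      by (rule decomposition_iff[OF gp \<iota>' sK])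
    ultimately show "\<exists>!x. x \<in> rational_points C \<and>
        (\<exists>D. decomposition_subgroup C L \<iota> x D \<and> s ` carrier (G_k C L \<iota>) \<subseteq> D)"
      by (simp only:)
  qed
qed

end
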